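(* Let $G$ be a locally compact group and let $(\Phi,\Psi)$ be a complementary pair of Young functions both satisfying the $\Delta_2$-condition, and suppose $\Phi$ satisfies the MA condition. Then the Banach algebra $A_\Phi(G)^{**}$, equipped with the first Arens product, has a right identity if and only if $G$ is amenable.
   Context: A Young function is an even, convex, continuous, real-valued function $\Phi:\mathbb{R}\to[0,\infty)$ with $\Phi(0)=0$ and $\lim_{x\to\infty}\Phi(x)=\infty$; its complementary function is $\Psi(y)=\sup\{x|y|-\Phi(x):x\ge0\}$. $\Phi$ satisfies the $\Delta_2$-condition if there is $k>0$ with $\Phi(2x)\le k\Phi(x)$ for all $x\ge0$. $\Phi$ satisfies the Milnes–Akimovič (MA) condition if for each $\epsilon>0$ there exist $\beta_\epsilon>1$ and $x_0(\epsilon)\ge0$ such that $\Phi'((1+\epsilon)x)\ge\beta_\epsilon\Phi'(x)$ for all $x\ge x_0(\epsilon)$. $L^\Phi(G)$ is the Orlicz space with Luxemburg norm $N_\Phi$, $L^\Psi(G)$ carries the Orlicz norm $\|\cdot\|_\Psi$. $A_\Phi(G)$ is the space of functions $u=\sum_n f_n*\check{g_n}$ ($f_n\in L^\Phi(G)$, $g_n\in L^\Psi(G)$, $\check g(x)=g(x^{-1})$, $\sum_n N_\Phi(f_n)\|g_n\|_\Psi<\infty$) with the infimum norm; a commutative Banach algebra under pointwise operations, whose dual is identified with $PM_\Psi(G)$ (ultraweak closure in $\mathcal{B}(L^\Psi(G))$ of convolution operators by measures in $M(G)$). First Arens product: $\langle u\cdot T,v\rangle=\langle T,uv\rangle$,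 $\langle\Gamma\odot T,u\rangle=\langle\Gamma,u\cdot T\rangle$, $\langle\tilde\Gamma\,\square\,\Gamma,T\rangle=\langle\tilde\Gamma,\Gamma\odot T\rangle$. *)

theory Defs
  imports "HOL-Analysis.Analysis"
begin

section \<open>Locally compact groups and Haar measure\<close>

text \<open>A (Hausdorff) topological group, written additively but not assumed commutative.\<close>
definition topological_group :: "('g::{group_add,topological_space}) itself \<Rightarrow> bool" where
  "topological_group _ \<longleftrightarrow>
     continuous_on (UNIV :: ('g \<times> 'g) set) (\<lambda>p. fst p + snd p) \<and>
     continuous_on (UNIV :: 'g set) uminus"

definition locally_compact_group :: "('g::{group_add,t2_space}) itself \<Rightarrow> bool" where
  "locally_compact_group T \<longleftrightarrow> topological_group T \<and>
     (\<forall>x::'g. \<exists>U K. open U \<and> compact K \<and> x \<in> U \<and> U \<subseteq> K)"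

text \<open>A left Haar measure: a nonzero left-invariant Radon measure on the Borel sets.\<close>
definition left_haar_measure :: "('g::{group_add,t2_space}) measure \<Rightarrow> bool" where
  "left_haar_measure \<mu> \<longleftrightarrow>
     sets \<mu> = sets borel \<and>
     (\<forall>x A. A \<in> sets borel \<longrightarrow> emeasure \<mu> ((\<lambda>y. x + y) ` A) = emeasure \<mu> A) \<and>
     (\<forall>K. compact K \<longrightarrow> emeasure \<mu> K < \<infinity>) \<and>
     (\<forall>U. open U \<longrightarrow> U \<noteq> {} \<longrightarrow> emeasure \<mu> U > 0) \<and>
     (\<forall>A \<in> sets borel. emeasure \<mu> A = (INF U \<in> {U. open U \<and> A \<subseteq> U}. emeasure \<mu> U)) \<and>
     (\<forall>U. open U \<longrightarrow> emeasure \<mu> U = (SUP K \<in> {K. compact K \<and> K \<subseteq> U}. emeasure \<mu> K))"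

section \<open>Young functions\<close>

definition young_function :: "(real \<Rightarrow> real) \<Rightarrow> bool" where
  "young_function \<Phi> \<longleftrightarrow>
     (\<forall>x. \<Phi> (- x) = \<Phi> x) \<and> convex_on UNIV \<Phi> \<and> continuous_on UNIV \<Phi> \<and>
     (\<forall>x. 0 \<le> \<Phi> x) \<and> \<Phi> 0 = 0 \<and> filterlim \<Phi> at_top at_top"

definition complementary_pair :: "(real \<Rightarrow> real) \<Rightarrow> (real \<Rightarrow> real) \<Rightarrow> bool" where
  "complementary_pair \<Phi> \<Psi> \<longleftrightarrow> young_function \<Phi> \<and> young_function \<Psi> \<and>
     (\<forall>y. bdd_above {x * \<bar>y\<bar> - \<Phi> x | x. x \<ge> 0} \<and>
          \<Psi> y = Sup {x * \<bar>y\<bar> - \<Phi> x | x. x \<ge> 0})"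

definition delta2 :: "(real \<Rightarrow> real) \<Rightarrow> bool" where
  "delta2 \<Phi> \<longleftrightarrow> (\<exists>k>0. \<forall>x\<ge>0. \<Phi> (2 * x) \<le> k * \<Phi> x)"

text \<open>Derivative of the convex function \<Phi> (taken as the right derivative).\<close>
definition young_deriv :: "(real \<Rightarrow> real) \<Rightarrow> real \<Rightarrow> real" where
  "young_deriv \<Phi> x = Lim (at_right 0) (\<lambda>h. (\<Phi> (x + h) - \<Phi> x) / h)"

definition MA_condition :: "(real \<Rightarrow> real) \<Rightarrow> bool" where
  "MA_condition \<Phi> \<longleftrightarrow> (\<forall>\<epsilon>>0. \<exists>\<beta>>1. \<exists>x0\<ge>0. \<forall>x\<ge>x0.
      young_deriv \<Phi> ((1 + \<epsilon>) * x) \<ge> \<beta> * young_deriv \<Phi> x)"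

section \<open>Orlicz spaces\<close>

definition orlicz_space :: "'g measure \<Rightarrow> (real \<Rightarrow> real) \<Rightarrow> ('g \<Rightarrow> complex) set" where
  "orlicz_space \<mu> \<Phi> = {f. f \<in> borel_measurable \<mu> \<and>
      (\<exists>k>0. (\<integral>\<^sup>+ x. ennreal (\<Phi> (cmod (f x) / k)) \<partial>\<mu>) < \<infinity>)}"

text \<open>Luxemburg norm.\<close>
definition luxemburg_norm :: "'g measure \<Rightarrow> (real \<Rightarrow> real) \<Rightarrow> ('g \<Rightarrow> complex) \<Rightarrow> real" where
  "luxemburg_norm \<mu> \<Phi> f =
     Inf {k. k > 0 \<and> (\<integral>\<^sup>+ x. ennreal (\<Phi> (cmod (f x) / k)) \<partial>\<mu>) \<le> 1}"

text \<open>Orlicz norm of g in L^\<Psi>, where \<Phi> is the complementary function of \<Psi>.\<close>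
definition orlicz_norm :: "'g measure \<Rightarrow> (real \<Rightarrow> real) \<Rightarrow> ('g \<Rightarrow> complex) \<Rightarrow> real" where
  "orlicz_norm \<mu> \<Phi> g =
     Sup {enn2real (\<integral>\<^sup>+ x. ennreal (cmod (f x) * cmod (g x)) \<partial>\<mu>) | f.
            f \<in> borel_measurable \<mu> \<and> (\<integral>\<^sup>+ x. ennreal (\<Phi> (cmod (f x))) \<partial>\<mu>) \<le> 1}"

text \<open>(f * g-check)(x) = \<integral> f(y) g(x^{-1} y) dy, written additively.\<close>
definition conv_check :: "('g::group_add) measure \<Rightarrow> ('g \<Rightarrow> complex) \<Rightarrow> ('g \<Rightarrow> complex) \<Rightarrow> 'g \<Rightarrow> complex" where
  "conv_check \<mu> f g x = (\<integral> y. f y * g (- x + y) \<partial>\<mu>)"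

section \<open>The Orlicz Figa-Talamanca Herz algebra\<close>

definition AP_rep :: "('g::group_add) measure \<Rightarrow> (real \<Rightarrow> real) \<Rightarrow> (real \<Rightarrow> real) \<Rightarrow>
    ('g \<Rightarrow> complex) \<Rightarrow> (nat \<Rightarrow> 'g \<Rightarrow> complex) \<Rightarrow> (nat \<Rightarrow> 'g \<Rightarrow> complex) \<Rightarrow> bool" where
  "AP_rep \<mu> \<Phi> \<Psi> u f g \<longleftrightarrow>
     (\<forall>n. f n \<in> orlicz_space \<mu> \<Phi> \<and> g n \<in> orlicz_space \<mu> \<Psi>) \<and>
     summable (\<lambda>n. luxemburg_norm \<mu> \<Phi> (f n) * orlicz_norm \<mu> \<Phi> (g n)) \<and>
     (\<forall>x. (\<lambda>n. conv_check \<mu> (f n) (g n) x) sums u x)"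

definition AP :: "('g::group_add) measure \<Rightarrow> (real \<Rightarrow> real) \<Rightarrow> (real \<Rightarrow> real) \<Rightarrow> ('g \<Rightarrow> complex) set" where
  "AP \<mu> \<Phi> \<Psi> = {u. \<exists>f g. AP_rep \<mu> \<Phi> \<Psi> u f g}"

definition AP_norm :: "('g::group_add) measure \<Rightarrow> (real \<Rightarrow> real) \<Rightarrow> (real \<Rightarrow> real) \<Rightarrow> ('g \<Rightarrow> complex) \<Rightarrow> real" where
  "AP_norm \<mu> \<Phi> \<Psi> u = Inf {(\<Sum>n. luxemburg_norm \<mu> \<Phi> (f n) * orlicz_norm \<mu> \<Phi> (g n)) | f g.
                               AP_rep \<mu> \<Phi> \<Psi> u f g}"

section \<open>Dual, bidual and the first Arens product (abstractly, for a normed algebra of functions)\<close>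

definition dual_space :: "'a set \<Rightarrow> ('a \<Rightarrow> real) \<Rightarrow> ('a \<Rightarrow> 'a \<Rightarrow> 'a) \<Rightarrow> (complex \<Rightarrow> 'a \<Rightarrow> 'a) \<Rightarrow>
     ('a \<Rightarrow> complex) set" where
  "dual_space A nrm add smul = {T.
     (\<forall>u\<in>A. \<forall>v\<in>A. T (add u v) = T u + T v) \<and>
     (\<forall>u\<in>A. \<forall>c. T (smul c u) = c * T u) \<and>
     (\<exists>C. \<forall>u\<in>A. cmod (T u) \<le> C * nrm u)}"

definition dual_norm :: "'a set \<Rightarrow> ('a \<Rightarrow> real) \<Rightarrow> ('a \<Rightarrow> complex) \<Rightarrow> real" where
  "dual_norm A nrm T = Sup {cmod (T u) | u. u \<in> A \<and> nrm u \<le> 1}"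

definition bidual_space :: "('a \<Rightarrow> complex) set \<Rightarrow> (('a \<Rightarrow> complex) \<Rightarrow> real) \<Rightarrow>
     ((('a \<Rightarrow> complex) \<Rightarrow> complex) set)" where
  "bidual_space D dn = {\<Gamma>.
     (\<forall>S\<in>D. \<forall>T\<in>D. \<Gamma> (\<lambda>u. S u + T u) = \<Gamma> S + \<Gamma> T) \<and>
     (\<forall>T\<in>D. \<forall>c. \<Gamma> (\<lambda>u. c * T u) = c * \<Gamma> T) \<and>
     (\<exists>C. \<forall>T\<in>D. cmod (\<Gamma> T) \<le> C * dn T)}"

text \<open>Module actions: (u . T)(v) = T(uv);  (\<Gamma> \<odot> T)(u) = \<Gamma>(u . T);  (\<Gamma>' \<box> \<Gamma>)(T) = \<Gamma>'(\<Gamma> \<odot> T).\<close>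
definition dual_act :: "('a \<Rightarrow> 'a \<Rightarrow> 'a) \<Rightarrow> 'a \<Rightarrow> ('a \<Rightarrow> complex) \<Rightarrow> ('a \<Rightarrow> complex)" where
  "dual_act mul u T = (\<lambda>v. T (mul u v))"

definition bidual_act :: "('a \<Rightarrow> 'a \<Rightarrow> 'a) \<Rightarrow> (('a \<Rightarrow> complex) \<Rightarrow> complex) \<Rightarrow> ('a \<Rightarrow> complex) \<Rightarrow> ('a \<Rightarrow> complex)" where
  "bidual_act mul \<Gamma> T = (\<lambda>u. \<Gamma> (dual_act mul u T))"

definition arens1 :: "('a \<Rightarrow> 'a \<Rightarrow> 'a) \<Rightarrow> (('a \<Rightarrow> complex) \<Rightarrow> complex) \<Rightarrow> (('a \<Rightarrow> complex) \<Rightarrow> complex) \<Rightarrow>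
     (('a \<Rightarrow> complex) \<Rightarrow> complex)" where
  "arens1 mul \<Gamma>' \<Gamma> = (\<lambda>T. \<Gamma>' (bidual_act mul \<Gamma> T))"

definition AP_dual :: "('g::group_add) measure \<Rightarrow> (real \<Rightarrow> real) \<Rightarrow> (real \<Rightarrow> real) \<Rightarrow> (('g \<Rightarrow> complex) \<Rightarrow> complex) set" where
  "AP_dual \<mu> \<Phi> \<Psi> = dual_space (AP \<mu> \<Phi> \<Psi>) (AP_norm \<mu> \<Phi> \<Psi>) (\<lambda>u v x. u x + v x) (\<lambda>c u x. c * u x)"

definition AP_bidual :: "('g::group_add) measure \<Rightarrow> (real \<Rightarrow> real) \<Rightarrow> (real \<Rightarrow> real) \<Rightarrow>
    ((('g \<Rightarrow> complex) \<Rightarrow> complex) \<Rightarrow> complex) set" where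
  "AP_bidual \<mu> \<Phi> \<Psi> = bidual_space (AP_dual \<mu> \<Phi> \<Psi>) (dual_norm (AP \<mu> \<Phi> \<Psi>) (AP_norm \<mu> \<Phi> \<Psi>))"

definition pointwise_mult :: "('g \<Rightarrow> complex) \<Rightarrow> ('g \<Rightarrow> complex) \<Rightarrow> ('g \<Rightarrow> complex)" where
  "pointwise_mult u v = (\<lambda>x. u x * v x)"

text \<open>A^{**} with the first Arens product has a right identity E: \<Gamma> \<box> E = \<Gamma> for all \<Gamma>.\<close>
definition AP_bidual_has_right_identity :: "('g::group_add) measure \<Rightarrow> (real \<Rightarrow> real) \<Rightarrow> (real \<Rightarrow> real) \<Rightarrow> bool" where
  "AP_bidual_has_right_identity \<mu> \<Phi> \<Psi> \<longleftrightarrow>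
     (\<exists>E \<in> AP_bidual \<mu> \<Phi> \<Psi>. \<forall>\<Gamma> \<in> AP_bidual \<mu> \<Phi> \<Psi>. \<forall>T \<in> AP_dual \<mu> \<Phi> \<Psi>.
        arens1 pointwise_mult \<Gamma> E T = \<Gamma> T)"

section \<open>Amenability\<close>

definition Linf :: "'g measure \<Rightarrow> ('g \<Rightarrow> real) set" where
  "Linf \<mu> = {f. f \<in> borel_measurable \<mu> \<and> (\<exists>C. AE x in \<mu>. \<bar>f x\<bar> \<le> C)}"

text \<open>Existence of a left-invariant mean on L^\<infinity>(G).\<close>
definition amenable :: "('g::group_add) measure \<Rightarrow> bool" where
  "amenable \<mu> \<longleftrightarrow> (\<exists>m :: ('g \<Rightarrow> real) \<Rightarrow> real.
     (\<forall>f\<in>Linf \<mu>. \<forall>g\<in>Linf \<mu>. \<forall>a b. m (\<lambda>x. a * f x + b * g x) = a * m f + b * m g) \<and>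
     (\<forall>f\<in>Linf \<mu>. \<forall>g\<in>Linf \<mu>. (AE x in \<mu>. f x = g x) \<longrightarrow> m f = m g) \<and>
     (\<forall>f\<in>Linf \<mu>. (AE x in \<mu>. f x \<ge> 0) \<longrightarrow> m f \<ge> 0) \<and>
     m (\<lambda>_. 1) = 1 \<and>
     (\<forall>f\<in>Linf \<mu>. \<forall>a. m (\<lambda>x. f (a + x)) = m f))"

end

theory Submission
  imports Defs "HOL-Library.Nat_Bijection"
begin

text \<open>
  A right identity \<open>E\<close> satisfies \<open>E (u \<cdot> T) = T u\<close>. For a convex combination \<open>T\<close> of point evaluations and
  \<open>u\<close> equal to 1 at these points this gives \<open>1 \<le> \<parallel>E\<parallel> \<parallel>T\<parallel>\<close>, so the powers of an averaging operator do not
  tend to 0 on \<open>L\<^sup>\<Phi>\<close>. The growth of \<open>\<Phi>\<close> forced by \<open>\<Delta>\<^sub>2\<close> for \<open>\<Psi>\<close> makes a root \<open>\<Phi> powr (1/r)\<close>, \<open>r > 1\<close>, nearly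
  convex, which carries this over to \<open>L\<^sup>r\<close>. There strict convexity produces almost invariant functions
  \<open>h\<close>, and a generalized limit of \<open>f \<mapsto> \<integral> f h\<^sup>r\<close> is an invariant mean.

  Conversely, let \<open>k\<close> be a compactly supported density that is almost invariant in \<open>L\<^sup>1\<close> under a compact set
  (Reiter), cut \<open>n k\<close> into the slices \<open>\<chi>\<^sub>j = min 1 (n k - j)\<^sup>+\<close>, and let \<open>e\<close> be the average of the
  convolutions of \<open>\<chi>\<^sub>j\<close> with its reflection. It has norm at most 4, since \<open>N\<^sub>\<Phi>\<close> and the Orlicz norm of an
  indicator function multiply to at most twice the measure of the set. Multiplying \<open>f * g\<close>-check by
  \<open>e\<close> inserts an inner product \<open>\<langle>a y, a (-x+y)\<rangle>\<close> of Hilbert space valued functions under the integral.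
  Replacing the inner product by an average over Rademacher signs, whose moments \<open>\<Delta>\<^sub>2\<close> controls, bounds
  the result in \<open>A\<^sub>\<Phi>\<close> by the sup norms of the two functions. So the \<open>e\<close> form an approximate
  identity of bounded multipliers, and a generalized limit \<open>E T = lim T e\<close> is a right identity.
\<close>

section \<open>Sublinear functionals and generalized limits\<close>

text \<open>Exchanges of integrals are made by hand: over a compact set a continuous kernel is
  rounded in one variable by a Borel map with finitely many values, and integrals become finite
  weighted sums. This one device gives Fubini for compactly supported kernels, the passage from
  finite to compact sets in Reiter's condition, and the finite-dimensional inner products to which
  signs can be attached. Slices replace the powers of \<open>k\<close> that serve for
  \<open>L^p\<close>, because no power fits a general pair \<open>\<Phi>\<close>,
  \<open>\<Psi>\<close>, whereas both norms of an indicator function are explicit up to a factor 2.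
  Slices take values in [0,1], so a squared difference is at most the difference itself, and an
  \<open>L^1\<close> estimate for \<open>k\<close> becomes a Hilbert space estimate. The sign
  average is needed because scalar factors in a tensor have to be replaced by vectors with a bound
  that does not depend on the dimension.\<close>

definition function_space :: "('a \<Rightarrow> real) set \<Rightarrow> bool" where
  "function_space V \<longleftrightarrow> V \<noteq> {} \<and>
     (\<forall>f\<in>V. \<forall>g\<in>V. (\<lambda>x. f x + g x) \<in> V) \<and> (\<forall>c. \<forall>f\<in>V. (\<lambda>x. c * f x) \<in> V)"

definition sublinear_on :: "('a \<Rightarrow> real) set \<Rightarrow> (('a \<Rightarrow> real) \<Rightarrow> real) \<Rightarrow> bool" where
  "sublinear_on V p \<longleftrightarrow>
     (\<forall>f\<in>V. \<forall>g\<in>V. p (\<lambda>x. f x + g x) \<le> p f + p g) \<and> (\<forall>c\<ge>0. \<forall>f\<in>V. p (\<lambda>x. c * f x) = c * p f)"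

definition linear_on_space :: "('a \<Rightarrow> real) set \<Rightarrow> (('a \<Rightarrow> real) \<Rightarrow> real) \<Rightarrow> bool" where
  "linear_on_space V l \<longleftrightarrow>
     (\<forall>f\<in>V. \<forall>g\<in>V. l (\<lambda>x. f x + g x) = l f + l g) \<and> (\<forall>c. \<forall>f\<in>V. l (\<lambda>x. c * f x) = c * l f)"

lemma function_spaceD:
  assumes "function_space V"
  shows "\<And>f g. f \<in> V \<Longrightarrow> g \<in> V \<Longrightarrow> (\<lambda>x. f x + g x) \<in> V"
    and "\<And>c f. f \<in> V \<Longrightarrow> (\<lambda>x. c * f x) \<in> V"
  using assms unfolding function_space_def by auto

lemma sublinear_onD:
  assumes "sublinear_on V p"
  shows "\<And>f g. f \<in> V \<Longrightarrow> g \<in> V \<Longrightarrow> p (\<lambda>x. f x + g x) \<le> p f + p g"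
    and "\<And>c f. c \<ge> 0 \<Longrightarrow> f \<in> V \<Longrightarrow> p (\<lambda>x. c * f x) = c * p f"
  using assms unfolding sublinear_on_def by auto

lemma linear_on_spaceD:
  assumes "linear_on_space V l"
  shows "\<And>f g. f \<in> V \<Longrightarrow> g \<in> V \<Longrightarrow> l (\<lambda>x. f x + g x) = l f + l g"
    and "\<And>c f. f \<in> V \<Longrightarrow> l (\<lambda>x. c * f x) = c * l f"
  using assms unfolding linear_on_space_def by auto

lemma linear_on_space_diff:
  assumes "function_space V" "linear_on_space V l" "f \<in> V" "g \<in> V"
  shows "l (\<lambda>x. f x - g x) = l f - l g"
proof -
  have "(\<lambda>x. (-1) * g x) \<in> V" using assms unfolding function_space_def by blast
  then have "l (\<lambda>x. f x + (-1) * g x) = l f + l (\<lambda>x. (-1) * g x)"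
    using linear_on_spaceD(1)[OF assms(2,3)] by blast
  also have "l (\<lambda>x. (-1) * g x) = (-1) * l g"
    by (rule linear_on_spaceD(2)[OF assms(2,4)])
  finally show ?thesis by simp
qed

lemma function_space_zero:
  assumes "function_space V" shows "(\<lambda>x. 0) \<in> V"
proof -
  obtain f where "f \<in> V" using assms by (auto simp: function_space_def)
  then have "(\<lambda>x. 0 * f x) \<in> V" using assms unfolding function_space_def by blast
  then show ?thesis by simp
qed

lemma function_space_diff:
  assumes "function_space V" "f \<in> V" "g \<in> V" shows "(\<lambda>x. f x - g x) \<in> V"
proof -
  have "(\<lambda>x. (-1) * g x) \<in> V" using assms unfolding function_space_def by blast
  from function_spaceD(1)[OF assms(1,2) this] have "(\<lambda>x. f x + (-1) * g x) \<in> V" .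
  then show ?thesis by simp
qed

lemma function_space_sum:
  assumes V: "function_space V" and "finite I" "\<And>i. i \<in> I \<Longrightarrow> f i \<in> V"
  shows "(\<lambda>x. \<Sum>i\<in>I. f i x) \<in> V"
  using assms(2,3)
proof (induction I rule: finite_induct)
  case empty then show ?case using function_space_zero[OF V] by simp
next
  case (insert i I)
  then show ?case using V unfolding function_space_def by simp
qed

lemma linear_on_space_sum:
  assumes V: "function_space V" and l: "linear_on_space V l"
    and "finite I" "\<And>i. i \<in> I \<Longrightarrow> f i \<in> V"
  shows "l (\<lambda>x. \<Sum>i\<in>I. f i x) = (\<Sum>i\<in>I. l (f i))"
  using assms(3,4)
proof (induction I rule: finite_induct)
  case empty
  have "l (\<lambda>x. 0 * 0) = 0 * l (\<lambda>x. 0)"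
    by (rule linear_on_spaceD(2)[OF l function_space_zero[OF V]])
  then show ?case by simp
next
  case (insert i I)
  have "(\<lambda>x. \<Sum>i\<in>I. f i x) \<in> V" using insert by (intro function_space_sum[OF V]) auto
  then show ?case using insert l unfolding linear_on_space_def by simp
qed

text \<open>A minimal sublinear functional is linear: otherwise it could be lowered in some direction \<open>v\<close>.\<close>

lemma sublinear_lower_in_direction:
  assumes V: "function_space V" and q: "sublinear_on V q" and v: "v \<in> V"
  defines "r \<equiv> \<lambda>w. Inf {q (\<lambda>x. w x + t * v x) - t * q v | t. t \<ge> 0}"
  shows "sublinear_on V r" "\<And>w t. w \<in> V \<Longrightarrow> t \<ge> 0 \<Longrightarrow> r w \<le> q (\<lambda>x. w x + t * v x) - t * q v"
proof -
  have V_add: "\<And>f g. f \<in> V \<Longrightarrow> g \<in> V \<Longrightarrow> (\<lambda>x. f x + g x) \<in> V" 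
    and V_sc: "\<And>c f. f \<in> V \<Longrightarrow> (\<lambda>x. c * f x) \<in> V" using V by (auto simp: function_space_def)
  have q_add: "\<And>f g. f \<in> V \<Longrightarrow> g \<in> V \<Longrightarrow> q (\<lambda>x. f x + g x) \<le> q f + q g"
    and q_sc: "\<And>(c::real) f. c \<ge> 0 \<Longrightarrow> f \<in> V \<Longrightarrow> q (\<lambda>x. c * f x) = c * q f"
    using q by (auto simp: sublinear_on_def)
  \<comment> \<open>Subadditivity applied to \<open>t * v = (w + t * v) + (- w)\<close> bounds the
    set below independently of \<open>t\<close>, so that the \<open>Inf\<close> in \<open>r\<close>
    is a true infimum.\<close>
  have lower: "- q (\<lambda>x. - w x) \<le> q (\<lambda>x. w x + t * v x) - t * q v" if "w \<in> V" "t \<ge> 0" for w t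
  proof -
    have 1: "(\<lambda>x. - w x) \<in> V" using V_sc[OF that(1), of "-1"] by simp
    have 2: "(\<lambda>x. w x + t * v x) \<in> V" using V_add[OF that(1) V_sc[OF v]] by simp
    have "t * q v = q (\<lambda>x. t * v x)" using q_sc[OF that(2) v] by simp
    also have "\<dots> = q (\<lambda>x. (w x + t * v x) + (- w x))" by (simp add: algebra_simps)
    also have "\<dots> \<le> q (\<lambda>x. w x + t * v x) + q (\<lambda>x. - w x)" by (rule q_add[OF 2 1])
    finally show ?thesis by simp
  qed
  have bdd: "bdd_below {q (\<lambda>x. w x + t * v x) - t * q v | t. t \<ge> 0}" if "w \<in> V" for w
    using lower[OF that] by (intro bdd_belowI[of _ "- q (\<lambda>x. - w x)"]) auto
  show le: "r w \<le> q (\<lambda>x. w x + t * v x) - t * q v" if "w \<in> V" "t \<ge> 0" for w t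
    unfolding r_def by (rule cInf_lower[OF _ bdd[OF that(1)]]) (use that in auto)
  have ge: "c \<le> r w" if "w \<in> V" "\<And>t. t \<ge> 0 \<Longrightarrow> c \<le> q (\<lambda>x. w x + t * v x) - t * q v" for w c
    unfolding r_def by (rule cInf_greatest) (use that in auto)
  have sub: "r (\<lambda>x. f x + g x) \<le> r f + r g" if "f \<in> V" "g \<in> V" for f g
  proof -
    have A: "r (\<lambda>x. f x + g x) - (q (\<lambda>x. g x + t * v x) - t * q v) \<le> r f" if t: "t \<ge> 0" for t
    proof (rule ge[OF \<open>f \<in> V\<close>])
      fix s :: real assume s: "s \<ge> 0"
      have "r (\<lambda>x. f x + g x) \<le> q (\<lambda>x. (f x + g x) + (s+t) * v x) - (s+t) * q v"
        using le[OF V_add[OF \<open>f \<in> V\<close> \<open>g \<in> V\<close>], of "s+t"] s t by simp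
      also have "(\<lambda>x. (f x + g x) + (s+t) * v x) = (\<lambda>x. (f x + s * v x) + (g x + t * v x))"
        by (auto simp: algebra_simps)
      also have "q \<dots> \<le> q (\<lambda>x. f x + s * v x) + q (\<lambda>x. g x + t * v x)"
        by (rule q_add; rule V_add) (use \<open>f \<in> V\<close> \<open>g \<in> V\<close> V_sc v in auto)
      finally show "r (\<lambda>x. f x + g x) - (q (\<lambda>x. g x + t * v x) - t * q v)
          \<le> q (\<lambda>x. f x + s * v x) - s * q v" by (simp add: algebra_simps)
    qed
    have "r (\<lambda>x. f x + g x) - r f \<le> r g"
      by (rule ge[OF \<open>g \<in> V\<close>], drule A, linarith)
    then show ?thesis by simp
  qed
  have scle: "r (\<lambda>x. c * f x) \<le> c * r f" if "c > 0" "f \<in> V" for c f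
  proof -
    have "r (\<lambda>x. c * f x) / c \<le> r f"
    proof (rule ge[OF that(2)])
      fix t :: real assume t: "t \<ge> 0"
      have "r (\<lambda>x. c * f x) \<le> q (\<lambda>x. c * f x + (c * t) * v x) - (c * t) * q v"
        by (rule le) (use that t V_sc in auto)
      also have "(\<lambda>x. c * f x + (c * t) * v x) = (\<lambda>x. c * (f x + t * v x))"
        by (auto simp: algebra_simps)
      also have "q \<dots> = c * q (\<lambda>x. f x + t * v x)"
        by (rule q_sc) (use that V_add V_sc v in auto)
      finally show "r (\<lambda>x. c * f x) / c \<le> q (\<lambda>x. f x + t * v x) - t * q v"
        using that by (simp add: field_simps)
    qed
    then show ?thesis using that by (simp add: field_simps)
  qed
  have sc: "r (\<lambda>x. c * f x) = c * r f" if "c > 0" "f \<in> V" for c f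
  proof (rule antisym[OF scle[OF that]])
    have "r (\<lambda>x. (1/c) * (c * f x)) \<le> (1/c) * r (\<lambda>x. c * f x)"
      by (rule scle) (use that V_sc in auto)
    then show "c * r f \<le> r (\<lambda>x. c * f x)" using that by (simp add: field_simps)
  qed
  have zero: "r (\<lambda>x. 0) = 0"
  proof (rule antisym)
    have z: "(\<lambda>x. 0) \<in> V" by (rule function_space_zero[OF V])
    have q0: "q (\<lambda>x. 0) = 0" using q_sc[OF order_refl z] by simp
    show "r (\<lambda>x. 0) \<le> 0" using le[OF z, of 0] q0 by simp
    show "0 \<le> r (\<lambda>x. 0)" by (rule ge[OF z]) (use q_sc[OF _ v] in simp)
  qed
  show "sublinear_on V r"
    unfolding sublinear_on_def
  proof (intro conjI ballI allI impI)
    fix c :: real and f assume "0 \<le> c" "f \<in> V"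
    then show "r (\<lambda>x. c * f x) = c * r f" using sc[of c f] zero by (cases "c = 0") auto
  qed (use sub in auto)
qed

text \<open>Zorn's lemma is applied downwards, to the sublinear functionals below \<open>p\<close>:
  the infimum of a chain is again sublinear, and a minimal element is linear. Subspaces are sets of
  functions with pointwise operations, so that the same theorem serves the generalized limits and
  the separation argument behind Reiter's condition.\<close>

theorem hahn_banach_sublinear:
  assumes V: "function_space V" and p: "sublinear_on V p"
  obtains l where "linear_on_space V l" "\<And>f. f \<in> V \<Longrightarrow> l f \<le> p f"
proof -
  \<comment> \<open>\<open>P\<close> compares values at all functions, so the values off
    \<open>V\<close> are normalized to 0; otherwise two functionals could fail to be comparable
    because of arguments that do not matter.\<close>
  define A where "A = {q. sublinear_on V q \<and> (\<forall>f\<in>V. q f \<le> p f) \<and> (\<forall>f. f \<notin> V \<longrightarrow> q f = 0)}"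
  define P where "P = (\<lambda>(q::('a \<Rightarrow> real) \<Rightarrow> real) q'. \<forall>f. q' f \<le> q f)"
  have V_add: "\<And>f g. f \<in> V \<Longrightarrow> g \<in> V \<Longrightarrow> (\<lambda>x. f x + g x) \<in> V" 
    and V_sc: "\<And>c f. f \<in> V \<Longrightarrow> (\<lambda>x. c * f x) \<in> V" using V by (auto simp: function_space_def)
  have restr: "(\<lambda>f. if f \<in> V then q f else 0) \<in> A" if "sublinear_on V q" "\<And>f. f \<in> V \<Longrightarrow> q f \<le> p f" for q
    using that V_add V_sc unfolding A_def sublinear_on_def by simp
  have neg: "- p (\<lambda>x. - f x) \<le> q f" if "q \<in> A" "f \<in> V" for q f
  proof -
    have m: "(\<lambda>x. - f x) \<in> V" using V_sc[OF that(2), of "-1"] by simp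
    have qs: "sublinear_on V q" using that unfolding A_def by blast
    have "q (\<lambda>x. 0 * f x) = 0 * q f" by (rule sublinear_onD(2)[OF qs _ that(2)]) simp
    then have "0 = q (\<lambda>x. f x + (- f x))" by simp
    also have "\<dots> \<le> q f + q (\<lambda>x. - f x)"
      by (rule sublinear_onD(1)[OF qs that(2) m])
    also have "q (\<lambda>x. - f x) \<le> p (\<lambda>x. - f x)" using that m unfolding A_def by blast
    finally show ?thesis by simp
  qed
  have "\<exists>m\<in>A. \<forall>a\<in>A. P m a \<longrightarrow> a = m"
  proof (rule predicate_Zorn)
    show "partial_order_on A (relation_of P A)"
      by (rule partial_order_on_relation_ofI) (auto simp: P_def intro: order.trans intro!: ext order.antisym)
  next
    fix C assume C: "C \<in> Chains (relation_of P A)"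
    have CA: "C \<subseteq> A" and comp: "\<And>a b. a \<in> C \<Longrightarrow> b \<in> C \<Longrightarrow> P a b \<or> P b a"
      using C unfolding Chains_def relation_of_def by auto
    show "\<exists>u\<in>A. \<forall>a\<in>C. P a u"
    proof (cases "C = {}")
      case True
      then show ?thesis using restr[OF p] by auto
    next
      case False
      define u where "u = (\<lambda>f. INF q\<in>C. q f)"
      have bdd: "bdd_below ((\<lambda>q. q f) ` C)" if "f \<in> V" for f
        using neg that CA by (intro bdd_belowI[of _ "- p (\<lambda>x. - f x)"]) auto
      have u_le: "u f \<le> q f" if "q \<in> C" "f \<in> V" for q f
        unfolding u_def by (rule cINF_lower[OF bdd]) (use that in auto)
      have u_ge: "c \<le> u f" if "\<And>q. q \<in> C \<Longrightarrow> c \<le> q f" for c f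
        unfolding u_def by (rule cINF_greatest[OF False]) (use that in auto)
      have qadd: "q (\<lambda>x. f x + g x) \<le> q f + q g" if "q \<in> C" "f \<in> V" "g \<in> V" for q f g
        using that CA sublinear_onD(1)[of V q f g] unfolding A_def by blast
      have qsc: "q (\<lambda>x. c * f x) = c * q f" if "q \<in> C" "f \<in> V" "c \<ge> 0" for q c f
        using that CA sublinear_onD(2)[of V q c f] unfolding A_def by blast
      have "sublinear_on V u"
        unfolding sublinear_on_def
      proof (intro conjI ballI allI impI)
        fix f g assume fg: "f \<in> V" "g \<in> V"
        have U: "u (\<lambda>x. f x + g x) \<le> q f + q' g" if qq: "q \<in> C" "q' \<in> C" for q q'
        proof -
          \<comment> \<open>Of two members of a chain the smaller one serves for both arguments;
            this is why subadditivity survives the infimum.\<close>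
          obtain s where s: "s \<in> C" "s f \<le> q f" "s g \<le> q' g"
            using comp[OF qq] qq unfolding P_def by blast
          show ?thesis using u_le[OF s(1) V_add[OF fg]] qadd[OF s(1) fg] s by linarith
        qed
        have U': "u (\<lambda>x. f x + g x) - q f \<le> u g" if q: "q \<in> C" for q
          by (rule u_ge, drule U[OF q], linarith)
        have "u (\<lambda>x. f x + g x) - u g \<le> u f"
          by (rule u_ge, drule U', linarith)
        then show "u (\<lambda>x. f x + g x) \<le> u f + u g" by simp
      next
        fix c :: real and f assume c: "0 \<le> c" "f \<in> V"
        have "u (\<lambda>x. c * f x) = (INF q\<in>C. c * q f)" unfolding u_def using qsc c by simp
        also have "\<dots> = c * u f"
        proof (cases "c = 0")
          case True then show ?thesis using False by simp
        next
          case F: False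
          with c have cp: "c > 0" by simp
          show ?thesis
          proof (rule antisym)
            have "(INF q\<in>C. c * q f) / c \<le> u f"
            proof (rule u_ge)
              fix q assume q: "q \<in> C"
              have "(INF q\<in>C. c * q f) \<le> c * q f"
                by (rule cINF_lower[OF _ q])
                   (use neg c CA cp in \<open>auto intro!: bdd_belowI2[of _ "c * (- p (\<lambda>x. - f x))"] mult_left_mono\<close>)
              then show "(INF q\<in>C. c * q f) / c \<le> q f" using cp by (simp add: field_simps)
            qed
            then show "(INF q\<in>C. c * q f) \<le> c * u f" using cp by (simp add: field_simps)
            show "c * u f \<le> (INF q\<in>C. c * q f)"
              by (rule cINF_greatest[OF False]) (use u_le c cp in auto)
          qed
        qed
        finally show "u (\<lambda>x. c * f x) = c * u f" .
      qed
      moreover have "u f \<le> p f" if "f \<in> V" for f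
      proof -
        obtain q where q: "q \<in> C" using False by blast
        then have "q f \<le> p f" using CA that unfolding A_def by blast
        then show ?thesis using u_le[OF q that] by simp
      qed
      ultimately have "(\<lambda>f. if f \<in> V then u f else 0) \<in> A" by (rule restr)
      moreover have "P q (\<lambda>f. if f \<in> V then u f else 0)" if "q \<in> C" for q
        using that u_le CA unfolding P_def A_def by auto
      ultimately show ?thesis by blast
    qed
  qed
  then obtain m where m: "m \<in> A" and minm: "\<And>a. a \<in> A \<Longrightarrow> P m a \<Longrightarrow> a = m" by blast
  have msub: "sublinear_on V m" using m by (simp add: A_def)
  have m_le: "m f \<le> p f" if "f \<in> V" for f using m that by (simp add: A_def)
  have add: "m (\<lambda>x. w x + v x) = m w + m v" if v: "v \<in> V" and w: "w \<in> V" for v w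
  proof (rule antisym)
    show "m (\<lambda>x. w x + v x) \<le> m w + m v" using msub that by (simp add: sublinear_on_def)
    \<comment> \<open>By minimality \<open>r = m\<close>, and the value \<open>t = 1\<close> in the
      infimum then gives the missing inequality.\<close>
    define r where "r = (\<lambda>w. Inf {m (\<lambda>x. w x + t * v x) - t * m v | t. t \<ge> 0})"
    have r: "sublinear_on V r" "\<And>w t. w \<in> V \<Longrightarrow> t \<ge> 0 \<Longrightarrow> r w \<le> m (\<lambda>x. w x + t * v x) - t * m v"
      using sublinear_lower_in_direction[OF V msub v] unfolding r_def by auto
    have rm: "r w \<le> m w" if "w \<in> V" for w using r(2)[OF that, of 0] by simp
    have "(\<lambda>f. if f \<in> V then r f else 0) \<in> A"
      by (rule restr[OF r(1)]) (use rm m_le order.trans in blast)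
    moreover have "P m (\<lambda>f. if f \<in> V then r f else 0)"
      using rm m unfolding P_def A_def by auto
    ultimately have "(\<lambda>f. if f \<in> V then r f else 0) = m" by (rule minm)
    then have "m w = r w" using w by (metis (mono_tags))
    then show "m w + m v \<le> m (\<lambda>x. w x + v x)" using r(2)[OF w, of 1] by simp
  qed
  have m0: "m (\<lambda>x. 0) = 0"
    using add[OF function_space_zero[OF V] function_space_zero[OF V]] by simp
  have minus: "m (\<lambda>x. - f x) = - m f" if "f \<in> V" for f
  proof -
    have "(\<lambda>x. - f x) \<in> V" using V_sc[OF that, of "-1"] by simp
    then have "m (\<lambda>x. f x + (- f x)) = m f + m (\<lambda>x. - f x)" by (rule add[OF _ that])
    then show ?thesis using m0 by simp
  qed
  have "linear_on_space V m"
    unfolding linear_on_space_def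
  proof (intro conjI ballI allI)
    fix c :: real and f assume f: "f \<in> V"
    have pos: "m (\<lambda>x. c * g x) = c * m g" if "c \<ge> 0" "g \<in> V" for c g
      using msub that by (simp add: sublinear_on_def)
    show "m (\<lambda>x. c * f x) = c * m f"
    proof (cases "c \<ge> 0")
      case True then show ?thesis using pos f by simp
    next
      case False
      have "m (\<lambda>x. - ((- c) * f x)) = - m (\<lambda>x. (- c) * f x)" by (rule minus) (rule V_sc[OF f])
      then show ?thesis using pos[of "-c", OF _ f] False by simp
    qed
  qed (use add in auto)
  then show ?thesis using that m_le by blast
qed

definition bounded_functions :: "('a \<Rightarrow> real) set" where
  "bounded_functions = {f. \<exists>C. \<forall>x. \<bar>f x\<bar> \<le> C}"

lemma function_space_bounded_functions: "function_space bounded_functions"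
  unfolding function_space_def bounded_functions_def
proof (intro conjI ballI allI)
  show "{f. \<exists>C. \<forall>x::'a. \<bar>f x\<bar> \<le> (C::real)} \<noteq> {}"
    by (rule ex_in_conv[THEN iffD1], rule exI[of _ "\<lambda>_. 0"]) auto
  fix f g :: "'a \<Rightarrow> real"
  assume "f \<in> {f. \<exists>C. \<forall>x. \<bar>f x\<bar> \<le> C}" "g \<in> {f. \<exists>C. \<forall>x. \<bar>f x\<bar> \<le> C}"
  then obtain C D where "\<forall>x. \<bar>f x\<bar> \<le> C" "\<forall>x. \<bar>g x\<bar> \<le> D" by auto
  then have "\<bar>f x + g x\<bar> \<le> C + D" for x
    using abs_triangle_ineq[of "f x" "g x"] by (meson add_mono order.trans)
  then show "(\<lambda>x. f x + g x) \<in> {f. \<exists>C. \<forall>x. \<bar>f x\<bar> \<le> C}" by blast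
next
  fix c and f :: "'a \<Rightarrow> real"
  assume "f \<in> {f. \<exists>C. \<forall>x. \<bar>f x\<bar> \<le> C}"
  then obtain C where C: "\<forall>x. \<bar>f x\<bar> \<le> C" by auto
  have "\<forall>x. \<bar>c * f x\<bar> \<le> \<bar>c\<bar> * C" by (simp add: C abs_mult mult_left_mono)
  then show "(\<lambda>x. c * f x) \<in> {f. \<exists>C. \<forall>x. \<bar>f x\<bar> \<le> C}" by blast
qed

text \<open>The functional \<open>p\<close> is the upper limit along \<open>F\<close>, written as
  the infimum of the eventual upper bounds. A linear functional below it lies between lower and
  upper limit, hence extends the limit. It takes the place of weak-star cluster points in both
  directions of the theorem.\<close>

theorem generalized_limit_exists:
  fixes F :: "'a filter"
  assumes F: "F \<noteq> bot"
  obtains L where "linear_on_space bounded_functions L"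
    "\<And>a c. a \<in> bounded_functions \<Longrightarrow> (\<forall>\<^sub>F i in F. a i \<le> c) \<Longrightarrow> L a \<le> c"
    "\<And>a c. a \<in> bounded_functions \<Longrightarrow> (\<forall>\<^sub>F i in F. c \<le> a i) \<Longrightarrow> c \<le> L a"
    "\<And>a c. a \<in> bounded_functions \<Longrightarrow> (a \<longlongrightarrow> c) F \<Longrightarrow> L a = c"
proof -
  define p where "p = (\<lambda>a::'a\<Rightarrow>real. Inf {c. \<forall>\<^sub>F i in F. a i \<le> c})"
  have lb: "- C \<le> c" if "\<forall>x. \<bar>a x\<bar> \<le> C" "\<forall>\<^sub>F i in F. a i \<le> c" for a :: "'a\<Rightarrow>real" and C c
  proof -
    have "\<forall>\<^sub>F i in F. - C \<le> c" using that(2) 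
      by eventually_elim (use that(1) in \<open>metis abs_le_D2 minus_le_iff order.trans\<close>)
    then show ?thesis using F by simp
  qed
  have bdd: "bdd_below {c. \<forall>\<^sub>F i in F. a i \<le> c}" if a: "a \<in> bounded_functions" for a
  proof -
    obtain C where "\<forall>x. \<bar>a x\<bar> \<le> C" using a unfolding bounded_functions_def by blast
    then show ?thesis using lb by (intro bdd_belowI[of _ "-C"]) blast
  qed
  have ne: "{c. \<forall>\<^sub>F i in F. a i \<le> c} \<noteq> {}" if a: "a \<in> bounded_functions" for a
  proof -
    obtain C where "\<forall>x. \<bar>a x\<bar> \<le> C" using a unfolding bounded_functions_def by blast
    then have "\<forall>\<^sub>F i in F. a i \<le> C" by (intro always_eventually) (simp add: abs_le_iff)
    then show ?thesis by blast
  qed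
  have p_le: "p a \<le> c" if "a \<in> bounded_functions" "\<forall>\<^sub>F i in F. a i \<le> c" for a c
    unfolding p_def by (rule cInf_lower[OF _ bdd]) (use that in auto)
  have p_ge: "c \<le> p a" if "a \<in> bounded_functions" "\<And>d. \<forall>\<^sub>F i in F. a i \<le> d \<Longrightarrow> c \<le> d" for a c
    unfolding p_def by (rule cInf_greatest[OF ne]) (use that in auto)
  have B_add: "\<And>f g. f \<in> bounded_functions \<Longrightarrow> g \<in> bounded_functions \<Longrightarrow> (\<lambda>x::'a. f x + g x) \<in> bounded_functions"
    and B_sc: "\<And>c f. f \<in> bounded_functions \<Longrightarrow> (\<lambda>x::'a. c * f x) \<in> bounded_functions"
    using function_spaceD[OF function_space_bounded_functions] by auto
  have "sublinear_on bounded_functions p"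
    unfolding sublinear_on_def
  proof (intro conjI ballI allI impI)
    fix f g :: "'a \<Rightarrow> real" assume fg: "f \<in> bounded_functions" "g \<in> bounded_functions"
    have *: "p (\<lambda>x. f x + g x) \<le> c + d" if "\<forall>\<^sub>F i in F. f i \<le> c" "\<forall>\<^sub>F i in F. g i \<le> d" for c d
      by (rule p_le[OF B_add[OF fg]], rule eventually_mono[OF eventually_conj[OF that]]) auto
    have "p (\<lambda>x. f x + g x) - c \<le> p g" if "\<forall>\<^sub>F i in F. f i \<le> c" for c
      using *[OF that] by (intro p_ge[OF fg(2)]) (simp add: algebra_simps)
    then have "p (\<lambda>x. f x + g x) - p g \<le> p f"
      by (intro p_ge[OF fg(1)]) (simp add: algebra_simps)
    then show "p (\<lambda>x. f x + g x) \<le> p f + p g" by simp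
  next
    fix c :: real and f :: "'a \<Rightarrow> real" assume c: "0 \<le> c" and f: "f \<in> bounded_functions"
    have le: "p (\<lambda>x. c * f x) \<le> c * p f" if c: "c > 0" and f: "f \<in> bounded_functions" for c :: real and f :: "'a \<Rightarrow> real"
    proof -
      have "p (\<lambda>x. c * f x) / c \<le> p f"
      proof (rule p_ge[OF f])
        fix d assume "\<forall>\<^sub>F i in F. f i \<le> d"
        then have "\<forall>\<^sub>F i in F. c * f i \<le> c * d" by eventually_elim (use c in simp)
        from p_le[OF B_sc[OF f] this] show "p (\<lambda>x. c * f x) / c \<le> d" using c by (simp add: field_simps)
      qed
      then show ?thesis using c by (simp add: field_simps)
    qed
    show "p (\<lambda>x. c * f x) = c * p f"
    proof (cases "c = 0")
      case True
      have "p (\<lambda>x. 0) = 0"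
      proof (rule antisym)
        have z: "(\<lambda>x. 0) \<in> bounded_functions" unfolding bounded_functions_def by auto
        show "p (\<lambda>x. 0) \<le> 0" by (rule p_le[OF z]) simp
        show "0 \<le> p (\<lambda>x. 0)" by (rule p_ge[OF z]) (use F in simp)
      qed
      then show ?thesis using True by simp
    next
      case False
      with c have cp: "c > 0" by simp
      have "p (\<lambda>x. (1/c) * (c * f x)) \<le> (1/c) * p (\<lambda>x. c * f x)"
        by (rule le) (use cp B_sc[OF f] in auto)
      then have "c * p f \<le> p (\<lambda>x. c * f x)" using cp by (simp add: field_simps)
      then show ?thesis using le[OF cp f] by simp
    qed
  qed
  then obtain L where L: "linear_on_space bounded_functions L" "\<And>f. f \<in> bounded_functions \<Longrightarrow> L f \<le> p f"
    using hahn_banach_sublinear[OF function_space_bounded_functions] by blast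
  have up: "L a \<le> c" if "a \<in> bounded_functions" "\<forall>\<^sub>F i in F. a i \<le> c" for a c
    using L(2)[OF that(1)] p_le[OF that] by simp
  have low: "c \<le> L a" if a: "a \<in> bounded_functions" and e: "\<forall>\<^sub>F i in F. c \<le> a i" for a c
  proof -
    have "L (\<lambda>x. (-1) * a x) \<le> - c"
      by (rule up[OF B_sc[OF a]]) (use e in \<open>eventually_elim, simp\<close>)
    moreover have "L (\<lambda>x. (-1) * a x) = (-1) * L a"
      by (rule linear_on_spaceD(2)[OF L(1) a])
    ultimately show ?thesis by simp
  qed
  have lim: "L a = c" if a: "a \<in> bounded_functions" and t: "(a \<longlongrightarrow> c) F" for a c
  proof -
    have 1: "L a \<le> c + e" if "e > 0" for e
      by (rule up[OF a], rule eventually_mono[OF order_tendstoD(2)[OF t, of "c + e"]]) (use that in auto)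
    have 2: "c - e \<le> L a" if "e > 0" for e
      by (rule low[OF a], rule eventually_mono[OF order_tendstoD(1)[OF t, of "c - e"]]) (use that in auto)
    have "c \<le> L a" by (rule field_le_epsilon) (use 2 in \<open>simp add: algebra_simps\<close>)
    moreover have "L a \<le> c" by (rule field_le_epsilon) (use 1 in simp)
    ultimately show ?thesis by simp
  qed
  show ?thesis using that[OF L(1) up low lim] by blast
qed

section \<open>Growth of Young functions\<close>

lemma bernoulli_powr_strict:
  fixes t r :: real
  assumes "t \<ge> 0" "t \<noteq> 1" "r > 1"
  shows "t powr r > 1 + r * (t - 1)"
proof -
  have d: "((\<lambda>x. x powr r) has_real_derivative r * x powr (r - 1)) (at x)" if "x > 0" for x
    using that by (auto intro!: derivative_eq_intros)
  consider "t = 0" | "0 < t" "t < 1" | "t > 1" using assms by linarith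
  then show ?thesis
  proof cases
    case 1 then show ?thesis using assms by simp
  next
    case 2
    obtain z where z: "z > t" "z < 1" "1 powr r - t powr r = (1 - t) * (r * z powr (r - 1))"
      using MVT2[OF 2(2), of "\<lambda>x. x powr r" "\<lambda>x. r * x powr (r-1)"] d 2 by auto
    have "z powr (r - 1) < 1 powr (r-1)" using z 2 assms by (intro powr_less_mono2) auto
    then have "(1 - t) * (r * z powr (r - 1)) < (1 - t) * (r * 1)" using 2 assms by simp
    then show ?thesis using z by (simp add: algebra_simps)
  next
    case 3
    obtain z where z: "z > 1" "z < t" "t powr r - 1 powr r = (t - 1) * (r * z powr (r - 1))"
      using MVT2[OF 3, of "\<lambda>x. x powr r" "\<lambda>x. r * x powr (r-1)"] d 3 by auto
    have "1 powr (r-1) < z powr (r - 1)" using z 3 assms by (intro powr_less_mono2) auto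
    then have "(t - 1) * (r * z powr (r - 1)) > (t - 1) * (r * 1)" using 3 assms by simp
    then show ?thesis using z by (simp add: algebra_simps)
  qed
qed

lemma powr_midpoint_strict:
  fixes a b r :: real
  assumes "a \<ge> 0" "b \<ge> 0" "a \<noteq> b" "r > 1"
  shows "((a + b) / 2) powr r < (a powr r + b powr r) / 2"
proof -
  define m where "m = (a + b) / 2"
  have m: "m > 0" using assms by (auto simp: m_def)
  have "1 + r * (a/m - 1) < (a/m) powr r" "1 + r * (b/m - 1) < (b/m) powr r"
    by (rule bernoulli_powr_strict; use assms m in \<open>auto simp: m_def field_simps\<close>)+
  moreover have "a / m + b / m = 2"
  proof -
    have "a / m + b / m = (a + b) / m" by (simp add: add_divide_distrib)
    also have "a + b = 2 * m" by (simp add: m_def)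
    finally show ?thesis using m by simp
  qed
  then have "r * ((a/m - 1) + (b/m - 1)) = 0" by simp
  then have "r * (a/m - 1) + r * (b/m - 1) = 0" by (simp only: distrib_left)
  ultimately have "2 < (a/m) powr r + (b/m) powr r" by linarith
  also have "\<dots> = (a powr r + b powr r) / m powr r"
    using assms m by (simp add: powr_divide add_divide_distrib)
  finally show ?thesis using m by (simp add: m_def field_simps)
qed

text \<open>Quantitative strict convexity, in a form that can be integrated over the group. Both
  sides are homogeneous of degree \<open>r\<close>, which reduces the claim to
  \<open>a + b = 1\<close>. On the compact set \<open>Q\<close>, where the relative difference is at
  least \<open>e\<close>, the midpoint gap has a positive lower bound \<open>d\<close>, and
  \<open>K = 1/d\<close>.\<close>

lemma powr_gap:
  fixes r e :: real
  assumes r: "r > 1" and e: "e > 0"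
  obtains K where "K \<ge> 0" "\<And>a b. a \<ge> 0 \<Longrightarrow> b \<ge> 0 \<Longrightarrow>
    \<bar>a powr r - b powr r\<bar> \<le> e * (a powr r + b powr r) +
      K * ((a powr r + b powr r) / 2 - ((a + b) / 2) powr r)"
proof -
  define D where "D = (\<lambda>a::real. (a powr r + (1 - a) powr r) / 2 - ((a + (1 - a)) / 2) powr r)"
  define Q where "Q = {a \<in> {0..1}. e * (a powr r + (1 - a) powr r) \<le> \<bar>a powr r - (1 - a) powr r\<bar>}"
  have c1: "continuous_on {0..1} (\<lambda>a::real. a powr r)"
    by (intro continuous_on_powr') (use r in \<open>auto intro!: continuous_intros\<close>)
  have c2: "continuous_on {0..1} (\<lambda>a::real. (1 - a) powr r)"
    by (intro continuous_on_powr') (use r in \<open>auto intro!: continuous_intros\<close>)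
  have "compact Q"
  proof -
    have "closed Q"
      unfolding Q_def
      by (intro continuous_on_closed_Collect_le continuous_on_mult continuous_on_add continuous_on_rabs
          continuous_on_diff continuous_on_const c1 c2) simp
    moreover have "bounded Q" unfolding Q_def by (rule bounded_subset[of "{0..1}"]) auto
    ultimately show ?thesis by (simp add: compact_eq_bounded_closed)
  qed
  have half: "1/2 \<notin> Q"
    using mult_pos_pos[OF e, of "(1/2) powr r"] by (auto simp: Q_def)
  have Dpos: "D a > 0" if "a \<in> Q" for a
    unfolding D_def using powr_midpoint_strict[of a "1 - a" r] that half r
    by (cases "a = 1/2") (auto simp: Q_def)
  have D0: "D a \<ge> 0" if "a \<in> {0..1}" for a
  proof (cases "a = 1 - a")
    case True
    then have h: "a = 1/2" by simp
    show ?thesis unfolding h by (simp add: D_def)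
  next
    case False
    then show ?thesis unfolding D_def using powr_midpoint_strict[of a "1 - a" r] that r by auto
  qed
  obtain d where d: "d > 0" "\<And>a. a \<in> Q \<Longrightarrow> d \<le> D a"
  proof (cases "Q = {}")
    case True then show ?thesis using that[of 1] by auto
  next
    case False
    have "continuous_on Q D"
      unfolding D_def
      by (rule continuous_on_subset[of "{0..1}"],
          intro continuous_on_divide continuous_on_add continuous_on_diff continuous_on_const c1 c2)
         (auto simp: Q_def)
    then obtain a where "a \<in> Q" "\<forall>y\<in>Q. D a \<le> D y"
      using continuous_attains_inf[OF \<open>compact Q\<close> False] by blast
    then show ?thesis using that[of "D a"] Dpos by auto
  qed
  have unit: "\<bar>a powr r - (1 - a) powr r\<bar> \<le> e * (a powr r + (1 - a) powr r) + (1/d) * D a"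
    if a: "a \<in> {0..1}" for a
  proof (cases "a \<in> Q")
    case True
    have "a powr r \<le> 1 powr r" "(1 - a) powr r \<le> 1 powr r"
      by (rule powr_mono2; use a r in simp)+
    then have "\<bar>a powr r - (1 - a) powr r\<bar> \<le> 1"
      by (smt (verit) powr_ge_zero powr_one_eq_one)
    also have "1 \<le> (1/d) * D a" using d True by (simp add: field_simps)
    also have "\<dots> \<le> e * (a powr r + (1 - a) powr r) + (1/d) * D a" using e by simp
    finally show ?thesis .
  next
    case False
    then have "\<bar>a powr r - (1 - a) powr r\<bar> \<le> e * (a powr r + (1 - a) powr r)"
      using a by (auto simp: Q_def)
    moreover have "0 \<le> (1/d) * D a" using d D0[OF a] by simp
    ultimately show ?thesis by linarith
  qed
  show ?thesis
  proof (rule that[of "1/d"])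
    show "0 \<le> 1/d" using d by simp
    fix a b :: real assume ab: "a \<ge> 0" "b \<ge> 0"
    show "\<bar>a powr r - b powr r\<bar> \<le> e * (a powr r + b powr r) +
      (1/d) * ((a powr r + b powr r) / 2 - ((a + b) / 2) powr r)"
    proof (cases "a + b = 0")
      case True
      then have "a = 0" "b = 0" using ab by auto
      then show ?thesis by simp
    next
      case False
      define s where "s = a + b"
      define t where "t = a / s"
      have s: "s > 0" using False ab by (simp add: s_def)
      have t: "t \<in> {0..1}" using s ab by (auto simp: t_def s_def)
      have as: "a = s * t" using s by (simp add: t_def)
      have "b = s - a" by (simp add: s_def)
      also have "\<dots> = s * (1 - t)" by (subst as) (simp add: right_diff_distrib)
      finally have bs: "b = s * (1 - t)" .
      have ap: "a powr r = s powr r * t powr r" by (subst as) (simp add: powr_mult)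
      have bp: "b powr r = s powr r * (1 - t) powr r" by (subst bs) (simp add: powr_mult)
      have mp: "((a + b) / 2) powr r = s powr r * ((t + (1 - t)) / 2) powr r"
      proof -
        have "(a + b) / 2 = s * ((t + (1 - t)) / 2)" by (simp add: s_def)
        then show ?thesis by (simp only: powr_mult)
      qed
      have "\<bar>a powr r - b powr r\<bar> = s powr r * \<bar>t powr r - (1 - t) powr r\<bar>"
        unfolding ap bp by (simp add: abs_mult flip: right_diff_distrib)
      also have "\<dots> \<le> s powr r * (e * (t powr r + (1 - t) powr r) + (1/d) * D t)"
        by (rule mult_left_mono[OF unit[OF t]]) simp
      also have "\<dots> = e * (a powr r + b powr r) +
          (1/d) * ((a powr r + b powr r) / 2 - ((a + b) / 2) powr r)"
        unfolding ap bp mp D_def by (simp add: algebra_simps)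
      finally show ?thesis .
    qed
  qed
qed

lemma young_functionD:
  assumes "young_function \<Phi>"
  shows "\<And>x. \<Phi> (- x) = \<Phi> x" "convex_on UNIV \<Phi>" "continuous_on UNIV \<Phi>" "\<And>x. 0 \<le> \<Phi> x" "\<Phi> 0 = 0"
    "filterlim \<Phi> at_top at_top"
  using assms by (auto simp: young_function_def)

lemma young_scale:
  assumes "young_function \<Phi>" "0 \<le> c" "c \<le> 1"
  shows "\<Phi> (c * x) \<le> c * \<Phi> x"
  using convex_onD[OF young_functionD(2)[OF assms(1)], of c 0 x] assms(2,3) young_functionD(5)[OF assms(1)]
  by simp

lemma young_mono:
  assumes "young_function \<Phi>" "0 \<le> s" "s \<le> t"
  shows "\<Phi> s \<le> \<Phi> t"
proof (cases "t = 0")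
  case True then show ?thesis using assms by simp
next
  case False
  then have "t > 0" using assms by simp
  then have "\<Phi> ((s/t) * t) \<le> (s/t) * \<Phi> t" by (intro young_scale[OF assms(1)]) (use assms in auto)
  also have "\<dots> \<le> 1 * \<Phi> t"
    by (rule mult_right_mono) (use assms \<open>t > 0\<close> young_functionD(4)[OF assms(1)] in auto)
  finally show ?thesis using \<open>t > 0\<close> by simp
qed

lemma young_ratio_mono:
  assumes "young_function \<Phi>" "0 < s" "s \<le> t"
  shows "t * \<Phi> s \<le> s * \<Phi> t"
proof -
  have "\<Phi> ((s/t) * t) \<le> (s/t) * \<Phi> t" by (intro young_scale[OF assms(1)]) (use assms in auto)
  then show ?thesis using assms by (simp add: field_simps)
qed

lemma young_measurable: "young_function \<Phi> \<Longrightarrow> \<Phi> \<in> borel_measurable borel"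
  by (intro borel_measurable_continuous_onI) (simp add: young_function_def)

lemma young_value_attained:
  assumes "young_function \<Phi>" "y > 0"
  obtains s where "s > 0" "\<Phi> s = y"
proof -
  have "eventually (\<lambda>x. \<Phi> x \<ge> y) at_top"
    using young_functionD(6)[OF assms(1)] unfolding filterlim_at_top by blast
  then obtain x where x: "x \<ge> 0" "\<Phi> x \<ge> y" 
    unfolding eventually_at_top_linorder by (meson max.cobounded1 max.cobounded2)
  obtain s where s: "0 \<le> s" "s \<le> x" "\<Phi> s = y"
    using IVT'[of \<Phi> 0 y x] x assms young_functionD(5)[OF assms(1)]
      continuous_on_subset[OF young_functionD(3)[OF assms(1)], of "{0..x}"] by auto
  have "s \<noteq> 0" using s assms young_functionD(5)[OF assms(1)] by auto
  then show ?thesis using that[of s] s by auto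
qed

text \<open>The true growth in \<open>l\<close> is polynomial; the cruder exponential is chosen
  because exponentials of sign sums have explicit moments. Beyond \<open>2^m > 2 * ln k\<close>,
  halving \<open>l\<close> costs a factor \<open>k \<le> exp (l/2)\<close>, which the exponential
  absorbs; for smaller \<open>l\<close> the constant \<open>C = k^m\<close> suffices.\<close>

lemma delta2_exp_growth:
  assumes y: "young_function \<Phi>" and d: "delta2 \<Phi>"
  obtains C where "C \<ge> 1" "\<And>l s. l \<ge> 0 \<Longrightarrow> s \<ge> 0 \<Longrightarrow> \<Phi> (l * s) \<le> C * exp l * \<Phi> s"
proof -
  obtain k0 where k0: "k0 > 0" "\<And>x. x \<ge> 0 \<Longrightarrow> \<Phi> (2 * x) \<le> k0 * \<Phi> x" using d by (auto simp: delta2_def)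
  define k where "k = max 1 k0"
  have k: "k \<ge> 1" "\<And>x. x \<ge> 0 \<Longrightarrow> \<Phi> (2 * x) \<le> k * \<Phi> x"
  proof -
    show "k \<ge> 1" by (simp add: k_def)
    fix x :: real assume "x \<ge> 0"
    have "k0 * \<Phi> x \<le> k * \<Phi> x"
      by (rule mult_right_mono) (use young_functionD(4)[OF y] in \<open>auto simp: k_def\<close>)
    then show "\<Phi> (2 * x) \<le> k * \<Phi> x" using k0(2)[OF \<open>x \<ge> 0\<close>] by simp
  qed
  have nn: "\<Phi> x \<ge> 0" for x using young_functionD(4)[OF y] by simp
  have pow: "\<Phi> (2^n * x) \<le> k^n * \<Phi> x" if "x \<ge> 0" for n x
  proof (induction n)
    case (Suc n)
    have "\<Phi> (2^Suc n * x) = \<Phi> (2 * (2^n * x))" by (simp add: mult.assoc)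
    also have "\<dots> \<le> k * \<Phi> (2^n * x)" using k(2) that by simp
    also have "\<dots> \<le> k * (k^n * \<Phi> x)" by (rule mult_left_mono[OF Suc]) (use k in simp)
    finally show ?case by simp
  qed simp
  obtain m where m: "2 * ln k < 2^m" using real_arch_pow[of 2 "2 * ln k"] by auto
  define C where "C = k^m"
  have C: "C \<ge> 1" using k by (simp add: C_def)
  have base: "\<Phi> (l * s) \<le> C * exp l * \<Phi> s" if "0 \<le> l" "l \<le> 2^m" "s \<ge> 0" for l s
  proof -
    have "\<Phi> (l * s) \<le> \<Phi> (2^m * s)" by (rule young_mono[OF y]) (use that in \<open>auto intro: mult_right_mono\<close>)
    also have "\<dots> \<le> C * \<Phi> s" unfolding C_def by (rule pow[OF that(3)])
    also have "C * \<Phi> s \<le> C * exp l * \<Phi> s"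
      by (rule mult_right_mono[OF _ nn]) (use C that in simp)
    finally show ?thesis .
  qed
  have ind: "\<Phi> (l * s) \<le> C * exp l * \<Phi> s" if "0 \<le> l" "l \<le> 2^m * 2^n" "s \<ge> 0" for l s n
    using that
  proof (induction n arbitrary: l)
    case 0 then show ?case using base by simp
  next
    case (Suc n)
    show ?case
    proof (cases "l \<le> 2^m")
      case True then show ?thesis using base Suc by simp
    next
      case False
      have "ln k \<le> l/2" using m False by simp
      then have "k \<le> exp (l/2)" using k by (simp add: ln_le_cancel_iff[symmetric] flip: ln_ge_iff)
      have "\<Phi> (l * s) = \<Phi> (2 * ((l/2) * s))" by simp
      also have "\<dots> \<le> k * \<Phi> ((l/2) * s)" by (rule k(2)) (use Suc in simp)
      also have "\<dots> \<le> k * (C * exp (l/2) * \<Phi> s)"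
        by (rule mult_left_mono[OF Suc.IH]) (use Suc k in auto)
      also have "\<dots> \<le> exp (l/2) * (C * exp (l/2) * \<Phi> s)"
        by (rule mult_right_mono[OF \<open>k \<le> exp (l/2)\<close>]) (use C nn in auto)
      also have "\<dots> = C * (exp (l/2) * exp (l/2)) * \<Phi> s" by (simp add: algebra_simps)
      also have "exp (l/2) * exp (l/2) = exp l" by (simp flip: exp_add)
      finally show ?thesis .
    qed
  qed
  have "\<Phi> (l * s) \<le> C * exp l * \<Phi> s" if "l \<ge> 0" "s \<ge> 0" for l s
  proof -
    obtain n where "l < 2^n" using real_arch_pow[of 2 l] by auto
    moreover have "(2::real)^n \<le> 2^m * 2^n" by simp
    ultimately have "l \<le> 2^m * 2^n" by linarith
    then show ?thesis using ind that by blast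
  qed
  then show ?thesis using that C by blast
qed

lemma complementary_pairD:
  assumes "complementary_pair \<Phi> \<Psi>"
  shows "young_function \<Phi>" "young_function \<Psi>"
    "\<And>s t. s \<ge> 0 \<Longrightarrow> t \<ge> 0 \<Longrightarrow> s * t \<le> \<Phi> s + \<Psi> t"
proof -
  show "young_function \<Phi>" "young_function \<Psi>" using assms by (auto simp: complementary_pair_def)
  fix s t :: real assume st: "s \<ge> 0" "t \<ge> 0"
  have b: "bdd_above {x * \<bar>t\<bar> - \<Phi> x | x. x \<ge> 0}" and e: "\<Psi> t = Sup {x * \<bar>t\<bar> - \<Phi> x | x. x \<ge> 0}"
    using assms unfolding complementary_pair_def by (metis (no_types, lifting))+
  have "s * \<bar>t\<bar> - \<Phi> s \<le> \<Psi> t" unfolding e by (rule cSup_upper[OF _ b]) (use st in auto)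
  then show "s * t \<le> \<Phi> s + \<Psi> t" using st by simp
qed

text \<open>For \<open>x > 0\<close> the number \<open>z\<close> is the slope of a supporting line
  of \<open>\<Phi>\<close> at \<open>x\<close>, obtained as the infimum of the difference quotients
  to the right. The line shows that the supremum defining \<open>\<Psi> z\<close> is attained at
  \<open>x\<close>; that it lies below \<open>\<Phi>\<close> at the origin gives
  \<open>z \<ge> 0\<close>.\<close>

lemma complementary_pair_equality:
  assumes c: "complementary_pair \<Phi> \<Psi>" and x: "x \<ge> 0"
  obtains z where "z \<ge> 0" "x * z = \<Phi> x + \<Psi> z"
proof (cases "x = 0")
  case True
  show ?thesis by (rule that[of 0]) (use True young_functionD(5)[OF complementary_pairD(1)[OF c]] young_functionD(5)[OF complementary_pairD(2)[OF c]] in auto)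
next
  case False
  with x have xp: "x > 0" by simp
  note y = complementary_pairD(1)[OF c]
  define z where "z = Inf ((\<lambda>t. (\<Phi> x - \<Phi> t) / (x - t)) ` ({x<..} \<inter> UNIV))"
  have sub: "\<Phi> t \<ge> \<Phi> x + z * (t - x)" for t
    unfolding z_def by (rule convex_le_Inf_differential[OF young_functionD(2)[OF y]]) auto
  have "0 \<ge> \<Phi> x - z * x" using sub[of 0] young_functionD(5)[OF y] by simp
  then have "z * x \<ge> 0" using young_functionD(4)[OF y, of x] by linarith
  then have z: "z \<ge> 0" using xp by (simp add: zero_le_mult_iff)
  have e: "\<Psi> z = Sup {x * \<bar>z\<bar> - \<Phi> x | x. x \<ge> 0}"
    using c unfolding complementary_pair_def by blast
  have "\<Psi> z \<le> x * z - \<Phi> x"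
    unfolding e
  proof (rule cSup_least)
    show "{x * \<bar>z\<bar> - \<Phi> x | x. x \<ge> 0} \<noteq> {}" by (auto intro: exI[of _ 0])
    fix w assume "w \<in> {x * \<bar>z\<bar> - \<Phi> x | x. x \<ge> 0}"
    then obtain t where "w = t * z - \<Phi> t" using z by auto
    then show "w \<le> x * z - \<Phi> x" using sub[of t] by (simp add: algebra_simps)
  qed
  then show ?thesis using that[of z] z complementary_pairD(3)[OF c x z] by simp
qed

text \<open>Let \<open>z\<close> give equality in Young's inequality for
  \<open>s = \<Psi> t / t\<close>. If \<open>z \<le> t\<close>, then
  \<open>\<Phi> s \<le> s * z \<le> s * t = \<Psi> t\<close>. If \<open>z > t\<close>, the slope of
  \<open>\<Psi>\<close> from the origin is at \<open>z\<close> at least as large as at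
  \<open>t\<close>, so \<open>s * z \<le> \<Psi> z\<close>, which leaves only
  \<open>\<Phi> s \<le> 0\<close>.\<close>

lemma young_of_conjugate_ratio:
  assumes c: "complementary_pair \<Phi> \<Psi>" and t: "t > 0"
  shows "\<Phi> (\<Psi> t / t) \<le> \<Psi> t"
proof -
  note y = complementary_pairD(2)[OF c]
  define s where "s = \<Psi> t / t"
  have s: "s \<ge> 0" using t young_functionD(4)[OF y] by (simp add: s_def)
  have st: "s * t = \<Psi> t" using t by (simp add: s_def)
  obtain z where z: "z \<ge> 0" "s * z = \<Phi> s + \<Psi> z" using complementary_pair_equality[OF c s] by blast
  show ?thesis
  proof (cases "z \<le> t")
    case True
    have "s * z \<le> s * t" by (rule mult_left_mono[OF True s])
    then have "\<Phi> s \<le> \<Psi> t" using z st young_functionD(4)[OF y, of z] by linarith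
    then show ?thesis by (simp add: s_def)
  next
    case False
    then have "z * \<Psi> t \<le> t * \<Psi> z" by (intro young_ratio_mono[OF y t]) simp
    moreover have "t * (s * z) = z * \<Psi> t" unfolding st[symmetric] by (simp only: ac_simps)
    ultimately have "t * (s * z) \<le> t * \<Psi> z" by linarith
    then have "s * z \<le> \<Psi> z" using t by simp
    then have "\<Phi> s \<le> 0" using z by linarith
    then show ?thesis using young_functionD(4)[OF y, of t] by (simp add: s_def)
  qed
qed

text \<open>Duality of the growth conditions. With \<open>z\<close> giving equality for
  \<open>x\<close>, Young's inequality for \<open>(k/2) * x\<close> and \<open>2 * z\<close> has the
  left side \<open>k * (x * z) = k * \<Phi> x + k * \<Psi> z\<close>, and the doubling bound for
  \<open>\<Psi>\<close> cancels the last term. Here \<open>l = k/2\<close>; the maximum with 3 in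
  \<open>k\<close> makes \<open>l\<close> exceed 1.\<close>

lemma nabla2_of_conjugate_delta2:
  assumes c: "complementary_pair \<Phi> \<Psi>" and d: "delta2 \<Psi>"
  obtains l where "l > 1" "\<And>x. x \<ge> 0 \<Longrightarrow> 2 * l * \<Phi> x \<le> \<Phi> (l * x)"
proof -
  note yS = complementary_pairD(2)[OF c]
  obtain k0 where k0: "k0 > 0" "\<And>x. x \<ge> 0 \<Longrightarrow> \<Psi> (2 * x) \<le> k0 * \<Psi> x" using d by (auto simp: delta2_def)
  define k where "k = max 3 k0"
  have "2 * (k/2) * \<Phi> x \<le> \<Phi> ((k/2) * x)" if x: "x \<ge> 0" for x
  proof -
    obtain z where z: "z \<ge> 0" "x * z = \<Phi> x + \<Psi> z" using complementary_pair_equality[OF c x] by blast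
    have "((k/2) * x) * (2 * z) \<le> \<Phi> ((k/2) * x) + \<Psi> (2 * z)"
      by (rule complementary_pairD(3)[OF c]) (use z x in \<open>auto simp: k_def\<close>)
    moreover have "\<Psi> (2 * z) \<le> k * \<Psi> z"
      using k0(2)[OF z(1)] mult_right_mono[of k0 k "\<Psi> z"] young_functionD(4)[OF yS, of z]
      by (simp add: k_def)
    ultimately have "k * (x * z) \<le> \<Phi> ((k/2) * x) + k * \<Psi> z" by (simp add: algebra_simps)
    then show ?thesis unfolding z(2) by (simp add: algebra_simps)
  qed
  moreover have "k/2 > 1" by (simp add: k_def)
  ultimately show ?thesis using that by blast
qed

text \<open>With \<open>l powr r = 2 * l\<close>, the function \<open>\<Phi> powr (1/r)\<close> has an almost increasing slope from the
  origin, which is enough for Jensen's inequality up to constants.\<close>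

lemma young_root_quasi_jensen:
  assumes c: "complementary_pair \<Phi> \<Psi>" and d: "delta2 \<Psi>"
  obtains r l where "r > 1" "l > 0"
    "\<And>(X::'a set) (w::'a \<Rightarrow> real) s. finite X \<Longrightarrow> (\<And>x. x \<in> X \<Longrightarrow> w x \<ge> 0) \<Longrightarrow> sum w X = 1 \<Longrightarrow>
       (\<And>x. x \<in> X \<Longrightarrow> s x \<ge> 0) \<Longrightarrow>
       \<Phi> ((\<Sum>x\<in>X. w x * s x) / 2) \<le> (l * (\<Sum>x\<in>X. w x * \<Phi> (s x) powr (1/r))) powr r"
proof -
  note y = complementary_pairD(1)[OF c]
  have nn: "\<Phi> x \<ge> 0" for x using young_functionD(4)[OF y] by simp
  obtain l where l: "l > 1" "\<And>x. x \<ge> 0 \<Longrightarrow> 2 * l * \<Phi> x \<le> \<Phi> (l * x)"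
    using nabla2_of_conjugate_delta2[OF c d] by blast
  \<comment> \<open>The exponent with \<open>l powr r = 2 * l\<close>. Scaling the argument by
    \<open>l\<close> then scales the root \<open>W\<close> by at least \<open>l\<close>, the
    behaviour of a function with non-decreasing slope from the origin; \<open>r > 1\<close> because
    \<open>2 * l > l\<close>.\<close>
  define r where "r = ln (2 * l) / ln l"
  have lnl: "ln l > 0" using l by simp
  have r: "r > 1" using l lnl by (simp add: r_def ln_mult)
  have rl: "l powr r = 2 * l" using l lnl by (simp add: powr_def r_def exp_ln)
  define W where "W = (\<lambda>x. \<Phi> x powr (1/r))"
  have Wr: "W x powr r = \<Phi> x" for x using r nn by (simp add: W_def powr_powr)
  have Wnn: "W x \<ge> 0" for x by (simp add: W_def)
  have Wmono: "W s \<le> W t" if "0 \<le> s" "s \<le> t" for s t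
    unfolding W_def by (rule powr_mono2) (use young_mono[OF y that] nn r in auto)
  have Wl: "l * W x \<le> W (l * x)" if "x \<ge> 0" for x
  proof -
    have "(2 * l) powr (1/r) = l" using rl[symmetric] r l by (simp add: powr_powr)
    then have "l * W x = (2 * l * \<Phi> x) powr (1/r)"
      using l nn[of x] by (simp add: W_def powr_mult)
    also have "\<dots> \<le> W (l * x)"
      unfolding W_def by (rule powr_mono2) (use l(2)[OF that] r l nn[of x] in auto)
    finally show ?thesis .
  qed
  have Wn: "l^n * W x \<le> W (l^n * x)" if "x \<ge> 0" for x n
  proof (induction n)
    case (Suc n)
    have "l^Suc n * W x \<le> l * W (l^n * x)" using Suc l by simp
    also have "\<dots> \<le> W (l * (l^n * x))" using Wl that l by simp
    finally show ?case by (simp add: mult.assoc)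
  qed simp
  \<comment> \<open>The ratio \<open>t/s\<close> is rounded down to a power of \<open>l\<close>,
    which costs the factor \<open>l\<close>.\<close>
  have slope: "t * W s \<le> l * s * W t" if "0 < s" "s \<le> t" for s t
  proof -
    have ts: "t/s \<ge> 1" using that by simp
    obtain n where n: "l^n \<le> t/s" "t/s < l^Suc n"
    proof -
      obtain N where N: "t/s < l^N" using real_arch_pow[OF l(1)] by blast
      define n where "n = (LEAST N. t/s < l^N)"
      have n1: "t/s < l^n" unfolding n_def by (rule LeastI[of _ N]) (rule N)
      then have "n \<noteq> 0" using ts by (intro notI) simp
      then obtain n' where n': "n = Suc n'" using not0_implies_Suc by blast
      then have "\<not> t/s < l^n'" unfolding n_def by (metis lessI not_less_Least)
      then show ?thesis using that[of n'] n1 n' by auto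
    qed
    have "(t/s) * W s \<le> l^Suc n * W s" using n Wnn by (intro mult_right_mono) auto
    also have "\<dots> = l * (l^n * W s)" by simp
    also have "\<dots> \<le> l * W (l^n * s)" using Wn[of s n] that l by simp
    also have "\<dots> \<le> l * W t"
      using Wmono[of "l^n * s" t] that l n(1) by (simp add: field_simps)
    finally show ?thesis using that by (simp add: field_simps)
  qed
  have "\<Phi> ((\<Sum>x\<in>X. w x * s x) / 2) \<le> (l * (\<Sum>x\<in>X. w x * \<Phi> (s x) powr (1/r))) powr r"
    if X: "finite X" "\<And>x. x \<in> X \<Longrightarrow> w x \<ge> 0" "sum w X = 1" "\<And>x. x \<in> X \<Longrightarrow> s x \<ge> 0"
    for X :: "'a set" and w s :: "'a \<Rightarrow> real"
  proof -
    define m where "m = (\<Sum>x\<in>X. w x * s x) / 2"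
    have m0: "m \<ge> 0" unfolding m_def using X by (auto intro!: sum_nonneg mult_nonneg_nonneg)
    have Wm: "W m \<le> l * (\<Sum>x\<in>X. w x * W (s x))"
    proof (cases "m = 0")
      case True
      have "W 0 = 0" using young_functionD(5)[OF y] by (simp add: W_def)
      then show ?thesis using True X l Wnn by (auto intro!: sum_nonneg mult_nonneg_nonneg)
    next
      case False
      with m0 have m: "m > 0" by simp
      \<comment> \<open>The division by 2 in the statement enters here: \<open>m\<close> is half the
        mean, so the mean of \<open>s x - m\<close> is again \<open>m\<close>. Terms with
        \<open>s x < m\<close> are nonpositive and are dropped; the others obey the slope
        bound.\<close>
      have "m * W m \<le> (\<Sum>x\<in>X. w x * (s x - m)) * W m"
      proof -
        have "(\<Sum>x\<in>X. w x * (s x - m)) = 2 * m - m"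
        proof -
          have "(\<Sum>x\<in>X. w x * m) = m" using X by (simp flip: sum_distrib_right)
          then show ?thesis by (simp add: right_diff_distrib sum_subtractf m_def)
        qed
        then show ?thesis by simp
      qed
      also have "\<dots> = (\<Sum>x\<in>X. w x * ((s x - m) * W m))" by (simp add: sum_distrib_right mult.assoc)
      also have "\<dots> \<le> (\<Sum>x\<in>X. w x * (l * m * W (s x)))"
      proof (intro sum_mono mult_left_mono)
        fix x assume x: "x \<in> X"
        show "(s x - m) * W m \<le> l * m * W (s x)"
        proof (cases "s x \<ge> m")
          case True
          have "(s x - m) * W m \<le> s x * W m" using m Wnn by (intro mult_right_mono) auto
          also have "\<dots> \<le> l * m * W (s x)" by (rule slope[OF m True])
          finally show ?thesis .
        next
          case False
          then have "(s x - m) * W m \<le> 0" using Wnn by (intro mult_nonpos_nonneg) auto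
          also have "0 \<le> l * m * W (s x)" using l m Wnn by simp
          finally show ?thesis .
        qed
      qed (use X in auto)
      also have "\<dots> = m * (l * (\<Sum>x\<in>X. w x * W (s x)))" by (simp add: sum_distrib_left algebra_simps)
      finally show ?thesis using m by simp
    qed
    have "\<Phi> m = W m powr r" by (simp add: Wr)
    also have "\<dots> \<le> (l * (\<Sum>x\<in>X. w x * W (s x))) powr r"
      by (rule powr_mono2) (use Wm Wnn r in auto)
    finally show ?thesis by (simp add: m_def W_def)
  qed
  then show ?thesis using that[of r l] r l by simp
qed

section \<open>Haar measure and Orlicz norms\<close>

locale haar_group =
  fixes \<mu> :: "('g::{group_add,t2_space}) measure"
  assumes lcg: "locally_compact_group TYPE('g)" and haar: "left_haar_measure \<mu>"
begin

abbreviation modular :: "(real \<Rightarrow> real) \<Rightarrow> ('g \<Rightarrow> complex) \<Rightarrow> ennreal" where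
  "modular \<Theta> f \<equiv> \<integral>\<^sup>+ x. ennreal (\<Theta> (cmod (f x))) \<partial>\<mu>"

lemma sets_haar[simp, measurable_cong]: "sets \<mu> = sets borel"
  using haar by (simp add: left_haar_measure_def)

lemma haarD:
  shows "\<forall>x A. A \<in> sets borel \<longrightarrow> emeasure \<mu> ((\<lambda>y. x + y) ` A) = emeasure \<mu> A"
    and "\<forall>K. compact K \<longrightarrow> emeasure \<mu> K < \<infinity>"
    and "\<forall>U. open U \<longrightarrow> U \<noteq> {} \<longrightarrow> emeasure \<mu> U > 0"
    and "\<forall>A \<in> sets borel. emeasure \<mu> A = (INF U \<in> {U. open U \<and> A \<subseteq> U}. emeasure \<mu> U)"
    and "\<forall>U. open U \<longrightarrow> emeasure \<mu> U = (SUP K \<in> {K. compact K \<and> K \<subseteq> U}. emeasure \<mu> K)"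
  using haar unfolding left_haar_measure_def by - (elim conjE, assumption)+

lemma space_haar[simp]: "space \<mu> = UNIV"
  using sets_eq_imp_space_eq[OF sets_haar] by simp

lemma continuous_group_ops:
  "continuous_on UNIV (\<lambda>p::'g \<times> 'g. fst p + snd p)" "continuous_on UNIV (uminus :: 'g \<Rightarrow> 'g)"
  using lcg by (auto simp: locally_compact_group_def topological_group_def)

lemma continuous_on_add_group[continuous_intros]:
  fixes f g :: "'b::topological_space \<Rightarrow> 'g"
  assumes "continuous_on S f" "continuous_on S g"
  shows "continuous_on S (\<lambda>x. f x + g x)"
  using continuous_on_compose2[OF continuous_group_ops(1) continuous_on_Pair[OF assms]] by simp

lemma continuous_on_uminus_group[continuous_intros]:
  fixes f :: "'b::topological_space \<Rightarrow> 'g"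
  assumes "continuous_on S f"
  shows "continuous_on S (\<lambda>x. - f x)"
  using continuous_on_compose2[OF continuous_group_ops(2) assms] by simp

lemma borel_measurable_continuous_haar:
  fixes f :: "'g \<Rightarrow> 'b::topological_space"
  shows "continuous_on UNIV f \<Longrightarrow> f \<in> borel_measurable \<mu>"
  using borel_measurable_continuous_onI[of f] measurable_cong_sets[OF sets_haar refl] by blast

lemma measurable_translate[measurable]: "(\<lambda>y. a + y) \<in> measurable \<mu> \<mu>"
proof -
  have "continuous_on UNIV (\<lambda>y::'g. a + y)" by (intro continuous_intros)
  then have "(\<lambda>y::'g. a + y) \<in> measurable borel borel" by (rule borel_measurable_continuous_onI)
  then show ?thesis using measurable_cong_sets[OF sets_haar sets_haar] by blast
qed

lemma measurable_translate_comp: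
  "f \<in> borel_measurable \<mu> \<Longrightarrow> (\<lambda>y. f (a + y)) \<in> borel_measurable \<mu>"
  using measurable_compose[OF measurable_translate] by blast

lemma distr_translate: "distr \<mu> \<mu> (\<lambda>y. a + y) = \<mu>"
proof (rule measure_eqI)
  fix A assume "A \<in> sets (distr \<mu> \<mu> (\<lambda>y. a + y))"
  then have A: "A \<in> sets borel" by simp
  have "(\<lambda>y. a + y) -` A \<inter> space \<mu> = (\<lambda>y. - a + y) ` A"
  proof (intro set_eqI iffI)
    fix y assume "y \<in> (\<lambda>y. a + y) -` A \<inter> space \<mu>"
    then have "a + y \<in> A" "y = - a + (a + y)" by (auto simp: add.assoc[symmetric])
    then show "y \<in> (\<lambda>y. - a + y) ` A" by blast
  next
    fix y assume "y \<in> (\<lambda>y. - a + y) ` A"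
    then obtain z where "z \<in> A" "y = - a + z" by blast
    then show "y \<in> (\<lambda>y. a + y) -` A \<inter> space \<mu>" by (simp add: add.assoc[symmetric])
  qed
  moreover have "emeasure \<mu> ((\<lambda>y. - a + y) ` A) = emeasure \<mu> A"
    using haarD(1) A by (elim allE) (rule mp)
  ultimately show "emeasure (distr \<mu> \<mu> (\<lambda>y. a + y)) A = emeasure \<mu> A"
    using A by (simp add: emeasure_distr)
qed simp

lemma nn_integral_translate:
  assumes "f \<in> borel_measurable \<mu>"
  shows "(\<integral>\<^sup>+ y. f (a + y) \<partial>\<mu>) = (\<integral>\<^sup>+ y. f y \<partial>\<mu>)"
proof -
  have "(\<integral>\<^sup>+ y. f y \<partial>\<mu>) = (\<integral>\<^sup>+ y. f y \<partial>distr \<mu> \<mu> (\<lambda>y. a + y))" by (simp only: distr_translate)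
  also have "\<dots> = (\<integral>\<^sup>+ y. f (a + y) \<partial>\<mu>)" by (rule nn_integral_distr) (use assms in auto)
  finally show ?thesis by simp
qed

lemma integral_translate:
  fixes f :: "'g \<Rightarrow> 'b::{banach, second_countable_topology}"
  assumes "f \<in> borel_measurable \<mu>"
  shows "(\<integral> y. f (a + y) \<partial>\<mu>) = (\<integral> y. f y \<partial>\<mu>)"
proof -
  have "(\<integral> y. f y \<partial>\<mu>) = (\<integral> y. f y \<partial>distr \<mu> \<mu> (\<lambda>y. a + y))" by (simp only: distr_translate)
  also have "\<dots> = (\<integral> y. f (a + y) \<partial>\<mu>)" by (rule integral_distr) (use assms in auto)
  finally show ?thesis by simp
qed

lemma integrable_translate:
  fixes f :: "'g \<Rightarrow> 'b::{banach, second_countable_topology}"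
  assumes "integrable \<mu> f"
  shows "integrable \<mu> (\<lambda>y. f (a + y))"
  by (rule integrable_distr[OF measurable_translate]) (simp add: distr_translate assms)

end

locale orlicz_setup = haar_group \<mu> for \<mu> :: "('g::{group_add,t2_space}) measure" +
  fixes \<Phi> \<Psi> :: "real \<Rightarrow> real"
  assumes pair: "complementary_pair \<Phi> \<Psi>" and d2\<Phi>: "delta2 \<Phi>" and d2\<Psi>: "delta2 \<Psi>"
begin

lemmas young\<Phi> = complementary_pairD(1)[OF pair] and young\<Psi> = complementary_pairD(2)[OF pair]
lemmas \<Phi>_nonneg = young_functionD(4)[OF young\<Phi>] and \<Psi>_nonneg = young_functionD(4)[OF young\<Psi>]

lemma measurable_young[measurable]: "\<Phi> \<in> borel_measurable borel" "\<Psi> \<in> borel_measurable borel"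
  using young_measurable young\<Phi> young\<Psi> by auto

abbreviation "L\<Phi> \<equiv> orlicz_space \<mu> \<Phi>"
abbreviation "L\<Psi> \<equiv> orlicz_space \<mu> \<Psi>"
abbreviation "N\<Phi> \<equiv> luxemburg_norm \<mu> \<Phi>"
abbreviation "N\<Psi> \<equiv> orlicz_norm \<mu> \<Phi>"

section \<open>Modulars and the Luxemburg norm\<close>

lemma orlicz_space_measurable: "f \<in> orlicz_space \<mu> \<Theta> \<Longrightarrow> f \<in> borel_measurable \<mu>"
  by (simp add: orlicz_space_def)

text \<open>The exponential growth bound turns one finite modular into finiteness at every scale.
  This is what allows membership, norms and tails to be handled through modulars later.\<close>

lemma orlicz_modular_finite:
  assumes y: "young_function \<Theta>" and d: "delta2 \<Theta>" and f: "f \<in> orlicz_space \<mu> \<Theta>" and c: "c \<ge> 0"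
  shows "(\<integral>\<^sup>+ x. ennreal (\<Theta> (c * cmod (f x))) \<partial>\<mu>) < \<infinity>"
proof -
  note [measurable] = young_measurable[OF y] orlicz_space_measurable[OF f]
  obtain k where k: "k > 0" "(\<integral>\<^sup>+ x. ennreal (\<Theta> (cmod (f x) / k)) \<partial>\<mu>) < \<infinity>"
    using f by (auto simp: orlicz_space_def)
  obtain C where C: "C \<ge> 1" "\<And>l s. l \<ge> 0 \<Longrightarrow> s \<ge> 0 \<Longrightarrow> \<Theta> (l * s) \<le> C * exp l * \<Theta> s"
    using delta2_exp_growth[OF y d] by blast
  have "(\<integral>\<^sup>+ x. ennreal (\<Theta> (c * cmod (f x))) \<partial>\<mu>)
      \<le> (\<integral>\<^sup>+ x. ennreal (C * exp (c * k)) * ennreal (\<Theta> (cmod (f x) / k)) \<partial>\<mu>)"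
  proof (rule nn_integral_mono)
    fix x
    have "\<Theta> (c * cmod (f x)) \<le> C * exp (c * k) * \<Theta> (cmod (f x) / k)"
      using C(2)[of "c * k" "cmod (f x) / k"] c k by simp
    then show "ennreal (\<Theta> (c * cmod (f x))) \<le> ennreal (C * exp (c * k)) * ennreal (\<Theta> (cmod (f x) / k))"
      using C by (subst ennreal_mult[symmetric]) (auto simp: young_functionD(4)[OF y] intro: ennreal_leI)
  qed
  also have "\<dots> = ennreal (C * exp (c * k)) * (\<integral>\<^sup>+ x. ennreal (\<Theta> (cmod (f x) / k)) \<partial>\<mu>)"
    by (rule nn_integral_cmult) measurable
  also have "\<dots> < \<infinity>" using k by (simp add: ennreal_mult_less_top)
  finally show ?thesis .
qed

lemma orlicz_spaceI:
  assumes "f \<in> borel_measurable \<mu>" "modular \<Theta> f < \<infinity>"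
  shows "f \<in> orlicz_space \<mu> \<Theta>"
  unfolding orlicz_space_def using assms by (auto intro!: exI[of _ 1])

lemma orlicz_space_cmult:
  assumes y: "young_function \<Theta>" and d: "delta2 \<Theta>" and f: "f \<in> orlicz_space \<mu> \<Theta>"
  shows "(\<lambda>x. c * f x) \<in> orlicz_space \<mu> \<Theta>"
  by (rule orlicz_spaceI)
     (use orlicz_modular_finite[OF y d f, of "cmod c"] orlicz_space_measurable[OF f] in \<open>auto simp: norm_mult\<close>)

lemma orlicz_space_mono:
  assumes y: "young_function \<Theta>" and g: "g \<in> orlicz_space \<mu> \<Theta>" 
    and f: "f \<in> borel_measurable \<mu>" and le: "\<And>x. cmod (f x) \<le> cmod (g x)"
  shows "f \<in> orlicz_space \<mu> \<Theta>"
proof -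
  obtain k where k: "k > 0" "(\<integral>\<^sup>+ x. ennreal (\<Theta> (cmod (g x) / k)) \<partial>\<mu>) < \<infinity>"
    using g by (auto simp: orlicz_space_def)
  have "(\<integral>\<^sup>+ x. ennreal (\<Theta> (cmod (f x) / k)) \<partial>\<mu>) \<le> (\<integral>\<^sup>+ x. ennreal (\<Theta> (cmod (g x) / k)) \<partial>\<mu>)"
    by (intro nn_integral_mono ennreal_leI young_mono[OF y] divide_right_mono le) (use k in auto)
  also note k(2)
  finally show ?thesis using f k(1) by (auto simp: orlicz_space_def)
qed

lemma zero_in_orlicz_space: "young_function \<Theta> \<Longrightarrow> (\<lambda>x. 0) \<in> orlicz_space \<mu> \<Theta>"
  by (rule orlicz_spaceI) (auto simp: young_functionD(5))

lemma modular_scale: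
  assumes y: "young_function \<Theta>" and [measurable]: "f \<in> borel_measurable \<mu>" and C: "C \<ge> 1"
    and m: "modular \<Theta> f \<le> ennreal C"
  shows "(\<integral>\<^sup>+ x. ennreal (\<Theta> (cmod (f x) / C)) \<partial>\<mu>) \<le> 1"
proof -
  note [measurable] = young_measurable[OF y]
  have "(\<integral>\<^sup>+ x. ennreal (\<Theta> (cmod (f x) / C)) \<partial>\<mu>) \<le> (\<integral>\<^sup>+ x. ennreal (1/C) * ennreal (\<Theta> (cmod (f x))) \<partial>\<mu>)"
  proof (rule nn_integral_mono)
    fix x
    have "\<Theta> ((1/C) * cmod (f x)) \<le> (1/C) * \<Theta> (cmod (f x))" by (rule young_scale[OF y]) (use C in auto)
    then show "ennreal (\<Theta> (cmod (f x) / C)) \<le> ennreal (1/C) * ennreal (\<Theta> (cmod (f x)))"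
      using C by (subst ennreal_mult[symmetric]) (auto simp: young_functionD(4)[OF y] intro!: ennreal_leI)
  qed
  also have "\<dots> = ennreal (1/C) * modular \<Theta> f"
    by (rule nn_integral_cmult) measurable
  also have "\<dots> \<le> ennreal (1/C) * ennreal C" by (rule mult_left_mono[OF m]) simp
  also have "\<dots> = 1" using C by (simp add: ennreal_mult[symmetric])
  finally show ?thesis .
qed

lemma luxemburg_le:
  assumes "k > 0" "(\<integral>\<^sup>+ x. ennreal (\<Theta> (cmod (f x) / k)) \<partial>\<mu>) \<le> 1"
  shows "luxemburg_norm \<mu> \<Theta> f \<le> k"
  unfolding luxemburg_norm_def by (rule cInf_lower) (use assms in \<open>auto intro: bdd_belowI[of _ 0]\<close>)

lemma luxemburg_le_modular:
  assumes y: "young_function \<Theta>" and f: "f \<in> borel_measurable \<mu>" and C: "C \<ge> 1"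
    and m: "modular \<Theta> f \<le> ennreal C"
  shows "luxemburg_norm \<mu> \<Theta> f \<le> C"
  by (rule luxemburg_le[OF _ modular_scale[OF y f C m]]) (use C in simp)

lemma luxemburg_witness:
  assumes y: "young_function \<Theta>" and d: "delta2 \<Theta>" and f: "f \<in> orlicz_space \<mu> \<Theta>"
  obtains k where "k > 0" "(\<integral>\<^sup>+ x. ennreal (\<Theta> (cmod (f x) / k)) \<partial>\<mu>) \<le> 1"
proof -
  define I where "I = modular \<Theta> f"
  have I: "I < \<infinity>" unfolding I_def using orlicz_modular_finite[OF y d f, of 1] by simp
  have "(\<integral>\<^sup>+ x. ennreal (\<Theta> (cmod (f x) / (1 + enn2real I))) \<partial>\<mu>) \<le> 1"
  proof (rule modular_scale[OF y orlicz_space_measurable[OF f]])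
    have "I = ennreal (enn2real I)" using I by simp
    also have "\<dots> \<le> ennreal (1 + enn2real I)" by (rule ennreal_leI) simp
    finally show "modular \<Theta> f \<le> ennreal (1 + enn2real I)" by (simp add: I_def)
  qed simp
  moreover have "1 + enn2real I > 0" by (simp add: add_pos_nonneg)
  ultimately show ?thesis using that by blast
qed

lemma luxemburg_nonneg:
  assumes y: "young_function \<Theta>" and d: "delta2 \<Theta>" and f: "f \<in> orlicz_space \<mu> \<Theta>"
  shows "luxemburg_norm \<mu> \<Theta> f \<ge> 0"
proof -
  obtain k where "k > 0" "(\<integral>\<^sup>+ x. ennreal (\<Theta> (cmod (f x) / k)) \<partial>\<mu>) \<le> 1"
    using luxemburg_witness[OF y d f] by blast
  then show ?thesis unfolding luxemburg_norm_def by (intro cInf_greatest) auto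
qed

lemma luxemburg_less:
  assumes y: "young_function \<Theta>" and d: "delta2 \<Theta>" and f: "f \<in> orlicz_space \<mu> \<Theta>"
    and k: "luxemburg_norm \<mu> \<Theta> f < k"
  shows "(\<integral>\<^sup>+ x. ennreal (\<Theta> (cmod (f x) / k)) \<partial>\<mu>) \<le> 1"
proof -
  have "{k. k > 0 \<and> (\<integral>\<^sup>+ x. ennreal (\<Theta> (cmod (f x) / k)) \<partial>\<mu>) \<le> 1} \<noteq> {}"
    using luxemburg_witness[OF y d f] by blast
  then obtain k' where k': "k' > 0" "(\<integral>\<^sup>+ x. ennreal (\<Theta> (cmod (f x) / k')) \<partial>\<mu>) \<le> 1" "k' < k"
    using cInf_lessD[OF _ k[unfolded luxemburg_norm_def]] by auto
  have "(\<integral>\<^sup>+ x. ennreal (\<Theta> (cmod (f x) / k)) \<partial>\<mu>) \<le> (\<integral>\<^sup>+ x. ennreal (\<Theta> (cmod (f x) / k')) \<partial>\<mu>)"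
    by (intro nn_integral_mono ennreal_leI young_mono[OF y] divide_left_mono) (use k' in auto)
  also note k'(2)
  finally show ?thesis .
qed

lemma luxemburg_mono:
  assumes y: "young_function \<Theta>" and d: "delta2 \<Theta>" and g: "g \<in> orlicz_space \<mu> \<Theta>"
    and le: "\<And>x. cmod (f x) \<le> cmod (g x)"
  shows "luxemburg_norm \<mu> \<Theta> f \<le> luxemburg_norm \<mu> \<Theta> g"
proof (rule dense_ge)
  fix k assume k: "luxemburg_norm \<mu> \<Theta> g < k"
  have k0: "k > 0" using luxemburg_nonneg[OF y d g] k by simp
  have "(\<integral>\<^sup>+ x. ennreal (\<Theta> (cmod (f x) / k)) \<partial>\<mu>) \<le> (\<integral>\<^sup>+ x. ennreal (\<Theta> (cmod (g x) / k)) \<partial>\<mu>)"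
    by (intro nn_integral_mono ennreal_leI young_mono[OF y] divide_right_mono le) (use k0 in auto)
  also have "\<dots> \<le> 1" by (rule luxemburg_less[OF y d g k])
  finally show "luxemburg_norm \<mu> \<Theta> f \<le> k" by (rule luxemburg_le[OF k0])
qed

lemma luxemburg_cmult_le:
  assumes y: "young_function \<Theta>" and d: "delta2 \<Theta>" and f: "f \<in> orlicz_space \<mu> \<Theta>"
  shows "luxemburg_norm \<mu> \<Theta> (\<lambda>x. c * f x) \<le> cmod c * luxemburg_norm \<mu> \<Theta> f"
proof (cases "c = 0")
  case True
  have "luxemburg_norm \<mu> \<Theta> (\<lambda>x. 0) \<le> 0"
  proof (rule dense_ge)
    fix k :: real assume "0 < k"
    then show "luxemburg_norm \<mu> \<Theta> (\<lambda>x. 0) \<le> k" by (rule luxemburg_le) (simp add: young_functionD(5)[OF y])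
  qed
  then show ?thesis using True by simp
next
  case False
  have "luxemburg_norm \<mu> \<Theta> (\<lambda>x. c * f x) / cmod c \<le> luxemburg_norm \<mu> \<Theta> f"
  proof (rule dense_ge)
    fix k assume k: "luxemburg_norm \<mu> \<Theta> f < k"
    have k0: "k > 0" using luxemburg_nonneg[OF y d f] k by simp
    have "luxemburg_norm \<mu> \<Theta> (\<lambda>x. c * f x) \<le> cmod c * k"
      by (rule luxemburg_le) (use luxemburg_less[OF y d f k] False k0 in \<open>auto simp: norm_mult\<close>)
    then show "luxemburg_norm \<mu> \<Theta> (\<lambda>x. c * f x) / cmod c \<le> k" using False by (simp add: field_simps)
  qed
  then show ?thesis using False by (simp add: field_simps)
qed

section \<open>Young's inequality, the Orlicz norm and Hoelder's inequality\<close>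

lemma young_nn_integral:
  assumes [measurable]: "f \<in> borel_measurable \<mu>" "g \<in> borel_measurable \<mu>"
  shows "(\<integral>\<^sup>+ x. ennreal (cmod (f x) * cmod (g x)) \<partial>\<mu>) \<le>
    modular \<Phi> f + modular \<Psi> g"
proof -
  have "(\<integral>\<^sup>+ x. ennreal (cmod (f x) * cmod (g x)) \<partial>\<mu>) \<le>
      (\<integral>\<^sup>+ x. ennreal (\<Phi> (cmod (f x))) + ennreal (\<Psi> (cmod (g x))) \<partial>\<mu>)"
    using complementary_pairD(3)[OF pair]
    by (intro nn_integral_mono) (simp add: ennreal_plus[symmetric] \<Phi>_nonneg \<Psi>_nonneg ennreal_leI del: ennreal_plus)
  also have "\<dots> = modular \<Phi> f + modular \<Psi> g"
    by (rule nn_integral_add) measurable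
  finally show ?thesis .
qed

lemma orlicz_norm_set:
  assumes g: "g \<in> L\<Psi>"
  defines "S \<equiv> {enn2real (\<integral>\<^sup>+ x. ennreal (cmod (f x) * cmod (g x)) \<partial>\<mu>) | f.
            f \<in> borel_measurable \<mu> \<and> modular \<Phi> f \<le> 1}"
  shows "bdd_above S" "S \<noteq> {}" "N\<Psi> g = Sup S"
    "\<And>f. f \<in> borel_measurable \<mu> \<Longrightarrow> modular \<Phi> f \<le> 1 \<Longrightarrow>
       (\<integral>\<^sup>+ x. ennreal (cmod (f x) * cmod (g x)) \<partial>\<mu>) < \<infinity>"
proof -
  define I where "I = modular \<Psi> g"
  have I: "I < \<infinity>" unfolding I_def using orlicz_modular_finite[OF young\<Psi> d2\<Psi> g, of 1] by simp
  have b: "(\<integral>\<^sup>+ x. ennreal (cmod (f x) * cmod (g x)) \<partial>\<mu>) \<le> 1 + I"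
    if "f \<in> borel_measurable \<mu>" "modular \<Phi> f \<le> 1" for f
    using young_nn_integral[OF that(1) orlicz_space_measurable[OF g]] that(2) unfolding I_def
    by (meson add_right_mono order.trans)
  have fin: "1 + I < \<infinity>" using I by simp
  show "bdd_above S" unfolding S_def
  proof (rule bdd_aboveI[of _ "enn2real (1 + I)"])
    fix v assume "v \<in> {enn2real (\<integral>\<^sup>+ x. ennreal (cmod (f x) * cmod (g x)) \<partial>\<mu>) | f.
            f \<in> borel_measurable \<mu> \<and> modular \<Phi> f \<le> 1}"
    then show "v \<le> enn2real (1 + I)" using b fin by (auto intro!: enn2real_mono)
  qed
  show "S \<noteq> {}" unfolding S_def
    using young_functionD(5)[OF young\<Phi>] by (auto intro!: exI[of _ "\<lambda>_. 0"])
  show "N\<Psi> g = Sup S" by (simp add: orlicz_norm_def S_def)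
  fix f assume "f \<in> borel_measurable \<mu>" "modular \<Phi> f \<le> 1"
  from le_less_trans[OF b[OF this] fin] show "(\<integral>\<^sup>+ x. ennreal (cmod (f x) * cmod (g x)) \<partial>\<mu>) < \<infinity>" .
qed

lemma orlicz_norm_upper:
  assumes g: "g \<in> L\<Psi>" and f: "f \<in> borel_measurable \<mu>" "modular \<Phi> f \<le> 1"
  shows "(\<integral>\<^sup>+ x. ennreal (cmod (f x) * cmod (g x)) \<partial>\<mu>) \<le> ennreal (N\<Psi> g)"
proof -
  have "enn2real (\<integral>\<^sup>+ x. ennreal (cmod (f x) * cmod (g x)) \<partial>\<mu>) \<le> N\<Psi> g"
    unfolding orlicz_norm_set(3)[OF g]
    by (rule cSup_upper[OF _ orlicz_norm_set(1)[OF g]]) (use f in blast)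
  then have "ennreal (enn2real (\<integral>\<^sup>+ x. ennreal (cmod (f x) * cmod (g x)) \<partial>\<mu>)) \<le> ennreal (N\<Psi> g)" by (rule ennreal_leI)
  moreover have "ennreal (enn2real (\<integral>\<^sup>+ x. ennreal (cmod (f x) * cmod (g x)) \<partial>\<mu>)) = (\<integral>\<^sup>+ x. ennreal (cmod (f x) * cmod (g x)) \<partial>\<mu>)"
    by (rule ennreal_enn2real) (use orlicz_norm_set(4)[OF g f] in simp)
  ultimately show ?thesis by simp
qed

lemma orlicz_norm_least:
  assumes g: "g \<in> L\<Psi>" and C: "C \<ge> 0"
    and le: "\<And>f. f \<in> borel_measurable \<mu> \<Longrightarrow> modular \<Phi> f \<le> 1 \<Longrightarrow>
      (\<integral>\<^sup>+ x. ennreal (cmod (f x) * cmod (g x)) \<partial>\<mu>) \<le> ennreal C"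
  shows "N\<Psi> g \<le> C"
  unfolding orlicz_norm_set(3)[OF g]
  by (rule cSup_least[OF orlicz_norm_set(2)[OF g]])
     (use le C in \<open>auto intro!: enn2real_leI\<close>)

lemma orlicz_norm_nonneg:
  assumes g: "g \<in> L\<Psi>" shows "N\<Psi> g \<ge> 0"
  unfolding orlicz_norm_set(3)[OF g]
proof (rule cSup_upper2[OF _ _ orlicz_norm_set(1)[OF g]])
  show "enn2real (\<integral>\<^sup>+ x. ennreal (cmod ((\<lambda>_. 0) x) * cmod (g x)) \<partial>\<mu>) \<in>
    {enn2real (\<integral>\<^sup>+ x. ennreal (cmod (f x) * cmod (g x)) \<partial>\<mu>) | f.
            f \<in> borel_measurable \<mu> \<and> modular \<Phi> f \<le> 1}"
    using young_functionD(5)[OF young\<Phi>] by (intro CollectI exI[of _ "\<lambda>_. 0"]) auto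
qed simp

lemma orlicz_norm_mono:
  assumes g: "g \<in> L\<Psi>" and f: "f \<in> L\<Psi>" and le: "\<And>x. cmod (f x) \<le> cmod (g x)"
  shows "N\<Psi> f \<le> N\<Psi> g"
proof (rule orlicz_norm_least[OF f orlicz_norm_nonneg[OF g]])
  fix h assume h: "h \<in> borel_measurable \<mu>" "modular \<Phi> h \<le> 1"
  have "(\<integral>\<^sup>+ x. ennreal (cmod (h x) * cmod (f x)) \<partial>\<mu>) \<le> (\<integral>\<^sup>+ x. ennreal (cmod (h x) * cmod (g x)) \<partial>\<mu>)"
    by (intro nn_integral_mono ennreal_leI mult_left_mono le) simp
  also have "\<dots> \<le> ennreal (N\<Psi> g)" by (rule orlicz_norm_upper[OF g h])
  finally show "(\<integral>\<^sup>+ x. ennreal (cmod (h x) * cmod (f x)) \<partial>\<mu>) \<le> ennreal (N\<Psi> g)" .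
qed

lemma orlicz_norm_cmult_le:
  assumes g: "g \<in> L\<Psi>" shows "N\<Psi> (\<lambda>x. c * g x) \<le> cmod c * N\<Psi> g"
proof (rule orlicz_norm_least[OF orlicz_space_cmult[OF young\<Psi> d2\<Psi> g]])
  show "cmod c * N\<Psi> g \<ge> 0" using orlicz_norm_nonneg[OF g] by simp
  fix h assume h: "h \<in> borel_measurable \<mu>" "modular \<Phi> h \<le> 1"
  note [measurable] = h(1) orlicz_space_measurable[OF g]
  have "(\<integral>\<^sup>+ x. ennreal (cmod (h x) * cmod (c * g x)) \<partial>\<mu>) = (\<integral>\<^sup>+ x. ennreal (cmod c) * ennreal (cmod (h x) * cmod (g x)) \<partial>\<mu>)"
    by (intro nn_integral_cong) (simp add: norm_mult ennreal_mult[symmetric] algebra_simps)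
  also have "\<dots> = ennreal (cmod c) * (\<integral>\<^sup>+ x. ennreal (cmod (h x) * cmod (g x)) \<partial>\<mu>)"
    by (rule nn_integral_cmult) measurable
  also have "\<dots> \<le> ennreal (cmod c) * ennreal (N\<Psi> g)"
    by (rule mult_left_mono[OF orlicz_norm_upper[OF g h]]) simp
  also have "\<dots> = ennreal (cmod c * N\<Psi> g)" by (simp add: ennreal_mult orlicz_norm_nonneg[OF g])
  finally show "(\<integral>\<^sup>+ x. ennreal (cmod (h x) * cmod (c * g x)) \<partial>\<mu>) \<le> ennreal (cmod c * N\<Psi> g)" .
qed

lemma orlicz_norm_le_modular:
  assumes g: "g \<in> borel_measurable \<mu>" and C: "C \<ge> 0" and m: "modular \<Psi> g \<le> ennreal C"
  shows "N\<Psi> g \<le> 1 + C"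
proof (rule orlicz_norm_least)
  show "g \<in> L\<Psi>" by (rule orlicz_spaceI[OF g]) (use m in \<open>auto intro: le_less_trans\<close>)
  fix h assume h: "h \<in> borel_measurable \<mu>" "modular \<Phi> h \<le> 1"
  have "(\<integral>\<^sup>+ x. ennreal (cmod (h x) * cmod (g x)) \<partial>\<mu>) \<le> 1 + ennreal C"
    using young_nn_integral[OF h(1) g] h(2) m by (meson add_mono order.trans)
  then show "(\<integral>\<^sup>+ x. ennreal (cmod (h x) * cmod (g x)) \<partial>\<mu>) \<le> ennreal (1 + C)"
    using C by (simp add: ennreal_plus)
qed (use C in simp)

text \<open>The test function \<open>\<Psi> |g| / |g|\<close> shows that the Orlicz norm dominates the Luxemburg norm.\<close>

lemma modular_le_one_of_orlicz_norm:
  assumes g: "g \<in> L\<Psi>" and lt: "N\<Psi> g < 1"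
  shows "modular \<Psi> g \<le> 1"
proof (rule ccontr)
  note [measurable] = orlicz_space_measurable[OF g]
  define I where "I = modular \<Psi> g"
  have Ifin: "I < \<infinity>" unfolding I_def using orlicz_modular_finite[OF young\<Psi> d2\<Psi> g, of 1] by simp
  define C where "C = enn2real I"
  have IC: "I = ennreal C" using Ifin by (simp add: C_def)
  assume "\<not> modular \<Psi> g \<le> 1"
  then have "ennreal 1 < ennreal C" unfolding IC[symmetric] I_def by simp
  then have C: "C > 1" by (simp add: ennreal_less_iff)
  define f where "f = (\<lambda>x. complex_of_real (\<Psi> (cmod (g x)) / cmod (g x)))"
  have [measurable]: "f \<in> borel_measurable \<mu>" unfolding f_def by measurable
  have f\<Phi>: "\<Phi> (cmod (f x)) \<le> \<Psi> (cmod (g x))" for x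
  proof (cases "g x = 0")
    case True then show ?thesis
      using young_functionD(5)[OF young\<Psi>] young_functionD(5)[OF young\<Phi>] by (simp add: f_def)
  next
    case False
    then show ?thesis
      using young_of_conjugate_ratio[OF pair, of "cmod (g x)"] \<Psi>_nonneg[of "cmod (g x)"] by (simp add: f_def norm_divide)
  qed
  have fg: "cmod (f x) * cmod (g x) = \<Psi> (cmod (g x))" for x
    using young_functionD(5)[OF young\<Psi>] \<Psi>_nonneg[of "cmod (g x)"] by (cases "g x = 0") (auto simp: f_def norm_divide)
  have "modular \<Phi> f \<le> ennreal C"
    unfolding IC[symmetric] I_def by (intro nn_integral_mono ennreal_leI f\<Phi>)
  then have "(\<integral>\<^sup>+ x. ennreal (\<Phi> (cmod (f x) / C)) \<partial>\<mu>) \<le> 1"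
    by (rule modular_scale[OF young\<Phi> \<open>f \<in> borel_measurable \<mu>\<close>, rotated]) (use C in simp)
  then have m: "(\<integral>\<^sup>+ x. ennreal (\<Phi> (cmod (f x / C))) \<partial>\<mu>) \<le> 1" using C by (simp add: norm_divide)
  \<comment> \<open>The function \<open>f / C\<close> is an admissible test function, and its
    pairing with \<open>g\<close> is \<open>C / C = 1\<close>, against the assumption on the
    norm.\<close>
  have "ennreal (1/C) * ennreal C = ennreal (1/C) * (\<integral>\<^sup>+ x. ennreal (cmod (f x) * cmod (g x)) \<partial>\<mu>)"
    unfolding IC[symmetric] I_def fg ..
  also have "\<dots> = (\<integral>\<^sup>+ x. ennreal (1/C) * ennreal (cmod (f x) * cmod (g x)) \<partial>\<mu>)"
    by (rule nn_integral_cmult[symmetric]) measurable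
  also have "\<dots> = (\<integral>\<^sup>+ x. ennreal (cmod (f x / C) * cmod (g x)) \<partial>\<mu>)"
    by (intro nn_integral_cong) (use C in \<open>simp add: norm_divide ennreal_mult[symmetric]\<close>)
  also have "\<dots> \<le> ennreal (N\<Psi> g)" by (rule orlicz_norm_upper[OF g _ m]) measurable
  finally have "1 \<le> N\<Psi> g" using C by (simp add: ennreal_mult[symmetric])
  then show False using lt by simp
qed

lemma hoelder:
  assumes f: "f \<in> L\<Phi>" and g: "g \<in> L\<Psi>"
  shows "(\<integral>\<^sup>+ x. ennreal (cmod (f x) * cmod (g x)) \<partial>\<mu>) \<le> ennreal (N\<Phi> f * N\<Psi> g)"
proof -
  note [measurable] = orlicz_space_measurable[OF f] orlicz_space_measurable[OF g]
  have *: "(\<integral>\<^sup>+ x. ennreal (cmod (f x) * cmod (g x)) \<partial>\<mu>) \<le> ennreal (k * N\<Psi> g)" if k: "N\<Phi> f < k" for k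
  proof -
    have k0: "k > 0" using luxemburg_nonneg[OF young\<Phi> d2\<Phi> f] k by simp
    have m: "(\<integral>\<^sup>+ x. ennreal (\<Phi> (cmod (f x / k))) \<partial>\<mu>) \<le> 1"
      using luxemburg_less[OF young\<Phi> d2\<Phi> f k] k0 by (simp add: norm_divide)
    have "(\<integral>\<^sup>+ x. ennreal (cmod (f x) * cmod (g x)) \<partial>\<mu>) = (\<integral>\<^sup>+ x. ennreal k * ennreal (cmod (f x / k) * cmod (g x)) \<partial>\<mu>)"
      by (intro nn_integral_cong) (use k0 in \<open>simp add: norm_divide ennreal_mult[symmetric]\<close>)
    also have "\<dots> = ennreal k * (\<integral>\<^sup>+ x. ennreal (cmod (f x / k) * cmod (g x)) \<partial>\<mu>)"
      by (rule nn_integral_cmult) measurable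
    also have "\<dots> \<le> ennreal k * ennreal (N\<Psi> g)"
      by (rule mult_left_mono[OF orlicz_norm_upper[OF g _ m]]) auto
    finally show ?thesis using k0 orlicz_norm_nonneg[OF g] by (simp add: ennreal_mult)
  qed
  define I where "I = (\<integral>\<^sup>+ x. ennreal (cmod (f x) * cmod (g x)) \<partial>\<mu>)"
  have "I < \<infinity>" using *[of "N\<Phi> f + 1"] unfolding I_def by (auto intro: le_less_trans)
  then have I: "I = ennreal (enn2real I)" by simp
  have le: "enn2real I \<le> k * N\<Psi> g" if "N\<Phi> f < k" for k
  proof -
    have "0 \<le> k * N\<Psi> g"
      using luxemburg_nonneg[OF young\<Phi> d2\<Phi> f] that orlicz_norm_nonneg[OF g] by simp
    then show ?thesis using *[OF that] unfolding I_def[symmetric] by (subst (asm) I) (simp add: ennreal_le_iff)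
  qed
  have "enn2real I \<le> N\<Phi> f * N\<Psi> g"
  proof (rule field_le_epsilon)
    fix e :: real assume e: "e > 0"
    \<comment> \<open>The increment is divided by \<open>1 + N\<Psi> g\<close> rather than by
      \<open>N\<Psi> g\<close>, which may vanish.\<close>
    define k where "k = N\<Phi> f + e / (1 + N\<Psi> g)"
    have p: "1 + N\<Psi> g > 0" using orlicz_norm_nonneg[OF g] by simp
    have "enn2real I \<le> k * N\<Psi> g" by (rule le) (use e p in \<open>simp add: k_def\<close>)
    also have "\<dots> = N\<Phi> f * N\<Psi> g + e * (N\<Psi> g / (1 + N\<Psi> g))" by (simp add: k_def algebra_simps)
    also have "e * (N\<Psi> g / (1 + N\<Psi> g)) \<le> e * 1"
      by (rule mult_left_mono) (use e p in auto)
    finally show "enn2real I \<le> N\<Phi> f * N\<Psi> g + e" by simp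
  qed
  then show ?thesis unfolding I_def[symmetric] by (subst I) (rule ennreal_leI)
qed

section \<open>Translations and the convolution integrals\<close>

lemma luxemburg_translate:
  assumes "f \<in> L\<Phi>"
  shows "(\<lambda>y. f (a + y)) \<in> L\<Phi>" "N\<Phi> (\<lambda>y. f (a + y)) = N\<Phi> f"
proof -
  note [measurable] = orlicz_space_measurable[OF assms]
  have *: "(\<integral>\<^sup>+ x. ennreal (\<Phi> (cmod (f (a + x)) / k)) \<partial>\<mu>) = (\<integral>\<^sup>+ x. ennreal (\<Phi> (cmod (f x) / k)) \<partial>\<mu>)" for k
    by (rule nn_integral_translate[where f = "\<lambda>x. ennreal (\<Phi> (cmod (f x) / k))"]) measurable
  show "N\<Phi> (\<lambda>y. f (a + y)) = N\<Phi> f" unfolding luxemburg_norm_def * ..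
  show "(\<lambda>y. f (a + y)) \<in> L\<Phi>"
    using assms measurable_translate_comp[of f a] unfolding orlicz_space_def by (simp add: *)
qed

text \<open>Left invariance moves the translation from \<open>g\<close> to \<open>f\<close>, where
  the Luxemburg norm does not notice it.\<close>

lemma conv_check_alt:
  assumes "f \<in> borel_measurable \<mu>" "g \<in> borel_measurable \<mu>"
  shows "conv_check \<mu> f g x = (\<integral> y. f (x + y) * g y \<partial>\<mu>)"
proof -
  note [measurable] = assms measurable_translate_comp[OF assms(2)]
  have "conv_check \<mu> f g x = (\<integral> y. f (x + y) * g (- x + (x + y)) \<partial>\<mu>)"
    unfolding conv_check_def
    by (rule integral_translate[symmetric, where f = "\<lambda>y. f y * g (- x + y)"]) measurable
  then show ?thesis by (simp add: add.assoc[symmetric])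
qed

lemma hoelder_translate:
  assumes f: "f \<in> L\<Phi>" and g: "g \<in> L\<Psi>"
  shows "(\<integral>\<^sup>+ y. ennreal (cmod (f y) * cmod (g (- x + y))) \<partial>\<mu>) \<le> ennreal (N\<Phi> f * N\<Psi> g)"
proof -
  note [measurable] = orlicz_space_measurable[OF f] measurable_translate_comp[OF orlicz_space_measurable[OF g]]
  have "(\<integral>\<^sup>+ y. ennreal (cmod (f y) * cmod (g (- x + y))) \<partial>\<mu>)
      = (\<integral>\<^sup>+ y. ennreal (cmod (f (x + y)) * cmod (g (- x + (x + y)))) \<partial>\<mu>)"
    by (rule nn_integral_translate[symmetric, where f = "\<lambda>y. ennreal (cmod (f y) * cmod (g (- x + y)))"]) measurable
  also have "\<dots> = (\<integral>\<^sup>+ y. ennreal (cmod (f (x + y)) * cmod (g y)) \<partial>\<mu>)" by (simp add: add.assoc[symmetric])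
  also have "\<dots> \<le> ennreal (N\<Phi> f * N\<Psi> g)"
    using hoelder[OF luxemburg_translate(1)[OF f, of x] g] luxemburg_translate(2)[OF f, of x] by simp
  finally show ?thesis .
qed

lemma conv_check_integrable:
  assumes f: "f \<in> L\<Phi>" and g: "g \<in> L\<Psi>"
  shows "integrable \<mu> (\<lambda>y. f y * g (- x + y))"
proof (rule integrableI_bounded)
  show "(\<lambda>y. f y * g (- x + y)) \<in> borel_measurable \<mu>"
    using orlicz_space_measurable[OF f] measurable_translate_comp[OF orlicz_space_measurable[OF g]] by measurable
  show "(\<integral>\<^sup>+ y. ennreal (norm (f y * g (- x + y))) \<partial>\<mu>) < \<infinity>"
    using hoelder_translate[OF f g, of x] by (simp add: norm_mult le_less_trans)
qed

lemma conv_check_bound: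
  assumes f: "f \<in> L\<Phi>" and g: "g \<in> L\<Psi>"
  shows "cmod (conv_check \<mu> f g x) \<le> N\<Phi> f * N\<Psi> g"
proof -
  have nn: "0 \<le> N\<Phi> f * N\<Psi> g"
    using luxemburg_nonneg[OF young\<Phi> d2\<Phi> f] orlicz_norm_nonneg[OF g] by simp
  have "ennreal (cmod (conv_check \<mu> f g x)) \<le> (\<integral>\<^sup>+ y. ennreal (norm (f y * g (- x + y))) \<partial>\<mu>)"
    unfolding conv_check_def by (rule integral_norm_bound_ennreal[OF conv_check_integrable[OF f g]])
  also have "\<dots> \<le> ennreal (N\<Phi> f * N\<Psi> g)" using hoelder_translate[OF f g, of x] by (simp add: norm_mult)
  finally show ?thesis using nn by (simp add: ennreal_le_iff)
qed

end

section \<open>The space of convolution series\<close>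

text \<open>A double series with a summable majorant is unconditionally summable, so the iterated
  sum equals the sum along any enumeration of the pairs, here \<open>prod_decode\<close>. The
  majorant is rearranged together with the series, because the norm bound of the merged series is
  needed as well as its value.\<close>

lemma double_series_diagonal:
  fixes z :: "nat \<Rightarrow> nat \<Rightarrow> complex" and w :: "nat \<Rightarrow> nat \<Rightarrow> real"
  assumes le: "\<And>n m. cmod (z n m) \<le> w n m" and sw: "\<And>n. summable (w n)"
    and ssw: "summable (\<lambda>n. \<Sum>m. w n m)"
  shows "(\<lambda>k. w (fst (prod_decode k)) (snd (prod_decode k))) sums (\<Sum>n. \<Sum>m. w n m)"
    and "(\<lambda>n. \<Sum>m. z n m) sums Z \<Longrightarrow> (\<lambda>k. z (fst (prod_decode k)) (snd (prod_decode k))) sums Z"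
proof -
  have w0: "w n m \<ge> 0" for n m using le[of n m] norm_ge_zero order.trans by blast
  have bij: "bij_betw prod_decode UNIV (UNIV \<times> UNIV)" using bij_prod_decode by simp
  define W where "W = (\<lambda>p. w (fst p) (snd p))"
  define Zf where "Zf = (\<lambda>p. z (fst p) (snd p))"
  have in1: "((\<lambda>m. W (n, m)) has_sum (\<Sum>m. w n m)) UNIV" for n
    unfolding W_def using summable_sums[OF sw[of n]] w0 by (intro sums_nonneg_imp_has_sum) auto
  have out1: "((\<lambda>n. \<Sum>m. w n m) has_sum (\<Sum>n. \<Sum>m. w n m)) UNIV"
    by (intro sums_nonneg_imp_has_sum summable_sums[OF ssw] suminf_nonneg[OF sw]) (rule w0)
  have sumW: "W summable_on (UNIV \<times> UNIV)"
    by (rule summable_on_SigmaI[OF in1]) (use out1 w0 in \<open>auto simp: has_sum_imp_summable W_def\<close>)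
  have "(W has_sum (\<Sum>n. \<Sum>m. w n m)) (UNIV \<times> UNIV)"
    by (rule has_sum_SigmaI[OF in1 out1 sumW])
  then have "((\<lambda>k. W (prod_decode k)) has_sum (\<Sum>n. \<Sum>m. w n m)) UNIV"
    by (simp only: has_sum_reindex_bij_betw[OF bij])
  from has_sum_imp_sums[OF this]
  show "(\<lambda>k. w (fst (prod_decode k)) (snd (prod_decode k))) sums (\<Sum>n. \<Sum>m. w n m)"
    by (simp add: W_def)
  assume Z: "(\<lambda>n. \<Sum>m. z n m) sums Z"
  have "(\<lambda>p. norm (Zf p)) summable_on (UNIV \<times> UNIV)"
    by (rule summable_on_comparison_test[OF sumW]) (use le in \<open>auto simp: Zf_def W_def\<close>)
  then have sumZ: "Zf summable_on (UNIV \<times> UNIV)" by (rule abs_summable_summable)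
  have nz: "summable (\<lambda>m. norm (z n m))" for n
    by (rule summable_comparison_test[OF _ sw[of n]]) (use le in auto)
  have in2: "((\<lambda>m. Zf (n, m)) has_sum (\<Sum>m. z n m)) UNIV" for n
    unfolding Zf_def using norm_summable_imp_has_sum[OF nz summable_sums[OF summable_norm_cancel[OF nz]]] by simp
  have "summable (\<lambda>n. norm (\<Sum>m. z n m))"
  proof (rule summable_comparison_test[OF _ ssw], intro exI allI impI)
    fix n
    have "norm (\<Sum>m. z n m) \<le> (\<Sum>m. norm (z n m))" by (rule summable_norm[OF nz])
    also have "\<dots> \<le> (\<Sum>m. w n m)" by (rule suminf_le[OF le nz sw])
    finally show "norm (norm (\<Sum>m. z n m)) \<le> (\<Sum>m. w n m)" by simp
  qed
  then have out2: "((\<lambda>n. \<Sum>m. z n m) has_sum Z) UNIV" by (rule norm_summable_imp_has_sum[OF _ Z])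
  have "(Zf has_sum Z) (UNIV \<times> UNIV)"
    by (rule has_sum_SigmaI[OF in2 out2 sumZ])
  then have "((\<lambda>k. Zf (prod_decode k)) has_sum Z) UNIV"
    by (simp only: has_sum_reindex_bij_betw[OF bij])
  from has_sum_imp_sums[OF this]
  show "(\<lambda>k. z (fst (prod_decode k)) (snd (prod_decode k))) sums Z"
    by (simp add: Zf_def)
qed

context orlicz_setup
begin

abbreviation "A \<equiv> AP \<mu> \<Phi> \<Psi>"
abbreviation "nA \<equiv> AP_norm \<mu> \<Phi> \<Psi>"
abbreviation "rep \<equiv> AP_rep \<mu> \<Phi> \<Psi>"

lemma repD:
  assumes "rep u f g"
  shows "\<And>n. f n \<in> L\<Phi>" "\<And>n. g n \<in> L\<Psi>" "summable (\<lambda>n. N\<Phi> (f n) * N\<Psi> (g n))"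
    "\<And>x. (\<lambda>n. conv_check \<mu> (f n) (g n) x) sums u x"
  using assms unfolding AP_rep_def by blast+

lemma norm_product_nonneg: "f \<in> L\<Phi> \<Longrightarrow> g \<in> L\<Psi> \<Longrightarrow> 0 \<le> N\<Phi> f * N\<Psi> g"
  using luxemburg_nonneg[OF young\<Phi> d2\<Phi>] orlicz_norm_nonneg by simp

lemma AP_norm_le:
  assumes "rep u f g" shows "nA u \<le> (\<Sum>n. N\<Phi> (f n) * N\<Psi> (g n))"
  unfolding AP_norm_def
proof (rule cInf_lower)
  show "bdd_below {\<Sum>n. N\<Phi> (f n) * N\<Psi> (g n) |f g. rep u f g}"
    by (rule bdd_belowI[of _ 0]) (auto intro!: suminf_nonneg norm_product_nonneg dest: repD)
qed (use assms in blast)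

lemma AP_norm_nonneg:
  assumes "u \<in> A" shows "nA u \<ge> 0"
  unfolding AP_norm_def
  by (rule cInf_greatest)
     (use assms in \<open>auto simp: AP_def intro!: suminf_nonneg norm_product_nonneg dest: repD\<close>)

lemma AP_norm_approx:
  assumes "u \<in> A" "nA u < c"
  obtains f g where "rep u f g" "(\<Sum>n. N\<Phi> (f n) * N\<Psi> (g n)) < c"
proof -
  have "{\<Sum>n. N\<Phi> (f n) * N\<Psi> (g n) |f g. rep u f g} \<noteq> {}" using assms(1) by (auto simp: AP_def)
  from cInf_lessD[OF this assms(2)[unfolded AP_norm_def]] show ?thesis using that by blast
qed

lemma AP_pointwise_bound:
  assumes "u \<in> A" shows "cmod (u x) \<le> nA u"
proof (rule dense_ge)
  fix c assume "nA u < c"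
  then obtain f g where fg: "rep u f g" "(\<Sum>n. N\<Phi> (f n) * N\<Psi> (g n)) < c"
    using AP_norm_approx[OF assms] by blast
  note r = repD[OF fg(1)]
  have b: "cmod (conv_check \<mu> (f n) (g n) x) \<le> N\<Phi> (f n) * N\<Psi> (g n)" for n
    by (rule conv_check_bound) (use r in auto)
  have s: "summable (\<lambda>n. cmod (conv_check \<mu> (f n) (g n) x))"
    by (rule summable_comparison_test[OF _ r(3)]) (use b in auto)
  have "cmod (u x) = cmod (\<Sum>n. conv_check \<mu> (f n) (g n) x)" using sums_unique[OF r(4)[of x]] by simp
  also have "\<dots> \<le> (\<Sum>n. cmod (conv_check \<mu> (f n) (g n) x))" by (rule summable_norm[OF s])
  also have "\<dots> \<le> (\<Sum>n. N\<Phi> (f n) * N\<Psi> (g n))" by (rule suminf_le[OF b s r(3)])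
  finally show "cmod (u x) \<le> c" using fg(2) by simp
qed

lemma AP_rep_double:
  assumes r: "\<And>n. rep (u n) (f n) (g n)"
    and s: "summable (\<lambda>n. \<Sum>m. N\<Phi> (f n m) * N\<Psi> (g n m))"
    and U: "\<And>x. (\<lambda>n. u n x) sums U x"
  defines "F \<equiv> \<lambda>k. f (fst (prod_decode k)) (snd (prod_decode k))"
    and "G \<equiv> \<lambda>k. g (fst (prod_decode k)) (snd (prod_decode k))"
  shows "rep U F G" "(\<Sum>k. N\<Phi> (F k) * N\<Psi> (G k)) = (\<Sum>n. \<Sum>m. N\<Phi> (f n m) * N\<Psi> (g n m))"
proof -
  have b: "cmod (conv_check \<mu> (f n m) (g n m) x) \<le> N\<Phi> (f n m) * N\<Psi> (g n m)" for n m x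
    by (rule conv_check_bound) (use repD[OF r] in auto)
  note d = double_series_diagonal[of "\<lambda>n m. conv_check \<mu> (f n m) (g n m) x" "\<lambda>n m. N\<Phi> (f n m) * N\<Psi> (g n m)" for x,
      OF b repD(3)[OF r] s]
  have w: "(\<lambda>k. N\<Phi> (F k) * N\<Psi> (G k)) sums (\<Sum>n. \<Sum>m. N\<Phi> (f n m) * N\<Psi> (g n m))"
    unfolding F_def G_def by (rule d(1))
  show "(\<Sum>k. N\<Phi> (F k) * N\<Psi> (G k)) = (\<Sum>n. \<Sum>m. N\<Phi> (f n m) * N\<Psi> (g n m))"
    using sums_unique[OF w] by simp
  show "rep U F G"
    unfolding AP_rep_def
  proof (intro conjI allI)
    show "F n \<in> L\<Phi>" "G n \<in> L\<Psi>" for n unfolding F_def G_def using repD[OF r] by auto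
    show "summable (\<lambda>k. N\<Phi> (F k) * N\<Psi> (G k))" using w by (rule sums_summable)
    fix x
    have "(\<lambda>n. \<Sum>m. conv_check \<mu> (f n m) (g n m) x) sums U x"
      using U[of x] sums_unique[OF repD(4)[OF r], of _ x] by simp
    then show "(\<lambda>k. conv_check \<mu> (F k) (G k) x) sums U x" unfolding F_def G_def by (rule d(2))
  qed
qed

text \<open>A completeness statement that asks only for pointwise convergence. Near-optimal
  representations of the terms, with excess \<open>e * (1/2)^Suc n\<close> for the term number
  \<open>n\<close>, are merged into one. Sums, kernel expansions and products with approximate units
  are all put into \<open>A\<close> in this way.\<close>

lemma AP_series:
  assumes u: "\<And>n. u n \<in> A" and b: "\<And>n. nA (u n) \<le> b n" "summable b"
    and U: "\<And>x. (\<lambda>n. u n x) sums U x"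
  shows "U \<in> A" "nA U \<le> suminf b"
proof -
  have main: "\<exists>F G. rep U F G \<and> (\<Sum>k. N\<Phi> (F k) * N\<Psi> (G k)) \<le> suminf b + e" if e: "e > 0" for e
  proof -
    define q where "q = (\<lambda>n. e * (1/2)^Suc n)"
    have qs: "q sums e" unfolding q_def using sums_mult[OF power_half_series, of e] by simp
    have "\<exists>f g. rep (u n) f g \<and> (\<Sum>m. N\<Phi> (f m) * N\<Psi> (g m)) \<le> b n + q n" for n
    proof -
      have "q n > 0" using e by (simp add: q_def)
      then have "nA (u n) < b n + q n" using b(1)[of n] by linarith
      then show ?thesis using AP_norm_approx[OF u[of n]] by (metis less_imp_le)
    qed
    then obtain f g where fg: "\<And>n. rep (u n) (f n) (g n)" "\<And>n. (\<Sum>m. N\<Phi> (f n m) * N\<Psi> (g n m)) \<le> b n + q n"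
      by metis
    have bq: "summable (\<lambda>n. b n + q n)" using b(2) qs by (intro summable_add) (auto simp: sums_iff)
    have nn: "0 \<le> (\<Sum>m. N\<Phi> (f n m) * N\<Psi> (g n m))" for n
      using repD[OF fg(1)[of n]] by (intro suminf_nonneg norm_product_nonneg) auto
    have s: "summable (\<lambda>n. \<Sum>m. N\<Phi> (f n m) * N\<Psi> (g n m))"
      by (rule summable_comparison_test[OF _ bq]) (use fg(2) nn in auto)
    have "(\<Sum>n. \<Sum>m. N\<Phi> (f n m) * N\<Psi> (g n m)) \<le> (\<Sum>n. b n + q n)"
      by (rule suminf_le[OF fg(2) s bq])
    also have "\<dots> = suminf b + e"
      using suminf_add[OF b(2), of q] qs by (simp add: sums_iff)
    finally have "(\<Sum>n. \<Sum>m. N\<Phi> (f n m) * N\<Psi> (g n m)) \<le> suminf b + e" .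
    then show ?thesis unfolding AP_rep_double(2)[OF fg(1) s U, symmetric]
      by (intro exI[of _ "\<lambda>k. f (fst (prod_decode k)) (snd (prod_decode k))"]
          exI[of _ "\<lambda>k. g (fst (prod_decode k)) (snd (prod_decode k))"] conjI AP_rep_double(1)[OF fg(1) s U])
  qed
  from main[of 1] show "U \<in> A" by (auto simp: AP_def)
  show "nA U \<le> suminf b"
  proof (rule field_le_epsilon)
    fix e :: real assume "e > 0"
    then obtain F G where "rep U F G" "(\<Sum>k. N\<Phi> (F k) * N\<Psi> (G k)) \<le> suminf b + e" using main by blast
    then show "nA U \<le> suminf b + e" using AP_norm_le by fastforce
  qed
qed

lemma conv_check_zero[simp]: "conv_check \<mu> (\<lambda>_. 0) g x = 0" "conv_check \<mu> f (\<lambda>_. 0) x = 0"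
  by (simp_all add: conv_check_def)

lemma luxemburg_zero: "N\<Phi> (\<lambda>_. 0) = 0"
  using luxemburg_cmult_le[OF young\<Phi> d2\<Phi> zero_in_orlicz_space[OF young\<Phi>], of 0]
    luxemburg_nonneg[OF young\<Phi> d2\<Phi> zero_in_orlicz_space[OF young\<Phi>]] by simp

lemma AP_tensor:
  assumes f: "f \<in> L\<Phi>" and g: "g \<in> L\<Psi>"
  shows "conv_check \<mu> f g \<in> A" "nA (conv_check \<mu> f g) \<le> N\<Phi> f * N\<Psi> g"
proof -
  define F where "F = (\<lambda>n::nat. if n = 0 then f else (\<lambda>_. 0))"
  define G where "G = (\<lambda>n::nat. if n = 0 then g else (\<lambda>_. 0))"
  have s: "(\<lambda>n. N\<Phi> (F n) * N\<Psi> (G n)) sums (N\<Phi> f * N\<Psi> g)"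
  proof -
    have "(\<lambda>n. N\<Phi> (F n) * N\<Psi> (G n)) = (\<lambda>n. if n = 0 then N\<Phi> f * N\<Psi> g else 0)"
      by (auto simp: F_def G_def luxemburg_zero)
    then show ?thesis using sums_single[of 0 "\<lambda>_. N\<Phi> f * N\<Psi> g"] by simp
  qed
  have r: "rep (conv_check \<mu> f g) F G"
    unfolding AP_rep_def
  proof (intro conjI allI)
    show "F n \<in> L\<Phi>" "G n \<in> L\<Psi>" for n
      using f g zero_in_orlicz_space[OF young\<Phi>] zero_in_orlicz_space[OF young\<Psi>] by (auto simp: F_def G_def)
    show "summable (\<lambda>n. N\<Phi> (F n) * N\<Psi> (G n))" using s by (rule sums_summable)
    fix x
    have "(\<lambda>n. conv_check \<mu> (F n) (G n) x) = (\<lambda>n. if n = 0 then conv_check \<mu> f g x else 0)"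
      by (auto simp: F_def G_def)
    then show "(\<lambda>n. conv_check \<mu> (F n) (G n) x) sums conv_check \<mu> f g x"
      using sums_single[of 0 "\<lambda>_. conv_check \<mu> f g x"] by simp
  qed
  then show "conv_check \<mu> f g \<in> A" by (auto simp: AP_def)
  show "nA (conv_check \<mu> f g) \<le> N\<Phi> f * N\<Psi> g" using AP_norm_le[OF r] sums_unique[OF s] by simp
qed

lemma AP_zero: "(\<lambda>_. 0) \<in> A" "nA (\<lambda>_. 0) = 0"
proof -
  have z: "(\<lambda>_. 0) \<in> L\<Phi>" "(\<lambda>_. 0) \<in> L\<Psi>"
    using zero_in_orlicz_space[OF young\<Phi>] zero_in_orlicz_space[OF young\<Psi>] by auto
  have e: "conv_check \<mu> (\<lambda>_. 0) (\<lambda>_. 0) = (\<lambda>_. 0)" by auto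
  show *: "(\<lambda>_. 0) \<in> A" using AP_tensor(1)[OF z] by (simp add: e)
  show "nA (\<lambda>_. 0) = 0" using AP_tensor(2)[OF z] AP_norm_nonneg[OF *] by (simp add: e luxemburg_zero)
qed

lemma AP_cmult:
  assumes u: "u \<in> A" shows "(\<lambda>x. c * u x) \<in> A" "nA (\<lambda>x. c * u x) \<le> cmod c * nA u"
proof -
  have main: "\<exists>F G. rep (\<lambda>x. c * u x) F G \<and> (\<Sum>n. N\<Phi> (F n) * N\<Psi> (G n)) \<le> cmod c * d" if d: "nA u < d" for d
  proof -
    obtain f g where fg: "rep u f g" "(\<Sum>n. N\<Phi> (f n) * N\<Psi> (g n)) < d" using AP_norm_approx[OF u d] by blast
    note r = repD[OF fg(1)]
    have le: "N\<Phi> (\<lambda>x. c * f n x) * N\<Psi> (g n) \<le> cmod c * (N\<Phi> (f n) * N\<Psi> (g n))" for n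
      using mult_right_mono[OF luxemburg_cmult_le[OF young\<Phi> d2\<Phi> r(1)] orlicz_norm_nonneg[OF r(2)]]
      by (simp add: mult.assoc)
    have mem: "(\<lambda>x. c * f n x) \<in> L\<Phi>" for n by (rule orlicz_space_cmult[OF young\<Phi> d2\<Phi> r(1)])
    have s1: "summable (\<lambda>n. cmod c * (N\<Phi> (f n) * N\<Psi> (g n)))" by (rule summable_mult[OF r(3)])
    have s: "summable (\<lambda>n. N\<Phi> (\<lambda>x. c * f n x) * N\<Psi> (g n))"
      by (rule summable_comparison_test[OF _ s1]) (use le norm_product_nonneg[OF mem r(2)] in auto)
    have "rep (\<lambda>x. c * u x) (\<lambda>n x. c * f n x) g"
      unfolding AP_rep_def
    proof (intro conjI allI)
      fix x
      have "conv_check \<mu> (\<lambda>x. c * f n x) (g n) x = c * conv_check \<mu> (f n) (g n) x" for n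
        by (simp add: conv_check_def mult.assoc)
      then show "(\<lambda>n. conv_check \<mu> (\<lambda>x. c * f n x) (g n) x) sums (c * u x)"
        using sums_mult[OF r(4)[of x], of c] by simp
    qed (use mem r s in auto)
    moreover have "(\<Sum>n. N\<Phi> (\<lambda>x. c * f n x) * N\<Psi> (g n)) \<le> cmod c * d"
    proof -
      have "(\<Sum>n. N\<Phi> (\<lambda>x. c * f n x) * N\<Psi> (g n)) \<le> (\<Sum>n. cmod c * (N\<Phi> (f n) * N\<Psi> (g n)))"
        by (rule suminf_le[OF le s s1])
      also have "\<dots> = cmod c * (\<Sum>n. N\<Phi> (f n) * N\<Psi> (g n))" by (rule suminf_mult[OF r(3)])
      also have "\<dots> \<le> cmod c * d" using fg(2) by (intro mult_left_mono) auto
      finally show ?thesis .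
    qed
    ultimately show ?thesis by blast
  qed
  from main[of "nA u + 1"] show "(\<lambda>x. c * u x) \<in> A" by (auto simp: AP_def)
  have le: "nA (\<lambda>x. c * u x) \<le> cmod c * d" if "nA u < d" for d
    using main[OF that] AP_norm_le by fastforce
  show "nA (\<lambda>x. c * u x) \<le> cmod c * nA u"
  proof (cases "c = 0")
    case True then show ?thesis using AP_zero by simp
  next
    case False
    have "nA (\<lambda>x. c * u x) / cmod c \<le> nA u"
      by (rule dense_ge) (use le False in \<open>simp add: field_simps\<close>)
    then show ?thesis using False by (simp add: field_simps)
  qed
qed

lemma AP_sum:
  assumes "finite I" and u: "\<And>i. i \<in> I \<Longrightarrow> u i \<in> A"
  shows "(\<lambda>x. \<Sum>i\<in>I. u i x) \<in> A" "nA (\<lambda>x. \<Sum>i\<in>I. u i x) \<le> (\<Sum>i\<in>I. nA (u i))"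
proof -
  have add: "(\<lambda>x. v x + w x) \<in> A \<and> nA (\<lambda>x. v x + w x) \<le> nA v + nA w" if "v \<in> A" "w \<in> A" for v w
  proof -
    define s where "s = (\<lambda>n::nat. if n = 0 then v else if n = 1 then w else (\<lambda>_. 0))"
    have fs: "h sums (h 0 + h 1)" if "\<And>n. n \<ge> 2 \<Longrightarrow> h n = 0" for h :: "nat \<Rightarrow> 'b::real_normed_vector"
    proof -
      have "h n = 0" if "n \<notin> {0,1}" for n using that \<open>\<And>n. n \<ge> 2 \<Longrightarrow> h n = 0\<close>[of n] by force
      then show ?thesis using sums_finite[of "{0,1}" h] by simp
    qed
    have b: "(\<lambda>n. nA (s n)) sums (nA v + nA w)"
      using fs[of "\<lambda>n. nA (s n)"] AP_zero(2) by (simp add: s_def)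
    have m: "s n \<in> A" for n using that AP_zero by (simp add: s_def)
    have "(\<lambda>n. s n x) sums (v x + w x)" for x using fs[of "\<lambda>n. s n x"] by (simp add: s_def)
    from AP_series[OF m order_refl sums_summable[OF b] this] show ?thesis using sums_unique[OF b] by simp
  qed
  have "(\<lambda>x. \<Sum>i\<in>I. u i x) \<in> A \<and> nA (\<lambda>x. \<Sum>i\<in>I. u i x) \<le> (\<Sum>i\<in>I. nA (u i))"
    using assms
  proof (induction I rule: finite_induct)
    case empty then show ?case using AP_zero by simp
  next
    case (insert i I)
    then show ?case using add[of "u i" "\<lambda>x. \<Sum>i\<in>I. u i x"] by fastforce
  qed
  then show "(\<lambda>x. \<Sum>i\<in>I. u i x) \<in> A" "nA (\<lambda>x. \<Sum>i\<in>I. u i x) \<le> (\<Sum>i\<in>I. nA (u i))" by auto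
qed

lemma AP_add:
  assumes "u \<in> A" "v \<in> A" shows "(\<lambda>x. u x + v x) \<in> A" "nA (\<lambda>x. u x + v x) \<le> nA u + nA v"
proof -
  have "finite (UNIV :: bool set)" by simp
  note AP_sum[OF this, of "\<lambda>i. if i then u else v"]
  then show "(\<lambda>x. u x + v x) \<in> A" "nA (\<lambda>x. u x + v x) \<le> nA u + nA v"
    using assms by (simp_all add: UNIV_bool add.commute)
qed

lemma AP_diff:
  assumes "u \<in> A" "v \<in> A" shows "(\<lambda>x. u x - v x) \<in> A" "nA (\<lambda>x. u x - v x) \<le> nA u + nA v"
  using AP_add[OF assms(1) AP_cmult(1)[OF assms(2), of "-1"]] AP_cmult(2)[OF assms(2), of "-1"] by auto

section \<open>Bounded functionals on the algebra\<close>

abbreviation "D \<equiv> AP_dual \<mu> \<Phi> \<Psi>"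
abbreviation "nD \<equiv> dual_norm A nA"

lemma AP_dualD:
  assumes "T \<in> D"
  shows "\<And>u v. u \<in> A \<Longrightarrow> v \<in> A \<Longrightarrow> T (\<lambda>x. u x + v x) = T u + T v"
    "\<And>u c. u \<in> A \<Longrightarrow> T (\<lambda>x. c * u x) = c * T u"
    "\<exists>C\<ge>0. \<forall>u\<in>A. cmod (T u) \<le> C * nA u"
proof -
  show "\<And>u v. u \<in> A \<Longrightarrow> v \<in> A \<Longrightarrow> T (\<lambda>x. u x + v x) = T u + T v" "\<And>u c. u \<in> A \<Longrightarrow> T (\<lambda>x. c * u x) = c * T u"
    using assms unfolding AP_dual_def dual_space_def by blast+
  obtain C where C: "\<And>u. u \<in> A \<Longrightarrow> cmod (T u) \<le> C * nA u"
    using assms unfolding AP_dual_def dual_space_def by blast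
  have "cmod (T u) \<le> max 0 C * nA u" if "u \<in> A" for u
    using C[OF that] mult_right_mono[OF max.cobounded2[of C 0] AP_norm_nonneg[OF that]] by linarith
  then show "\<exists>C\<ge>0. \<forall>u\<in>A. cmod (T u) \<le> C * nA u" by (intro exI[of _ "max 0 C"]) auto
qed

lemma AP_dualI:
  assumes "\<And>u v. u \<in> A \<Longrightarrow> v \<in> A \<Longrightarrow> T (\<lambda>x. u x + v x) = T u + T v"
    "\<And>u c. u \<in> A \<Longrightarrow> T (\<lambda>x. c * u x) = c * T u"
    "\<And>u. u \<in> A \<Longrightarrow> cmod (T u) \<le> C * nA u"
  shows "T \<in> D"
  using assms unfolding AP_dual_def dual_space_def by blast

lemma AP_dual_diff:
  assumes "T \<in> D" "u \<in> A" "v \<in> A" shows "T (\<lambda>x. u x - v x) = T u - T v"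
  using AP_dualD(1)[OF assms(1,2) AP_cmult(1)[OF assms(3), of "-1"]] AP_dualD(2)[OF assms(1,3), of "-1"] by simp

text \<open>A positive bound \<open>C\<close> stands in place of \<open>nA u\<close>, so that no
  element of norm 0 has to be normalized. The first half of the proof shows that the supremum in the
  dual norm is taken over a bounded set.\<close>

lemma dual_norm_bound:
  assumes T: "T \<in> D" and u: "u \<in> A" and C: "nA u \<le> C" "C > 0"
  shows "cmod (T u) \<le> C * nD T"
proof -
  obtain K where K: "K \<ge> 0" "\<And>u. u \<in> A \<Longrightarrow> cmod (T u) \<le> K * nA u" using AP_dualD(3)[OF T] by blast
  have bdd: "bdd_above {cmod (T u) |u. u \<in> A \<and> nA u \<le> 1}"
  proof (rule bdd_aboveI[of _ K])
    fix c assume "c \<in> {cmod (T u) |u. u \<in> A \<and> nA u \<le> 1}"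
    then obtain v where v: "v \<in> A" "nA v \<le> 1" "c = cmod (T v)" by blast
    then show "c \<le> K" using K(2)[OF v(1)] mult_left_mono[OF v(2) K(1)] by simp
  qed
  define v where "v = (\<lambda>x. complex_of_real (1/C) * u x)"
  have v: "v \<in> A" unfolding v_def by (rule AP_cmult[OF u])
  have "nA v \<le> (1/C) * nA u" using AP_cmult(2)[OF u, of "complex_of_real (1/C)"] C by (simp add: v_def norm_divide)
  also have "\<dots> \<le> 1" using C by (simp add: field_simps)
  finally have "cmod (T v) \<le> nD T"
    unfolding dual_norm_def by (intro cSup_upper[OF _ bdd]) (use v in blast)
  moreover have "cmod (T v) = cmod (T u) / C"
    using AP_dualD(2)[OF T u, of "complex_of_real (1/C)"] C by (simp add: v_def norm_divide norm_mult)
  ultimately show ?thesis using C by (simp add: field_simps)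
qed

lemma dual_norm_least:
  assumes "\<And>u. u \<in> A \<Longrightarrow> nA u \<le> 1 \<Longrightarrow> cmod (T u) \<le> C"
  shows "nD T \<le> C"
  unfolding dual_norm_def
proof (rule cSup_least)
  show "{cmod (T u) |u. u \<in> A \<and> nA u \<le> 1} \<noteq> {}" using AP_zero by (auto intro!: exI[of _ "\<lambda>_. 0"])
qed (use assms in blast)

lemma dual_norm_nonneg: "T \<in> D \<Longrightarrow> nD T \<ge> 0"
  using dual_norm_bound[OF _ AP_zero(1), of T 1] AP_zero(2) by (simp add: order.trans[OF norm_ge_zero])

end

section \<open>Slowly decaying averages\<close>

text \<open>Jensen's inequality: Bernoulli's inequality at the points \<open>y a / m\<close>, with
  \<open>m\<close> the mean, summed over \<open>A\<close>; the linear terms cancel.\<close>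

lemma powr_mean_le:
  fixes y :: "'a \<Rightarrow> real"
  assumes A: "finite A" "A \<noteq> {}" and y: "\<And>a. a \<in> A \<Longrightarrow> y a \<ge> 0" and r: "r > 1"
  shows "((\<Sum>a\<in>A. y a) / card A) powr r \<le> (\<Sum>a\<in>A. y a powr r) / card A"
proof -
  define m where "m = (\<Sum>a\<in>A. y a) / card A"
  have N: "real (card A) > 0" using A by (simp add: card_gt_0_iff)
  have m0: "m \<ge> 0" unfolding m_def using y by (simp add: sum_nonneg)
  show ?thesis
  proof (cases "m = 0")
    case True then show ?thesis unfolding m_def[symmetric] by (simp add: sum_nonneg)
  next
    case False
    with m0 have m: "m > 0" by simp
    have b: "1 + r * (y a / m - 1) \<le> (y a / m) powr r" if "a \<in> A" for a
    proof (cases "y a / m = 1")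
      case True then show ?thesis by simp
    next
      case False
      then show ?thesis using bernoulli_powr_strict[of "y a / m" r] y[OF that] m r by simp
    qed
    have "(\<Sum>a\<in>A. 1 + r * (y a / m - 1)) = card A + r * ((\<Sum>a\<in>A. y a) / m - card A)"
      by (simp add: sum.distrib sum_distrib_left[symmetric] sum_subtractf sum_divide_distrib)
    also have "(\<Sum>a\<in>A. y a) / m = card A" using m N by (simp add: m_def field_simps)
    finally have "real (card A) \<le> (\<Sum>a\<in>A. (y a / m) powr r)"
      using sum_mono[of A "\<lambda>a. 1 + r * (y a / m - 1)" "\<lambda>a. (y a / m) powr r"] b by simp
    also have "\<dots> = (\<Sum>a\<in>A. y a powr r) / m powr r"
      using y m by (simp add: powr_divide sum_divide_distrib)
    finally show ?thesis unfolding m_def[symmetric] using m N by (simp add: field_simps)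
  qed
qed

text \<open>Replacing \<open>y a\<close> and \<open>y b\<close> by their midpoint leaves the mean
  unchanged and lowers the sum of the powers by twice the gap of the pair. Jensen's inequality for
  the modified family \<open>z\<close> then shows that the loss in the mean contains this
  gap.\<close>

lemma powr_mean_gap:
  fixes y :: "'a \<Rightarrow> real"
  assumes A: "finite A" and y: "\<And>a. a \<in> A \<Longrightarrow> y a \<ge> 0" and r: "r > 1" and ab: "a \<in> A" "b \<in> A" "a \<noteq> b"
  shows "(2 / card A) * ((y a powr r + y b powr r) / 2 - ((y a + y b) / 2) powr r)
    \<le> (\<Sum>a\<in>A. y a powr r) / card A - ((\<Sum>a\<in>A. y a) / card A) powr r"
proof -
  define m where "m = (y a + y b) / 2"
  define z where "z = y(a := m, b := m)"
  define S where "S = A - {a, b}"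
  have AS: "A = insert a (insert b S)" "a \<notin> insert b S" "b \<notin> S" "finite S" using A ab by (auto simp: S_def)
  have zS: "z c = y c" if "c \<in> S" for c using that by (auto simp: S_def z_def)
  have s1: "(\<Sum>a\<in>A. z a) = (\<Sum>a\<in>A. y a)"
    using AS zS by (simp add: z_def m_def)
  have s2: "(\<Sum>a\<in>A. z a powr r) = (\<Sum>a\<in>A. y a powr r) - (y a powr r + y b powr r) + 2 * m powr r"
    using AS zS by (simp add: z_def)
  have "((\<Sum>a\<in>A. z a) / card A) powr r \<le> (\<Sum>a\<in>A. z a powr r) / card A"
    by (rule powr_mean_le) (use A ab y r in \<open>auto simp: z_def m_def\<close>)
  moreover have "((\<Sum>a\<in>A. y a powr r) - (y a powr r + y b powr r) + 2 * m powr r) / card A =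
      (\<Sum>a\<in>A. y a powr r) / card A - (2 / card A) * ((y a powr r + y b powr r) / 2 - m powr r)"
    by (simp add: add_divide_distrib diff_divide_distrib right_diff_distrib)
  ultimately show ?thesis unfolding s1 s2 m_def by linarith
qed

lemma decreasing_sequence_slow_step:
  fixes a :: "nat \<Rightarrow> real"
  assumes a0: "a 0 \<le> 1" and d: "0 < d" "d < 1" and n: "(1 - d)^n < a n"
  shows "\<exists>i<n. (1 - d) * a i < a (Suc i)"
proof (rule ccontr)
  assume "\<not> (\<exists>i<n. (1 - d) * a i < a (Suc i))"
  then have step: "a (Suc i) \<le> (1 - d) * a i" if "i < n" for i using that by force
  have "a i \<le> (1 - d)^i" if "i \<le> n" for i
    using that
  proof (induction i)
    case 0 then show ?case using a0 by simp
  next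
    case (Suc i)
    then have "a (Suc i) \<le> (1 - d) * a i" using step by simp
    also have "\<dots> \<le> (1 - d) * (1 - d)^i" by (rule mult_left_mono) (use Suc d in auto)
    finally show ?case by simp
  qed
  then show False using n by force
qed

context haar_group
begin

text \<open>Despite the name these are densities, namely the almost invariant ones of Reiter's
  condition. The sets shrink as \<open>B\<close> grows and \<open>e\<close> decreases, so once they
  are nonempty they generate a proper filter.\<close>

definition invariance_defect :: "'g set \<Rightarrow> real \<Rightarrow> ('g \<Rightarrow> real) set" where
  "invariance_defect B e = {k. integrable \<mu> k \<and> (\<forall>x. k x \<ge> 0) \<and> (\<integral>x. k x \<partial>\<mu>) = 1 \<and>
     (\<forall>a\<in>B. (\<integral>x. \<bar>k (a + x) - k x\<bar> \<partial>\<mu>) \<le> e)}"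

text \<open>The mean of \<open>f\<close> is a generalized limit of the averages of \<open>f\<close>
  against \<open>k\<close> along the filter generated by the sets of almost invariant densities.
  Translating \<open>f\<close> amounts to translating \<open>k\<close> by the inverse element, which
  changes the average by an amount that tends to 0.\<close>

lemma amenable_of_almost_invariant:
  assumes ai: "\<And>B e. finite B \<Longrightarrow> e > 0 \<Longrightarrow> invariance_defect B e \<noteq> {}"
  shows "amenable \<mu>"
proof -
  define I where "I = {(B::'g set, e::real). finite B \<and> e > 0}"
  define F where "F = (INF p\<in>I. principal (invariance_defect (fst p) (snd p)))"
  have ev: "eventually P F \<longleftrightarrow> (\<exists>p\<in>I. \<forall>k\<in>invariance_defect (fst p) (snd p). P k)" for P
    unfolding F_def
  proof (subst eventually_INF_base)
    show "I \<noteq> {}" by (auto simp: I_def intro!: exI[of _ "{}"] exI[of _ 1])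
    fix p q assume "p \<in> I" "q \<in> I"
    then show "\<exists>x\<in>I. principal (invariance_defect (fst x) (snd x)) \<le>
        inf (principal (invariance_defect (fst p) (snd p))) (principal (invariance_defect (fst q) (snd q)))"
      by (intro bexI[of _ "(fst p \<union> fst q, min (snd p) (snd q))"]) (auto simp: I_def invariance_defect_def)
  qed (simp add: eventually_principal)
  have "F \<noteq> bot"
  proof
    assume "F = bot"
    then have "eventually (\<lambda>_. False) F" by simp
    then show False using ai unfolding ev I_def by fastforce
  qed
  then obtain L where L: "linear_on_space bounded_functions L"
    "\<And>a c. a \<in> bounded_functions \<Longrightarrow> (\<forall>\<^sub>F i in F. c \<le> a i) \<Longrightarrow> c \<le> L a"
    "\<And>a c. a \<in> bounded_functions \<Longrightarrow> (a \<longlongrightarrow> c) F \<Longrightarrow> L a = c"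
    using generalized_limit_exists[of F] by metis
  define P where "P = {k::'g\<Rightarrow>real. integrable \<mu> k \<and> (\<forall>x. k x \<ge> 0) \<and> (\<integral>x. k x \<partial>\<mu>) = 1}"
  have PF: "eventually (\<lambda>k. k \<in> P) F"
    unfolding ev by (rule bexI[of _ "({},1)"]) (auto simp: P_def I_def invariance_defect_def)
  \<comment> \<open>The value is cut to 0 when \<open>k\<close> is not a density, so that
    \<open>v f\<close> is bounded on all functions \<open>k\<close> and not only eventually along
    \<open>F\<close>.\<close>
  define v where "v = (\<lambda>(f::'g\<Rightarrow>real) k. if k \<in> P then (\<integral>x. f x * k x \<partial>\<mu>) else 0)"
  have integ: "integrable \<mu> (\<lambda>x. f x * k x)" and bd: "\<bar>\<integral>x. f x * k x \<partial>\<mu>\<bar> \<le> C * (\<integral>x. \<bar>k x\<bar> \<partial>\<mu>)"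
    if f: "f \<in> Linf \<mu>" and C: "AE x in \<mu>. \<bar>f x\<bar> \<le> C" and k: "integrable \<mu> k" for f k C
  proof -
    have [measurable]: "f \<in> borel_measurable \<mu>" using f by (simp add: Linf_def)
    have kC: "integrable \<mu> (\<lambda>x. C * \<bar>k x\<bar>)" using k by simp
    have ae: "AE x in \<mu>. norm (f x * k x) \<le> C * \<bar>k x\<bar>"
      using C by eventually_elim (simp add: abs_mult mult_right_mono)
    show i: "integrable \<mu> (\<lambda>x. f x * k x)"
      by (rule Bochner_Integration.integrable_bound[OF kC]) (use k ae in \<open>auto elim!: eventually_mono\<close>)
    have "\<bar>\<integral>x. f x * k x \<partial>\<mu>\<bar> \<le> (\<integral>x. \<bar>f x * k x\<bar> \<partial>\<mu>)" by (rule integral_abs_bound)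
    also have "\<dots> \<le> (\<integral>x. C * \<bar>k x\<bar> \<partial>\<mu>)"
      by (rule integral_mono_AE) (use i kC ae in auto)
    finally show "\<bar>\<integral>x. f x * k x \<partial>\<mu>\<bar> \<le> C * (\<integral>x. \<bar>k x\<bar> \<partial>\<mu>)" by simp
  qed
  have ibd: "integrable \<mu> (\<lambda>x. f x * k x)" if "f \<in> Linf \<mu>" "integrable \<mu> k" for f k
    using that integ unfolding Linf_def by blast
  have vb: "v f \<in> bounded_functions" if f: "f \<in> Linf \<mu>" for f
  proof -
    obtain C where C: "AE x in \<mu>. \<bar>f x\<bar> \<le> C" using f by (auto simp: Linf_def)
    have "\<bar>v f k\<bar> \<le> \<bar>C\<bar>" for k
    proof (cases "k \<in> P")
      case True
      then have "integrable \<mu> k" "(\<integral>x. \<bar>k x\<bar> \<partial>\<mu>) = 1" by (auto simp: P_def)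
      then show ?thesis using bd[OF f C, of k] True by (simp add: v_def)
    qed (simp add: v_def)
    then show ?thesis unfolding bounded_functions_def by blast
  qed
  define m where "m = (\<lambda>f. L (v f))"
  have lin: "m (\<lambda>x. a * f x + b * g x) = a * m f + b * m g" if f: "f \<in> Linf \<mu>" and g: "g \<in> Linf \<mu>" for f g a b
  proof -
    have "v (\<lambda>x. a * f x + b * g x) = (\<lambda>k. a * v f k + b * v g k)"
    proof
      fix k
      show "v (\<lambda>x. a * f x + b * g x) k = a * v f k + b * v g k"
      proof (cases "k \<in> P")
        case True
        then have k: "integrable \<mu> k" by (simp add: P_def)
        have "(\<integral>x. (a * f x + b * g x) * k x \<partial>\<mu>) = (\<integral>x. a * (f x * k x) + b * (g x * k x) \<partial>\<mu>)"
          by (simp add: algebra_simps)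
        also have "\<dots> = a * (\<integral>x. f x * k x \<partial>\<mu>) + b * (\<integral>x. g x * k x \<partial>\<mu>)"
          using ibd[OF f k] ibd[OF g k] by simp
        finally show ?thesis using True by (simp add: v_def)
      qed (simp add: v_def)
    qed
    moreover have "L (\<lambda>k. a * v f k + b * v g k) = L (\<lambda>k. a * v f k) + L (\<lambda>k. b * v g k)"
      by (rule linear_on_spaceD(1)[OF L(1)]) (use function_spaceD(2)[OF function_space_bounded_functions] vb f g in auto)
    moreover have "L (\<lambda>k. a * v f k) = a * L (v f)" by (rule linear_on_spaceD(2)[OF L(1) vb[OF f]])
    moreover have "L (\<lambda>k. b * v g k) = b * L (v g)" by (rule linear_on_spaceD(2)[OF L(1) vb[OF g]])
    ultimately show ?thesis by (simp add: m_def)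
  qed
  have ae: "m f = m g" if "f \<in> Linf \<mu>" "g \<in> Linf \<mu>" "AE x in \<mu>. f x = g x" for f g
  proof -
    have "(\<integral>x. f x * k x \<partial>\<mu>) = (\<integral>x. g x * k x \<partial>\<mu>)" if "k \<in> P" for k
      by (rule integral_cong_AE) (use \<open>f \<in> _\<close> \<open>g \<in> _\<close> \<open>AE x in \<mu>. f x = g x\<close> that in \<open>auto simp: Linf_def P_def\<close>)
    then have "v f = v g" by (auto simp: v_def)
    then show ?thesis by (simp add: m_def)
  qed
  have pos: "m f \<ge> 0" if f: "f \<in> Linf \<mu>" and p: "AE x in \<mu>. f x \<ge> 0" for f
    unfolding m_def
  proof (rule L(2)[OF vb[OF f]], rule always_eventually, rule allI)
    fix k
    have "(\<integral>x. f x * k x \<partial>\<mu>) \<ge> 0" if "k \<in> P"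
      by (rule integral_nonneg_AE) (use p that in \<open>auto simp: P_def elim!: eventually_mono\<close>)
    then show "0 \<le> v f k" by (simp add: v_def)
  qed
  have one: "m (\<lambda>_. 1) = 1"
    unfolding m_def
  proof (rule L(3))
    have "(\<lambda>_. 1) \<in> Linf \<mu>" by (auto simp: Linf_def intro: exI[of _ 1])
    then show "v (\<lambda>_. 1) \<in> bounded_functions" by (rule vb)
    have "eventually (\<lambda>k. v (\<lambda>_. 1) k = 1) F" using PF by eventually_elim (simp add: v_def P_def)
    then show "(v (\<lambda>_. 1) \<longlongrightarrow> 1) F" by (rule tendsto_eventually)
  qed
  have inv: "m (\<lambda>x. f (a + x)) = m f" if f: "f \<in> Linf \<mu>" for f a
  proof -
    have fm[measurable]: "f \<in> borel_measurable \<mu>" using f by (simp add: Linf_def)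
    obtain C0 where C0: "AE x in \<mu>. \<bar>f x\<bar> \<le> C0" using f by (auto simp: Linf_def)
    define C where "C = \<bar>C0\<bar> + 1"
    have C: "AE x in \<mu>. \<bar>f x\<bar> \<le> C" "C > 0" using C0 by (auto simp: C_def elim!: eventually_mono)
    have "AE x in distr \<mu> \<mu> (\<lambda>y. a + y). \<bar>f x\<bar> \<le> C" by (subst distr_translate) (rule C(1))
    then have "AE x in \<mu>. \<bar>f (a + x)\<bar> \<le> C" by (subst (asm) AE_distr_iff) auto
    then have fa: "(\<lambda>x. f (a + x)) \<in> Linf \<mu>" using measurable_translate_comp[OF fm, of a] by (auto simp: Linf_def)
    \<comment> \<open>The substitution \<open>x\<close> to \<open>- a + x\<close> carries the
      translation over to \<open>k\<close>, which explains the set \<open>{- a}\<close>; the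
      essential bound \<open>C\<close> of \<open>f\<close> then multiplies the \<open>L^1\<close>
      defect of \<open>k\<close>.\<close>
    have diff: "\<bar>v (\<lambda>x. f (a + x)) k - v f k\<bar> \<le> C * e" if k: "k \<in> invariance_defect {- a} e" for k e
    proof -
      have kP: "k \<in> P" and ki: "integrable \<mu> k" and ke: "(\<integral>x. \<bar>k (- a + x) - k x\<bar> \<partial>\<mu>) \<le> e"
        using k by (auto simp: invariance_defect_def P_def)
      have ka: "integrable \<mu> (\<lambda>x. k (- a + x))" by (rule integrable_translate[OF ki])
      have "(\<integral>x. f (a + x) * k x \<partial>\<mu>) = (\<integral>x. f (a + x) * k (- a + (a + x)) \<partial>\<mu>)"
        by (simp add: add.assoc[symmetric])
      also have "\<dots> = (\<integral>x. f x * k (- a + x) \<partial>\<mu>)"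
        by (rule integral_translate[where f = "\<lambda>x. f x * k (- a + x)"]) (use ka in measurable)
      finally have "v (\<lambda>x. f (a + x)) k - v f k = (\<integral>x. f x * (k (- a + x) - k x) \<partial>\<mu>)"
        using kP ibd[OF f ka] ibd[OF f ki] by (simp add: v_def right_diff_distrib)
      also have "\<bar>\<dots>\<bar> \<le> C * (\<integral>x. \<bar>k (- a + x) - k x\<bar> \<partial>\<mu>)"
        by (rule bd[OF f C(1)]) (use ka ki in auto)
      also have "\<dots> \<le> C * e" using ke C by simp
      finally show ?thesis .
    qed
    have "((\<lambda>k. v (\<lambda>x. f (a + x)) k - v f k) \<longlongrightarrow> 0) F"
      unfolding tendsto_iff
    proof (intro allI impI)
      fix e :: real assume e: "e > 0"
      show "eventually (\<lambda>k. dist (v (\<lambda>x. f (a + x)) k - v f k) 0 < e) F"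
        unfolding ev
      proof (rule bexI[of _ "({- a}, e / (2 * C))"])
        show "\<forall>k\<in>invariance_defect (fst ({- a}, e / (2 * C))) (snd ({- a}, e / (2 * C))).
            dist (v (\<lambda>x. f (a + x)) k - v f k) 0 < e"
        proof
          fix k assume "k \<in> invariance_defect (fst ({- a}, e / (2 * C))) (snd ({- a}, e / (2 * C)))"
          then have "\<bar>v (\<lambda>x. f (a + x)) k - v f k\<bar> \<le> C * (e / (2 * C))" by (intro diff) simp
          also have "\<dots> < e" using C e by simp
          finally show "dist (v (\<lambda>x. f (a + x)) k - v f k) 0 < e" by (simp add: dist_norm)
        qed
        show "({- a}, e / (2 * C)) \<in> I" using e C by (simp add: I_def)
      qed
    qed
    moreover have "(\<lambda>k. v (\<lambda>x. f (a + x)) k - v f k) \<in> bounded_functions"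
      by (rule function_space_diff[OF function_space_bounded_functions vb[OF fa] vb[OF f]])
    ultimately have "L (\<lambda>k. v (\<lambda>x. f (a + x)) k - v f k) = 0" by (intro L(3))
    moreover have "L (\<lambda>k. v (\<lambda>x. f (a + x)) k - v f k) = L (v (\<lambda>x. f (a + x))) - L (v f)"
      by (rule linear_on_space_diff[OF function_space_bounded_functions L(1) vb[OF fa] vb[OF f]])
    ultimately show ?thesis by (simp add: m_def)
  qed
  show ?thesis unfolding amenable_def
    by (rule exI[of _ m]) (use lin ae pos one inv in blast)
qed

section \<open>Powers of averaging operators\<close>

definition avg :: "'g set \<Rightarrow> ('g \<Rightarrow> real) \<Rightarrow> 'g \<Rightarrow> real" where
  "avg B f = (\<lambda>y. (\<Sum>a\<in>B. f (a + y)) / card B)"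

text \<open>The power number \<open>n\<close> averages over words of length \<open>n\<close> in
  \<open>B\<close>. Writing it with weights on points matters because such weights also define a
  functional on \<open>A\<close>, to which the bound coming from the right identity applies.\<close>

lemma avg_power_weights:
  assumes B: "finite B" "B \<noteq> {}"
  obtains X :: "'g set" and w where "finite X" "\<And>x. x \<in> X \<Longrightarrow> w x \<ge> 0" "sum w X = 1"
    "\<And>f y. (avg B ^^ n) f y = (\<Sum>x\<in>X. w x * f (x + y))"
proof -
  have "\<exists>X w. finite X \<and> (\<forall>x\<in>X. w x \<ge> 0) \<and> sum w X = 1 \<and>
      (\<forall>f y. (avg B ^^ n) f y = (\<Sum>x\<in>X. w x * f (x + y)))"
  proof (induction n)
    case 0
    show ?case by (rule exI[of _ "{0}"], rule exI[of _ "\<lambda>_. 1"]) simp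
  next
    case (Suc n)
    then obtain X w where X: "finite X" "\<forall>x\<in>X. w x \<ge> 0" "sum w X = 1"
      "\<And>f y. (avg B ^^ n) f y = (\<Sum>x\<in>X. w x * f (x + y))" by blast
    define p where "p = (\<lambda>(x::'g, a::'g). a + x)"
    define q where "q = (\<lambda>(x::'g, a::'g). w x / card B)"
    \<comment> \<open>Different pairs may have the same sum \<open>a + x\<close>, so the weights are
      collected over the fibres of \<open>p\<close>.\<close>
    define w' where "w' = (\<lambda>z. sum q {i \<in> X \<times> B. p i = z})"
    have fin: "finite (X \<times> B)" using X B by simp
    have red: "(\<Sum>z\<in>p ` (X \<times> B). w' z * h z) = (\<Sum>i\<in>X \<times> B. q i * h (p i))" for h :: "'g \<Rightarrow> real"
    proof -
      have "(\<Sum>i\<in>X \<times> B. q i * h (p i)) = (\<Sum>z\<in>p ` (X \<times> B). \<Sum>i\<in>{i \<in> X \<times> B. p i = z}. q i * h (p i))"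
        by (rule sum.image_gen[OF fin])
      also have "\<dots> = (\<Sum>z\<in>p ` (X \<times> B). w' z * h z)"
        by (intro sum.cong refl) (simp add: w'_def sum_distrib_right)
      finally show ?thesis by simp
    qed
    show ?case
    proof (intro exI conjI allI ballI)
      show "finite (p ` (X \<times> B))" using fin by simp
      show "w' z \<ge> 0" for z unfolding w'_def q_def using X(2) by (auto intro!: sum_nonneg)
      have "sum w' (p ` (X \<times> B)) = (\<Sum>i\<in>X \<times> B. q i)" using red[of "\<lambda>_. 1"] by simp
      also have "\<dots> = (\<Sum>x\<in>X. \<Sum>a\<in>B. w x / card B)" by (simp only: q_def sum.cartesian_product)
      also have "\<dots> = 1" using B X(3) by simp
      finally show "sum w' (p ` (X \<times> B)) = 1" .
      fix f y
      have "(avg B ^^ Suc n) f y = (avg B ^^ n) (avg B f) y" by (simp add: funpow_swap1)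
      also have "\<dots> = (\<Sum>x\<in>X. w x * avg B f (x + y))" by (rule X(4))
      also have "\<dots> = (\<Sum>x\<in>X. \<Sum>a\<in>B. (w x / card B) * f (a + x + y))"
        by (simp add: avg_def sum_distrib_left sum_divide_distrib add.assoc)
      also have "\<dots> = (\<Sum>i\<in>X \<times> B. q i * f (p i + y))"
        by (simp add: q_def p_def sum.cartesian_product case_prod_beta)
      also have "\<dots> = (\<Sum>z\<in>p ` (X \<times> B). w' z * f (z + y))" by (rule red[symmetric])
      finally show "(avg B ^^ Suc n) f y = (\<Sum>z\<in>p ` (X \<times> B). w' z * f (z + y))" .
    qed
  qed
  then show ?thesis using that by metis
qed

lemma avg_measurable[measurable (raw)]: "f \<in> borel_measurable \<mu> \<Longrightarrow> avg B f \<in> borel_measurable \<mu>"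
  unfolding avg_def
  by (intro borel_measurable_divide borel_measurable_sum borel_measurable_const measurable_translate_comp)

lemma avg_nonneg: "(\<And>x. f x \<ge> 0) \<Longrightarrow> avg B f y \<ge> 0"
  unfolding avg_def by (simp add: sum_nonneg)

lemma avg_power_measurable_nonneg:
  assumes "f \<in> borel_measurable \<mu>" "\<And>x. f x \<ge> 0"
  shows "(avg B ^^ n) f \<in> borel_measurable \<mu>" "(avg B ^^ n) f x \<ge> 0"
proof -
  have "(avg B ^^ n) f \<in> borel_measurable \<mu> \<and> (\<forall>x. (avg B ^^ n) f x \<ge> 0)"
    by (induction n) (use assms avg_measurable avg_nonneg in auto)
  then show "(avg B ^^ n) f \<in> borel_measurable \<mu>" "(avg B ^^ n) f x \<ge> 0" by auto
qed

text \<open>For \<open>n\<close> with \<open>(1 - d)^n < c\<close> the moments \<open>A i\<close>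
  cannot shrink by the factor \<open>1 - d\<close> at each of the \<open>n\<close> steps. At a step
  that loses almost nothing, \<open>powr_mean_gap\<close> makes the midpoint gaps small in the
  integral, and \<open>powr_gap\<close> converts this into \<open>L^1\<close> closeness of
  \<open>H i powr r\<close> to its translates.\<close>

lemma almost_invariant_of_slow_decay:
  assumes B: "finite B" "0 \<in> B" and r: "r > 1" and e: "e > 0" and c: "c > 0"
    and F: "\<And>n. \<exists>F. F \<in> borel_measurable \<mu> \<and> (\<forall>x. F x \<ge> 0) \<and> (\<integral>\<^sup>+ x. ennreal (F x powr r) \<partial>\<mu>) \<le> 1 \<and>
        ennreal c < (\<integral>\<^sup>+ x. ennreal ((avg B ^^ n) F x powr r) \<partial>\<mu>)"
  shows "invariance_defect B e \<noteq> {}"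
proof -
  define M where "M = real (card B)"
  have M: "M > 0" using B by (auto simp: M_def card_gt_0_iff)
  obtain K where K: "K \<ge> 0" "\<And>a b. a \<ge> 0 \<Longrightarrow> b \<ge> 0 \<Longrightarrow>
    \<bar>a powr r - b powr r\<bar> \<le> (e/4) * (a powr r + b powr r) +
      K * ((a powr r + b powr r) / 2 - ((a + b) / 2) powr r)"
    using powr_gap[OF r, of "e/4"] e by auto
  \<comment> \<open>The final estimate is \<open>e/2 + (K * M * d) / 2\<close>. This choice makes
    the second term at most \<open>e/2\<close>, and the minimum keeps \<open>d\<close> below
    1.\<close>
  define d where "d = min (1/2) (e / (K * M + 1))"
  have KM: "K * M + 1 > 0" using K M by (simp add: add_nonneg_pos)
  have d: "0 < d" "d < 1" using e KM by (auto simp: d_def)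
  have dK: "K * M * d \<le> e"
  proof -
    have "K * M * d \<le> (K * M + 1) * (e / (K * M + 1))"
      by (rule mult_mono) (use K M d e KM in \<open>auto simp: d_def\<close>)
    then show ?thesis using KM by simp
  qed
  obtain n where n: "(1 - d)^n < c" using real_arch_pow_inv[OF c, of "1 - d"] d by auto
  obtain F where F': "F \<in> borel_measurable \<mu>" "\<And>x. F x \<ge> 0" "(\<integral>\<^sup>+ x. ennreal (F x powr r) \<partial>\<mu>) \<le> 1"
    "ennreal c < (\<integral>\<^sup>+ x. ennreal ((avg B ^^ n) F x powr r) \<partial>\<mu>)" using F[of n] by blast
  define H where "H = (\<lambda>i. (avg B ^^ i) F)"
  have Hm[measurable]: "H i \<in> borel_measurable \<mu>" and Hn: "H i x \<ge> 0" for i x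
    unfolding H_def by (rule avg_power_measurable_nonneg[OF F'(1,2)])+
  define a' where "a' = (\<lambda>i. \<integral>\<^sup>+ x. ennreal (H i x powr r) \<partial>\<mu>)"
  have HS: "H (Suc i) = avg B (H i)" for i by (simp add: H_def)
  have jensen: "H (Suc i) x powr r \<le> (\<Sum>b\<in>B. H i (b + x) powr r) / M" for i x
    unfolding HS avg_def M_def by (rule powr_mean_le) (use B Hn r in auto)
  have tr: "(\<integral>\<^sup>+ x. ennreal (H i (b + x) powr r) \<partial>\<mu>) = a' i" for i b
    unfolding a'_def by (rule nn_integral_translate[where f = "\<lambda>x. ennreal (H i x powr r)"]) measurable
  have [measurable]: "(\<lambda>x. H i (b + x)) \<in> borel_measurable \<mu>" for i b by (rule measurable_translate_comp) measurable
  have a'1: "a' i \<le> 1" for i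
  proof (induction i)
    case 0 then show ?case using F'(3) by (simp add: a'_def H_def)
  next
    case (Suc i)
    have "a' (Suc i) \<le> (\<integral>\<^sup>+ x. (\<Sum>b\<in>B. ennreal (1/M) * ennreal (H i (b + x) powr r)) \<partial>\<mu>)"
      unfolding a'_def
    proof (rule nn_integral_mono)
      fix x
      have "(\<Sum>b\<in>B. ennreal (1/M) * ennreal (H i (b + x) powr r)) = (\<Sum>b\<in>B. ennreal ((1/M) * H i (b + x) powr r))"
        by (intro sum.cong refl) (subst ennreal_mult[symmetric], use M in auto)
      also have "\<dots> = ennreal (\<Sum>b\<in>B. (1/M) * H i (b + x) powr r)" by (rule sum_ennreal) (use M in auto)
      also have "\<dots> = ennreal ((\<Sum>b\<in>B. H i (b + x) powr r) / M)" by (simp add: sum_divide_distrib)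
      finally show "ennreal (H (Suc i) x powr r) \<le> (\<Sum>b\<in>B. ennreal (1/M) * ennreal (H i (b + x) powr r))"
        using jensen[of i x] by (simp add: ennreal_leI)
    qed
    also have "\<dots> = (\<Sum>b\<in>B. ennreal (1/M) * (\<integral>\<^sup>+ x. ennreal (H i (b + x) powr r) \<partial>\<mu>))"
      by (subst nn_integral_sum) (auto intro!: sum.cong nn_integral_cmult)
    also have "\<dots> = of_nat (card B) * (ennreal (1/M) * a' i)" unfolding tr by simp
    also have "\<dots> = (ennreal M * ennreal (1/M)) * a' i" by (simp add: ennreal_of_nat_eq_real_of_nat mult.assoc M_def)
    also have "ennreal M * ennreal (1/M) = 1" using M by (simp add: ennreal_mult[symmetric])
    finally show ?case using Suc by simp
  qed
  have int: "integrable \<mu> (\<lambda>x. H i x powr r)" for i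
  proof (rule integrableI_bounded)
    have "(\<integral>\<^sup>+ x. ennreal (norm (H i x powr r)) \<partial>\<mu>) = a' i" by (simp add: a'_def)
    also have "\<dots> < \<infinity>" using a'1[of i] by (auto intro: le_less_trans)
    finally show "(\<integral>\<^sup>+ x. ennreal (norm (H i x powr r)) \<partial>\<mu>) < \<infinity>" .
  qed measurable
  define A where "A = (\<lambda>i. \<integral>x. H i x powr r \<partial>\<mu>)"
  have aA: "a' i = ennreal (A i)" for i
    unfolding a'_def A_def by (rule nn_integral_eq_integral[OF int]) simp
  have A0: "A i \<ge> 0" for i unfolding A_def by simp
  have "\<exists>i<n. (1 - d) * A i < A (Suc i)"
  proof (rule decreasing_sequence_slow_step)
    show "A 0 \<le> 1" using a'1[of 0] by (simp add: aA)
    show "(1 - d)^n < A n"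
    proof -
      have "ennreal c < ennreal (A n)" using F'(4) unfolding aA[symmetric] a'_def H_def .
      then show ?thesis using n c by (simp add: ennreal_less_iff)
    qed
  qed (use d in auto)
  then obtain i where i: "(1 - d) * A i < A (Suc i)" by blast
  \<comment> \<open>If \<open>A i\<close> vanished, so would the moment of the next average, against
    the strict inequality in \<open>i\<close>. The density below is divided by
    \<open>A i\<close>.\<close>
  have Apos: "A i > 0"
  proof (rule ccontr)
    assume "\<not> A i > 0"
    then have "A i = 0" using A0[of i] by simp
    then have z: "(\<integral>x. H i x powr r \<partial>\<mu>) = 0" by (simp add: A_def)
    have "A (Suc i) \<le> (\<integral>x. (\<Sum>b\<in>B. H i (b + x) powr r) / M \<partial>\<mu>)"
      unfolding A_def by (rule integral_mono[OF int _ jensen])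
        (use integrable_translate[OF int] in \<open>auto intro!: integrable_divide Bochner_Integration.integrable_sum\<close>)
    also have "\<dots> = (\<Sum>b\<in>B. (\<integral>x. H i (b + x) powr r \<partial>\<mu>)) / M"
      using integrable_translate[OF int] by simp
    also have "\<dots> = 0" using integral_translate[of "\<lambda>x. H i x powr r"] z by simp
    finally show False using i \<open>A i = 0\<close> by simp
  qed
  define k where "k = (\<lambda>x. H i x powr r / A i)"
  have intt: "integrable \<mu> (\<lambda>x. H i (b + x) powr r)" for b by (rule integrable_translate[OF int])
  have itr: "(\<integral>x. H i (b + x) powr r \<partial>\<mu>) = A i" for b
    unfolding A_def by (rule integral_translate[where f = "\<lambda>x. H i x powr r"]) measurable
  have "k \<in> invariance_defect B e"
    unfolding invariance_defect_def
  proof (intro CollectI conjI allI ballI)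
    show "integrable \<mu> k" unfolding k_def using int by simp
    show "k x \<ge> 0" for x unfolding k_def using Apos by simp
    show "(\<integral>x. k x \<partial>\<mu>) = 1" unfolding k_def using Apos by (simp add: A_def)
    fix b assume b: "b \<in> B"
    show "(\<integral>x. \<bar>k (b + x) - k x\<bar> \<partial>\<mu>) \<le> e"
    proof (cases "b = 0")
      case True then show ?thesis using e by simp
    next
      case False
      \<comment> \<open>Since \<open>0\<close> is in \<open>B\<close>, the function
        \<open>H i\<close> is itself one of the averaged translates. The gap of the pair
        \<open>b\<close>, \<open>0\<close> is therefore controlled by the total loss
        \<open>tot\<close> of the step.\<close>
      define gap where "gap = (\<lambda>x. (H i (b + x) powr r + H i x powr r) / 2 - ((H i (b + x) + H i x) / 2) powr r)"
      define tot where "tot = (\<lambda>x. (\<Sum>b\<in>B. H i (b + x) powr r) / M - H (Suc i) x powr r)"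
      have g: "(2/M) * gap x \<le> tot x" for x
        using powr_mean_gap[of B "\<lambda>b. H i (b + x)" r b 0] B b False Hn r
        unfolding gap_def tot_def HS avg_def M_def by simp
      have toti: "integrable \<mu> tot"
        unfolding tot_def using intt int by (auto intro!: Bochner_Integration.integrable_diff integrable_divide Bochner_Integration.integrable_sum)
      have "(\<integral>x. tot x \<partial>\<mu>) = (\<Sum>b\<in>B. (\<integral>x. H i (b + x) powr r \<partial>\<mu>)) / M - A (Suc i)"
        unfolding tot_def A_def using intt int by simp
      also have "\<dots> = A i - A (Suc i)" using M unfolding itr by (simp add: M_def)
      finally have totv: "(\<integral>x. tot x \<partial>\<mu>) \<le> d * A i" using i left_diff_distrib[of 1 d "A i"] by linarith
      have pw: "\<bar>k (b + x) - k x\<bar> \<le> (1 / A i) * ((e/4) * (H i (b + x) powr r + H i x powr r) + K * (M/2) * tot x)" for x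
      proof -
        have "\<bar>k (b + x) - k x\<bar> = (1 / A i) * \<bar>H i (b + x) powr r - H i x powr r\<bar>"
          unfolding k_def diff_divide_distrib[symmetric] abs_divide using Apos by simp
        also have "\<dots> \<le> (1 / A i) * ((e/4) * (H i (b + x) powr r + H i x powr r) + K * gap x)"
          unfolding gap_def by (rule mult_left_mono[OF K(2)]) (use Hn Apos in auto)
        also have "\<dots> \<le> (1 / A i) * ((e/4) * (H i (b + x) powr r + H i x powr r) + K * (M/2) * tot x)"
        proof -
          have "gap x \<le> (M/2) * tot x" using g[of x] M by (simp add: field_simps)
          then have "K * gap x \<le> K * ((M/2) * tot x)" by (rule mult_left_mono[OF _ K(1)])
          then show ?thesis using Apos by (intro mult_left_mono) (auto simp: mult.assoc)
        qed
        finally show ?thesis .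
      qed
      have ii: "integrable \<mu> (\<lambda>x. (1 / A i) * ((e/4) * (H i (b + x) powr r + H i x powr r) + K * (M/2) * tot x))"
        using intt int toti by simp
      have "(\<integral>x. \<bar>k (b + x) - k x\<bar> \<partial>\<mu>) \<le> (\<integral>x. (1 / A i) * ((e/4) * (H i (b + x) powr r + H i x powr r) + K * (M/2) * tot x) \<partial>\<mu>)"
        by (rule integral_mono[OF _ ii pw]) (use int intt in \<open>auto simp: k_def\<close>)
      also have "\<dots> = (1 / A i) * ((e/4) * (A i + A i) + K * (M/2) * (\<integral>x. tot x \<partial>\<mu>))"
        using intt int toti itr[of b] by (simp add: A_def)
      also have "\<dots> \<le> (1 / A i) * ((e/4) * (A i + A i) + K * (M/2) * (d * A i))"
        using totv K M Apos by (intro mult_left_mono add_left_mono) auto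
      also have "\<dots> = e/2 + (K * M * d) / 2" using Apos by (simp add: field_simps)
      also have "\<dots> \<le> e" using dK by simp
      finally show ?thesis .
    qed
  qed
  then show ?thesis by blast
qed

section \<open>From a right identity to an invariant mean\<close>

lemma identity_neighbourhood:
  obtains U K where "open U" "(0::'g) \<in> U" "compact K" "U \<subseteq> K" "0 < emeasure \<mu> U" "emeasure \<mu> U < \<infinity>"
proof -
  obtain U K where UK: "open U" "compact K" "(0::'g) \<in> U" "U \<subseteq> K"
    using lcg unfolding locally_compact_group_def by blast
  have "emeasure \<mu> U > 0" using haarD(3) UK by blast
  moreover have "emeasure \<mu> U \<le> emeasure \<mu> K"
    by (rule emeasure_mono[OF UK(4)]) (use UK in \<open>simp add: borel_compact\<close>)
  moreover have "emeasure \<mu> K < \<infinity>" using haarD(2) UK by blast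
  ultimately show ?thesis using that UK by (auto intro: le_less_trans)
qed

end

context orlicz_setup
begin

lemma indicator_in_orlicz_space:
  assumes y: "young_function \<Theta>" and F: "F \<in> sets borel" "emeasure \<mu> F < \<infinity>"
  shows "(\<lambda>x. complex_of_real (c * indicator F x)) \<in> orlicz_space \<mu> \<Theta>"
proof (rule orlicz_spaceI)
  show "(\<lambda>x. complex_of_real (c * indicator F x)) \<in> borel_measurable \<mu>" using F by measurable
  have "(\<integral>\<^sup>+ x. ennreal (\<Theta> (cmod (complex_of_real (c * indicator F x)))) \<partial>\<mu>)
      = (\<integral>\<^sup>+ x. ennreal (\<Theta> \<bar>c\<bar>) * indicator F x \<partial>\<mu>)"
    by (intro nn_integral_cong) (auto simp: indicator_def young_functionD(5)[OF y] abs_mult simp del: of_real_mult)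
  also have "\<dots> = ennreal (\<Theta> \<bar>c\<bar>) * emeasure \<mu> F" by (rule nn_integral_cmult_indicator) (use F in simp)
  also have "\<dots> < \<infinity>" using F by (simp add: ennreal_mult_less_top)
  finally show "(\<integral>\<^sup>+ x. ennreal (\<Theta> (cmod (complex_of_real (c * indicator F x)))) \<partial>\<mu>) < \<infinity>" .
qed

text \<open>The first factor is the indicator of the union \<open>F\<close> of the translates of
  \<open>U\<close> by \<open>X\<close>, the second the normalized indicator of \<open>U\<close>. For
  \<open>x\<close> in \<open>X\<close> the translate of \<open>U\<close> lies wholly in
  \<open>F\<close>, so the convolution is the normalized measure of \<open>U\<close>.\<close>

lemma AP_one_on_finite:
  assumes X: "finite X"
  obtains u where "u \<in> A" "\<And>x. x \<in> X \<Longrightarrow> u x = 1"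
proof -
  obtain U K where U: "open U" "(0::'g) \<in> U" "0 < emeasure \<mu> U" "emeasure \<mu> U < \<infinity>"
    using identity_neighbourhood by metis
  define F where "F = (\<Union>x\<in>X. (\<lambda>y. x + y) ` U)"
  have tr: "(\<lambda>y. x + y) ` U \<in> sets borel" for x
  proof -
    have "(\<lambda>y. x + y) ` U = (\<lambda>y. - x + y) -` U \<inter> space \<mu>"
    proof (intro set_eqI iffI)
      fix z assume "z \<in> (\<lambda>y. - x + y) -` U \<inter> space \<mu>"
      then have "- x + z \<in> U" "z = x + (- x + z)" by (auto simp: add.assoc[symmetric])
      then show "z \<in> (\<lambda>y. x + y) ` U" by blast
    qed (auto simp: add.assoc[symmetric])
    also have "\<dots> \<in> sets \<mu>" using U by (intro measurable_sets[OF measurable_translate]) auto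
    finally show ?thesis by simp
  qed
  have Fm: "F \<in> sets borel" unfolding F_def using X tr by (intro sets.finite_UN) auto
  have "emeasure \<mu> F \<le> (\<Sum>x\<in>X. emeasure \<mu> ((\<lambda>y. x + y) ` U))"
    unfolding F_def by (rule emeasure_subadditive_finite) (use X tr in auto)
  also have "\<dots> = (\<Sum>x\<in>X. emeasure \<mu> U)" using haarD(1) U by (intro sum.cong) auto
  also have "\<dots> < \<infinity>" using U by (simp add: ennreal_mult_less_top of_nat_less_top)
  finally have Ff: "emeasure \<mu> F < \<infinity>" .
  define f where "f = (\<lambda>x. complex_of_real (1 * indicator F x))"
  define g where "g = (\<lambda>x. complex_of_real (1 / measure \<mu> U * indicator U x))"
  have f: "f \<in> L\<Phi>" unfolding f_def by (rule indicator_in_orlicz_space[OF young\<Phi> Fm Ff])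
  have g: "g \<in> L\<Psi>" unfolding g_def by (rule indicator_in_orlicz_space[OF young\<Psi>]) (use U in auto)
  have mU: "measure \<mu> U > 0" using U by (simp add: measure_def enn2real_positive_iff)
  have "conv_check \<mu> f g x = 1" if x: "x \<in> X" for x
  proof -
    have "conv_check \<mu> f g x = (\<integral>y. f (x + y) * g y \<partial>\<mu>)"
      by (rule conv_check_alt) (use f g orlicz_space_measurable in auto)
    also have "\<dots> = (\<integral>y. complex_of_real (1 / measure \<mu> U * indicator U y) \<partial>\<mu>)"
      by (rule Bochner_Integration.integral_cong) (use x in \<open>auto simp: f_def g_def F_def indicator_def\<close>)
    also have "\<dots> = complex_of_real (\<integral>y. 1 / measure \<mu> U * indicator U y \<partial>\<mu>)" by (rule integral_complex_of_real)
    also have "(\<integral>y. 1 / measure \<mu> U * indicator U y \<partial>\<mu>) = 1" using mU U by simp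
    finally show ?thesis by simp
  qed
  then show ?thesis using that[of "conv_check \<mu> f g"] AP_tensor(1)[OF f g] by blast
qed

abbreviation "DD \<equiv> AP_bidual \<mu> \<Phi> \<Psi>"

lemma evaluation_in_bidual:
  assumes u: "u \<in> A" shows "(\<lambda>S. S u) \<in> DD"
  unfolding AP_bidual_def bidual_space_def
proof (intro CollectI conjI ballI allI)
  have "cmod (T u) \<le> (nA u + 1) * nD T" if "T \<in> D" for T
    by (rule dual_norm_bound[OF that u]) (use AP_norm_nonneg[OF u] in auto)
  then show "\<exists>C. \<forall>T\<in>D. cmod (T u) \<le> C * nD T" by blast
qed auto

text \<open>Evaluation at \<open>u\<close> belongs to the bidual; testing the identity on it unfolds
  the Arens product to this equation.\<close>

lemma right_identity_reproduces:
  assumes E: "E \<in> DD" "\<forall>\<Gamma>\<in>DD. \<forall>T\<in>D. arens1 pointwise_mult \<Gamma> E T = \<Gamma> T" and T: "T \<in> D" and u: "u \<in> A"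
  shows "E (dual_act pointwise_mult u T) = T u"
proof -
  have "arens1 pointwise_mult (\<lambda>S. S u) E T = T u" using E(2) evaluation_in_bidual[OF u] T by blast
  then show ?thesis by (simp add: arens1_def bidual_act_def)
qed

lemma point_functional_in_dual:
  fixes c :: "'g \<Rightarrow> real"
  assumes "finite X"
  shows "(\<lambda>v. \<Sum>x\<in>X. complex_of_real (c x) * v x) \<in> D"
proof (rule AP_dualI[where C = "\<Sum>x\<in>X. \<bar>c x\<bar>"])
  fix u assume u: "u \<in> A"
  have "cmod (\<Sum>x\<in>X. complex_of_real (c x) * u x) \<le> (\<Sum>x\<in>X. cmod (complex_of_real (c x) * u x))" by (rule norm_sum)
  also have "\<dots> \<le> (\<Sum>x\<in>X. \<bar>c x\<bar> * nA u)"
    by (intro sum_mono) (simp add: norm_mult mult_left_mono AP_pointwise_bound[OF u])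
  finally show "cmod (\<Sum>x\<in>X. complex_of_real (c x) * u x) \<le> (\<Sum>x\<in>X. \<bar>c x\<bar>) * nA u" by (simp add: sum_distrib_right)
qed (auto simp: distrib_left sum.distrib sum_distrib_left algebra_simps)

lemma right_identity_point_bound:
  assumes "AP_bidual_has_right_identity \<mu> \<Phi> \<Psi>"
  obtains C where "C > 0" "\<And>X (c::'g\<Rightarrow>real). finite X \<Longrightarrow> sum c X = 1 \<Longrightarrow>
     1 \<le> C * nD (\<lambda>v. \<Sum>x\<in>X. complex_of_real (c x) * v x)"
proof -
  obtain E where E: "E \<in> DD" "\<forall>\<Gamma>\<in>DD. \<forall>T\<in>D. arens1 pointwise_mult \<Gamma> E T = \<Gamma> T"
    using assms unfolding AP_bidual_has_right_identity_def by blast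
  obtain C where C: "\<And>T. T \<in> D \<Longrightarrow> cmod (E T) \<le> C * nD T"
    using E(1) unfolding AP_bidual_def bidual_space_def by blast
  have "1 \<le> (\<bar>C\<bar> + 1) * nD (\<lambda>v. \<Sum>x\<in>X. complex_of_real (c x) * v x)" if X: "finite X" "sum c X = 1" for X and c :: "'g \<Rightarrow> real"
  proof -
    define T where "T = (\<lambda>v. \<Sum>x\<in>X. complex_of_real (c x) * v x)"
    have T: "T \<in> D" unfolding T_def by (rule point_functional_in_dual[OF X(1)])
    obtain u where u: "u \<in> A" "\<And>x. x \<in> X \<Longrightarrow> u x = 1" using AP_one_on_finite[OF X(1)] by blast
    \<comment> \<open>The equality holds at arbitrary functions \<open>v\<close>, not only at those
      in \<open>A\<close>. This matters because \<open>E\<close> acts on total functions and could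
      tell apart functionals that agree on \<open>A\<close>.\<close>
    have "dual_act pointwise_mult u T = T"
      unfolding dual_act_def pointwise_mult_def T_def by (intro ext sum.cong) (use u in auto)
    then have "E T = T u" using right_identity_reproduces[OF E T u(1)] by simp
    also have "T u = complex_of_real (sum c X)" unfolding T_def by (simp add: u(2))
    finally have "1 \<le> C * nD T" using C[OF T] X by simp
    also have "\<dots> \<le> (\<bar>C\<bar> + 1) * nD T" by (rule mult_right_mono) (use dual_norm_nonneg[OF T] in auto)
    finally show ?thesis by (simp add: T_def)
  qed
  then show ?thesis using that[of "\<bar>C\<bar> + 1"] by (simp add: add_nonneg_pos)
qed

text \<open>Paired with a convolution of \<open>f\<close> and \<open>g\<close>, the functional
  integrates the weighted sum of translates of \<open>f\<close> against \<open>g\<close>, so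
  Hoelder's inequality bounds its dual norm by the norm of that sum as an operator on
  \<open>L\<Phi>\<close>. The operator bound is stated as an implication between modulars, because
  its failure has to supply a concrete \<open>f\<close>.\<close>

lemma point_functional_norm_le:
  fixes w :: "'g \<Rightarrow> real"
  assumes X: "finite X" "\<And>x. x \<in> X \<Longrightarrow> w x \<ge> 0" and M: "M > 0"
    and P: "\<And>f. f \<in> borel_measurable \<mu> \<Longrightarrow> (\<forall>x. f x \<ge> 0) \<Longrightarrow> (\<integral>\<^sup>+ y. ennreal (\<Phi> (f y)) \<partial>\<mu>) \<le> 1 \<Longrightarrow>
      (\<integral>\<^sup>+ y. ennreal (\<Phi> ((\<Sum>x\<in>X. w x * f (x + y)) / M)) \<partial>\<mu>) \<le> 1"
  shows "nD (\<lambda>v. \<Sum>x\<in>X. complex_of_real (w x) * v x) \<le> M"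
proof -
  define T where "T = (\<lambda>v::'g\<Rightarrow>complex. \<Sum>x\<in>X. complex_of_real (w x) * v x)"
  define Q where "Q = (\<lambda>f y. complex_of_real (\<Sum>x\<in>X. w x * cmod (f (x + y))))"
  have Qm: "Q f \<in> borel_measurable \<mu>" if "f \<in> L\<Phi>" for f :: "'g \<Rightarrow> complex"
  proof -
    have [measurable]: "(\<lambda>y. f (x + y)) \<in> borel_measurable \<mu>" for x
      by (rule measurable_translate_comp[OF orlicz_space_measurable[OF that]])
    show ?thesis unfolding Q_def by measurable
  qed
  have Qmod: "(\<integral>\<^sup>+ y. ennreal (\<Phi> (cmod (Q f y) / (M * k))) \<partial>\<mu>) \<le> 1" if f: "f \<in> L\<Phi>" and k: "N\<Phi> f < k" for f k
  proof -
    have k0: "k > 0" using luxemburg_nonneg[OF young\<Phi> d2\<Phi> f] k by simp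
    have "(\<integral>\<^sup>+ y. ennreal (\<Phi> ((\<Sum>x\<in>X. w x * (cmod (f (x + y)) / k)) / M)) \<partial>\<mu>) \<le> 1"
      by (rule P) (use luxemburg_less[OF young\<Phi> d2\<Phi> f k] orlicz_space_measurable[OF f] k0 in auto)
    moreover have "cmod (Q f y) / (M * k) = (\<Sum>x\<in>X. w x * (cmod (f (x + y)) / k)) / M" for y
    proof -
      have "(\<Sum>x\<in>X. w x * cmod (f (x + y))) \<ge> 0" using X by (intro sum_nonneg mult_nonneg_nonneg) auto
      then have "cmod (Q f y) = (\<Sum>x\<in>X. w x * cmod (f (x + y)))" unfolding Q_def norm_of_real by simp
      then show ?thesis using M k0 by (simp add: sum_divide_distrib mult.commute)
    qed
    ultimately show ?thesis by simp
  qed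
  have QL: "Q f \<in> L\<Phi>" if f: "f \<in> L\<Phi>" for f
  proof -
    have "N\<Phi> f < N\<Phi> f + 1" by simp
    from Qmod[OF f this] have "(\<integral>\<^sup>+ y. ennreal (\<Phi> (cmod (Q f y) / (M * (N\<Phi> f + 1)))) \<partial>\<mu>) < \<infinity>"
      by (auto intro: le_less_trans)
    moreover have "M * (N\<Phi> f + 1) > 0" using M luxemburg_nonneg[OF young\<Phi> d2\<Phi> f] by simp
    ultimately show ?thesis using Qm[OF f] unfolding orlicz_space_def by blast
  qed
  have QN: "N\<Phi> (Q f) \<le> M * N\<Phi> f" if f: "f \<in> L\<Phi>" for f
  proof -
    have "N\<Phi> (Q f) / M \<le> N\<Phi> f"
    proof (rule dense_ge)
      fix k assume k: "N\<Phi> f < k"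
      have "k > 0" using luxemburg_nonneg[OF young\<Phi> d2\<Phi> f] k by simp
      then have "N\<Phi> (Q f) \<le> M * k" using M by (intro luxemburg_le Qmod[OF f k]) simp
      then show "N\<Phi> (Q f) / M \<le> k" using M by (simp add: field_simps)
    qed
    then show ?thesis using M by (simp add: field_simps)
  qed
  have T1: "cmod (T (conv_check \<mu> f g)) \<le> M * (N\<Phi> f * N\<Psi> g)" if f: "f \<in> L\<Phi>" and g: "g \<in> L\<Psi>" for f g
  proof -
    have fg: "integrable \<mu> (\<lambda>y. f (x + y) * g y)" for x
      using integrable_translate[OF conv_check_integrable[OF f g, of x], of x] by (simp add: add.assoc[symmetric])
    have "cmod (T (conv_check \<mu> f g)) = cmod (\<Sum>x\<in>X. complex_of_real (w x) * (\<integral>y. f (x + y) * g y \<partial>\<mu>))"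
      unfolding T_def using conv_check_alt[OF orlicz_space_measurable[OF f] orlicz_space_measurable[OF g]] by simp
    also have "(\<Sum>x\<in>X. complex_of_real (w x) * (\<integral>y. f (x + y) * g y \<partial>\<mu>)) =
        (\<integral>y. (\<Sum>x\<in>X. complex_of_real (w x) * (f (x + y) * g y)) \<partial>\<mu>)"
      using fg by (subst Bochner_Integration.integral_sum) auto
    finally have e: "cmod (T (conv_check \<mu> f g)) = cmod (\<integral>y. (\<Sum>x\<in>X. complex_of_real (w x) * (f (x + y) * g y)) \<partial>\<mu>)" .
    have "ennreal (cmod (T (conv_check \<mu> f g))) \<le> (\<integral>\<^sup>+ y. ennreal (norm (\<Sum>x\<in>X. complex_of_real (w x) * (f (x + y) * g y))) \<partial>\<mu>)"
      unfolding e by (rule integral_norm_bound_ennreal) (use fg in auto)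
    also have "\<dots> \<le> (\<integral>\<^sup>+ y. ennreal (cmod (Q f y) * cmod (g y)) \<partial>\<mu>)"
    proof (intro nn_integral_mono ennreal_leI)
      fix y
      have "norm (\<Sum>x\<in>X. complex_of_real (w x) * (f (x + y) * g y)) \<le> (\<Sum>x\<in>X. norm (complex_of_real (w x) * (f (x + y) * g y)))"
        by (rule norm_sum)
      also have "\<dots> = (\<Sum>x\<in>X. w x * cmod (f (x + y))) * cmod (g y)"
        using X by (simp add: norm_mult sum_distrib_right mult.assoc)
      also have "\<dots> \<le> cmod (Q f y) * cmod (g y)" unfolding Q_def norm_of_real by (intro mult_right_mono) auto
      finally show "norm (\<Sum>x\<in>X. complex_of_real (w x) * (f (x + y) * g y)) \<le> cmod (Q f y) * cmod (g y)" .
    qed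
    also have "\<dots> \<le> ennreal (N\<Phi> (Q f) * N\<Psi> g)" by (rule hoelder[OF QL[OF f] g])
    also have "\<dots> \<le> ennreal (M * (N\<Phi> f * N\<Psi> g))"
      using mult_right_mono[OF QN[OF f] orlicz_norm_nonneg[OF g]] by (intro ennreal_leI) (simp add: mult.assoc)
    finally show ?thesis using M norm_product_nonneg[OF f g] by (subst (asm) ennreal_le_iff) auto
  qed
  have "nD T \<le> M"
  proof (rule dual_norm_least)
    fix u assume u: "u \<in> A" "nA u \<le> 1"
    show "cmod (T u) \<le> M"
    proof (rule field_le_epsilon)
      fix e :: real assume e: "e > 0"
      have "nA u < 1 + e / M" using u e M by (simp add: add_strict_increasing2 less_add_same_cancel1 order_le_less_trans)
      then obtain f g where fg: "rep u f g" "(\<Sum>n. N\<Phi> (f n) * N\<Psi> (g n)) < 1 + e / M" using AP_norm_approx[OF u(1)] by blast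
      note r = repD[OF fg(1)]
      have "(\<lambda>n. T (conv_check \<mu> (f n) (g n))) sums T u"
        unfolding T_def by (intro sums_sum sums_mult r(4))
      note Ts = this
      have le: "norm (T (conv_check \<mu> (f n) (g n))) \<le> M * (N\<Phi> (f n) * N\<Psi> (g n))" for n using T1 r by blast
      have s: "summable (\<lambda>n. M * (N\<Phi> (f n) * N\<Psi> (g n)))" by (rule summable_mult[OF r(3)])
      have sn: "summable (\<lambda>n. norm (T (conv_check \<mu> (f n) (g n))))"
        by (rule summable_comparison_test[OF _ s]) (use le in auto)
      have "cmod (T u) = norm (\<Sum>n. T (conv_check \<mu> (f n) (g n)))" using sums_unique[OF Ts] by simp
      also have "\<dots> \<le> (\<Sum>n. norm (T (conv_check \<mu> (f n) (g n))))" by (rule summable_norm[OF sn])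
      also have "\<dots> \<le> (\<Sum>n. M * (N\<Phi> (f n) * N\<Psi> (g n)))" by (rule suminf_le[OF le sn s])
      also have "\<dots> = M * (\<Sum>n. N\<Phi> (f n) * N\<Psi> (g n))" by (rule suminf_mult[OF r(3)])
      also have "\<dots> \<le> M * (1 + e / M)" using fg(2) M by (intro mult_left_mono) auto
      also have "\<dots> = M + e" using M by (simp add: field_simps)
      finally show "cmod (T u) \<le> M + e" .
    qed
  qed
  then show ?thesis by (simp add: T_def)
qed

theorem amenable_of_right_identity:
  assumes "AP_bidual_has_right_identity \<mu> \<Phi> \<Psi>"
  shows "amenable \<mu>"
proof (rule amenable_of_almost_invariant)
  fix B0 :: "'g set" and e :: real assume B0: "finite B0" and e: "e > 0"
  \<comment> \<open>The identity is adjoined so that every translate is compared with the function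
    itself; afterwards the defect for the larger set implies the one for \<open>B0\<close>.\<close>
  define B where "B = insert 0 B0"
  have B: "finite B" "0 \<in> B" "B \<noteq> {}" using B0 by (auto simp: B_def)
  obtain C where C: "C > 0" "\<And>X (c::'g\<Rightarrow>real). finite X \<Longrightarrow> sum c X = 1 \<Longrightarrow>
     1 \<le> C * nD (\<lambda>v. \<Sum>x\<in>X. complex_of_real (c x) * v x)" using right_identity_point_bound[OF assms] by blast
  \<comment> \<open>Chosen so that a dual norm of at most \<open>M\<close> would give the
    contradiction \<open>1 \<le> C * M = 1/2\<close>.\<close>
  define M where "M = 1 / (2 * C)"
  have M: "M > 0" using C by (simp add: M_def)
  have "\<exists>r l. r > 1 \<and> l > 0 \<and> (\<forall>(X::'g set) (w::'g \<Rightarrow> real) s. finite X \<longrightarrow> (\<forall>x\<in>X. w x \<ge> 0) \<longrightarrow>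
      sum w X = 1 \<longrightarrow> (\<forall>x\<in>X. s x \<ge> 0) \<longrightarrow>
      \<Phi> ((\<Sum>x\<in>X. w x * s x) / 2) \<le> (l * (\<Sum>x\<in>X. w x * \<Phi> (s x) powr (1/r))) powr r)"
  proof (rule young_root_quasi_jensen[OF pair d2\<Psi>, where 'a = 'g], goal_cases)
    case (1 r l)
    show ?case by (rule exI[of _ r], rule exI[of _ l], intro conjI allI impI 1) auto
  qed
  then obtain r l where r: "r > 1" "l > 0"
    and J: "\<forall>(X::'g set) (w::'g \<Rightarrow> real) s. finite X \<longrightarrow> (\<forall>x\<in>X. w x \<ge> 0) \<longrightarrow>
      sum w X = 1 \<longrightarrow> (\<forall>x\<in>X. s x \<ge> 0) \<longrightarrow>
      \<Phi> ((\<Sum>x\<in>X. w x * s x) / 2) \<le> (l * (\<Sum>x\<in>X. w x * \<Phi> (s x) powr (1/r))) powr r"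
    by blast
  obtain C2 where C2: "C2 \<ge> 1" "\<And>l s. l \<ge> 0 \<Longrightarrow> s \<ge> 0 \<Longrightarrow> \<Phi> (l * s) \<le> C2 * exp l * \<Phi> s"
    using delta2_exp_growth[OF young\<Phi> d2\<Phi>] by blast
  \<comment> \<open>Collects the losses in passing from \<open>\<Phi>\<close> to its root: the
    argument is rescaled by \<open>2 / M\<close>, where the 2 undoes the halving in the quasi Jensen
    inequality, and the factor \<open>l\<close> of that inequality is raised to the power
    \<open>r\<close>.\<close>
  define q where "q = C2 * exp (2 / M) * l powr r"
  have q: "q > 0" using C2 r by (simp add: q_def)
  have "\<exists>F. F \<in> borel_measurable \<mu> \<and> (\<forall>x. F x \<ge> 0) \<and> (\<integral>\<^sup>+ x. ennreal (F x powr r) \<partial>\<mu>) \<le> 1 \<and>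
        ennreal (1 / q) < (\<integral>\<^sup>+ x. ennreal ((avg B ^^ n) F x powr r) \<partial>\<mu>)" for n
  proof -
    obtain X :: "'g set" and w where X: "finite X" "\<And>x. x \<in> X \<Longrightarrow> w x \<ge> 0" "sum w X = 1"
      "\<And>f y. (avg B ^^ n) f y = (\<Sum>x\<in>X. w x * f (x + y))" using avg_power_weights[OF B(1,3)] by blast
    obtain f where f: "f \<in> borel_measurable \<mu>" "\<forall>x. f x \<ge> 0" "(\<integral>\<^sup>+ y. ennreal (\<Phi> (f y)) \<partial>\<mu>) \<le> 1"
      "\<not> (\<integral>\<^sup>+ y. ennreal (\<Phi> ((\<Sum>x\<in>X. w x * f (x + y)) / M)) \<partial>\<mu>) \<le> 1"
    proof (rule ccontr)
      assume "\<not> thesis"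
      then have "nD (\<lambda>v. \<Sum>x\<in>X. complex_of_real (w x) * v x) \<le> M"
        using that by (intro point_functional_norm_le[OF X(1,2) M]) blast+
      then have "C * nD (\<lambda>v. \<Sum>x\<in>X. complex_of_real (w x) * v x) \<le> C * M" using C by simp
      also have "C * M = 1/2" using C by (simp add: M_def)
      finally show False using C(2)[OF X(1,3)] by simp
    qed
    \<comment> \<open>The root turns modular at most 1 into \<open>L^r\<close> norm at most 1. Up to
      the factor \<open>q\<close>, the powers of its averages dominate \<open>\<Phi>\<close> of the
      averages of \<open>f\<close>, whose modular exceeds 1.\<close>
    define F where "F = (\<lambda>x. \<Phi> (f x) powr (1/r))"
    note [measurable] = f(1)
    have Fm[measurable]: "F \<in> borel_measurable \<mu>" unfolding F_def by measurable
    have F0: "F x \<ge> 0" for x by (simp add: F_def)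
    have Fr: "F x powr r = \<Phi> (f x)" for x using r \<Phi>_nonneg[of "f x"] by (simp add: F_def powr_powr)
    have [measurable]: "(avg B ^^ n) F \<in> borel_measurable \<mu>" by (rule avg_power_measurable_nonneg[OF Fm F0])
    have pw: "\<Phi> ((\<Sum>x\<in>X. w x * f (x + y)) / M) \<le> q * (avg B ^^ n) F y powr r" for y
    proof -
      define s where "s = (\<Sum>x\<in>X. w x * f (x + y))"
      have s0: "s \<ge> 0" unfolding s_def using X f by (intro sum_nonneg mult_nonneg_nonneg) auto
      have "\<Phi> (s / M) = \<Phi> ((2 / M) * (s / 2))" by simp
      also have "\<dots> \<le> C2 * exp (2 / M) * \<Phi> (s / 2)" by (rule C2(2)) (use M s0 in auto)
      also have "\<Phi> (s / 2) \<le> (l * (\<Sum>x\<in>X. w x * F (x + y))) powr r"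
        using J[rule_format, of X w "\<lambda>x. f (x + y)"] X f unfolding s_def F_def by simp
      also have "(\<Sum>x\<in>X. w x * F (x + y)) = (avg B ^^ n) F y" using X(4) by simp
      also have "(l * (avg B ^^ n) F y) powr r = l powr r * (avg B ^^ n) F y powr r" by (rule powr_mult)
      finally show ?thesis using C2(1) by (simp add: s_def q_def mult.assoc)
    qed
    have "1 < (\<integral>\<^sup>+ y. ennreal (\<Phi> ((\<Sum>x\<in>X. w x * f (x + y)) / M)) \<partial>\<mu>)" using f(4) by simp
    also have "\<dots> \<le> (\<integral>\<^sup>+ y. ennreal q * ennreal ((avg B ^^ n) F y powr r) \<partial>\<mu>)"
      using pw q by (intro nn_integral_mono) (subst ennreal_mult[symmetric], auto intro!: ennreal_leI)
    also have "\<dots> = ennreal q * (\<integral>\<^sup>+ y. ennreal ((avg B ^^ n) F y powr r) \<partial>\<mu>)"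
      by (rule nn_integral_cmult) measurable
    finally have big: "1 < ennreal q * (\<integral>\<^sup>+ y. ennreal ((avg B ^^ n) F y powr r) \<partial>\<mu>)" .
    have "ennreal (1 / q) < (\<integral>\<^sup>+ y. ennreal ((avg B ^^ n) F y powr r) \<partial>\<mu>)"
    proof (rule ccontr)
      assume "\<not> ennreal (1 / q) < (\<integral>\<^sup>+ y. ennreal ((avg B ^^ n) F y powr r) \<partial>\<mu>)"
      then have "ennreal q * (\<integral>\<^sup>+ y. ennreal ((avg B ^^ n) F y powr r) \<partial>\<mu>) \<le> ennreal q * ennreal (1 / q)"
        by (intro mult_left_mono) auto
      also have "\<dots> = 1" using q by (simp add: ennreal_mult[symmetric])
      finally show False using big by simp
    qed
    then show ?thesis using Fm F0 f(3) by (intro exI[of _ F]) (simp add: Fr)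
  qed
  then have "invariance_defect B e \<noteq> {}"
    using q by (intro almost_invariant_of_slow_decay[OF B(1,2) r(1) e, of "1 / q"]) auto
  then show "invariance_defect B0 e \<noteq> {}" unfolding invariance_defect_def B_def by auto
qed

end

section \<open>Continuous functions of compact support\<close>

context haar_group
begin

definition Cc :: "('g \<Rightarrow> real) set" where
  "Cc = {f. continuous_on UNIV f \<and> (\<exists>K. compact K \<and> (\<forall>x. x \<notin> K \<longrightarrow> f x = 0))}"

lemma CcI: "continuous_on UNIV f \<Longrightarrow> compact K \<Longrightarrow> (\<And>x. x \<notin> K \<Longrightarrow> f x = 0) \<Longrightarrow> f \<in> Cc"
  unfolding Cc_def by blast

lemma CcE:
  assumes "f \<in> Cc" obtains K where "compact K" "\<And>x. x \<notin> K \<Longrightarrow> f x = 0"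
  using assms unfolding Cc_def by blast

lemma Cc_continuous: "f \<in> Cc \<Longrightarrow> continuous_on UNIV f" by (simp add: Cc_def)

lemma Cc_measurable[measurable_dest]: "f \<in> Cc \<Longrightarrow> f \<in> borel_measurable \<mu>"
  by (rule borel_measurable_continuous_haar[OF Cc_continuous])

lemma measure_compact_finite: "compact K \<Longrightarrow> emeasure \<mu> K < \<infinity>"
  using haarD(2) by blast

lemma compact_measurable[simp]: "compact K \<Longrightarrow> (K :: 'g set) \<in> sets borel"
  by (rule borel_compact)

lemma integrable_indicator_compact: "compact K \<Longrightarrow> integrable \<mu> (\<lambda>x. indicator K x :: real)"
  using measure_compact_finite[of K] by (simp add: less_top)

lemma continuous_bounded_on_compact:
  fixes f :: "'g \<Rightarrow> real"
  assumes "continuous_on UNIV f" "compact K"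
  obtains C where "C \<ge> 0" "\<And>x. x \<in> K \<Longrightarrow> \<bar>f x\<bar> \<le> C"
proof -
  have "compact (f ` K)" by (rule compact_continuous_image[OF continuous_on_subset[OF assms(1)] assms(2)]) simp
  then obtain C where "\<forall>y\<in>f ` K. norm y \<le> C" using compact_imp_bounded bounded_iff by metis
  then show ?thesis using that[of "max C 0"] by force
qed

lemma integrable_compact_support:
  fixes f :: "'g \<Rightarrow> real"
  assumes f: "f \<in> borel_measurable \<mu>" and K: "compact K" "\<And>x. x \<notin> K \<Longrightarrow> f x = 0" and C: "\<And>x. x \<in> K \<Longrightarrow> \<bar>f x\<bar> \<le> C"
  shows "integrable \<mu> f" "(\<integral>x. \<bar>f x\<bar> \<partial>\<mu>) \<le> C * measure \<mu> K"
proof -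
  have i: "integrable \<mu> (\<lambda>x. C * indicator K x)" using integrable_indicator_compact[OF K(1)] by simp
  have le: "\<bar>f x\<bar> \<le> C * indicator K x" for x using K(2)[of x] C[of x] by (cases "x \<in> K") auto
  show fi: "integrable \<mu> f"
    by (rule Bochner_Integration.integrable_bound[OF i f]) (rule AE_I2, simp only: real_norm_def, rule order.trans[OF le abs_ge_self])
  have "(\<integral>x. \<bar>f x\<bar> \<partial>\<mu>) \<le> (\<integral>x. C * indicator K x \<partial>\<mu>)" by (rule integral_mono) (use fi i le in auto)
  also have "\<dots> = C * measure \<mu> K" using K(1) by simp
  finally show "(\<integral>x. \<bar>f x\<bar> \<partial>\<mu>) \<le> C * measure \<mu> K" .
qed

lemma Cc_integrable: assumes "f \<in> Cc" shows "integrable \<mu> f"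
proof -
  obtain K where K: "compact K" "\<And>x. x \<notin> K \<Longrightarrow> f x = 0" using CcE[OF assms] by blast
  obtain C where "\<And>x. x \<in> K \<Longrightarrow> \<bar>f x\<bar> \<le> C" using continuous_bounded_on_compact[OF Cc_continuous[OF assms] K(1)] by blast
  then show ?thesis using integrable_compact_support(1)[OF Cc_measurable[OF assms] K] by blast
qed

lemma Cc_bounded: assumes "f \<in> Cc" obtains C where "C \<ge> 0" "\<And>x. \<bar>f x\<bar> \<le> C"
proof -
  obtain K where K: "compact K" "\<And>x. x \<notin> K \<Longrightarrow> f x = 0" using CcE[OF assms] by blast
  obtain C where C: "C \<ge> 0" "\<And>x. x \<in> K \<Longrightarrow> \<bar>f x\<bar> \<le> C" using continuous_bounded_on_compact[OF Cc_continuous[OF assms] K(1)] by blast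
  have "\<bar>f x\<bar> \<le> C" for x using C K(2)[of x] by (cases "x \<in> K") auto
  then show ?thesis using that C by blast
qed

lemma Cc_add: assumes "f \<in> Cc" "g \<in> Cc" shows "(\<lambda>x. f x + g x) \<in> Cc"
proof -
  obtain K L where K: "compact K" "\<And>x. x \<notin> K \<Longrightarrow> f x = 0" and L: "compact L" "\<And>x. x \<notin> L \<Longrightarrow> g x = 0"
    using CcE[OF assms(1)] CcE[OF assms(2)] by metis
  show ?thesis by (rule CcI[of _ "K \<union> L"])
    (use K L assms Cc_continuous compact_Un in \<open>auto intro!: continuous_intros\<close>)
qed

lemma Cc_mult: assumes "f \<in> Cc" "continuous_on UNIV h" shows "(\<lambda>x. h x * f x) \<in> Cc"
proof -
  obtain K where K: "compact K" "\<And>x. x \<notin> K \<Longrightarrow> f x = 0" using CcE[OF assms(1)] by blast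
  show ?thesis by (rule CcI[OF _ K(1)]) (use K assms Cc_continuous in \<open>auto intro!: continuous_intros\<close>)
qed

lemma Cc_cmult: "f \<in> Cc \<Longrightarrow> (\<lambda>x. c * f x) \<in> Cc" by (rule Cc_mult) auto

lemma Cc_zero: "(\<lambda>_. 0) \<in> Cc" by (rule CcI[of _ "{}"]) auto

lemma Cc_diff: "f \<in> Cc \<Longrightarrow> g \<in> Cc \<Longrightarrow> (\<lambda>x. f x - g x) \<in> Cc"
  using Cc_add[of f "\<lambda>x. (-1) * g x"] Cc_cmult[of g "-1"] by simp

lemma Cc_sum: "finite I \<Longrightarrow> (\<And>i. i \<in> I \<Longrightarrow> f i \<in> Cc) \<Longrightarrow> (\<lambda>x. \<Sum>i\<in>I. f i x) \<in> Cc"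
  by (induction I rule: finite_induct) (auto simp: Cc_zero Cc_add)

lemma compact_sum_set:
  fixes K L :: "'g set"
  assumes "compact K" "compact L" shows "compact {x + y | x y. x \<in> K \<and> y \<in> L}"
proof -
  have "{x + y | x y. x \<in> K \<and> y \<in> L} = (\<lambda>p. fst p + snd p) ` (K \<times> L)" by force
  then show ?thesis using compact_continuous_image[OF continuous_on_subset[OF continuous_group_ops(1)] compact_Times[OF assms]] by simp
qed

lemma compact_neg_sum_set:
  fixes K L :: "'g set"
  assumes "compact K" "compact L" shows "compact {- x + y | x y. x \<in> K \<and> y \<in> L}"
proof -
  have c: "continuous_on (K \<times> L) (\<lambda>p. - fst p + snd p)" by (intro continuous_intros)
  have "{- x + y | x y. x \<in> K \<and> y \<in> L} = (\<lambda>p. - fst p + snd p) ` (K \<times> L)" by force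
  then show ?thesis using compact_continuous_image[OF c compact_Times[OF assms]] by simp
qed

lemma Cc_translate: assumes "f \<in> Cc" shows "(\<lambda>x. f (a + x)) \<in> Cc"
proof -
  obtain K where K: "compact K" "\<And>x. x \<notin> K \<Longrightarrow> f x = 0" using CcE[OF assms] by blast
  show ?thesis
  proof (rule CcI[OF _ compact_neg_sum_set[OF compact_sing[of a] K(1)]])
    show "continuous_on UNIV (\<lambda>x. f (a + x))"
      by (rule continuous_on_compose2[OF Cc_continuous[OF assms]]) (auto intro!: continuous_intros)
    fix x assume x: "x \<notin> {- x + y |x y. x \<in> {a} \<and> y \<in> K}"
    have "x = - a + (a + x)" by (simp add: add.assoc[symmetric])
    then have "a + x \<notin> K" using x by blast
    then show "f (a + x) = 0" by (rule K)
  qed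
qed

section \<open>Rounding to finitely many points and Riemann sums\<close>

lemma tube:
  fixes F :: "'g \<times> 'g \<Rightarrow> real"
  assumes "continuous_on UNIV F" "compact K" "e > 0"
  obtains V where "open V" "y0 \<in> V" "\<And>y t. y \<in> V \<Longrightarrow> t \<in> K \<Longrightarrow> \<bar>F (y, t) - F (y0, t)\<bar> \<le> e"
proof -
  have "continuous_on (UNIV \<times> K) F" using assms(1) continuous_on_subset by blast
  then obtain V where "y0 \<in> V" "open V" "\<forall>x\<in>V \<inter> UNIV. \<forall>t\<in>K. dist (F (x, t)) (F (y0, t)) \<le> e"
    by (rule continuous_on_prod_compactE[OF _ assms(2) UNIV_I assms(3)])
  then show ?thesis using that by (auto simp: dist_real_def)
qed

text \<open>A finite subcover is made disjoint one set at a time, and each piece is sent to the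
  centre of its neighbourhood. Composed with \<open>\<tau>\<close>, any function is a simple
  function, so the integrals below become finite sums without a uniform structure or a countable
  base.\<close>

lemma rounding_map:
  fixes V :: "'g \<Rightarrow> 'g set"
  assumes K: "compact K" and V: "\<And>y. y \<in> K \<Longrightarrow> open (V y) \<and> y \<in> V y"
  obtains \<tau> where "finite (range \<tau>)" "\<And>p. {w. \<tau> w = p} \<in> sets borel" "\<And>w. w \<in> K \<Longrightarrow> \<tau> w \<in> K \<and> w \<in> V (\<tau> w)"
proof -
  obtain Y where Y: "Y \<subseteq> K" "finite Y" "K \<subseteq> (\<Union>y\<in>Y. V y)"
    using compactE_image[OF K, of K V] V by blast
  have "\<exists>\<tau>. finite (range \<tau>) \<and> (\<forall>p. {w. \<tau> w = p} \<in> sets borel) \<and> (\<forall>w\<in>(\<Union>y\<in>Z. V y). \<tau> w \<in> Z \<and> w \<in> V (\<tau> w))"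
    if "finite Z" "Z \<subseteq> Y" for Z
    using that
  proof (induction Z rule: finite_induct)
    case empty
    \<comment> \<open>A dummy value for points outside the cover; weights that vanish off
      \<open>K\<close> do not see it.\<close>
    show ?case by (rule exI[of _ "\<lambda>_. 0"]) auto
  next
    case (insert y Z)
    then obtain \<tau> where \<tau>: "finite (range \<tau>)" "\<And>p. {w. \<tau> w = p} \<in> sets borel"
      "\<And>w. w \<in> (\<Union>y\<in>Z. V y) \<Longrightarrow> \<tau> w \<in> Z \<and> w \<in> V (\<tau> w)" by blast
    have o: "open (V y)" using insert Y V by blast
    show ?case
    proof (intro exI[of _ "\<lambda>w. if w \<in> V y then y else \<tau> w"] conjI allI)
      show "finite (range (\<lambda>w. if w \<in> V y then y else \<tau> w))"
        by (rule finite_subset[of _ "insert y (range \<tau>)"]) (use \<tau> in auto)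
      fix p
      have "{w. (if w \<in> V y then y else \<tau> w) = p} = (if p = y then V y else {}) \<union> ({w. \<tau> w = p} - V y)" by auto
      also have "\<dots> \<in> sets borel" using o \<tau>(2) by auto
      finally show "{w. (if w \<in> V y then y else \<tau> w) = p} \<in> sets borel" .
    next
      show "\<forall>w\<in>(\<Union>y\<in>insert y Z. V y). (if w \<in> V y then y else \<tau> w) \<in> insert y Z \<and> w \<in> V (if w \<in> V y then y else \<tau> w)"
        using \<tau>(3) by auto
    qed
  qed
  from this[OF Y(2) order_refl] obtain \<tau> where "finite (range \<tau>)" "\<And>p. {w. \<tau> w = p} \<in> sets borel"
      "\<And>w. w \<in> (\<Union>y\<in>Y. V y) \<Longrightarrow> \<tau> w \<in> Y \<and> w \<in> V (\<tau> w)" by blast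
  then show ?thesis using that[of \<tau>] Y by blast
qed

lemma integral_rounded:
  fixes \<theta> :: "'g \<Rightarrow> real" and \<tau> :: "'g \<Rightarrow> 't" and G :: "'t \<Rightarrow> real"
  assumes \<theta>: "integrable \<mu> \<theta>" and \<tau>: "finite (range \<tau>)" "\<And>p. {w. \<tau> w = p} \<in> sets borel"
  shows "integrable \<mu> (\<lambda>y. \<theta> y * G (\<tau> y))"
    "(\<integral>y. \<theta> y * G (\<tau> y) \<partial>\<mu>) = (\<Sum>p\<in>range \<tau>. (\<integral>y. \<theta> y * indicator {w. \<tau> w = p} y \<partial>\<mu>) * G p)"
proof -
  have e: "\<theta> y * G (\<tau> y) = (\<Sum>p\<in>range \<tau>. (\<theta> y * indicator {w. \<tau> w = p} y) * G p)" for y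
  proof -
    have "(\<Sum>p\<in>range \<tau>. (\<theta> y * indicator {w. \<tau> w = p} y) * G p) = (\<Sum>p\<in>range \<tau>. if \<tau> y = p then \<theta> y * G p else 0)"
      by (intro sum.cong) (auto simp: indicator_def)
    also have "\<dots> = \<theta> y * G (\<tau> y)" by (subst sum.delta'[OF \<tau>(1)]) simp
    finally show ?thesis by simp
  qed
  have i: "integrable \<mu> (\<lambda>y. \<theta> y * indicator {w. \<tau> w = p} y)" for p
    using integrable_real_mult_indicator[of "{w. \<tau> w = p}" \<mu> \<theta>] \<theta> \<tau>(2) by simp
  show "integrable \<mu> (\<lambda>y. \<theta> y * G (\<tau> y))" unfolding e using i by simp
  show "(\<integral>y. \<theta> y * G (\<tau> y) \<partial>\<mu>) = (\<Sum>p\<in>range \<tau>. (\<integral>y. \<theta> y * indicator {w. \<tau> w = p} y \<partial>\<mu>) * G p)"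
    unfolding e using i by simp
qed

lemma riemann_error:
  fixes \<theta> G :: "'g \<Rightarrow> real"
  assumes \<theta>: "integrable \<mu> \<theta>" "\<And>y. y \<notin> K \<Longrightarrow> \<theta> y = 0" and \<theta>G: "integrable \<mu> (\<lambda>y. \<theta> y * G y)"
    and \<tau>: "finite (range \<tau>)" "\<And>p. {w. \<tau> w = p} \<in> sets borel"
    and e: "\<And>y. y \<in> K \<Longrightarrow> \<bar>G y - G (\<tau> y)\<bar> \<le> e"
  shows "\<bar>(\<integral>y. \<theta> y * G y \<partial>\<mu>) - (\<Sum>p\<in>range \<tau>. (\<integral>y. \<theta> y * indicator {w. \<tau> w = p} y \<partial>\<mu>) * G p)\<bar> \<le> e * (\<integral>y. \<bar>\<theta> y\<bar> \<partial>\<mu>)"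
proof -
  note r = integral_rounded[OF \<theta>(1) \<tau>, of G]
  have "(\<integral>y. \<theta> y * G y \<partial>\<mu>) - (\<integral>y. \<theta> y * G (\<tau> y) \<partial>\<mu>) = (\<integral>y. \<theta> y * G y - \<theta> y * G (\<tau> y) \<partial>\<mu>)"
    using \<theta>G r(1) by simp
  also have "\<bar>\<dots>\<bar> \<le> (\<integral>y. \<bar>\<theta> y * G y - \<theta> y * G (\<tau> y)\<bar> \<partial>\<mu>)" by (rule integral_abs_bound)
  also have "\<dots> \<le> (\<integral>y. e * \<bar>\<theta> y\<bar> \<partial>\<mu>)"
  proof (rule integral_mono)
    fix y
    show "\<bar>\<theta> y * G y - \<theta> y * G (\<tau> y)\<bar> \<le> e * \<bar>\<theta> y\<bar>"
      using e[of y] \<theta>(2)[of y] by (cases "y \<in> K") (auto simp: abs_mult mult.commute[of e] mult_left_mono simp flip: right_diff_distrib)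
  qed (use \<theta> \<theta>G r(1) in auto)
  finally show ?thesis unfolding r(2) by simp
qed

lemma rounding_for_kernel:
  fixes F :: "'g \<times> 'g \<Rightarrow> real"
  assumes F: "continuous_on UNIV F" and K: "compact K" and L: "compact L" and e: "e > 0"
  obtains \<tau> where "finite (range \<tau>)" "\<And>p. {w. \<tau> w = p} \<in> sets borel"
    "\<And>y t. y \<in> K \<Longrightarrow> t \<in> L \<Longrightarrow> \<bar>F (y, t) - F (\<tau> y, t)\<bar> \<le> e" "\<And>y. y \<in> K \<Longrightarrow> \<tau> y \<in> K"
proof -
  have "\<forall>y0. \<exists>V. open V \<and> y0 \<in> V \<and> (\<forall>y t. y \<in> V \<longrightarrow> t \<in> L \<longrightarrow> \<bar>F (y, t) - F (y0, t)\<bar> \<le> e)"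
    using tube[OF F L e] by metis
  then obtain V where V: "\<And>y0. open (V y0)" "\<And>y0. y0 \<in> V y0"
    "\<And>y0 y t. y \<in> V y0 \<Longrightarrow> t \<in> L \<Longrightarrow> \<bar>F (y, t) - F (y0, t)\<bar> \<le> e" by metis
  obtain \<tau> where "finite (range \<tau>)" "\<And>p. {w. \<tau> w = p} \<in> sets borel" "\<And>w. w \<in> K \<Longrightarrow> \<tau> w \<in> K \<and> w \<in> V (\<tau> w)"
    using rounding_map[OF K, of V] V by blast
  then show ?thesis using that[of \<tau>] V(3) by blast
qed

lemma continuous_section:
  fixes F :: "'g \<times> 'g \<Rightarrow> real"
  assumes "continuous_on UNIV F"
  shows "continuous_on UNIV (\<lambda>t. F (y, t))" "continuous_on UNIV (\<lambda>t. F (t, y))"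
  by (rule continuous_on_compose2[OF assms]; auto intro!: continuous_intros)+

lemma L1_continuous:
  fixes F :: "'g \<times> 'g \<Rightarrow> real"
  assumes F: "continuous_on UNIV F" and V1: "open V1" "z0 \<in> V1" and K: "compact K"
    and z: "\<And>z t. z \<in> V1 \<Longrightarrow> t \<notin> K \<Longrightarrow> F (z, t) = 0" and e: "e > 0"
  obtains V where "open V" "z0 \<in> V" "\<And>z. z \<in> V \<Longrightarrow> (\<integral>t. \<bar>F (z, t) - F (z0, t)\<bar> \<partial>\<mu>) \<le> e"
proof -
  define d where "d = e / (measure \<mu> K + 1)"
  have mp: "measure \<mu> K + 1 > 0" by (simp add: add_nonneg_pos)
  have d: "d > 0" using e mp by (simp add: d_def)
  obtain V where V: "open V" "z0 \<in> V" "\<And>y t. y \<in> V \<Longrightarrow> t \<in> K \<Longrightarrow> \<bar>F (y, t) - F (z0, t)\<bar> \<le> d"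
    using tube[OF F K d] by metis
  have "(\<integral>t. \<bar>F (z', t) - F (z0, t)\<bar> \<partial>\<mu>) \<le> e" if "z' \<in> V \<inter> V1" for z'
  proof -
    have "(\<integral>t. \<bar>F (z', t) - F (z0, t)\<bar> \<partial>\<mu>) \<le> d * measure \<mu> K"
      by (rule integrable_compact_support(2)[OF _ K])
         (use V z that V1 continuous_section(1)[OF F] in \<open>auto intro!: borel_measurable_continuous_haar continuous_intros\<close>)
    also have "\<dots> \<le> d * (measure \<mu> K + 1)" using d by simp
    also have "\<dots> = e" using mp by (simp add: d_def)
    finally show ?thesis .
  qed
  then show ?thesis using that[of "V \<inter> V1"] V V1 by auto
qed

lemma continuous_integral_parameter:
  fixes F :: "'g \<times> 'g \<Rightarrow> real"
  assumes F: "continuous_on UNIV F" and z: "\<And>z0. \<exists>V K. open V \<and> z0 \<in> V \<and> compact K \<and> (\<forall>z\<in>V. \<forall>t. t \<notin> K \<longrightarrow> F (z, t) = 0)"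
  shows "continuous_on UNIV (\<lambda>z. \<integral>t. F (z, t) \<partial>\<mu>)"
proof -
  have "((\<lambda>z. \<integral>t. F (z, t) \<partial>\<mu>) \<longlongrightarrow> (\<integral>t. F (z0, t) \<partial>\<mu>)) (nhds z0)" for z0
    unfolding tendsto_iff
  proof (intro allI impI)
    fix e :: real assume e: "e > 0"
    obtain V1 K where V1: "open V1" "z0 \<in> V1" "compact K" "\<And>z t. z \<in> V1 \<Longrightarrow> t \<notin> K \<Longrightarrow> F (z, t) = 0" using z[of z0] by blast
    obtain V where V: "open V" "z0 \<in> V" "\<And>z. z \<in> V \<Longrightarrow> (\<integral>t. \<bar>F (z, t) - F (z0, t)\<bar> \<partial>\<mu>) \<le> e / 2"
      using L1_continuous[OF F V1(1-4) half_gt_zero[OF e]] by blast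
    have cc: "(\<lambda>t. F (z, t)) \<in> Cc" if "z \<in> V1" for z
      by (rule CcI[OF continuous_section(1)[OF F] V1(3)]) (use V1(4) that in auto)
    have "dist (\<integral>t. F (z, t) \<partial>\<mu>) (\<integral>t. F (z0, t) \<partial>\<mu>) < e" if "z \<in> V \<inter> V1" for z
    proof -
      have "(\<integral>t. F (z, t) \<partial>\<mu>) - (\<integral>t. F (z0, t) \<partial>\<mu>) = (\<integral>t. F (z, t) - F (z0, t) \<partial>\<mu>)"
        using Cc_integrable[OF cc] that V1 by simp
      also have "\<bar>\<dots>\<bar> \<le> (\<integral>t. \<bar>F (z, t) - F (z0, t)\<bar> \<partial>\<mu>)" by (rule integral_abs_bound)
      also have "\<dots> \<le> e / 2" using V that by blast
      finally show ?thesis using e by (simp add: dist_real_def)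
    qed
    then show "\<forall>\<^sub>F x in nhds z0. dist (\<integral>t. F (x, t) \<partial>\<mu>) (\<integral>t. F (z0, t) \<partial>\<mu>) < e"
      unfolding eventually_nhds using V V1 by (intro exI[of _ "V \<inter> V1"]) auto
  qed
  then show ?thesis unfolding continuous_on_def
    by (intro ballI) (rule tendsto_mono[rotated], assumption, simp add: at_within_def)
qed

text \<open>Rounding the first variable brings both iterated integrals within \<open>a * e\<close>
  of the same finite sum of the terms \<open>c p * J p\<close>. The tools are uniform continuity on
  the compact supports and finite additivity of the integral.\<close>

lemma fubini_compact:
  fixes F :: "'g \<times> 'g \<Rightarrow> real"
  assumes F: "continuous_on UNIV F" and K: "compact K" "compact L" and z: "\<And>t y. t \<notin> K \<or> y \<notin> L \<Longrightarrow> F (t, y) = 0"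
  shows "(\<integral>t. (\<integral>y. F (t, y) \<partial>\<mu>) \<partial>\<mu>) = (\<integral>y. (\<integral>t. F (t, y) \<partial>\<mu>) \<partial>\<mu>)"
proof -
  define J where "J = (\<lambda>t. \<integral>y. F (t, y) \<partial>\<mu>)"
  define I where "I = (\<lambda>y. \<integral>t. F (t, y) \<partial>\<mu>)"
  define F' where "F' = (\<lambda>p. F (snd p, fst p))"
  have F': "continuous_on UNIV F'" unfolding F'_def by (rule continuous_on_compose2[OF F]) (auto intro!: continuous_intros)
  have "continuous_on UNIV J" unfolding J_def by (rule continuous_integral_parameter[OF F]) (use K z in blast)
  then have Jc: "J \<in> Cc" by (rule CcI[OF _ K(1)]) (simp add: J_def z)
  have "continuous_on UNIV (\<lambda>z. \<integral>t. F' (z, t) \<partial>\<mu>)"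
    by (rule continuous_integral_parameter[OF F']) (rule exI[of _ UNIV], rule exI[of _ K], use K z in \<open>auto simp: F'_def\<close>)
  then have Ic: "I \<in> Cc" by (intro CcI[OF _ K(2)]) (simp_all add: I_def F'_def z)
  define a where "a = measure \<mu> K * measure \<mu> L"
  have main: "\<bar>(\<integral>t. J t \<partial>\<mu>) - (\<integral>y. I y \<partial>\<mu>)\<bar> \<le> 2 * a * e" if e: "e > 0" for e
  proof -
    obtain \<tau> where \<tau>: "finite (range \<tau>)" "\<And>p. {w. \<tau> w = p} \<in> sets borel"
      "\<And>y t. y \<in> K \<Longrightarrow> t \<in> L \<Longrightarrow> \<bar>F (y, t) - F (\<tau> y, t)\<bar> \<le> e" "\<And>y. y \<in> K \<Longrightarrow> \<tau> y \<in> K" using rounding_for_kernel[OF F K e] by metis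
    define \<theta> where "\<theta> = (\<lambda>x. indicator K x :: real)"
    have \<theta>: "integrable \<mu> \<theta>" "\<And>y. y \<notin> K \<Longrightarrow> \<theta> y = 0" "(\<integral>y. \<bar>\<theta> y\<bar> \<partial>\<mu>) = measure \<mu> K"
      using integrable_indicator_compact[OF K(1)] K(1) by (auto simp: \<theta>_def)
    define c where "c = (\<lambda>p. \<integral>y. \<theta> y * indicator {w. \<tau> w = p} y \<partial>\<mu>)"
    have Fcc: "(\<lambda>t. F (t, y)) \<in> Cc" "(\<lambda>y. F (t, y)) \<in> Cc" for t y
      by (rule CcI[OF continuous_section(2)[OF F] K(1)], simp add: z) (rule CcI[OF continuous_section(1)[OF F] K(2)], simp add: z)
    have \<theta>F: "(\<lambda>t. \<theta> t * F (t, y)) = (\<lambda>t. F (t, y))" for y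
    proof
      show "\<theta> t * F (t, y) = F (t, y)" for t using z[of t y] by (cases "t \<in> K") (auto simp: \<theta>_def)
    qed
    have \<theta>J: "(\<lambda>t. \<theta> t * J t) = J"
    proof
      show "\<theta> t * J t = J t" for t using z[of t] by (cases "t \<in> K") (auto simp: \<theta>_def J_def)
    qed
    have s1: "\<bar>I y - (\<Sum>p\<in>range \<tau>. c p * F (p, y))\<bar> \<le> e * measure \<mu> K" for y
    proof -
      have le: "\<bar>F (t, y) - F (\<tau> t, y)\<bar> \<le> e" if "t \<in> K" for t using \<tau>(3)[OF that] z e by (cases "y \<in> L") auto
      have "\<bar>(\<integral>t. \<theta> t * F (t, y) \<partial>\<mu>) - (\<Sum>p\<in>range \<tau>. c p * F (p, y))\<bar> \<le> e * (\<integral>y. \<bar>\<theta> y\<bar> \<partial>\<mu>)"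
        unfolding c_def
        by (rule riemann_error[where K = K and G = "\<lambda>t. F (t, y)", OF \<theta>(1,2) _ \<tau>(1,2) le])
           (simp_all add: \<theta>F Cc_integrable[OF Fcc(1)])
      then show ?thesis by (simp only: \<theta>F \<theta>(3) I_def)
    qed
    have RC: "(\<lambda>y. \<Sum>p\<in>range \<tau>. c p * F (p, y)) \<in> Cc" by (rule Cc_sum[OF \<tau>(1)]) (rule Cc_cmult[OF Fcc(2)])
    have "\<bar>(\<integral>y. I y \<partial>\<mu>) - (\<integral>y. (\<Sum>p\<in>range \<tau>. c p * F (p, y)) \<partial>\<mu>)\<bar> = \<bar>\<integral>y. I y - (\<Sum>p\<in>range \<tau>. c p * F (p, y)) \<partial>\<mu>\<bar>"
      using Cc_integrable[OF Ic] Cc_integrable[OF RC] by simp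
    also have "\<dots> \<le> (\<integral>y. \<bar>I y - (\<Sum>p\<in>range \<tau>. c p * F (p, y))\<bar> \<partial>\<mu>)" by (rule integral_abs_bound)
    also have "\<dots> \<le> e * measure \<mu> K * measure \<mu> L"
      by (rule integrable_compact_support(2)[OF Cc_measurable[OF Cc_diff[OF Ic RC]] K(2)]) (use s1 z in \<open>auto simp: I_def\<close>)
    also have "(\<integral>y. (\<Sum>p\<in>range \<tau>. c p * F (p, y)) \<partial>\<mu>) = (\<Sum>p\<in>range \<tau>. c p * J p)"
      unfolding J_def using Cc_integrable[OF Fcc(2)] by simp
    finally have 1: "\<bar>(\<integral>y. I y \<partial>\<mu>) - (\<Sum>p\<in>range \<tau>. c p * J p)\<bar> \<le> a * e" by (simp add: a_def ac_simps)
    have le: "\<bar>J t - J (\<tau> t)\<bar> \<le> e * measure \<mu> L" if "t \<in> K" for t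
    proof -
      have "\<bar>J t - J (\<tau> t)\<bar> = \<bar>\<integral>y. F (t, y) - F (\<tau> t, y) \<partial>\<mu>\<bar>" unfolding J_def using Cc_integrable[OF Fcc(2)] by simp
      also have "\<dots> \<le> (\<integral>y. \<bar>F (t, y) - F (\<tau> t, y)\<bar> \<partial>\<mu>)" by (rule integral_abs_bound)
      also have "\<dots> \<le> e * measure \<mu> L"
        by (rule integrable_compact_support(2)[OF Cc_measurable[OF Cc_diff[OF Fcc(2) Fcc(2)]] K(2)]) (use \<tau>(3)[OF that] z in auto)
      finally show ?thesis .
    qed
    have 2: "\<bar>(\<integral>t. J t \<partial>\<mu>) - (\<Sum>p\<in>range \<tau>. c p * J p)\<bar> \<le> a * e"
    proof -
      have "\<bar>(\<integral>t. \<theta> t * J t \<partial>\<mu>) - (\<Sum>p\<in>range \<tau>. c p * J p)\<bar> \<le> (e * measure \<mu> L) * (\<integral>y. \<bar>\<theta> y\<bar> \<partial>\<mu>)"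
        unfolding c_def
        by (rule riemann_error[where K = K and G = J, OF \<theta>(1,2) _ \<tau>(1,2) le]) (simp_all add: \<theta>J Cc_integrable[OF Jc])
      then show ?thesis unfolding \<theta>J \<theta>(3) a_def by (simp only: ac_simps)
    qed
    from 1 2 have "\<bar>(\<integral>t. J t \<partial>\<mu>) - (\<integral>y. I y \<partial>\<mu>)\<bar> \<le> a * e + a * e" by linarith
    then show ?thesis by simp
  qed
  have a0: "a \<ge> 0" by (simp add: a_def)
  have "\<bar>(\<integral>t. J t \<partial>\<mu>) - (\<integral>y. I y \<partial>\<mu>)\<bar> \<le> 0 + d" if d: "d > 0" for d
  proof -
    have "2 * a * (d / (2 * a + 1)) \<le> d" using a0 d by (simp add: field_simps)
    then show ?thesis using main[of "d / (2 * a + 1)"] a0 d by (simp add: add_nonneg_pos)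
  qed
  then have "\<bar>(\<integral>t. J t \<partial>\<mu>) - (\<integral>y. I y \<partial>\<mu>)\<bar> \<le> 0" by (rule field_le_epsilon)
  then show ?thesis by (simp add: I_def J_def)
qed

section \<open>Bump functions and convolution\<close>

lemma completely_regular_group: "completely_regular_space (euclidean :: 'g topology)"
proof (rule locally_compact_regular_imp_completely_regular_space)
  show "locally_compact_space (euclidean :: 'g topology)"
    using lcg unfolding locally_compact_space_def locally_compact_group_def by (simp add: open_openin[symmetric])
  show "Hausdorff_space (euclidean :: 'g topology) \<or> regular_space (euclidean :: 'g topology)"
    unfolding Hausdorff_space_def by (metis disjnt_def hausdorff open_openin)
qed

lemma bump_function:
  assumes V: "open V" "(0::'g) \<in> V"
  obtains e where "e \<in> Cc" "\<And>x. e x \<ge> 0" "(\<integral>x. e x \<partial>\<mu>) = 1" "\<And>x. x \<notin> V \<Longrightarrow> e x = 0"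
proof -
  obtain U K where U: "open U" "(0::'g) \<in> U" "compact K" "U \<subseteq> K" using identity_neighbourhood by metis
  have "closedin euclidean (- (U \<inter> V)) \<and> 0 \<in> topspace euclidean - (- (U \<inter> V))" using U V by auto
  then obtain f :: "'g \<Rightarrow> real" where f: "continuous_map euclidean (top_of_set {0..1}) f" "f 0 = 0" "f ` (- (U \<inter> V)) \<subseteq> {1}"
    using completely_regular_group unfolding completely_regular_space_def by meson
  have fc: "continuous_on UNIV f" and f01: "\<And>x. f x \<in> {0..1}"
    using f(1) by (auto simp: continuous_map_in_subtopology)
  define h where "h = (\<lambda>x. 1 - f x)"
  have h: "h \<in> Cc" by (rule CcI[OF _ U(3)]) (use fc f(3) U in \<open>auto simp: h_def intro!: continuous_intros\<close>)
  have h0: "h x \<ge> 0" for x using f01[of x] by (simp add: h_def)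
  \<comment> \<open>An open set that contains the identity and so has positive measure; the integral
    of \<open>h\<close> is therefore positive and can be normalized.\<close>
  define S where "S = {x. h x > 1/2}"
  have So: "open S" unfolding S_def by (rule open_Collect_less) (use Cc_continuous[OF h] in auto)
  have "0 \<in> S" using f(2) by (simp add: S_def h_def)
  then have Sp: "emeasure \<mu> S > 0" using haarD(3) So by blast
  have "(\<integral>x. h x \<partial>\<mu>) \<noteq> 0"
  proof
    assume "(\<integral>x. h x \<partial>\<mu>) = 0"
    then have "AE x in \<mu>. h x = 0" using integral_nonneg_eq_0_iff_AE[OF Cc_integrable[OF h]] h0 by simp
    then have "AE x in \<mu>. \<not> h x > 1/2" by eventually_elim simp
    from emeasure_eq_0_AE[OF this] have "emeasure \<mu> S = 0" by (simp add: S_def)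
    then show False using Sp by simp
  qed
  moreover have "(\<integral>x. h x \<partial>\<mu>) \<ge> 0" using h0 by simp
  ultimately have ip: "(\<integral>x. h x \<partial>\<mu>) > 0" by simp
  show ?thesis
  proof (rule that[of "\<lambda>x. (1 / (\<integral>x. h x \<partial>\<mu>)) * h x"])
    show "(\<lambda>x. (1 / (\<integral>x. h x \<partial>\<mu>)) * h x) \<in> Cc" by (rule Cc_cmult[OF h])
    show "(\<integral>x. (1 / (\<integral>x. h x \<partial>\<mu>)) * h x \<partial>\<mu>) = 1" using ip by simp
    show "(1 / (\<integral>x. h x \<partial>\<mu>)) * h x = 0" if "x \<notin> V" for x using f(3) that by (auto simp: h_def)
    show "(1 / (\<integral>x. h x \<partial>\<mu>)) * h x \<ge> 0" for x using ip h0 by simp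
  qed
qed

text \<open>The usual group convolution. Left translation acts on the factor \<open>\<theta>\<close>
  alone, so that almost invariance can be arranged in terms of \<open>\<theta>\<close> and inherited
  by the convolution.\<close>

definition cconv :: "('g \<Rightarrow> real) \<Rightarrow> ('g \<Rightarrow> real) \<Rightarrow> 'g \<Rightarrow> real" where
  "cconv \<theta> k x = (\<integral>y. \<theta> y * k (- y + x) \<partial>\<mu>)"

lemma cconv_kernel_continuous:
  "\<theta> \<in> Cc \<Longrightarrow> k \<in> Cc \<Longrightarrow> continuous_on UNIV (\<lambda>p. \<theta> (fst p) * k (- fst p + snd p))"
  by (intro continuous_on_mult continuous_on_compose2[OF Cc_continuous[of \<theta>]] continuous_on_compose2[OF Cc_continuous[of k]])
     (auto intro!: continuous_intros)

lemma cconv_integrand_Cc: assumes "\<theta> \<in> Cc" "k \<in> Cc" shows "(\<lambda>y. \<theta> y * k (- y + x)) \<in> Cc"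
proof -
  obtain K where K: "compact K" "\<And>x. x \<notin> K \<Longrightarrow> \<theta> x = 0" using CcE[OF assms(1)] by blast
  show ?thesis by (rule CcI[OF _ K(1)]) (use continuous_section(2)[OF cconv_kernel_continuous[OF assms]] K in auto)
qed

lemma cconv_properties:
  assumes \<theta>: "\<theta> \<in> Cc" and k: "k \<in> Cc"
  shows "cconv \<theta> k \<in> Cc" "(\<integral>x. cconv \<theta> k x \<partial>\<mu>) = (\<integral>x. \<theta> x \<partial>\<mu>) * (\<integral>x. k x \<partial>\<mu>)"
proof -
  obtain K where K: "compact K" "\<And>x. x \<notin> K \<Longrightarrow> \<theta> x = 0" using CcE[OF \<theta>] by blast
  obtain L where L: "compact L" "\<And>x. x \<notin> L \<Longrightarrow> k x = 0" using CcE[OF k] by blast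
  define M where "M = {x + y | x y. x \<in> K \<and> y \<in> L}"
  have M: "compact M" unfolding M_def by (rule compact_sum_set[OF K(1) L(1)])
  define F where "F = (\<lambda>p. \<theta> (fst p) * k (- fst p + snd p))"
  have F: "continuous_on UNIV F" unfolding F_def by (rule cconv_kernel_continuous[OF \<theta> k])
  have Fz: "F (t, y) = 0" if "t \<notin> K \<or> y \<notin> M" for t y
  proof (rule ccontr)
    assume "F (t, y) \<noteq> 0"
    then have "t \<in> K" "- t + y \<in> L" using K(2) L(2) by (auto simp: F_def)
    moreover have "y = t + (- t + y)" by (simp add: add.assoc[symmetric])
    ultimately show False using that unfolding M_def by blast
  qed
  have F': "continuous_on UNIV (\<lambda>p. F (snd p, fst p))" by (rule continuous_on_compose2[OF F]) (auto intro!: continuous_intros)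
  have "continuous_on UNIV (\<lambda>x. \<integral>y. (\<lambda>p. F (snd p, fst p)) (x, y) \<partial>\<mu>)"
    by (rule continuous_integral_parameter[OF F']) (rule exI[of _ UNIV], rule exI[of _ K], use K(1) Fz in auto)
  then have c: "continuous_on UNIV (cconv \<theta> k)" unfolding cconv_def[abs_def] by (simp add: F_def)
  show "cconv \<theta> k \<in> Cc"
  proof (rule CcI[OF c M])
    fix x assume "x \<notin> M"
    then have "\<theta> y * k (- y + x) = 0" for y using Fz[of y x] by (simp add: F_def)
    then show "cconv \<theta> k x = 0" by (simp only: cconv_def) simp
  qed
  have "(\<integral>x. cconv \<theta> k x \<partial>\<mu>) = (\<integral>x. (\<integral>y. F (y, x) \<partial>\<mu>) \<partial>\<mu>)" by (simp add: cconv_def F_def)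
  also have "\<dots> = (\<integral>y. (\<integral>x. F (y, x) \<partial>\<mu>) \<partial>\<mu>)" by (rule fubini_compact[OF F K(1) M Fz, symmetric])
  also have "\<dots> = (\<integral>y. \<theta> y * (\<integral>x. k x \<partial>\<mu>) \<partial>\<mu>)"
    unfolding F_def using integral_translate[OF Cc_measurable[OF k]] by simp
  finally show "(\<integral>x. cconv \<theta> k x \<partial>\<mu>) = (\<integral>x. \<theta> x \<partial>\<mu>) * (\<integral>x. k x \<partial>\<mu>)" by simp
qed

lemma Cc_abs: "f \<in> Cc \<Longrightarrow> (\<lambda>x. \<bar>f x\<bar>) \<in> Cc"
  unfolding Cc_def by (auto intro!: continuous_intros)

lemma cconv_L1_bound:
  assumes \<theta>: "\<theta> \<in> Cc" and k: "k \<in> Cc" and k0: "\<And>x. k x \<ge> 0"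
  shows "(\<integral>x. \<bar>cconv \<theta> k x\<bar> \<partial>\<mu>) \<le> (\<integral>x. \<bar>\<theta> x\<bar> \<partial>\<mu>) * (\<integral>x. k x \<partial>\<mu>)"
proof -
  have "(\<integral>x. \<bar>cconv \<theta> k x\<bar> \<partial>\<mu>) \<le> (\<integral>x. cconv (\<lambda>x. \<bar>\<theta> x\<bar>) k x \<partial>\<mu>)"
  proof (rule integral_mono)
    show "\<bar>cconv \<theta> k x\<bar> \<le> cconv (\<lambda>x. \<bar>\<theta> x\<bar>) k x" for x
      using integral_abs_bound[of \<mu> "\<lambda>y. \<theta> y * k (- y + x)"] k0 by (simp add: cconv_def abs_mult)
  qed (use Cc_integrable[OF Cc_abs[OF cconv_properties(1)[OF \<theta> k]]] Cc_integrable[OF cconv_properties(1)[OF Cc_abs[OF \<theta>] k]] in auto)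
  also have "\<dots> = (\<integral>x. \<bar>\<theta> x\<bar> \<partial>\<mu>) * (\<integral>x. k x \<partial>\<mu>)" by (rule cconv_properties(2)[OF Cc_abs[OF \<theta>] k])
  finally show ?thesis .
qed

lemma cconv_translate:
  assumes "\<theta> \<in> Cc" "k \<in> Cc"
  shows "cconv \<theta> k (z + x) = cconv (\<lambda>y. \<theta> (z + y)) k x"
proof -
  have *: "- (z + y) + (z + x) = - y + x" for y
  proof -
    have "- (z + y) + (z + x) = - y + (- z + z) + x" by (simp only: minus_add add.assoc)
    then show ?thesis by simp
  qed
  have "cconv \<theta> k (z + x) = (\<integral>y. \<theta> (z + y) * k (- (z + y) + (z + x)) \<partial>\<mu>)"
    unfolding cconv_def
    by (rule integral_translate[symmetric, where f = "\<lambda>y. \<theta> y * k (- y + (z + x))"])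
       (rule Cc_measurable[OF cconv_integrand_Cc[OF assms]])
  then show ?thesis by (simp only: cconv_def *)
qed

lemma cconv_diff:
  assumes "\<theta> \<in> Cc" "\<eta> \<in> Cc" "k \<in> Cc"
  shows "cconv (\<lambda>y. \<theta> y - \<eta> y) k x = cconv \<theta> k x - cconv \<eta> k x"
  unfolding cconv_def left_diff_distrib
  using Cc_integrable[OF cconv_integrand_Cc[OF assms(1,3)]] Cc_integrable[OF cconv_integrand_Cc[OF assms(2,3)]] by simp

lemma compact_neighbourhood:
  obtains U K where "open U" "(z::'g) \<in> U" "compact K" "U \<subseteq> K"
  using lcg unfolding locally_compact_group_def by blast

lemma translation_L1_continuous:
  assumes f: "f \<in> Cc" and e: "e > 0"
  obtains V where "open V" "z0 \<in> V" "\<And>z. z \<in> V \<Longrightarrow> (\<integral>t. \<bar>f (z + t) - f (z0 + t)\<bar> \<partial>\<mu>) \<le> e"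
proof -
  obtain U K where U: "open U" "z0 \<in> U" "compact K" "U \<subseteq> K" using compact_neighbourhood[of z0] by metis
  obtain L where L: "compact L" "\<And>x. x \<notin> L \<Longrightarrow> f x = 0" using CcE[OF f] by blast
  have c: "continuous_on UNIV (\<lambda>p. f (fst p + snd p))"
    by (rule continuous_on_compose2[OF Cc_continuous[OF f]]) (auto intro!: continuous_intros)
  have z: "(\<lambda>p. f (fst p + snd p)) (z, t) = 0" if "z \<in> U" "t \<notin> {- x + y | x y. x \<in> K \<and> y \<in> L}" for z t
  proof -
    have "t = - z + (z + t)" by (simp add: add.assoc[symmetric])
    then have "z + t \<notin> L" using that U by blast
    then show ?thesis using L by simp
  qed
  obtain V where "open V" "z0 \<in> V" "\<And>z. z \<in> V \<Longrightarrow>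
      (\<integral>t. \<bar>(\<lambda>p. f (fst p + snd p)) (z, t) - (\<lambda>p. f (fst p + snd p)) (z0, t)\<bar> \<partial>\<mu>) \<le> e"
    using L1_continuous[OF c U(1,2) compact_neg_sum_set[OF U(3) L(1)] z e] by blast
  then show ?thesis using that[of V] by simp
qed

section \<open>Reiter's condition\<close>

text \<open>The matrix of \<open>amenable\<close>, named so that one fixed mean can be passed
  through the following lemmas.\<close>

definition invariant_mean :: "(('g \<Rightarrow> real) \<Rightarrow> real) \<Rightarrow> bool" where
  "invariant_mean m \<longleftrightarrow>
     (\<forall>f\<in>Linf \<mu>. \<forall>g\<in>Linf \<mu>. \<forall>a b. m (\<lambda>x. a * f x + b * g x) = a * m f + b * m g) \<and>
     (\<forall>f\<in>Linf \<mu>. \<forall>g\<in>Linf \<mu>. (AE x in \<mu>. f x = g x) \<longrightarrow> m f = m g) \<and>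
     (\<forall>f\<in>Linf \<mu>. (AE x in \<mu>. f x \<ge> 0) \<longrightarrow> m f \<ge> 0) \<and>
     m (\<lambda>_. 1) = 1 \<and>
     (\<forall>f\<in>Linf \<mu>. \<forall>a. m (\<lambda>x. f (a + x)) = m f)"

lemma invariant_meanD:
  assumes "invariant_mean m"
  shows "\<And>f g a b. f \<in> Linf \<mu> \<Longrightarrow> g \<in> Linf \<mu> \<Longrightarrow> m (\<lambda>x. a * f x + b * g x) = a * m f + b * m g"
    "\<And>f. f \<in> Linf \<mu> \<Longrightarrow> (\<And>x. f x \<ge> 0) \<Longrightarrow> m f \<ge> 0" "m (\<lambda>_. 1) = 1"
    "\<And>f a. f \<in> Linf \<mu> \<Longrightarrow> m (\<lambda>x. f (a + x)) = m f"
proof -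
  have c: "\<forall>f\<in>Linf \<mu>. \<forall>g\<in>Linf \<mu>. \<forall>a b. m (\<lambda>x. a * f x + b * g x) = a * m f + b * m g"
    "\<forall>f\<in>Linf \<mu>. (AE x in \<mu>. f x \<ge> 0) \<longrightarrow> m f \<ge> 0" "m (\<lambda>_. 1) = 1"
    "\<forall>f\<in>Linf \<mu>. \<forall>a. m (\<lambda>x. f (a + x)) = m f"
    using assms unfolding invariant_mean_def by - (elim conjE, assumption)+
  show "m (\<lambda>x. a * f x + b * g x) = a * m f + b * m g" if "f \<in> Linf \<mu>" "g \<in> Linf \<mu>" for f g a b
    using bspec[OF bspec[OF c(1) that(1)] that(2)] by (elim allE)
  show "m f \<ge> 0" if "f \<in> Linf \<mu>" "\<And>x. f x \<ge> 0" for f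
    by (rule mp[OF bspec[OF c(2) that(1)] AE_I2[OF that(2)]])
  show "m (\<lambda>_. 1) = 1" by (rule c(3))
  show "m (\<lambda>x. f (a + x)) = m f" if "f \<in> Linf \<mu>" for f a using bspec[OF c(4) that] by (elim allE)
qed

lemma LinfI: "f \<in> borel_measurable \<mu> \<Longrightarrow> (\<And>x. \<bar>f x\<bar> \<le> C) \<Longrightarrow> f \<in> Linf \<mu>"
  unfolding Linf_def by auto

lemma Linf_continuous: "continuous_on UNIV f \<Longrightarrow> (\<And>x. \<bar>f x\<bar> \<le> C) \<Longrightarrow> f \<in> Linf \<mu>"
  by (rule LinfI[OF borel_measurable_continuous_haar])

lemma Linf_lincomb:
  assumes "f \<in> Linf \<mu>" "g \<in> Linf \<mu>" shows "(\<lambda>x. a * f x + b * g x) \<in> Linf \<mu>"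
proof -
  obtain C D where C: "AE x in \<mu>. \<bar>f x\<bar> \<le> C" and D: "AE x in \<mu>. \<bar>g x\<bar> \<le> D" using assms by (auto simp: Linf_def)
  have "AE x in \<mu>. \<bar>a * f x + b * g x\<bar> \<le> \<bar>a\<bar> * C + \<bar>b\<bar> * D"
    using C D
  proof eventually_elim
    case (elim x)
    have "\<bar>a * f x + b * g x\<bar> \<le> \<bar>a\<bar> * \<bar>f x\<bar> + \<bar>b\<bar> * \<bar>g x\<bar>" using abs_triangle_ineq[of "a * f x" "b * g x"] by (simp add: abs_mult)
    also have "\<dots> \<le> \<bar>a\<bar> * C + \<bar>b\<bar> * D" using elim by (intro add_mono mult_left_mono) auto
    finally show ?case .
  qed
  then show ?thesis using assms unfolding Linf_def by (auto intro!: borel_measurable_add borel_measurable_times)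
qed

lemma mean_sum:
  assumes m: "invariant_mean m" and "finite I" "\<And>i. i \<in> I \<Longrightarrow> f i \<in> Linf \<mu>"
  shows "(\<lambda>x. \<Sum>i\<in>I. c i * f i x) \<in> Linf \<mu> \<and> m (\<lambda>x. \<Sum>i\<in>I. c i * f i x) = (\<Sum>i\<in>I. c i * m (f i))"
  using assms(2,3)
proof (induction I rule: finite_induct)
  case empty
  have o: "(\<lambda>_. 1) \<in> Linf \<mu>" by (rule LinfI[of _ 1]) auto
  show ?case using Linf_lincomb[OF o o, of 0 0] invariant_meanD(1)[OF m o o, of 0 0] by simp
next
  case (insert i I)
  then have "f i \<in> Linf \<mu>" "(\<lambda>x. \<Sum>i\<in>I. c i * f i x) \<in> Linf \<mu>" "m (\<lambda>x. \<Sum>i\<in>I. c i * f i x) = (\<Sum>i\<in>I. c i * m (f i))" by auto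
  from Linf_lincomb[OF this(1,2), of "c i" 1] invariant_meanD(1)[OF m this(1,2), of "c i" 1] this(3)
  show ?case using insert by simp
qed

lemma mean_diff_bound:
  assumes m: "invariant_mean m" and f: "f \<in> Linf \<mu>" "g \<in> Linf \<mu>" and C: "\<And>x. \<bar>f x - g x\<bar> \<le> C"
  shows "\<bar>m f - m g\<bar> \<le> C"
proof -
  have o: "(\<lambda>_. 1) \<in> Linf \<mu>" by (rule LinfI[of _ 1]) auto
  have d: "(\<lambda>x. 1 * f x + (-1) * g x) \<in> Linf \<mu>" by (rule Linf_lincomb[OF f])
  have md: "m (\<lambda>x. 1 * f x + (-1) * g x) = m f - m g" using invariant_meanD(1)[OF m f, of 1 "-1"] by simp
  have "0 \<le> m (\<lambda>x. C * 1 + s * (1 * f x + (-1) * g x))" if "s = 1 \<or> s = -1" for s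
  proof (rule invariant_meanD(2)[OF m Linf_lincomb[OF o d]])
    fix x show "0 \<le> C * 1 + s * (1 * f x + (-1) * g x)" using C[of x] that by (auto simp: abs_le_iff)
  qed
  moreover have "m (\<lambda>x. C * 1 + s * (1 * f x + (-1) * g x)) = C + s * (m f - m g)" for s
    using invariant_meanD(1)[OF m o d, of C s] md invariant_meanD(3)[OF m] by simp
  ultimately have "0 \<le> C + s * (m f - m g)" if "s = 1 \<or> s = -1" for s using that by simp
  from this[of 1] this[of "-1"] show ?thesis by (simp add: abs_le_iff)
qed

lemma rounding_for_L1:
  assumes f: "f \<in> Cc" and K: "compact K" and e: "e > 0"
  obtains \<tau> where "finite (range \<tau>)" "\<And>p. {w. \<tau> w = p} \<in> sets borel"
    "\<And>y. y \<in> K \<Longrightarrow> (\<integral>t. \<bar>f (y + t) - f (\<tau> y + t)\<bar> \<partial>\<mu>) \<le> e" "\<And>y. y \<in> K \<Longrightarrow> \<tau> y \<in> K"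
proof -
  have "\<forall>z0. \<exists>V. open V \<and> z0 \<in> V \<and> (\<forall>z\<in>V. (\<integral>t. \<bar>f (z + t) - f (z0 + t)\<bar> \<partial>\<mu>) \<le> e)"
    using translation_L1_continuous[OF f e] by metis
  then obtain V where V: "\<And>y0. open (V y0)" "\<And>y0. y0 \<in> V y0"
    "\<And>y0 y. y \<in> V y0 \<Longrightarrow> (\<integral>t. \<bar>f (y + t) - f (y0 + t)\<bar> \<partial>\<mu>) \<le> e" by metis
  obtain \<tau> where "finite (range \<tau>)" "\<And>p. {w. \<tau> w = p} \<in> sets borel" "\<And>w. w \<in> K \<Longrightarrow> \<tau> w \<in> K \<and> w \<in> V (\<tau> w)"
    using rounding_map[OF K, of V] V by blast
  then show ?thesis using that[of \<tau>] V(3) by blast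
qed

lemma weighted_integral_bound:
  fixes \<theta> G :: "'g \<Rightarrow> real"
  assumes \<theta>: "integrable \<mu> \<theta>" and G: "G \<in> borel_measurable \<mu>" "\<And>y. \<bar>G y\<bar> \<le> C"
  shows "integrable \<mu> (\<lambda>y. \<theta> y * G y)" "\<bar>\<integral>y. \<theta> y * G y \<partial>\<mu>\<bar> \<le> (\<integral>y. \<bar>\<theta> y\<bar> \<partial>\<mu>) * C"
proof -
  have i: "integrable \<mu> (\<lambda>y. \<bar>\<theta> y\<bar> * C)" using \<theta> by simp
  have C0: "C \<ge> 0" using G(2)[of undefined] by simp
  have le: "\<bar>\<theta> y * G y\<bar> \<le> \<bar>\<theta> y\<bar> * C" for y by (simp add: abs_mult mult_left_mono G(2))
  show j: "integrable \<mu> (\<lambda>y. \<theta> y * G y)"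
    by (rule Bochner_Integration.integrable_bound[OF i]) (use \<theta> G(1) le C0 in \<open>auto simp: abs_mult\<close>)
  have "\<bar>\<integral>y. \<theta> y * G y \<partial>\<mu>\<bar> \<le> (\<integral>y. \<bar>\<theta> y * G y\<bar> \<partial>\<mu>)" by (rule integral_abs_bound)
  also have "\<dots> \<le> (\<integral>y. \<bar>\<theta> y\<bar> * C \<partial>\<mu>)" by (rule integral_mono) (use i j le in auto)
  finally show "\<bar>\<integral>y. \<theta> y * G y \<partial>\<mu>\<bar> \<le> (\<integral>y. \<bar>\<theta> y\<bar> \<partial>\<mu>) * C" by simp
qed

lemma average_continuous:
  assumes \<theta>: "\<theta> \<in> Cc" and h: "continuous_on UNIV h"
  shows "continuous_on UNIV (\<lambda>x. \<integral>y. \<theta> y * h (y + x) \<partial>\<mu>)" "continuous_on UNIV (\<lambda>x. \<integral>y. \<theta> y * h (- y + x) \<partial>\<mu>)"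
proof -
  obtain K where K: "compact K" "\<And>x. x \<notin> K \<Longrightarrow> \<theta> x = 0" using CcE[OF \<theta>] by blast
  have c: "continuous_on UNIV (\<lambda>p. \<theta> (snd p) * h (snd p + fst p))" "continuous_on UNIV (\<lambda>p. \<theta> (snd p) * h (- snd p + fst p))"
    by (intro continuous_on_mult continuous_on_compose2[OF Cc_continuous[OF \<theta>]] continuous_on_compose2[OF h]; auto intro!: continuous_intros)+
  have "continuous_on UNIV (\<lambda>x. \<integral>y. (\<lambda>p. \<theta> (snd p) * h (snd p + fst p)) (x, y) \<partial>\<mu>)"
    by (rule continuous_integral_parameter[OF c(1)], rule exI[of _ UNIV], rule exI[of _ K]) (use K in auto)
  then show "continuous_on UNIV (\<lambda>x. \<integral>y. \<theta> y * h (y + x) \<partial>\<mu>)" by simp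
  have "continuous_on UNIV (\<lambda>x. \<integral>y. (\<lambda>p. \<theta> (snd p) * h (- snd p + fst p)) (x, y) \<partial>\<mu>)"
    by (rule continuous_integral_parameter[OF c(2)], rule exI[of _ UNIV], rule exI[of _ K]) (use K in auto)
  then show "continuous_on UNIV (\<lambda>x. \<integral>y. \<theta> y * h (- y + x) \<partial>\<mu>)" by simp
qed

text \<open>A left invariant mean is also invariant under averaging \<open>h\<close> by densities: after smoothing \<open>h\<close> with a
  bump \<open>e\<close> near the identity, the left translates of \<open>h\<close> depend continuously on the translation in the
  sup norm, so the average is uniformly approximated by finite combinations of translates.\<close>

lemma mean_annihilates_average:
  assumes m: "invariant_mean m" and \<theta>: "\<theta> \<in> Cc" "(\<integral>y. \<theta> y \<partial>\<mu>) = 0" and h: "continuous_on UNIV h" "\<And>x. \<bar>h x\<bar> \<le> C"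
  shows "m (\<lambda>x. \<integral>y. \<theta> y * h (y + x) \<partial>\<mu>) = 0"
proof -
  define Q where "Q = (\<lambda>x. \<integral>y. \<theta> y * h (y + x) \<partial>\<mu>)"
  define n\<theta> where "n\<theta> = (\<integral>y. \<bar>\<theta> y\<bar> \<partial>\<mu>)"
  have C0: "C \<ge> 0" using h(2)[of 0] by simp
  have n0: "n\<theta> \<ge> 0" by (simp add: n\<theta>_def)
  have \<theta>i: "integrable \<mu> \<theta>" by (rule Cc_integrable[OF \<theta>(1)])
  have hm: "(\<lambda>y. h (y + x)) \<in> borel_measurable \<mu>" "(\<lambda>y. h (- y + x)) \<in> borel_measurable \<mu>" for x
    by (rule borel_measurable_continuous_haar, rule continuous_on_compose2[OF h(1)], auto intro!: continuous_intros)+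
  obtain K where K: "compact K" "\<And>x. x \<notin> K \<Longrightarrow> \<theta> x = 0" using CcE[OF \<theta>(1)] by blast
  have Qb: "\<bar>Q x\<bar> \<le> n\<theta> * C" for x unfolding Q_def n\<theta>_def by (rule weighted_integral_bound(2)[OF \<theta>i hm(1)]) (rule h(2))
  have QL: "Q \<in> Linf \<mu>" by (rule Linf_continuous[OF average_continuous(1)[OF \<theta>(1) h(1), folded Q_def] Qb])
  have main: "\<bar>m Q\<bar> \<le> d * (C + C * n\<theta>)" if d: "d > 0" for d
  proof -
    obtain V where V: "open V" "0 \<in> V" "\<And>z. z \<in> V \<Longrightarrow> (\<integral>t. \<bar>\<theta> (z + t) - \<theta> (0 + t)\<bar> \<partial>\<mu>) \<le> d"
      using translation_L1_continuous[OF \<theta>(1) d, of 0] by blast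
    obtain e where e: "e \<in> Cc" "\<And>x. e x \<ge> 0" "(\<integral>x. e x \<partial>\<mu>) = 1" "\<And>x. x \<notin> V \<Longrightarrow> e x = 0" using bump_function[OF V(1,2)] by blast
    have ei: "integrable \<mu> e" by (rule Cc_integrable[OF e(1)])
    have ne: "(\<integral>x. \<bar>e x\<bar> \<partial>\<mu>) = 1" using e(2,3) by simp
    obtain L where L: "compact L" "\<And>x. x \<notin> L \<Longrightarrow> e x = 0" using CcE[OF e(1)] by blast
    define S where "S = (\<lambda>x. \<integral>t. e t * h (- t + x) \<partial>\<mu>)"
    have Sc: "continuous_on UNIV S" unfolding S_def by (rule average_continuous(2)[OF e(1) h(1)])
    have Sb: "\<bar>S x\<bar> \<le> C" for x
      using weighted_integral_bound(2)[OF ei hm(2)[of x] h(2)] by (simp add: S_def ne)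
    have SL: "S \<in> Linf \<mu>" by (rule Linf_continuous[OF Sc Sb])
    define B where "B = (\<lambda>x. \<integral>y. \<theta> y * S (y + x) \<partial>\<mu>)"
    have Sm: "(\<lambda>y. S (y + x)) \<in> borel_measurable \<mu>" for x
      by (rule borel_measurable_continuous_haar, rule continuous_on_compose2[OF Sc]) (auto intro!: continuous_intros)
    have Bb: "\<bar>B x\<bar> \<le> n\<theta> * C" for x unfolding B_def n\<theta>_def by (rule weighted_integral_bound(2)[OF \<theta>i Sm]) (rule Sb)
    have BL: "B \<in> Linf \<mu>" by (rule Linf_continuous[OF average_continuous(1)[OF \<theta>(1) Sc, folded B_def] Bb])
    \<comment> \<open>Exchanging the integrals and substituting moves the shift by \<open>t\<close>
      from \<open>h\<close> to \<open>\<theta>\<close>; for \<open>t\<close> in the support of the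
      bump, \<open>\<theta>\<close> changes by at most \<open>d\<close> in
      \<open>L^1\<close>.\<close>
    have QB: "\<bar>Q x - B x\<bar> \<le> d * C" for x
    proof -
      define F where "F = (\<lambda>p. e (fst p) * \<theta> (snd p) * h (- fst p + (snd p + x)))"
      have Fc: "continuous_on UNIV F" unfolding F_def
        by (intro continuous_on_mult continuous_on_compose2[OF Cc_continuous[OF \<theta>(1)]] continuous_on_compose2[OF Cc_continuous[OF e(1)]]
            continuous_on_compose2[OF h(1)]) (auto intro!: continuous_intros)
      have Fz: "F (t, y) = 0" if "t \<notin> L \<or> y \<notin> K" for t y using that L K by (auto simp: F_def)
      define R where "R = (\<lambda>t. \<integral>y. \<theta> (t + y) * h (y + x) \<partial>\<mu>)"
      have "B x = (\<integral>y. (\<integral>t. F (t, y) \<partial>\<mu>) \<partial>\<mu>)"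
        unfolding B_def S_def F_def by (simp add: mult.assoc mult.left_commute[of "e _"])
      also have "\<dots> = (\<integral>t. (\<integral>y. F (t, y) \<partial>\<mu>) \<partial>\<mu>)" by (rule fubini_compact[OF Fc L(1) K(1) Fz, symmetric])
      also have "(\<lambda>t. \<integral>y. F (t, y) \<partial>\<mu>) = (\<lambda>t. e t * R t)"
      proof
        fix t
        have "(\<integral>y. \<theta> y * h (- t + (y + x)) \<partial>\<mu>) = (\<integral>y. \<theta> (t + y) * h (- t + ((t + y) + x)) \<partial>\<mu>)"
        proof (rule integral_translate[symmetric, where f = "\<lambda>y. \<theta> y * h (- t + (y + x))"])
          have "(\<lambda>y. h (- t + (y + x))) \<in> borel_measurable \<mu>"
            by (rule borel_measurable_continuous_haar, rule continuous_on_compose2[OF h(1)]) (auto intro!: continuous_intros)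
          then show "(\<lambda>y. \<theta> y * h (- t + (y + x))) \<in> borel_measurable \<mu>" using Cc_measurable[OF \<theta>(1)] by measurable
        qed
        also have "(\<lambda>y. - t + ((t + y) + x)) = (\<lambda>y. y + x)" by (simp add: add.assoc[symmetric])
        then have "(\<integral>y. \<theta> (t + y) * h (- t + ((t + y) + x)) \<partial>\<mu>) = R t" by (simp add: R_def fun_eq_iff)
        finally show "(\<integral>y. F (t, y) \<partial>\<mu>) = e t * R t" by (simp add: F_def mult.assoc)
      qed
      finally have Bx: "B x = (\<integral>t. e t * R t \<partial>\<mu>)" .
      have Qx: "Q x = (\<integral>t. e t * Q x \<partial>\<mu>)" using e(3) by simp
      have RQ: "\<bar>R t - Q x\<bar> \<le> d * C" if "t \<in> V" for t
      proof -
        have ti: "integrable \<mu> (\<lambda>y. \<theta> (t + y))" by (rule integrable_translate[OF \<theta>i])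
        have "R t - Q x = (\<integral>y. (\<theta> (t + y) - \<theta> y) * h (y + x) \<partial>\<mu>)"
          unfolding R_def Q_def left_diff_distrib
          using weighted_integral_bound(1)[OF ti hm(1) h(2)] weighted_integral_bound(1)[OF \<theta>i hm(1) h(2)] by simp
        also have "\<bar>\<dots>\<bar> \<le> (\<integral>y. \<bar>\<theta> (t + y) - \<theta> y\<bar> \<partial>\<mu>) * C"
          by (rule weighted_integral_bound(2)[OF _ hm(1)]) (use ti \<theta>i h(2) in auto)
        also have "\<dots> \<le> d * C" using V(3)[OF that] C0 by (intro mult_right_mono) auto
        finally show ?thesis .
      qed
      have iR: "integrable \<mu> (\<lambda>t. e t * R t)"
      proof (rule Cc_integrable, rule CcI[OF _ L(1)])
        have "continuous_on UNIV (\<lambda>t. \<integral>y. F (t, y) \<partial>\<mu>)"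
          by (rule continuous_integral_parameter[OF Fc], rule exI[of _ UNIV], rule exI[of _ K]) (use K Fz in auto)
        then show "continuous_on UNIV (\<lambda>t. e t * R t)" unfolding \<open>(\<lambda>t. \<integral>y. F (t, y) \<partial>\<mu>) = (\<lambda>t. e t * R t)\<close> .
      qed (simp add: L)
      have "\<bar>Q x - B x\<bar> = \<bar>\<integral>t. e t * Q x - e t * R t \<partial>\<mu>\<bar>" unfolding Bx by (subst Qx) (use iR ei in simp)
      also have "\<dots> \<le> (\<integral>t. \<bar>e t * Q x - e t * R t\<bar> \<partial>\<mu>)" by (rule integral_abs_bound)
      also have "\<dots> \<le> (\<integral>t. e t * (d * C) \<partial>\<mu>)"
      proof (rule integral_mono)
        fix t
        have "\<bar>e t * Q x - e t * R t\<bar> = e t * \<bar>R t - Q x\<bar>" using e(2)[of t] by (simp add: abs_mult abs_minus_commute flip: right_diff_distrib)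
        then show "\<bar>e t * Q x - e t * R t\<bar> \<le> e t * (d * C)" using RQ[of t] e(2)[of t] e(4)[of t] by (cases "t \<in> V") (auto intro: mult_left_mono)
      qed (use iR ei in auto)
      finally show ?thesis using e(3) by simp
    qed
    obtain \<tau> where \<tau>: "finite (range \<tau>)" "\<And>p. {w. \<tau> w = p} \<in> sets borel"
      "\<And>y. y \<in> K \<Longrightarrow> (\<integral>t. \<bar>e (y + t) - e (\<tau> y + t)\<bar> \<partial>\<mu>) \<le> d"
      by (rule rounding_for_L1[OF e(1) K(1) d]) (rule that)
    define c where "c = (\<lambda>p. \<integral>y. \<theta> y * indicator {w. \<tau> w = p} y \<partial>\<mu>)"
    \<comment> \<open>The weights add up to the integral of \<open>\<theta>\<close>, which is 0.
      Since \<open>m\<close> gives all translates of \<open>S\<close> the same value, it annihilates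
      the Riemann sum \<open>R2\<close>.\<close>
    have csum: "(\<Sum>p\<in>range \<tau>. c p) = 0" using integral_rounded(2)[OF \<theta>i \<tau>(1,2), of "\<lambda>_. 1"] \<theta>(2) by (simp add: c_def)
    \<comment> \<open>A translate of \<open>S\<close> is \<open>h\<close> smoothed by a translate of
      \<open>e\<close>, so translation of \<open>S\<close> is continuous in the sup norm because
      translation of \<open>e\<close> is continuous in \<open>L^1\<close>; uniform continuity of
      \<open>h\<close> does not enter.\<close>
    have Sshift: "S (y + x) = (\<integral>t. e (y + t) * h (- t + x) \<partial>\<mu>)" for x y
    proof -
      have *: "- (y + t) + (y + x) = - t + x" for t
      proof -
        have "- (y + t) + (y + x) = - t + (- y + y) + x" by (simp only: minus_add add.assoc)
        then show ?thesis by simp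
      qed
      have "S (y + x) = (\<integral>t. e (y + t) * h (- (y + t) + (y + x)) \<partial>\<mu>)"
        unfolding S_def
        by (rule integral_translate[symmetric, where f = "\<lambda>t. e t * h (- t + (y + x))"]) (use hm(2) Cc_measurable[OF e(1)] in measurable)
      then show ?thesis by (simp only: *)
    qed
    have Sdiff: "\<bar>S (y + x) - S (\<tau> y + x)\<bar> \<le> d * C" if "y \<in> K" for x y
    proof -
      have ti: "integrable \<mu> (\<lambda>t. e (z + t))" for z by (rule integrable_translate[OF ei])
      have "S (y + x) - S (\<tau> y + x) = (\<integral>t. (e (y + t) - e (\<tau> y + t)) * h (- t + x) \<partial>\<mu>)"
        unfolding Sshift left_diff_distrib using weighted_integral_bound(1)[OF ti hm(2) h(2)] by simp
      also have "\<bar>\<dots>\<bar> \<le> (\<integral>t. \<bar>e (y + t) - e (\<tau> y + t)\<bar> \<partial>\<mu>) * C"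
        by (rule weighted_integral_bound(2)[OF _ hm(2)]) (use ti h(2) in auto)
      also have "\<dots> \<le> d * C" using \<tau>(3)[OF that] C0 by (intro mult_right_mono) auto
      finally show ?thesis .
    qed
    have tl: "(\<lambda>x. S (p + x)) \<in> Linf \<mu>" for p
      by (rule LinfI[OF _ Sb]) (rule measurable_translate_comp[OF borel_measurable_continuous_haar[OF Sc]])
    define R2 where "R2 = (\<lambda>x. \<Sum>p\<in>range \<tau>. c p * S (p + x))"
    have R2: "R2 \<in> Linf \<mu>" "m R2 = (\<Sum>p\<in>range \<tau>. c p * m (\<lambda>x. S (p + x)))"
      using mean_sum[OF m \<tau>(1), of "\<lambda>p x. S (p + x)" c] tl unfolding R2_def by auto
    have "m R2 = (\<Sum>p\<in>range \<tau>. c p) * m S" using R2(2) invariant_meanD(4)[OF m SL] by (simp add: sum_distrib_right)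
    then have mR2: "m R2 = 0" using csum by simp
    have "\<bar>B x - R2 x\<bar> \<le> (d * C) * n\<theta>" for x
      unfolding B_def R2_def c_def n\<theta>_def
      by (rule riemann_error[where K = K and G = "\<lambda>y. S (y + x)", OF \<theta>i K(2) _ \<tau>(1,2) Sdiff])
         (use weighted_integral_bound(1)[OF \<theta>i Sm Sb] in auto)
    from mean_diff_bound[OF m BL R2(1) this] mR2 have "\<bar>m B\<bar> \<le> (d * C) * n\<theta>" by simp
    moreover have "\<bar>m Q - m B\<bar> \<le> d * C" by (rule mean_diff_bound[OF m QL BL QB])
    ultimately have "\<bar>m Q\<bar> \<le> d * C + (d * C) * n\<theta>" by linarith
    then show ?thesis by (simp add: algebra_simps)
  qed
  define a where "a = C + C * n\<theta>"
  have a0: "a \<ge> 0" using C0 n0 by (simp add: a_def)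
  have "\<bar>m Q\<bar> \<le> 0 + d" if d: "d > 0" for d
  proof -
    have "d / (a + 1) * a \<le> d" using a0 d by (simp add: field_simps)
    then show ?thesis using main[of "d / (a + 1)"] a0 d by (simp add: a_def[symmetric])
  qed
  then have "\<bar>m Q\<bar> \<le> 0" by (rule field_le_epsilon)
  then show ?thesis by (simp add: Q_def)
qed

lemma cconv_linear_right:
  assumes "\<theta> \<in> Cc" "q \<in> Cc" "r \<in> Cc"
  shows "cconv \<theta> (\<lambda>x. q x + r x) z = cconv \<theta> q z + cconv \<theta> r z" "cconv \<theta> (\<lambda>x. c * q x) z = c * cconv \<theta> q z"
  unfolding cconv_def using Cc_integrable[OF cconv_integrand_Cc[OF assms(1,2)]] Cc_integrable[OF cconv_integrand_Cc[OF assms(1,3)]]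
  by (simp_all add: distrib_left mult.left_commute)

text \<open>The function \<open>h\<close> represents \<open>l\<close> after smoothing by
  \<open>\<psi>\<close>. It is continuous and bounded, which replaces the search for a density of
  \<open>l\<close> in the dual of \<open>L^1\<close>. The formula says that \<open>l\<close> passes
  under the convolution integral; it is proved by rounding \<open>y\<close>, since then the
  convolution becomes a finite combination of translates.\<close>

lemma L1_functional_of_cconv:
  assumes l: "linear_on_space Cc l" and lb: "\<And>f. f \<in> Cc \<Longrightarrow> \<bar>l f\<bar> \<le> (\<integral>z. \<bar>f z\<bar> \<partial>\<mu>)" and \<psi>: "\<psi> \<in> Cc"
  defines "h \<equiv> \<lambda>x. l (\<lambda>z. \<psi> (- x + z))"
  shows "continuous_on UNIV h" "\<And>x. \<bar>h x\<bar> \<le> (\<integral>z. \<bar>\<psi> z\<bar> \<partial>\<mu>)"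
    "\<And>\<theta> x. \<theta> \<in> Cc \<Longrightarrow> l (cconv \<theta> (\<lambda>z. \<psi> (- x + z))) = (\<integral>y. \<theta> y * h (y + x) \<partial>\<mu>)"
proof -
  have fsC: "function_space Cc" unfolding function_space_def using Cc_zero Cc_add Cc_cmult by blast
  have tr: "(\<lambda>z. \<psi> (- x + z)) \<in> Cc" for x by (rule Cc_translate[OF \<psi>])
  show hb: "\<bar>h x\<bar> \<le> (\<integral>z. \<bar>\<psi> z\<bar> \<partial>\<mu>)" for x
    using lb[OF tr[of x]] integral_translate[of "\<lambda>z. \<bar>\<psi> z\<bar>" "- x"] Cc_measurable[OF Cc_abs[OF \<psi>]] by (simp add: h_def)
  have hd: "\<bar>h x - h x'\<bar> \<le> (\<integral>z. \<bar>\<psi> (- x + z) - \<psi> (- x' + z)\<bar> \<partial>\<mu>)" for x x'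
    using linear_on_space_diff[OF fsC l tr[of x] tr[of x']] lb[OF Cc_diff[OF tr[of x] tr[of x']]] by (simp add: h_def)
  show hc: "continuous_on UNIV h"
    unfolding continuous_on_def
  proof
    fix x0
    have "(h \<longlongrightarrow> h x0) (nhds x0)" unfolding tendsto_iff
    proof (intro allI impI)
      fix e :: real assume e: "e > 0"
      obtain V where V: "open V" "- x0 \<in> V" "\<And>z. z \<in> V \<Longrightarrow> (\<integral>t. \<bar>\<psi> (z + t) - \<psi> (- x0 + t)\<bar> \<partial>\<mu>) \<le> e / 2"
        using translation_L1_continuous[OF \<psi> half_gt_zero[OF e], of "- x0"] by blast
      have o: "open (uminus -` V)" by (rule open_vimage[OF V(1) continuous_group_ops(2)])
      have "dist (h x) (h x0) < e" if "x \<in> uminus -` V" for x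
        using hd[of x x0] V(3)[of "- x"] that e by (simp add: dist_real_def)
      then show "\<forall>\<^sub>F x in nhds x0. dist (h x) (h x0) < e" unfolding eventually_nhds using o V(2) by (intro exI[of _ "uminus -` V"]) auto
    qed
    then show "(h \<longlongrightarrow> h x0) (at x0 within UNIV)" by (rule tendsto_mono[rotated]) (simp add: at_within_def)
  qed
  fix \<theta> x assume \<theta>: "\<theta> \<in> Cc"
  obtain K where K: "compact K" "\<And>x. x \<notin> K \<Longrightarrow> \<theta> x = 0" using CcE[OF \<theta>] by blast
  obtain L where L: "compact L" "\<And>x. x \<notin> L \<Longrightarrow> \<psi> x = 0" using CcE[OF \<psi>] by blast
  have \<theta>i: "integrable \<mu> \<theta>" by (rule Cc_integrable[OF \<theta>])
  define M where "M = {y + (x + z) | y z. y \<in> K \<and> z \<in> L}"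
  have M: "compact M"
  proof -
    have "M = {y + w | y w. y \<in> K \<and> w \<in> {u + z | u z. u \<in> {x} \<and> z \<in> L}}" unfolding M_def by auto
    then show ?thesis using compact_sum_set[OF K(1) compact_sum_set[OF compact_sing[of x] L(1)]] by simp
  qed
  define F where "F = (\<lambda>p. \<psi> (- (fst p + x) + snd p))"
  have Fc: "continuous_on UNIV F" unfolding F_def
    by (rule continuous_on_compose2[OF Cc_continuous[OF \<psi>]]) (auto intro!: continuous_intros)
  have Fz: "F (y, z) = 0" if "y \<in> K" "z \<notin> M" for y z
  proof (rule ccontr)
    assume "F (y, z) \<noteq> 0"
    then have "- (y + x) + z \<in> L" using L(2) by (auto simp: F_def)
    moreover have "z = y + (x + (- (y + x) + z))" by (simp only: add.assoc[symmetric]) simp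
    ultimately show False using that unfolding M_def by blast
  qed
  have Ft: "(\<lambda>z. F (p, z)) \<in> Cc" for p unfolding F_def by (simp add: tr)
  have cF: "cconv \<theta> (\<lambda>z. \<psi> (- x + z)) z = (\<integral>y. \<theta> y * F (y, z) \<partial>\<mu>)" for z
    by (simp only: cconv_def F_def fst_conv snd_conv minus_add add.assoc)
  have hF: "h (y + x) = l (\<lambda>z. F (y, z))" for y by (simp add: h_def F_def)
  define n\<theta> where "n\<theta> = (\<integral>y. \<bar>\<theta> y\<bar> \<partial>\<mu>)"
  define b where "b = measure \<mu> M * n\<theta>"
  have b0: "b \<ge> 0" by (simp add: b_def n\<theta>_def)
  define X where "X = l (cconv \<theta> (\<lambda>z. \<psi> (- x + z)))"
  define Y where "Y = (\<integral>y. \<theta> y * h (y + x) \<partial>\<mu>)"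
  have main: "\<bar>X - Y\<bar> \<le> 2 * b * e" if e: "e > 0" for e
  proof -
    obtain \<tau> where \<tau>: "finite (range \<tau>)" "\<And>p. {w. \<tau> w = p} \<in> sets borel"
      "\<And>y t. y \<in> K \<Longrightarrow> t \<in> M \<Longrightarrow> \<bar>F (y, t) - F (\<tau> y, t)\<bar> \<le> e" "\<And>y. y \<in> K \<Longrightarrow> \<tau> y \<in> K"
      using rounding_for_kernel[OF Fc K(1) M e] by metis
    have \<tau>F: "\<bar>F (y, t) - F (\<tau> y, t)\<bar> \<le> e" if "y \<in> K" for y t
      using \<tau>(3)[OF that] Fz[OF that] Fz[OF \<tau>(4)[OF that]] e by (cases "t \<in> M") auto
    define c where "c = (\<lambda>p. \<integral>y. \<theta> y * indicator {w. \<tau> w = p} y \<partial>\<mu>)"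
    define R where "R = (\<lambda>z. \<Sum>p\<in>range \<tau>. c p * F (p, z))"
    have RC: "R \<in> Cc" unfolding R_def by (rule Cc_sum[OF \<tau>(1)]) (rule Cc_cmult[OF Ft])
    have cC: "cconv \<theta> (\<lambda>z. \<psi> (- x + z)) \<in> Cc" by (rule cconv_properties(1)[OF \<theta> tr])
    have Fi: "integrable \<mu> (\<lambda>y. \<theta> y * F (y, z))" for z
      using Cc_integrable[OF Cc_mult[OF \<theta> continuous_section(2)[OF Fc, of z]]] by (simp add: mult.commute)
    have e1: "\<bar>cconv \<theta> (\<lambda>z. \<psi> (- x + z)) z - R z\<bar> \<le> e * n\<theta>" for z
      unfolding cF R_def c_def n\<theta>_def
      by (rule riemann_error[where K = K and G = "\<lambda>y. F (y, z)", OF \<theta>i K(2) Fi \<tau>(1,2) \<tau>F]) auto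
    \<comment> \<open>The Riemann sum keeps its support in \<open>M\<close>: a value of
      \<open>\<tau>\<close> not taken on \<open>K\<close> has weight 0, and the other values lie in
      \<open>K\<close>. Thus a uniform error gives an \<open>L^1\<close> error.\<close>
    have Rz: "cconv \<theta> (\<lambda>z. \<psi> (- x + z)) z - R z = 0" if "z \<notin> M" for z
    proof -
      have "\<theta> y * F (y, z) = 0" for y using Fz[of y z] K(2)[of y] that by (cases "y \<in> K") auto
      then have "cconv \<theta> (\<lambda>z. \<psi> (- x + z)) z = 0" unfolding cF by (simp only:) simp
      moreover have "c p * F (p, z) = 0" for p
      proof (cases "p \<in> \<tau> ` K")
        case True then show ?thesis using Fz \<tau>(4) that by auto
      next
        case False
        then have "\<theta> y * indicator {w. \<tau> w = p} y = 0" for y using K(2)[of y] by (cases "y \<in> K") (auto simp: indicator_def)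
        then have "c p = 0" unfolding c_def by (simp only:) simp
        then show ?thesis by simp
      qed
      then have "R z = 0" unfolding R_def by (simp only:) simp
      ultimately show ?thesis by simp
    qed
    have "\<bar>X - l R\<bar> = \<bar>l (\<lambda>z. cconv \<theta> (\<lambda>z. \<psi> (- x + z)) z - R z)\<bar>"
      unfolding X_def using linear_on_space_diff[OF fsC l cC RC] by simp
    also have "\<dots> \<le> (\<integral>z. \<bar>cconv \<theta> (\<lambda>z. \<psi> (- x + z)) z - R z\<bar> \<partial>\<mu>)" by (rule lb[OF Cc_diff[OF cC RC]])
    also have "\<dots> \<le> (e * n\<theta>) * measure \<mu> M"
      by (rule integrable_compact_support(2)[OF Cc_measurable[OF Cc_diff[OF cC RC]] M]) (use e1 Rz in auto)
    finally have 1: "\<bar>X - l R\<bar> \<le> b * e" by (simp add: b_def ac_simps)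
    have lR: "l R = (\<Sum>p\<in>range \<tau>. c p * h (p + x))"
    proof -
      have "l R = (\<Sum>p\<in>range \<tau>. l (\<lambda>z. c p * F (p, z)))"
        unfolding R_def by (rule linear_on_space_sum[OF fsC l \<tau>(1)]) (rule Cc_cmult[OF Ft])
      then show ?thesis using linear_on_spaceD(2)[OF l Ft] by (simp add: hF)
    qed
    have hm: "(\<lambda>y. h (y + x)) \<in> borel_measurable \<mu>"
      by (rule borel_measurable_continuous_haar, rule continuous_on_compose2[OF hc]) (auto intro!: continuous_intros)
    have le: "\<bar>h (y + x) - h (\<tau> y + x)\<bar> \<le> e * measure \<mu> M" if y: "y \<in> K" for y
    proof -
      have "\<bar>h (y + x) - h (\<tau> y + x)\<bar> \<le> (\<integral>z. \<bar>F (y, z) - F (\<tau> y, z)\<bar> \<partial>\<mu>)"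
        using hd[of "y + x" "\<tau> y + x"] by (simp add: F_def)
      also have "\<dots> \<le> e * measure \<mu> M"
        by (rule integrable_compact_support(2)[OF Cc_measurable[OF Cc_diff[OF Ft Ft]] M])
           (use \<tau>F[OF y] Fz[OF y] Fz[OF \<tau>(4)[OF y]] in auto)
      finally show ?thesis .
    qed
    have "\<bar>Y - l R\<bar> \<le> (e * measure \<mu> M) * n\<theta>"
      unfolding Y_def lR c_def n\<theta>_def
      by (rule riemann_error[where K = K and G = "\<lambda>y. h (y + x)", OF \<theta>i K(2) weighted_integral_bound(1)[OF \<theta>i hm hb] \<tau>(1,2) le]) auto
    then have 2: "\<bar>Y - l R\<bar> \<le> b * e" by (simp add: b_def ac_simps)
    from 1 2 have "\<bar>X - Y\<bar> \<le> b * e + b * e" by linarith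
    then show ?thesis by simp
  qed
  have "\<bar>X - Y\<bar> \<le> 0 + d" if d: "d > 0" for d
  proof -
    have "2 * b * (d / (2 * b + 1)) \<le> d" using b0 d by (simp add: field_simps)
    then show ?thesis using main[of "d / (2 * b + 1)"] b0 d by (simp add: add_nonneg_pos)
  qed
  then have "\<bar>X - Y\<bar> \<le> 0" by (rule field_le_epsilon)
  then show "l (cconv \<theta> (\<lambda>z. \<psi> (- x + z))) = (\<integral>y. \<theta> y * h (y + x) \<partial>\<mu>)" by (simp add: X_def Y_def)
qed

text \<open>A separation argument. If the inequality fails for every nonnegative \<open>q\<close>,
  the families \<open>W q\<close> stay away from 0 in the sense of \<open>HW\<close>, and
  Hahn-Banach gives a functional \<open>l\<close> bounded by \<open>nv\<close> with
  \<open>l (W q)\<close> at least \<open>e\<close> times the integral of \<open>q\<close>. Tested on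
  the translates of one bump, this makes the sum of the functions \<open>Q a\<close> at least
  \<open>e\<close> everywhere, although the mean annihilates each of them.\<close>

lemma reiter_finite:
  fixes B :: "'g set"
  assumes m: "invariant_mean m" and B: "finite B" and e: "e > 0"
    and \<theta>: "\<And>a. a \<in> B \<Longrightarrow> \<theta> a \<in> Cc" "\<And>a. a \<in> B \<Longrightarrow> (\<integral>y. \<theta> a y \<partial>\<mu>) = 0"
  shows "\<exists>q\<in>Cc. (\<forall>x. q x \<ge> 0) \<and> (\<Sum>a\<in>B. \<integral>z. \<bar>cconv (\<theta> a) q z\<bar> \<partial>\<mu>) < e * (\<integral>z. q z \<partial>\<mu>)"
proof (rule ccontr)
  define Cp where "Cp = {q\<in>Cc. \<forall>x. q x \<ge> 0}"
  assume "\<not> ?thesis"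
  then have H: "e * (\<integral>z. q z \<partial>\<mu>) \<le> (\<Sum>a\<in>B. \<integral>z. \<bar>cconv (\<theta> a) q z\<bar> \<partial>\<mu>)" if "q \<in> Cp" for q
    using that by (force simp: Cp_def not_less)
  \<comment> \<open>A family indexed by \<open>B\<close> is coded as a single function of pairs, so
    that \<open>V\<close> is a function space; \<open>nv\<close> sees only first coordinates in
    \<open>B\<close>.\<close>
  define V where "V = {v::'g\<times>'g\<Rightarrow>real. \<forall>a. (\<lambda>z. v (a, z)) \<in> Cc}"
  have V: "function_space V" unfolding function_space_def V_def
    by (auto intro!: Cc_add Cc_cmult exI[of _ "\<lambda>_. 0"] Cc_zero)
  define nv where "nv = (\<lambda>v::'g\<times>'g\<Rightarrow>real. \<Sum>a\<in>B. \<integral>z. \<bar>v (a, z)\<bar> \<partial>\<mu>)"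
  have nv_add: "nv (\<lambda>p. v p + w p) \<le> nv v + nv w" if "v \<in> V" "w \<in> V" for v w
    unfolding nv_def sum.distrib[symmetric]
  proof (rule sum_mono)
    fix a
    have c: "(\<lambda>z. v (a, z)) \<in> Cc" "(\<lambda>z. w (a, z)) \<in> Cc" using that by (auto simp: V_def)
    have i: "integrable \<mu> (\<lambda>z. \<bar>v (a, z)\<bar>)" "integrable \<mu> (\<lambda>z. \<bar>w (a, z)\<bar>)" using Cc_integrable[OF c(1)] Cc_integrable[OF c(2)] by auto
    have "(\<integral>z. \<bar>v (a, z) + w (a, z)\<bar> \<partial>\<mu>) \<le> (\<integral>z. \<bar>v (a, z)\<bar> + \<bar>w (a, z)\<bar> \<partial>\<mu>)"
      by (rule integral_mono) (use i Cc_integrable[OF Cc_add[OF c]] in auto)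
    then show "(\<integral>z. \<bar>v (a, z) + w (a, z)\<bar> \<partial>\<mu>) \<le> (\<integral>z. \<bar>v (a, z)\<bar> \<partial>\<mu>) + (\<integral>z. \<bar>w (a, z)\<bar> \<partial>\<mu>)" using i by simp
  qed
  have nv_sc: "nv (\<lambda>p. c * v p) = \<bar>c\<bar> * nv v" for c v
    unfolding nv_def by (simp add: abs_mult sum_distrib_left)
  define W where "W = (\<lambda>q (p::'g\<times>'g). if fst p \<in> B then cconv (\<theta> (fst p)) q (snd p) else 0)"
  have WV: "W q \<in> V" if "q \<in> Cp" for q
    unfolding V_def W_def
  proof (intro CollectI allI)
    fix a
    show "(\<lambda>z. if fst (a, z) \<in> B then cconv (\<theta> (fst (a, z))) q (snd (a, z)) else 0) \<in> Cc"
      using that cconv_properties(1)[OF \<theta>(1), of a q] by (cases "a \<in> B") (auto simp: Cp_def Cc_zero)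
  qed
  have W_add: "W (\<lambda>x. q x + r x) = (\<lambda>p. W q p + W r p)" if "q \<in> Cp" "r \<in> Cp" for q r
    using that cconv_linear_right(1)[OF \<theta>(1)] unfolding W_def Cp_def by auto
  have W_sc: "W (\<lambda>x. c * q x) = (\<lambda>p. c * W q p)" if "q \<in> Cp" for c q
    using that cconv_linear_right(2)[OF \<theta>(1)] unfolding W_def Cp_def by auto
  have Cp_add: "(\<lambda>x. q x + r x) \<in> Cp" if "q \<in> Cp" "r \<in> Cp" for q r using that by (auto simp: Cp_def Cc_add)
  have Cp_sc: "(\<lambda>x. c * q x) \<in> Cp" if "q \<in> Cp" "c \<ge> 0" for q and c :: real using that by (auto simp: Cp_def Cc_cmult)
  have Cp0: "(\<lambda>_. 0) \<in> Cp" by (simp add: Cp_def Cc_zero)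
  have HW: "e * (\<integral>z. q z \<partial>\<mu>) \<le> nv (W q)" if "q \<in> Cp" for q using H[OF that] by (simp add: nv_def W_def)
  define P where "P = (\<lambda>v q. nv (\<lambda>p. v p + W q p) - e * (\<integral>z. q z \<partial>\<mu>))"
  \<comment> \<open>The choice \<open>q = 0\<close> gives \<open>pf \<le> nv\<close>, and at
    \<open>v = - W q\<close> the same \<open>q\<close> gives the value \<open>- e\<close> times its
    integral. A linear functional below \<open>pf\<close> therefore has both properties wanted of
    \<open>l\<close>.\<close>
  define pf where "pf = (\<lambda>v. INF q\<in>Cp. P v q)"
  have low: "- nv v \<le> P v q" if "v \<in> V" "q \<in> Cp" for v q
  proof -
    have a: "(\<lambda>p. v p + W q p) \<in> V" by (rule function_spaceD(1)[OF V that(1) WV[OF that(2)]])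
    have b: "(\<lambda>p. (-1) * v p) \<in> V" by (rule function_spaceD(2)[OF V that(1)])
    have "nv (W q) \<le> nv (\<lambda>p. v p + W q p) + nv v" using nv_add[OF a b] nv_sc[of "-1" v] by simp
    then show ?thesis using HW[OF that(2)] by (simp add: P_def)
  qed
  have bdd: "bdd_below (P v ` Cp)" if "v \<in> V" for v using low[OF that] by (intro bdd_belowI2[of _ "- nv v"]) auto
  have pf_le: "pf v \<le> P v q" if "v \<in> V" "q \<in> Cp" for v q unfolding pf_def by (rule cINF_lower[OF bdd[OF that(1)] that(2)])
  have pf_ge: "c \<le> pf v" if "\<And>q. q \<in> Cp \<Longrightarrow> c \<le> P v q" for c v unfolding pf_def by (rule cINF_greatest) (use Cp0 that in auto)
  have Cpi: "integrable \<mu> q" if "q \<in> Cp" for q using that Cc_integrable by (auto simp: Cp_def)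
  have "sublinear_on V pf"
    unfolding sublinear_on_def
  proof (intro conjI ballI allI impI)
    fix v w assume vw: "v \<in> V" "w \<in> V"
    have 1: "pf (\<lambda>p. v p + w p) \<le> P v q + P w r" if "q \<in> Cp" "r \<in> Cp" for q r
    proof -
      have a: "(\<lambda>p. v p + W q p) \<in> V" "(\<lambda>p. w p + W r p) \<in> V"
        by (rule function_spaceD(1)[OF V]; use vw WV that in auto)+
      have "pf (\<lambda>p. v p + w p) \<le> P (\<lambda>p. v p + w p) (\<lambda>x. q x + r x)"
        by (rule pf_le[OF function_spaceD(1)[OF V vw] Cp_add[OF that]])
      also have "\<dots> = nv (\<lambda>p. (v p + W q p) + (w p + W r p)) - e * ((\<integral>z. q z \<partial>\<mu>) + (\<integral>z. r z \<partial>\<mu>))"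
        unfolding P_def W_add[OF that] using Cpi[OF that(1)] Cpi[OF that(2)] by (simp add: ac_simps)
      also have "\<dots> \<le> P v q + P w r" unfolding P_def using nv_add[OF a] by (simp add: distrib_left)
      finally show ?thesis .
    qed
    have 2: "pf (\<lambda>p. v p + w p) - P v q \<le> pf w" if q: "q \<in> Cp" for q by (rule pf_ge, drule 1[OF q], linarith)
    have "pf (\<lambda>p. v p + w p) - pf w \<le> pf v" by (rule pf_ge, drule 2, linarith)
    then show "pf (\<lambda>p. v p + w p) \<le> pf v + pf w" by simp
  next
    have le: "pf (\<lambda>p. c * v p) \<le> c * pf v" if c: "c > 0" and v: "v \<in> V" for c :: real and v
    proof -
      have "pf (\<lambda>p. c * v p) / c \<le> pf v"
      proof (rule pf_ge)
        fix q assume q: "q \<in> Cp"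
        have "pf (\<lambda>p. c * v p) \<le> P (\<lambda>p. c * v p) (\<lambda>x. c * q x)"
          by (rule pf_le[OF function_spaceD(2)[OF V v] Cp_sc[OF q]]) (use c in simp)
        also have "\<dots> = nv (\<lambda>p. c * (v p + W q p)) - c * (e * (\<integral>z. q z \<partial>\<mu>))"
          unfolding P_def W_sc[OF q] by (simp add: distrib_left)
        also have "\<dots> = c * P v q" unfolding nv_sc P_def using c by (simp add: right_diff_distrib)
        finally show "pf (\<lambda>p. c * v p) / c \<le> P v q" using c by (simp add: field_simps)
      qed
      then show ?thesis using c by (simp add: field_simps)
    qed
    fix c :: real and v assume c: "0 \<le> c" and v: "v \<in> V"
    show "pf (\<lambda>p. c * v p) = c * pf v"
    proof (cases "c = 0")
      case True
      have z: "(\<lambda>_. 0) \<in> V" by (rule function_space_zero[OF V])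
      have nv0: "nv (\<lambda>_. 0) = 0" by (simp add: nv_def)
      have W0: "W (\<lambda>_. 0) = (\<lambda>_. 0)" using W_sc[OF Cp0, of 0] by simp
      have "pf (\<lambda>_. 0) \<le> 0" using pf_le[OF z Cp0] by (simp add: P_def W0 nv0)
      moreover have "0 \<le> pf (\<lambda>_. 0)" by (rule pf_ge) (use low[OF z] nv0 in simp)
      ultimately show ?thesis using True by simp
    next
      case False
      with c have cp: "c > 0" by simp
      have "pf (\<lambda>p. (1/c) * (c * v p)) \<le> (1/c) * pf (\<lambda>p. c * v p)"
        by (rule le) (use cp function_spaceD(2)[OF V v] in auto)
      then have "c * pf v \<le> pf (\<lambda>p. c * v p)" using cp by (simp add: field_simps)
      then show ?thesis using le[OF cp v] by simp
    qed
  qed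
  then obtain l where l: "linear_on_space V l" "\<And>v. v \<in> V \<Longrightarrow> l v \<le> pf v" using hahn_banach_sublinear[OF V] by blast
  have l_nv: "\<bar>l v\<bar> \<le> nv v" if v: "v \<in> V" for v
  proof -
    have W0: "W (\<lambda>_. 0) = (\<lambda>_. 0)" using W_sc[OF Cp0, of 0] by simp
    have 1: "l v \<le> nv v" if "v \<in> V" for v using l(2)[OF that] pf_le[OF that Cp0] by (simp add: P_def W0)
    have mv: "(\<lambda>p. (-1) * v p) \<in> V" by (rule function_spaceD(2)[OF V v])
    have "l (\<lambda>p. (-1) * v p) \<le> nv (\<lambda>p. (-1) * v p)" by (rule 1[OF mv])
    then have "- l v \<le> nv v" using linear_on_spaceD(2)[OF l(1) v, of "-1"] nv_sc[of "-1" v] by simp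
    then show ?thesis using 1[OF v] by (simp add: abs_le_iff)
  qed
  have l_W: "e * (\<integral>z. q z \<partial>\<mu>) \<le> l (W q)" if q: "q \<in> Cp" for q
  proof -
    have mv: "(\<lambda>p. (-1) * W q p) \<in> V" by (rule function_spaceD(2)[OF V WV[OF q]])
    have "l (\<lambda>p. (-1) * W q p) \<le> P (\<lambda>p. (-1) * W q p) q" using l(2)[OF mv] pf_le[OF mv q] by simp
    also have "\<dots> = - e * (\<integral>z. q z \<partial>\<mu>)" by (simp add: P_def nv_def)
    finally show ?thesis using linear_on_spaceD(2)[OF l(1) WV[OF q], of "-1"] by simp
  qed
  define emb where "emb = (\<lambda>a f (p::'g\<times>'g). if fst p = a then f (snd p) else 0 :: real)"
  have embV: "emb a f \<in> V" if "f \<in> Cc" for a f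
    unfolding V_def emb_def
  proof (intro CollectI allI)
    fix b
    show "(\<lambda>z. if fst (b, z) = a then f (snd (b, z)) else 0) \<in> Cc" using that by (cases "b = a") (auto simp: Cc_zero)
  qed
  define la where "la = (\<lambda>a f. l (emb a f))"
  have la_lin: "linear_on_space Cc (la a)" for a
    unfolding linear_on_space_def
  proof (intro conjI ballI allI)
    fix f g assume fg: "f \<in> Cc" "g \<in> Cc"
    have "emb a (\<lambda>x. f x + g x) = (\<lambda>p. emb a f p + emb a g p)" by (auto simp: emb_def)
    then show "la a (\<lambda>x. f x + g x) = la a f + la a g" unfolding la_def using linear_on_spaceD(1)[OF l(1) embV[OF fg(1)] embV[OF fg(2)]] by simp
  next
    fix c f assume f: "f \<in> Cc"
    have "emb a (\<lambda>x. c * f x) = (\<lambda>p. c * emb a f p)" by (auto simp: emb_def)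
    then show "la a (\<lambda>x. c * f x) = c * la a f" unfolding la_def using linear_on_spaceD(2)[OF l(1) embV[OF f]] by simp
  qed
  have la_b: "\<bar>la a f\<bar> \<le> (\<integral>z. \<bar>f z\<bar> \<partial>\<mu>)" if a: "a \<in> B" and f: "f \<in> Cc" for a f
  proof -
    have "nv (emb a f) = (\<Sum>b\<in>B. if b = a then (\<integral>z. \<bar>f z\<bar> \<partial>\<mu>) else 0)"
      unfolding nv_def by (intro sum.cong) (auto simp: emb_def)
    also have "\<dots> = (\<integral>z. \<bar>f z\<bar> \<partial>\<mu>)" using B a by simp
    finally show ?thesis using l_nv[OF embV[OF f, of a]] by (simp add: la_def)
  qed
  obtain \<psi> where \<psi>: "\<psi> \<in> Cc" "\<And>x. \<psi> x \<ge> 0" "(\<integral>x. \<psi> x \<partial>\<mu>) = 1" by (rule bump_function[OF open_UNIV UNIV_I]) (rule that)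
  define h where "h = (\<lambda>a x. la a (\<lambda>z. \<psi> (- x + z)))"
  have hp: "continuous_on UNIV (h a)" "\<And>x. \<bar>h a x\<bar> \<le> (\<integral>z. \<bar>\<psi> z\<bar> \<partial>\<mu>)"
    "\<And>t x. t \<in> Cc \<Longrightarrow> la a (cconv t (\<lambda>z. \<psi> (- x + z))) = (\<integral>y. t y * h a (y + x) \<partial>\<mu>)" if "a \<in> B" for a
    using L1_functional_of_cconv[OF la_lin[of a] la_b[OF that] \<psi>(1)] unfolding h_def by auto
  define Q where "Q = (\<lambda>a x. \<integral>y. \<theta> a y * h a (y + x) \<partial>\<mu>)"
  have QL: "Q a \<in> Linf \<mu>" if a: "a \<in> B" for a
  proof -
    have hm: "(\<lambda>y. h a (y + x)) \<in> borel_measurable \<mu>" for x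
      by (rule borel_measurable_continuous_haar, rule continuous_on_compose2[OF hp(1)[OF a]]) (auto intro!: continuous_intros)
    show ?thesis unfolding Q_def
      by (rule Linf_continuous[OF average_continuous(1)[OF \<theta>(1)[OF a] hp(1)[OF a]] weighted_integral_bound(2)[OF Cc_integrable[OF \<theta>(1)[OF a]] hm hp(2)[OF a]]])
  qed
  have sQ: "e \<le> (\<Sum>a\<in>B. 1 * Q a x)" for x
  proof -
    have q: "(\<lambda>z. \<psi> (- x + z)) \<in> Cp" using Cc_translate[OF \<psi>(1)] \<psi>(2) by (simp add: Cp_def)
    have "W (\<lambda>z. \<psi> (- x + z)) = (\<lambda>p. \<Sum>a\<in>B. emb a (cconv (\<theta> a) (\<lambda>z. \<psi> (- x + z))) p)"
      using B by (auto simp: W_def emb_def)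
    then have "l (W (\<lambda>z. \<psi> (- x + z))) = (\<Sum>a\<in>B. l (emb a (cconv (\<theta> a) (\<lambda>z. \<psi> (- x + z)))))"
      using linear_on_space_sum[OF V l(1) B, of "\<lambda>a. emb a (cconv (\<theta> a) (\<lambda>z. \<psi> (- x + z)))"]
        embV[OF cconv_properties(1)[OF \<theta>(1) Cc_translate[OF \<psi>(1)]]] by simp
    also have "\<dots> = (\<Sum>a\<in>B. 1 * Q a x)" by (intro sum.cong) (use hp(3) \<theta>(1) in \<open>auto simp: Q_def la_def\<close>)
    finally show ?thesis using l_W[OF q] integral_translate[OF Cc_measurable[OF \<psi>(1)], of "- x"] \<psi>(3) by simp
  qed
  note ms = mean_sum[OF m B, of Q "\<lambda>_. 1", OF QL]
  have "m (Q a) = 0" if a: "a \<in> B" for a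
    unfolding Q_def by (rule mean_annihilates_average[OF m \<theta>(1)[OF a] \<theta>(2)[OF a] hp(1)[OF a] hp(2)[OF a]])
  then have mz: "m (\<lambda>x. \<Sum>a\<in>B. 1 * Q a x) = 0" using ms by simp
  have o: "(\<lambda>_. 1) \<in> Linf \<mu>" by (rule LinfI[of _ 1]) auto
  have "0 \<le> m (\<lambda>x. 1 * (\<Sum>a\<in>B. 1 * Q a x) + (- e) * 1)"
  proof (rule invariant_meanD(2)[OF m Linf_lincomb[OF conjunct1[OF ms] o]])
    show "0 \<le> 1 * (\<Sum>a\<in>B. 1 * Q a x) + (- e) * 1" for x using sQ[of x] by linarith
  qed auto
  also have "\<dots> = - e" using invariant_meanD(1)[OF m conjunct1[OF ms] o, of 1 "- e"] mz invariant_meanD(3)[OF m] by simp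
  finally show False using e by simp
qed

text \<open>Convolution with a fixed \<open>\<eta>\<close> upgrades a finite set of translations to
  a compact one. In \<open>L^1\<close> the translates of \<open>\<eta>\<close> by \<open>K\<close>
  are within \<open>e/2\<close> of finitely many of them, and for these the finite version, applied
  to the functions \<open>\<theta> a\<close> of integral 0, supplies the other
  \<open>e/2\<close>.\<close>

theorem reiter_compact:
  assumes "amenable \<mu>" and K: "compact K" and e: "e > 0"
  obtains k where "k \<in> Cc" "\<And>x. k x \<ge> 0" "(\<integral>x. k x \<partial>\<mu>) = 1" "\<And>y. y \<in> K \<Longrightarrow> (\<integral>w. \<bar>k (y + w) - k w\<bar> \<partial>\<mu>) \<le> e"
proof -
  obtain m where m: "invariant_mean m" using assms(1) unfolding amenable_def invariant_mean_def by blast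
  obtain \<eta> where \<eta>: "\<eta> \<in> Cc" "\<And>x. \<eta> x \<ge> 0" "(\<integral>x. \<eta> x \<partial>\<mu>) = 1" by (rule bump_function[OF open_UNIV UNIV_I]) (rule that)
  have e2: "e / 2 > 0" using e by simp
  obtain \<tau> where \<tau>: "finite (range \<tau>)" "\<And>p. {w. \<tau> w = p} \<in> sets borel"
    "\<And>y. y \<in> K \<Longrightarrow> (\<integral>t. \<bar>\<eta> (y + t) - \<eta> (\<tau> y + t)\<bar> \<partial>\<mu>) \<le> e / 2"
    by (rule rounding_for_L1[OF \<eta>(1) K e2]) (rule that)
  define \<theta> where "\<theta> = (\<lambda>a y. \<eta> (a + y) - \<eta> y)"
  have \<theta>: "\<theta> a \<in> Cc" for a unfolding \<theta>_def by (rule Cc_diff[OF Cc_translate[OF \<eta>(1)] \<eta>(1)])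
  have \<theta>0: "(\<integral>y. \<theta> a y \<partial>\<mu>) = 0" for a
    unfolding \<theta>_def using integral_translate[OF Cc_measurable[OF \<eta>(1)], of a] Cc_integrable[OF \<eta>(1)] Cc_integrable[OF Cc_translate[OF \<eta>(1)]] by simp
  obtain q where q: "q \<in> Cc" "\<And>x. q x \<ge> 0" "(\<Sum>a\<in>range \<tau>. \<integral>z. \<bar>cconv (\<theta> a) q z\<bar> \<partial>\<mu>) < (e / 2) * (\<integral>z. q z \<partial>\<mu>)"
    using reiter_finite[OF m \<tau>(1) e2, of \<theta>] \<theta> \<theta>0 by blast
  have "0 \<le> (\<Sum>a\<in>range \<tau>. \<integral>z. \<bar>cconv (\<theta> a) q z\<bar> \<partial>\<mu>)" by (intro sum_nonneg) simp
  then have "0 < (e / 2) * (\<integral>z. q z \<partial>\<mu>)" using q(3) by linarith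
  then have qp: "(\<integral>z. q z \<partial>\<mu>) > 0" using e by (simp add: zero_less_mult_iff)
  define s where "s = 1 / (\<integral>z. q z \<partial>\<mu>)"
  have s: "s > 0" using qp by (simp add: s_def)
  define k0 where "k0 = (\<lambda>x. s * q x)"
  have k0: "k0 \<in> Cc" "\<And>x. k0 x \<ge> 0" "(\<integral>x. k0 x \<partial>\<mu>) = 1"
  proof -
    show "k0 \<in> Cc" unfolding k0_def by (rule Cc_cmult[OF q(1)])
    show "k0 x \<ge> 0" for x using q(2) s by (simp add: k0_def)
    show "(\<integral>x. k0 x \<partial>\<mu>) = 1" using qp by (simp add: k0_def s_def)
  qed
  have one: "(\<integral>z. \<bar>cconv (\<theta> a) k0 z\<bar> \<partial>\<mu>) \<le> e / 2" if a: "a \<in> range \<tau>" for a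
  proof -
    have "(\<integral>z. \<bar>cconv (\<theta> a) k0 z\<bar> \<partial>\<mu>) = s * (\<integral>z. \<bar>cconv (\<theta> a) q z\<bar> \<partial>\<mu>)"
      unfolding k0_def cconv_linear_right(2)[OF \<theta> q(1) q(1)] using s by (simp add: abs_mult)
    also have "(\<integral>z. \<bar>cconv (\<theta> a) q z\<bar> \<partial>\<mu>) \<le> (\<Sum>a\<in>range \<tau>. \<integral>z. \<bar>cconv (\<theta> a) q z\<bar> \<partial>\<mu>)"
      by (rule member_le_sum[OF a]) (use \<tau>(1) in auto)
    also note q(3)
    finally have "(\<integral>z. \<bar>cconv (\<theta> a) k0 z\<bar> \<partial>\<mu>) \<le> s * ((e / 2) * (\<integral>z. q z \<partial>\<mu>))" using s by simp
    also have "\<dots> = e / 2" using qp by (simp add: s_def)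
    finally show ?thesis .
  qed
  show ?thesis
  proof (rule that[of "cconv \<eta> k0"])
    show "cconv \<eta> k0 \<in> Cc" by (rule cconv_properties(1)[OF \<eta>(1) k0(1)])
    show "cconv \<eta> k0 x \<ge> 0" for x unfolding cconv_def using \<eta>(2) k0(2) by simp
    show "(\<integral>x. cconv \<eta> k0 x \<partial>\<mu>) = 1" using cconv_properties(2)[OF \<eta>(1) k0(1)] \<eta>(3) k0(3) by simp
    fix y assume y: "y \<in> K"
    define d where "d = (\<lambda>t. \<eta> (y + t) - \<eta> (\<tau> y + t))"
    have d: "d \<in> Cc" unfolding d_def by (rule Cc_diff[OF Cc_translate[OF \<eta>(1)] Cc_translate[OF \<eta>(1)]])
    have dn: "(\<integral>t. \<bar>d t\<bar> \<partial>\<mu>) \<le> e / 2" using \<tau>(3)[OF y] by (simp add: d_def)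
    have eq: "cconv \<eta> k0 (y + w) - cconv \<eta> k0 w = cconv d k0 w + cconv (\<theta> (\<tau> y)) k0 w" for w
      unfolding cconv_translate[OF \<eta>(1) k0(1)] d_def \<theta>_def
      by (simp add: cconv_diff[OF Cc_translate[OF \<eta>(1)] Cc_translate[OF \<eta>(1)] k0(1)] cconv_diff[OF Cc_translate[OF \<eta>(1)] \<eta>(1) k0(1)])
    have i: "integrable \<mu> (\<lambda>w. \<bar>cconv d k0 w\<bar>)" "integrable \<mu> (\<lambda>w. \<bar>cconv (\<theta> (\<tau> y)) k0 w\<bar>)"
      using Cc_integrable[OF cconv_properties(1)[OF d k0(1)]] Cc_integrable[OF cconv_properties(1)[OF \<theta> k0(1)]] by auto
    have "(\<integral>w. \<bar>cconv \<eta> k0 (y + w) - cconv \<eta> k0 w\<bar> \<partial>\<mu>) \<le> (\<integral>w. \<bar>cconv d k0 w\<bar> + \<bar>cconv (\<theta> (\<tau> y)) k0 w\<bar> \<partial>\<mu>)"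
      unfolding eq by (rule integral_mono)
        (use i Cc_integrable[OF Cc_add[OF cconv_properties(1)[OF d k0(1)] cconv_properties(1)[OF \<theta> k0(1)]]] in auto)
    also have "\<dots> = (\<integral>w. \<bar>cconv d k0 w\<bar> \<partial>\<mu>) + (\<integral>w. \<bar>cconv (\<theta> (\<tau> y)) k0 w\<bar> \<partial>\<mu>)" using i by simp
    also have "(\<integral>w. \<bar>cconv d k0 w\<bar> \<partial>\<mu>) \<le> (\<integral>t. \<bar>d t\<bar> \<partial>\<mu>) * (\<integral>x. k0 x \<partial>\<mu>)" by (rule cconv_L1_bound[OF d k0(1,2)])
    also have "\<dots> \<le> e / 2" using dn k0(3) by simp
    also have "(\<integral>w. \<bar>cconv (\<theta> (\<tau> y)) k0 w\<bar> \<partial>\<mu>) \<le> e / 2" by (rule one) simp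
    finally show "(\<integral>w. \<bar>cconv \<eta> k0 (y + w) - cconv \<eta> k0 w\<bar> \<partial>\<mu>) \<le> e" by simp
  qed
qed

end

section \<open>Rademacher averages and kernels\<close>

text \<open>The subgaussian bound for one sign. The exponent \<open>t\<^sup>2\<close> instead of its
  half follows from elementary bounds for \<open>exp\<close> and costs only constants.\<close>

lemma exp_symmetric_le: "exp t + exp (- t) \<le> 2 * exp (t\<^sup>2)" for t :: real
proof -
  have *: "exp t + exp (- t) \<le> 2 * exp (t\<^sup>2)" if t: "t \<ge> 0" for t :: real
  proof (cases "t \<le> 1")
    case True
    have "exp t \<le> 1 + t + t\<^sup>2" by (rule exp_bound[OF t True])
    moreover have "exp (- t) \<le> 1 - t + t\<^sup>2"
    proof -
      have "1 \<le> (1 - t + t\<^sup>2) * (1 + t)" using t by (simp add: power2_eq_square algebra_simps)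
      also have "\<dots> \<le> (1 - t + t\<^sup>2) * exp t"
        by (rule mult_left_mono[OF exp_ge_add_one_self]) (use True in simp)
      finally show ?thesis by (simp add: exp_minus field_simps)
    qed
    moreover have "1 + t\<^sup>2 \<le> exp (t\<^sup>2)" by (rule exp_ge_add_one_self)
    ultimately show ?thesis by linarith
  next
    case False
    then have "t \<le> t\<^sup>2" by (auto simp: power2_eq_square)
    moreover from this have "- t \<le> t\<^sup>2" using False by linarith
    ultimately have "t \<le> t\<^sup>2" "- t \<le> t\<^sup>2" by auto
    then have "exp t \<le> exp (t\<^sup>2)" "exp (- t) \<le> exp (t\<^sup>2)" by auto
    then show ?thesis by linarith
  qed
  show ?thesis using *[of t] *[of "- t"] by (cases "t \<ge> 0") auto
qed

text \<open>A vector of signs on \<open>I\<close> is coded as the set \<open>E\<close> of indices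
  with sign +1, so that a sum over \<open>Pow I\<close> is an expectation up to the factor
  \<open>2 ^ card I\<close>.\<close>

definition rsign :: "'i set \<Rightarrow> 'i \<Rightarrow> real" where "rsign E i = (if i \<in> E then 1 else -1)"

lemma rsign_orthogonal:
  assumes "finite I" "i \<in> I" "j \<in> I"
  shows "(\<Sum>E\<in>Pow I. rsign E i * rsign E j) = (if i = j then 2 ^ card I else 0)"
proof (cases "i = j")
  case True
  have "(\<Sum>E\<in>Pow I. rsign E i * rsign E j) = (\<Sum>E\<in>Pow I. 1)" by (rule sum.cong) (auto simp: rsign_def True)
  then show ?thesis using True assms by (simp add: card_Pow)
next
  case False
  \<comment> \<open>Flipping the sign of \<open>i\<close> is an involution of \<open>Pow I\<close>
    that negates the product when \<open>j\<close> differs from \<open>i\<close>.\<close>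
  define t where "t = (\<lambda>E. if i \<in> E then E - {i} else insert i E)"
  have "(\<Sum>E\<in>Pow I. rsign E i * rsign E j) = (\<Sum>E\<in>Pow I. rsign (t E) i * rsign (t E) j)"
    by (rule sum.reindex_bij_witness[of _ t t]) (use assms in \<open>auto simp: t_def insert_absorb\<close>)
  also have "\<dots> = (\<Sum>E\<in>Pow I. - (rsign E i * rsign E j))"
    by (rule sum.cong) (use False in \<open>auto simp: t_def rsign_def\<close>)
  finally show ?thesis using False by (simp add: sum_negf)
qed

lemma rsign_exp_sum:
  assumes "finite I"
  shows "(\<Sum>E\<in>Pow I. exp (\<Sum>i\<in>I. rsign E i * t i)) = (\<Prod>i\<in>I. exp (t i) + exp (- t i))"
proof -
  have "(\<Prod>i\<in>I. exp (t i) + exp (- t i)) = (\<Sum>E\<in>Pow I. (\<Prod>i\<in>E. exp (t i)) * (\<Prod>i\<in>I-E. exp (- t i)))"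
    by (rule prod_add[OF assms])
  also have "\<dots> = (\<Sum>E\<in>Pow I. exp (\<Sum>i\<in>I. rsign E i * t i))"
  proof (rule sum.cong[OF refl])
    fix E assume E: "E \<in> Pow I"
    have "(\<Sum>i\<in>I. rsign E i * t i) = (\<Sum>i\<in>E. rsign E i * t i) + (\<Sum>i\<in>I-E. rsign E i * t i)"
      using E assms by (subst sum.subset_diff[of E]) auto
    also have "\<dots> = (\<Sum>i\<in>E. t i) + (\<Sum>i\<in>I-E. - t i)" by (intro arg_cong2[where f = "(+)"] sum.cong) (auto simp: rsign_def)
    finally show "(\<Prod>i\<in>E. exp (t i)) * (\<Prod>i\<in>I-E. exp (- t i)) = exp (\<Sum>i\<in>I. rsign E i * t i)"
      using E assms finite_subset[of E I] by (simp add: exp_add exp_sum)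
  qed
  finally show ?thesis by simp
qed

text \<open>The exponential of \<open>2 * \<bar>x\<bar>\<close> is at most
  \<open>exp (2 * x) + exp (- 2 * x)\<close>, each of which factorizes over the independent signs.
  The exponent 4 is the square of the coefficient 2, and the factor 2 counts the two
  exponentials.\<close>

lemma rsign_exp_moment:
  assumes I: "finite I" and t: "(\<Sum>i\<in>I. (t i)\<^sup>2) \<le> 1"
  shows "(\<Sum>E\<in>Pow I. exp (2 * \<bar>\<Sum>i\<in>I. rsign E i * t i\<bar>)) \<le> 2 ^ card I * (2 * exp 4)"
proof -
  have b: "(\<Sum>E\<in>Pow I. exp (\<Sum>i\<in>I. rsign E i * (s * t i))) \<le> 2 ^ card I * exp 4" if s: "s\<^sup>2 = 4" for s
  proof -
    have "(\<Sum>E\<in>Pow I. exp (\<Sum>i\<in>I. rsign E i * (s * t i))) = (\<Prod>i\<in>I. exp (s * t i) + exp (- (s * t i)))"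
      by (rule rsign_exp_sum[OF I])
    also have "\<dots> \<le> (\<Prod>i\<in>I. 2 * exp ((s * t i)\<^sup>2))"
      by (intro prod_mono conjI exp_symmetric_le) (simp add: add_nonneg_nonneg)
    also have "\<dots> = 2 ^ card I * exp (4 * (\<Sum>i\<in>I. (t i)\<^sup>2))"
      using I by (simp add: prod.distrib exp_sum[symmetric] power_mult_distrib s sum_distrib_left)
    also have "\<dots> \<le> 2 ^ card I * exp 4" using t by simp
    finally show ?thesis .
  qed
  have "(\<Sum>E\<in>Pow I. exp (2 * \<bar>\<Sum>i\<in>I. rsign E i * t i\<bar>)) \<le>
      (\<Sum>E\<in>Pow I. exp (\<Sum>i\<in>I. rsign E i * (2 * t i)) + exp (\<Sum>i\<in>I. rsign E i * ((-2) * t i)))"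
  proof (rule sum_mono)
    fix E
    define x where "x = (\<Sum>i\<in>I. rsign E i * t i)"
    have *: "(\<Sum>i\<in>I. rsign E i * (s * t i)) = s * x" for s by (simp add: x_def sum_distrib_left mult.left_commute)
    show "exp (2 * \<bar>\<Sum>i\<in>I. rsign E i * t i\<bar>) \<le> exp (\<Sum>i\<in>I. rsign E i * (2 * t i)) + exp (\<Sum>i\<in>I. rsign E i * ((-2) * t i))"
      unfolding * x_def[symmetric] by (cases "x \<ge> 0") (simp_all add: add_increasing add_increasing2)
  qed
  also have "\<dots> \<le> 2 ^ card I * exp 4 + 2 ^ card I * exp 4"
    unfolding sum.distrib by (intro add_mono b) auto
  also have "\<dots> = 2 ^ card I * (2 * exp 4)" by simp
  finally show ?thesis .
qed

context orlicz_setup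
begin

text \<open>Pulling \<open>R\<close> out of \<open>\<Theta>\<close> costs
  \<open>exp \<bar>R y\<bar>\<close>, and the Cauchy-Schwarz inequality with the weight
  \<open>\<Theta> (cmod (f y))\<close> trades this for the exponential of
  \<open>2 * \<bar>R y\<bar>\<close>. The gain is the square root: later the bounds for the two
  factors of a tensor are multiplied, and only first moments of \<open>x\<close> are under
  control.\<close>

lemma modular_mult_bound:
  assumes y: "young_function \<Theta>" and C: "C \<ge> 1" "\<And>l s. l \<ge> 0 \<Longrightarrow> s \<ge> 0 \<Longrightarrow> \<Theta> (l * s) \<le> C * exp l * \<Theta> s"
    and f[measurable]: "f \<in> borel_measurable \<mu>" and R[measurable]: "R \<in> borel_measurable \<mu>"
    and m: "modular \<Theta> f \<le> 1"
    and x: "x \<ge> 0" "(\<integral>\<^sup>+ y. ennreal (\<Theta> (cmod (f y)) * exp (2 * \<bar>R y\<bar>)) \<partial>\<mu>) \<le> ennreal x"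
  shows "(\<integral>\<^sup>+ y. ennreal (\<Theta> (cmod (f y * complex_of_real (R y)))) \<partial>\<mu>) \<le> ennreal (C * sqrt x)"
proof -
  note [measurable] = young_measurable[OF y]
  have nn: "\<Theta> s \<ge> 0" for s by (rule young_functionD(4)[OF y])
  define Y where "Y = (\<integral>\<^sup>+ y. ennreal (\<Theta> (cmod (f y)) * exp \<bar>R y\<bar>) \<partial>\<mu>)"
  have "Y = (\<integral>\<^sup>+ y. ennreal (sqrt (\<Theta> (cmod (f y)))) * ennreal (sqrt (\<Theta> (cmod (f y))) * exp \<bar>R y\<bar>) \<partial>\<mu>)"
    unfolding Y_def by (intro nn_integral_cong) (simp add: ennreal_mult[symmetric] nn mult.assoc[symmetric])
  then have "Y\<^sup>2 \<le> (\<integral>\<^sup>+ y. (ennreal (sqrt (\<Theta> (cmod (f y)))))\<^sup>2 \<partial>\<mu>) * (\<integral>\<^sup>+ y. (ennreal (sqrt (\<Theta> (cmod (f y))) * exp \<bar>R y\<bar>))\<^sup>2 \<partial>\<mu>)"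
    by (simp only:) (rule Cauchy_Schwarz_nn_integral; measurable)
  also have "(\<integral>\<^sup>+ y. (ennreal (sqrt (\<Theta> (cmod (f y)))))\<^sup>2 \<partial>\<mu>) = modular \<Theta> f"
    by (intro nn_integral_cong) (simp add: ennreal_power nn)
  also have "(\<integral>\<^sup>+ y. (ennreal (sqrt (\<Theta> (cmod (f y))) * exp \<bar>R y\<bar>))\<^sup>2 \<partial>\<mu>) = (\<integral>\<^sup>+ y. ennreal (\<Theta> (cmod (f y)) * exp (2 * \<bar>R y\<bar>)) \<partial>\<mu>)"
    by (intro nn_integral_cong) (simp add: ennreal_power nn power_mult_distrib exp_double[symmetric])
  also have "modular \<Theta> f * (\<integral>\<^sup>+ y. ennreal (\<Theta> (cmod (f y)) * exp (2 * \<bar>R y\<bar>)) \<partial>\<mu>) \<le> 1 * ennreal x"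
    by (rule mult_mono[OF m x(2)]) auto
  finally have Y2: "Y\<^sup>2 \<le> ennreal x" by simp
  have YB: "Y \<le> ennreal (sqrt x)"
  proof (rule ccontr)
    assume "\<not> Y \<le> ennreal (sqrt x)"
    then have lt: "ennreal (sqrt x) < Y" by simp
    have "Y < \<infinity>"
    proof (rule ccontr)
      assume "\<not> Y < \<infinity>"
      then have "Y = \<infinity>" by (metis infinity_ennreal_def top.not_eq_extremum)
      then show False using Y2 by (simp add: power2_eq_square ennreal_top_mult top_unique)
    qed
    then have YY: "Y = ennreal (enn2real Y)" by simp
    then have "sqrt x < enn2real Y" using lt x(1) by (metis ennreal_less_iff real_sqrt_ge_zero)
    then have "x < (enn2real Y)\<^sup>2" using x(1) by (metis real_sqrt_ge_zero real_sqrt_pow2 power_strict_mono pos2)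
    then have "ennreal x < ennreal ((enn2real Y)\<^sup>2)" using x(1) by (simp add: ennreal_less_iff)
    also have "\<dots> = Y\<^sup>2" by (subst (2) YY) (simp add: ennreal_power)
    finally show False using Y2 by simp
  qed
  have "(\<integral>\<^sup>+ y. ennreal (\<Theta> (cmod (f y * complex_of_real (R y)))) \<partial>\<mu>) \<le> (\<integral>\<^sup>+ y. ennreal C * ennreal (\<Theta> (cmod (f y)) * exp \<bar>R y\<bar>) \<partial>\<mu>)"
  proof (rule nn_integral_mono)
    fix y
    have "\<Theta> (\<bar>R y\<bar> * cmod (f y)) \<le> C * exp \<bar>R y\<bar> * \<Theta> (cmod (f y))" by (rule C(2)) auto
    then show "ennreal (\<Theta> (cmod (f y * complex_of_real (R y)))) \<le> ennreal C * ennreal (\<Theta> (cmod (f y)) * exp \<bar>R y\<bar>)"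
      using C(1) nn by (subst ennreal_mult[symmetric]) (auto simp: norm_mult mult_ac intro!: ennreal_leI)
  qed
  also have "\<dots> = ennreal C * Y" unfolding Y_def by (rule nn_integral_cmult) measurable
  also have "\<dots> \<le> ennreal C * ennreal (sqrt x)" by (rule mult_left_mono[OF YB]) simp
  also have "\<dots> = ennreal (C * sqrt x)" using C(1) x(1) by (simp add: ennreal_mult)
  finally show ?thesis .
qed

text \<open>The sum over the signs is taken first, pointwise in \<open>y\<close>, where the moment
  bound is independent of the number of indices. The bound for a single choice of signs may be
  large; \<open>x E\<close> records it and is controlled on average only.\<close>

lemma rademacher_modular:
  fixes a :: "'i \<Rightarrow> 'g \<Rightarrow> real"
  assumes y: "young_function \<Theta>" and C: "C \<ge> 1" "\<And>l s. l \<ge> 0 \<Longrightarrow> s \<ge> 0 \<Longrightarrow> \<Theta> (l * s) \<le> C * exp l * \<Theta> s"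
    and f[measurable]: "f \<in> borel_measurable \<mu>" and m: "modular \<Theta> f \<le> 1"
    and I: "finite I" and a: "\<And>i. i \<in> I \<Longrightarrow> a i \<in> borel_measurable \<mu>" "\<And>y. (\<Sum>i\<in>I. (a i y)\<^sup>2) \<le> 1"
  obtains x where "\<And>E. E \<in> Pow I \<Longrightarrow> x E \<ge> 0" "(\<Sum>E\<in>Pow I. x E) \<le> 2 ^ card I * (2 * exp 4)"
    "\<And>E. E \<in> Pow I \<Longrightarrow> (\<integral>\<^sup>+ y. ennreal (\<Theta> (cmod (f y * complex_of_real (\<Sum>i\<in>I. rsign E i * a i y)))) \<partial>\<mu>) \<le> ennreal (C * sqrt (x E))"
proof -
  note [measurable] = young_measurable[OF y]
  have nn: "\<Theta> s \<ge> 0" for s by (rule young_functionD(4)[OF y])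
  define R where "R = (\<lambda>E y. \<Sum>i\<in>I. rsign E i * a i y)"
  have [measurable]: "R E \<in> borel_measurable \<mu>" for E unfolding R_def using a(1) by measurable
  define X where "X = (\<lambda>E. \<integral>\<^sup>+ y. ennreal (\<Theta> (cmod (f y)) * exp (2 * \<bar>R E y\<bar>)) \<partial>\<mu>)"
  have "(\<Sum>E\<in>Pow I. X E) = (\<integral>\<^sup>+ y. (\<Sum>E\<in>Pow I. ennreal (\<Theta> (cmod (f y)) * exp (2 * \<bar>R E y\<bar>))) \<partial>\<mu>)"
    unfolding X_def by (rule nn_integral_sum[symmetric]) measurable
  also have "\<dots> \<le> (\<integral>\<^sup>+ y. ennreal (2 ^ card I * (2 * exp 4)) * ennreal (\<Theta> (cmod (f y))) \<partial>\<mu>)"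
  proof (rule nn_integral_mono)
    fix y
    have "(\<Sum>E\<in>Pow I. ennreal (\<Theta> (cmod (f y)) * exp (2 * \<bar>R E y\<bar>))) = ennreal (\<Sum>E\<in>Pow I. \<Theta> (cmod (f y)) * exp (2 * \<bar>R E y\<bar>))"
      by (rule sum_ennreal) (simp add: nn)
    also have "(\<Sum>E\<in>Pow I. \<Theta> (cmod (f y)) * exp (2 * \<bar>R E y\<bar>)) = \<Theta> (cmod (f y)) * (\<Sum>E\<in>Pow I. exp (2 * \<bar>R E y\<bar>))"
      by (rule sum_distrib_left[symmetric])
    also have "\<dots> \<le> \<Theta> (cmod (f y)) * (2 ^ card I * (2 * exp 4))"
      unfolding R_def by (rule mult_left_mono[OF rsign_exp_moment[OF I a(2)] nn])
    finally show "(\<Sum>E\<in>Pow I. ennreal (\<Theta> (cmod (f y)) * exp (2 * \<bar>R E y\<bar>))) \<le> ennreal (2 ^ card I * (2 * exp 4)) * ennreal (\<Theta> (cmod (f y)))"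
      by (subst ennreal_mult[symmetric]) (auto simp: nn mult_ac intro: ennreal_leI)
  qed
  also have "\<dots> = ennreal (2 ^ card I * (2 * exp 4)) * modular \<Theta> f" by (rule nn_integral_cmult) measurable
  also have "\<dots> \<le> ennreal (2 ^ card I * (2 * exp 4)) * 1" by (rule mult_left_mono[OF m]) simp
  finally have XS: "(\<Sum>E\<in>Pow I. X E) \<le> ennreal (2 ^ card I * (2 * exp 4))" by simp
  have Xfin: "X E < \<infinity>" if "E \<in> Pow I" for E
  proof -
    have "X E \<le> (\<Sum>E\<in>Pow I. X E)" by (rule member_le_sum) (use that I in auto)
    also note XS
    also have "ennreal (2 ^ card I * (2 * exp 4)) < \<infinity>" by simp
    finally show ?thesis .
  qed
  have Xe: "X E = ennreal (enn2real (X E))" if "E \<in> Pow I" for E using Xfin[OF that] by simp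
  have "(\<Sum>E\<in>Pow I. X E) = (\<Sum>E\<in>Pow I. ennreal (enn2real (X E)))" by (rule sum.cong[OF refl Xe])
  also have "\<dots> = ennreal (\<Sum>E\<in>Pow I. enn2real (X E))" by (rule sum_ennreal) simp
  finally have "(\<Sum>E\<in>Pow I. X E) = ennreal (\<Sum>E\<in>Pow I. enn2real (X E))" .
  then have s: "(\<Sum>E\<in>Pow I. enn2real (X E)) \<le> 2 ^ card I * (2 * exp 4)" using XS by (simp add: ennreal_le_iff)
  show ?thesis
  proof (rule that[of "\<lambda>E. enn2real (X E)"])
    fix E assume E: "E \<in> Pow I"
    show "(\<integral>\<^sup>+ y. ennreal (\<Theta> (cmod (f y * complex_of_real (\<Sum>i\<in>I. rsign E i * a i y)))) \<partial>\<mu>) \<le> ennreal (C * sqrt (enn2real (X E)))"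
      by (rule modular_mult_bound[OF y C f _ m, where R = "\<lambda>y. \<Sum>i\<in>I. rsign E i * a i y"])
         (use Xe[OF E] a(1) in \<open>auto simp: X_def R_def\<close>)
  qed (use s in auto)
qed

lemma conv_check_bilinear:
  fixes a b :: "'i \<Rightarrow> 'g \<Rightarrow> complex"
  assumes I: "finite I" and fa: "\<And>i. i \<in> I \<Longrightarrow> a i \<in> L\<Phi>" and gb: "\<And>i. i \<in> I \<Longrightarrow> b i \<in> L\<Psi>"
  shows "conv_check \<mu> (\<lambda>y. \<Sum>i\<in>I. c i * a i y) (\<lambda>y. \<Sum>i\<in>I. d i * b i y) x =
    (\<Sum>i\<in>I. \<Sum>j\<in>I. c i * d j * conv_check \<mu> (a i) (b j) x)"
proof -
  have "conv_check \<mu> (\<lambda>y. \<Sum>i\<in>I. c i * a i y) (\<lambda>y. \<Sum>i\<in>I. d i * b i y) x =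
      (\<integral>y. (\<Sum>i\<in>I. \<Sum>j\<in>I. c i * d j * (a i y * b j (- x + y))) \<partial>\<mu>)"
    unfolding conv_check_def sum_product by (intro Bochner_Integration.integral_cong sum.cong) (auto simp: mult_ac)
  also have "\<dots> = (\<Sum>i\<in>I. \<Sum>j\<in>I. c i * d j * conv_check \<mu> (a i) (b j) x)"
    unfolding conv_check_def using conv_check_integrable[OF fa gb] by simp
  finally show ?thesis .
qed

lemma sum_squares_bound:
  assumes "finite I" "(\<Sum>i\<in>I. (t i)\<^sup>2) \<le> (1::real)" "i \<in> I" shows "\<bar>t i\<bar> \<le> 1"
proof -
  have "(t i)\<^sup>2 \<le> (\<Sum>i\<in>I. (t i)\<^sup>2)" by (rule member_le_sum[OF assms(3)]) (use assms in auto)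
  then have "(t i)\<^sup>2 \<le> 1" using assms(2) by linarith
  then show ?thesis by (simp add: abs_square_le_1)
qed

lemma orlicz_space_mult_real:
  assumes y: "young_function \<Theta>" and f: "f \<in> orlicz_space \<mu> \<Theta>" and a: "a \<in> borel_measurable \<mu>" "\<And>y. \<bar>a y\<bar> \<le> 1"
  shows "(\<lambda>y. f y * complex_of_real (a y)) \<in> orlicz_space \<mu> \<Theta>"
  by (rule orlicz_space_mono[OF y f])
     (use orlicz_space_measurable[OF f] a in \<open>auto simp: norm_mult intro: mult_left_le\<close>)

text \<open>By orthogonality of the signs the diagonal sum is the mean, over all sign vectors, of
  the single tensors formed by \<open>fR E\<close> and \<open>gR E\<close>, so its norm is at most
  the mean of the products of norms. The constant does not depend on the number of indices, which is
  what makes inner products of arbitrary dimension admissible.\<close>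

lemma rademacher_tensor_normalized:
  obtains K where "K > 0" "\<And>I (a::'i\<Rightarrow>'g\<Rightarrow>real) b f g. finite I \<Longrightarrow>
     (\<And>i. i \<in> I \<Longrightarrow> a i \<in> borel_measurable \<mu> \<and> b i \<in> borel_measurable \<mu>) \<Longrightarrow>
     (\<And>y. (\<Sum>i\<in>I. (a i y)\<^sup>2) \<le> 1) \<Longrightarrow> (\<And>y. (\<Sum>i\<in>I. (b i y)\<^sup>2) \<le> 1) \<Longrightarrow>
     f \<in> borel_measurable \<mu> \<Longrightarrow> g \<in> borel_measurable \<mu> \<Longrightarrow>
     modular \<Phi> f \<le> 1 \<Longrightarrow> modular \<Psi> g \<le> 1 \<Longrightarrow>
     (\<lambda>x. \<Sum>i\<in>I. conv_check \<mu> (\<lambda>y. f y * complex_of_real (a i y)) (\<lambda>y. g y * complex_of_real (b i y)) x) \<in> A \<and>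
     nA (\<lambda>x. \<Sum>i\<in>I. conv_check \<mu> (\<lambda>y. f y * complex_of_real (a i y)) (\<lambda>y. g y * complex_of_real (b i y)) x) \<le> K"
proof -
  obtain C1 where C1: "C1 \<ge> 1" "\<And>l s. l \<ge> 0 \<Longrightarrow> s \<ge> 0 \<Longrightarrow> \<Phi> (l * s) \<le> C1 * exp l * \<Phi> s" using delta2_exp_growth[OF young\<Phi> d2\<Phi>] by blast
  obtain C2 where C2: "C2 \<ge> 1" "\<And>l s. l \<ge> 0 \<Longrightarrow> s \<ge> 0 \<Longrightarrow> \<Psi> (l * s) \<le> C2 * exp l * \<Psi> s" using delta2_exp_growth[OF young\<Psi> d2\<Psi>] by blast
  define K where "K = 2 + (C1\<^sup>2 + C2\<^sup>2) * (2 * exp 4)"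
  have K: "K > 0" unfolding K_def by (simp add: add_pos_nonneg)
  have "(\<lambda>x. \<Sum>i\<in>I. conv_check \<mu> (\<lambda>y. f y * complex_of_real (a i y)) (\<lambda>y. g y * complex_of_real (b i y)) x) \<in> A \<and>
     nA (\<lambda>x. \<Sum>i\<in>I. conv_check \<mu> (\<lambda>y. f y * complex_of_real (a i y)) (\<lambda>y. g y * complex_of_real (b i y)) x) \<le> K"
    if I: "finite I" and ab: "\<And>i. i \<in> I \<Longrightarrow> a i \<in> borel_measurable \<mu> \<and> b i \<in> borel_measurable \<mu>"
      and a: "\<And>y. (\<Sum>i\<in>I. (a i y)\<^sup>2) \<le> 1" and b: "\<And>y. (\<Sum>i\<in>I. (b i y)\<^sup>2) \<le> 1"
      and fm: "f \<in> borel_measurable \<mu>" and gm: "g \<in> borel_measurable \<mu>"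
      and f1: "modular \<Phi> f \<le> 1" and g1: "modular \<Psi> g \<le> 1"
    for I :: "'i set" and a b f g
  proof -
    have f: "f \<in> L\<Phi>" by (rule orlicz_spaceI[OF fm]) (use f1 in \<open>auto intro: le_less_trans\<close>)
    have g: "g \<in> L\<Psi>" by (rule orlicz_spaceI[OF gm]) (use g1 in \<open>auto intro: le_less_trans\<close>)
    define fa where "fa = (\<lambda>i y. f y * complex_of_real (a i y))"
    define gb where "gb = (\<lambda>i y. g y * complex_of_real (b i y))"
    have fa: "fa i \<in> L\<Phi>" if "i \<in> I" for i unfolding fa_def
      by (rule orlicz_space_mult_real[OF young\<Phi> f]) (use ab that sum_squares_bound[OF I a that] in auto)
    have gb: "gb i \<in> L\<Psi>" if "i \<in> I" for i unfolding gb_def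
      by (rule orlicz_space_mult_real[OF young\<Psi> g]) (use ab that sum_squares_bound[OF I b that] in auto)
    define fR where "fR = (\<lambda>E y. \<Sum>i\<in>I. complex_of_real (rsign E i) * fa i y)"
    define gR where "gR = (\<lambda>E y. \<Sum>i\<in>I. complex_of_real (rsign E i) * gb i y)"
    have fRe: "fR E y = f y * complex_of_real (\<Sum>i\<in>I. rsign E i * a i y)" for E y
      unfolding fR_def fa_def by (simp add: sum_distrib_left mult_ac)
    have gRe: "gR E y = g y * complex_of_real (\<Sum>i\<in>I. rsign E i * b i y)" for E y
      unfolding gR_def gb_def by (simp add: sum_distrib_left mult_ac)
    have am: "\<And>i. i \<in> I \<Longrightarrow> a i \<in> borel_measurable \<mu>" and bm: "\<And>i. i \<in> I \<Longrightarrow> b i \<in> borel_measurable \<mu>" using ab by auto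
    obtain x where x: "\<And>E. E \<in> Pow I \<Longrightarrow> x E \<ge> 0" "(\<Sum>E\<in>Pow I. x E) \<le> 2 ^ card I * (2 * exp 4)"
      "\<And>E. E \<in> Pow I \<Longrightarrow> (\<integral>\<^sup>+ y. ennreal (\<Phi> (cmod (fR E y))) \<partial>\<mu>) \<le> ennreal (C1 * sqrt (x E))"
      unfolding fRe by (rule rademacher_modular[OF young\<Phi> C1 fm f1 I am a]) (auto intro: that)
    obtain z where z: "\<And>E. E \<in> Pow I \<Longrightarrow> z E \<ge> 0" "(\<Sum>E\<in>Pow I. z E) \<le> 2 ^ card I * (2 * exp 4)"
      "\<And>E. E \<in> Pow I \<Longrightarrow> (\<integral>\<^sup>+ y. ennreal (\<Psi> (cmod (gR E y))) \<partial>\<mu>) \<le> ennreal (C2 * sqrt (z E))"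
      unfolding gRe by (rule rademacher_modular[OF young\<Psi> C2 gm g1 I bm b]) (auto intro: that)
    have fRm: "fR E \<in> borel_measurable \<mu>" for E unfolding fR_def using orlicz_space_measurable[OF fa] by measurable
    have gRm: "gR E \<in> borel_measurable \<mu>" for E unfolding gR_def using orlicz_space_measurable[OF gb] by measurable
    have fRL: "fR E \<in> L\<Phi>" if "E \<in> Pow I" for E
      by (rule orlicz_spaceI[OF fRm]) (rule le_less_trans[OF x(3)[OF that]], simp)
    have gRL: "gR E \<in> L\<Psi>" if "E \<in> Pow I" for E
      by (rule orlicz_spaceI[OF gRm]) (rule le_less_trans[OF z(3)[OF that]], simp)
    have fN: "N\<Phi> (fR E) \<le> 1 + C1 * sqrt (x E)" if E: "E \<in> Pow I" for E
    proof (rule luxemburg_le_modular[OF young\<Phi> fRm])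
      show "1 + C1 * sqrt (x E) \<ge> 1" using C1 x(1)[OF E] by simp
      show "(\<integral>\<^sup>+ y. ennreal (\<Phi> (cmod (fR E y))) \<partial>\<mu>) \<le> ennreal (1 + C1 * sqrt (x E))"
        by (rule order.trans[OF x(3)[OF E]]) (simp add: ennreal_leI)
    qed
    have gN: "N\<Psi> (gR E) \<le> 1 + C2 * sqrt (z E)" if E: "E \<in> Pow I" for E
      by (rule orlicz_norm_le_modular[OF gRm _ z(3)[OF E]]) (use C2 z(1)[OF E] in simp)
    define u where "u = (\<lambda>E x. complex_of_real (1 / 2 ^ card I) * conv_check \<mu> (fR E) (gR E) x)"
    have uA: "u E \<in> A" if "E \<in> Pow I" for E unfolding u_def by (rule AP_cmult(1)[OF AP_tensor(1)[OF fRL[OF that] gRL[OF that]]])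
    have un: "nA (u E) \<le> (1 / 2 ^ card I) * (2 + C1\<^sup>2 * x E + C2\<^sup>2 * z E)" if E: "E \<in> Pow I" for E
    proof -
      \<comment> \<open>Squaring removes the square roots of \<open>x E\<close> and
        \<open>z E\<close>, so that the bounds on their sums over \<open>Pow I\<close> can be
        used.\<close>
      have am: "(1 + p) * (1 + q) \<le> 2 + p\<^sup>2 + q\<^sup>2" for p q :: real
        using sum_squares_ge_zero[of "p - 1" "q - 1"] zero_le_power2[of "p - q"] zero_le_power2[of "p - 1"] zero_le_power2[of "q - 1"]
        by (simp add: power2_eq_square algebra_simps)
      have "N\<Phi> (fR E) * N\<Psi> (gR E) \<le> (1 + C1 * sqrt (x E)) * (1 + C2 * sqrt (z E))"
        by (rule mult_mono[OF fN[OF E] gN[OF E]]) (use C1 x(1)[OF E] orlicz_norm_nonneg[OF gRL[OF E]] in auto)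
      also have "\<dots> \<le> 2 + (C1 * sqrt (x E))\<^sup>2 + (C2 * sqrt (z E))\<^sup>2" by (rule am)
      also have "\<dots> = 2 + C1\<^sup>2 * x E + C2\<^sup>2 * z E" using x(1)[OF E] z(1)[OF E] by (simp add: power_mult_distrib)
      finally have p: "nA (conv_check \<mu> (fR E) (gR E)) \<le> 2 + C1\<^sup>2 * x E + C2\<^sup>2 * z E"
        using AP_tensor(2)[OF fRL[OF E] gRL[OF E]] by linarith
      have "nA (u E) \<le> cmod (complex_of_real (1 / 2 ^ card I)) * nA (conv_check \<mu> (fR E) (gR E))"
        unfolding u_def by (rule AP_cmult(2)[OF AP_tensor(1)[OF fRL[OF E] gRL[OF E]]])
      also have "cmod (complex_of_real (1 / 2 ^ card I)) = 1 / 2 ^ card I" by (simp add: norm_divide norm_power)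
      also have "(1 / 2 ^ card I) * nA (conv_check \<mu> (fR E) (gR E)) \<le> (1 / 2 ^ card I) * (2 + C1\<^sup>2 * x E + C2\<^sup>2 * z E)"
        by (rule mult_left_mono[OF p]) simp
      finally show ?thesis .
    qed
    have fin: "finite (Pow I)" using I by simp
    have eq: "(\<lambda>x. \<Sum>i\<in>I. conv_check \<mu> (fa i) (gb i) x) = (\<lambda>x. \<Sum>E\<in>Pow I. u E x)"
    proof
      fix x
      have "(\<Sum>E\<in>Pow I. conv_check \<mu> (fR E) (gR E) x) =
          (\<Sum>E\<in>Pow I. \<Sum>i\<in>I. \<Sum>j\<in>I. complex_of_real (rsign E i) * complex_of_real (rsign E j) * conv_check \<mu> (fa i) (gb j) x)"
        unfolding fR_def gR_def by (intro sum.cong refl conv_check_bilinear[OF I fa gb])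
      also have "\<dots> = (\<Sum>i\<in>I. \<Sum>j\<in>I. complex_of_real (\<Sum>E\<in>Pow I. rsign E i * rsign E j) * conv_check \<mu> (fa i) (gb j) x)"
        by (subst sum.swap, intro sum.cong refl, subst sum.swap, intro sum.cong refl) (simp add: sum_distrib_right)
      also have "\<dots> = (\<Sum>i\<in>I. \<Sum>j\<in>I. (if i = j then 2 ^ card I else 0) * conv_check \<mu> (fa i) (gb j) x)"
        by (intro sum.cong refl) (simp add: rsign_orthogonal[OF I])
      also have "\<dots> = (\<Sum>i\<in>I. \<Sum>j\<in>I. if i = j then 2 ^ card I * conv_check \<mu> (fa i) (gb j) x else 0)"
        by (intro sum.cong refl) auto
      also have "\<dots> = (\<Sum>i\<in>I. 2 ^ card I * conv_check \<mu> (fa i) (gb i) x)" by (intro sum.cong refl) (simp add: sum.delta'[OF I])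
      also have "\<dots> = 2 ^ card I * (\<Sum>i\<in>I. conv_check \<mu> (fa i) (gb i) x)" by (rule sum_distrib_left[symmetric])
      finally show "(\<Sum>i\<in>I. conv_check \<mu> (fa i) (gb i) x) = (\<Sum>E\<in>Pow I. u E x)"
        unfolding u_def sum_distrib_left[symmetric] by simp
    qed
    have "nA (\<lambda>x. \<Sum>E\<in>Pow I. u E x) \<le> (\<Sum>E\<in>Pow I. nA (u E))" by (rule AP_sum(2)[OF fin uA])
    also have "\<dots> \<le> (\<Sum>E\<in>Pow I. (1 / 2 ^ card I) * (2 + C1\<^sup>2 * x E + C2\<^sup>2 * z E))" by (rule sum_mono[OF un])
    also have "\<dots> = (1 / 2 ^ card I) * (2 * 2 ^ card I + C1\<^sup>2 * (\<Sum>E\<in>Pow I. x E) + C2\<^sup>2 * (\<Sum>E\<in>Pow I. z E))"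
      unfolding sum_distrib_left[symmetric] sum.distrib using I by (simp add: card_Pow sum_distrib_left)
    also have "\<dots> \<le> (1 / 2 ^ card I) * (2 * 2 ^ card I + C1\<^sup>2 * (2 ^ card I * (2 * exp 4)) + C2\<^sup>2 * (2 ^ card I * (2 * exp 4)))"
      by (intro mult_left_mono add_mono order_refl x(2) z(2)) auto
    also have "\<dots> = K" by (simp add: K_def field_simps)
    finally have "nA (\<lambda>x. \<Sum>i\<in>I. conv_check \<mu> (fa i) (gb i) x) \<le> K" unfolding eq .
    moreover have "(\<lambda>x. \<Sum>i\<in>I. conv_check \<mu> (fa i) (gb i) x) \<in> A" unfolding eq by (rule AP_sum(1)[OF fin uA])
    ultimately show ?thesis unfolding fa_def gb_def by simp
  qed
  then show ?thesis using that[OF K] by blast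
qed

end

lemma le_product_of_upper:
  fixes c p q X :: real
  assumes "\<And>d. d > 0 \<Longrightarrow> X \<le> c * (p + d) * (q + d)"
  shows "X \<le> c * p * q"
proof -
  have "((\<lambda>d. c * (p + d) * (q + d)) \<longlongrightarrow> c * (p + 0) * (q + 0)) (at_right 0)" by (intro tendsto_intros)
  moreover have "\<forall>\<^sub>F d in at_right 0. X \<le> c * (p + d) * (q + d)"
    using assms by (auto simp: eventually_at_filter)
  ultimately have "X \<le> c * (p + 0) * (q + 0)" by (rule tendsto_lowerbound) simp
  then show ?thesis by simp
qed

context orlicz_setup
begin

text \<open>The index type is fixed to a slice number with a pair of rounding points, the shape in
  which the lemma is applied. The predicate lets one constant be shared by all later
  statements.\<close>

definition rad_const :: "real \<Rightarrow> bool" where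
  "rad_const K \<longleftrightarrow> K > 0 \<and> (\<forall>I (a::nat\<times>'g\<times>'g\<Rightarrow>'g\<Rightarrow>real) b f g. finite I \<longrightarrow>
     (\<forall>i\<in>I. a i \<in> borel_measurable \<mu> \<and> b i \<in> borel_measurable \<mu>) \<longrightarrow>
     (\<forall>y. (\<Sum>i\<in>I. (a i y)\<^sup>2) \<le> 1) \<longrightarrow> (\<forall>y. (\<Sum>i\<in>I. (b i y)\<^sup>2) \<le> 1) \<longrightarrow>
     f \<in> borel_measurable \<mu> \<longrightarrow> g \<in> borel_measurable \<mu> \<longrightarrow>
     modular \<Phi> f \<le> 1 \<longrightarrow> modular \<Psi> g \<le> 1 \<longrightarrow>
     (\<lambda>x. \<Sum>i\<in>I. conv_check \<mu> (\<lambda>y. f y * complex_of_real (a i y)) (\<lambda>y. g y * complex_of_real (b i y)) x) \<in> A \<and>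
     nA (\<lambda>x. \<Sum>i\<in>I. conv_check \<mu> (\<lambda>y. f y * complex_of_real (a i y)) (\<lambda>y. g y * complex_of_real (b i y)) x) \<le> K)"

lemma rad_const_exists: "\<exists>K. rad_const K"
proof (rule rademacher_tensor_normalized[where 'i = "nat\<times>'g\<times>'g"], goal_cases)
  case (1 K)
  show ?case unfolding rad_const_def
    by (rule exI[of _ K], intro conjI[OF 1(1)] allI impI) (rule 1(2), auto)
qed

lemma orlicz_space_mult_bounded:
  assumes y: "young_function \<Theta>" and d: "delta2 \<Theta>" and f: "f \<in> orlicz_space \<mu> \<Theta>" and a: "a \<in> borel_measurable \<mu>" "\<And>y. \<bar>a y\<bar> \<le> c"
  shows "(\<lambda>y. f y * complex_of_real (a y)) \<in> orlicz_space \<mu> \<Theta>"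
proof (rule orlicz_space_mono[OF y orlicz_space_cmult[OF y d f, of "complex_of_real c"]])
  show "(\<lambda>y. f y * complex_of_real (a y)) \<in> borel_measurable \<mu>" using orlicz_space_measurable[OF f] a by measurable
  show "cmod (f y * complex_of_real (a y)) \<le> cmod (complex_of_real c * f y)" for y
    using mult_left_mono[OF order.trans[OF a(2)[of y] abs_ge_self], of "cmod (f y)"] by (simp add: norm_mult mult.commute)
qed

lemma rademacher_tensor:
  fixes a b :: "nat\<times>'g\<times>'g\<Rightarrow>'g\<Rightarrow>real"
  assumes K: "rad_const K" and I: "finite I" and ab: "\<And>i. i \<in> I \<Longrightarrow> a i \<in> borel_measurable \<mu>" "\<And>i. i \<in> I \<Longrightarrow> b i \<in> borel_measurable \<mu>"
    and \<alpha>: "\<alpha> > 0" "\<And>y. (\<Sum>i\<in>I. (a i y)\<^sup>2) \<le> \<alpha>\<^sup>2" and \<beta>: "\<beta> > 0" "\<And>y. (\<Sum>i\<in>I. (b i y)\<^sup>2) \<le> \<beta>\<^sup>2"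
    and f: "f \<in> L\<Phi>" and g: "g \<in> L\<Psi>"
  shows "(\<lambda>x. \<Sum>i\<in>I. conv_check \<mu> (\<lambda>y. f y * complex_of_real (a i y)) (\<lambda>y. g y * complex_of_real (b i y)) x) \<in> A \<and>
     nA (\<lambda>x. \<Sum>i\<in>I. conv_check \<mu> (\<lambda>y. f y * complex_of_real (a i y)) (\<lambda>y. g y * complex_of_real (b i y)) x) \<le> K * \<alpha> * \<beta> * N\<Phi> f * N\<Psi> g"
proof -
  define u where "u = (\<lambda>x. \<Sum>i\<in>I. conv_check \<mu> (\<lambda>y. f y * complex_of_real (a i y)) (\<lambda>y. g y * complex_of_real (b i y)) x)"
  have main: "u \<in> A \<and> nA u \<le> K * \<alpha> * \<beta> * k * k'" if k: "N\<Phi> f < k" and k': "N\<Psi> g < k'" for k k'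
  proof -
    have k0: "k > 0" using luxemburg_nonneg[OF young\<Phi> d2\<Phi> f] k by simp
    have k0': "k' > 0" using orlicz_norm_nonneg[OF g] k' by simp
    define f' where "f' = (\<lambda>y. complex_of_real (1/k) * f y)"
    define g' where "g' = (\<lambda>y. complex_of_real (1/k') * g y)"
    define a' where "a' = (\<lambda>i y. a i y / \<alpha>)"
    define b' where "b' = (\<lambda>i y. b i y / \<beta>)"
    have f1: "modular \<Phi> f' \<le> 1"
      using luxemburg_less[OF young\<Phi> d2\<Phi> f k] k0 by (simp add: f'_def norm_divide)
    have gL: "g' \<in> L\<Psi>" unfolding g'_def by (rule orlicz_space_cmult[OF young\<Psi> d2\<Psi> g])
    have "N\<Psi> g' \<le> (1/k') * N\<Psi> g" using orlicz_norm_cmult_le[OF g, of "complex_of_real (1/k')"] k0' by (simp add: g'_def norm_divide)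
    also have "\<dots> < 1" using k' k0' by (simp add: field_simps)
    finally have g1: "modular \<Psi> g' \<le> 1" by (rule modular_le_one_of_orlicz_norm[OF gL])
    have sa: "(\<Sum>i\<in>I. (a' i y)\<^sup>2) \<le> 1" for y
      using \<alpha>(2)[of y] \<alpha>(1) by (simp add: a'_def power_divide sum_divide_distrib[symmetric])
    have sb: "(\<Sum>i\<in>I. (b' i y)\<^sup>2) \<le> 1" for y
      using \<beta>(2)[of y] \<beta>(1) by (simp add: b'_def power_divide sum_divide_distrib[symmetric])
    define u' where "u' = (\<lambda>x. \<Sum>i\<in>I. conv_check \<mu> (\<lambda>y. f' y * complex_of_real (a' i y)) (\<lambda>y. g' y * complex_of_real (b' i y)) x)"
    have fm: "f' \<in> borel_measurable \<mu>" unfolding f'_def using orlicz_space_measurable[OF f] by measurable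
    have u': "u' \<in> A \<and> nA u' \<le> K"
      using K fm orlicz_space_measurable[OF gL] I ab sa sb f1 g1 unfolding rad_const_def u'_def a'_def b'_def
      by (elim conjE allE[of _ I] allE[of _ "\<lambda>i y. a i y / \<alpha>"] allE[of _ "\<lambda>i y. b i y / \<beta>"] allE[of _ f'] allE[of _ g']) auto
    define s where "s = \<alpha> * \<beta> * k * k'"
    have s: "s > 0" using \<alpha> \<beta> k0 k0' by (simp add: s_def)
    have "u = (\<lambda>x. complex_of_real s * u' x)"
    proof
      fix x
      have "conv_check \<mu> (\<lambda>y. f y * complex_of_real (a i y)) (\<lambda>y. g y * complex_of_real (b i y)) x =
          complex_of_real s * conv_check \<mu> (\<lambda>y. f' y * complex_of_real (a' i y)) (\<lambda>y. g' y * complex_of_real (b' i y)) x" for i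
      proof -
        have "complex_of_real s * conv_check \<mu> (\<lambda>y. f' y * complex_of_real (a' i y)) (\<lambda>y. g' y * complex_of_real (b' i y)) x =
           (\<integral>y. complex_of_real s * (f' y * complex_of_real (a' i y) * (g' (- x + y) * complex_of_real (b' i (- x + y)))) \<partial>\<mu>)"
          unfolding conv_check_def by simp
        also have "\<dots> = conv_check \<mu> (\<lambda>y. f y * complex_of_real (a i y)) (\<lambda>y. g y * complex_of_real (b i y)) x"
          unfolding conv_check_def
          by (rule Bochner_Integration.integral_cong[OF refl])
             (use \<alpha>(1) \<beta>(1) k0 k0' in \<open>simp add: s_def f'_def g'_def a'_def b'_def field_simps\<close>)
        finally show ?thesis by simp
      qed
      then show "u x = complex_of_real s * u' x" by (simp add: u_def u'_def sum_distrib_left)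
    qed
    then have "u \<in> A" "nA u \<le> s * nA u'" using AP_cmult[of u' "complex_of_real s"] u' s by auto
    moreover have "s * nA u' \<le> s * K" using u' s by simp
    ultimately show ?thesis by (simp add: s_def mult_ac)
  qed
  have "u \<in> A" using main[of "N\<Phi> f + 1" "N\<Psi> g + 1"] by simp
  moreover have "nA u \<le> K * \<alpha> * \<beta> * N\<Phi> f * N\<Psi> g" by (rule le_product_of_upper) (use main in simp)
  ultimately show ?thesis by (simp add: u_def)
qed

section \<open>Kernels inserted under the convolution integral\<close>

definition vten :: "('g \<Rightarrow> complex) \<Rightarrow> ('g \<Rightarrow> complex) \<Rightarrow> ('g \<Rightarrow> 'g \<Rightarrow> real) \<Rightarrow> 'g \<Rightarrow> complex" where
  "vten f g \<kappa> x = (\<integral>y. f y * g (- x + y) * complex_of_real (\<kappa> y (- x + y)) \<partial>\<mu>)"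

text \<open>After rounding, the integral over \<open>W\<close> is a finite sum with weights
  \<open>c p\<close>, and the kernel is an inner product of vectors indexed by \<open>I\<close>; the
  square roots of the weights are given to the two factors. The values of \<open>\<tau>\<close> are
  pairs so that two consecutive roundings can be treated by the same lemma.\<close>

lemma step_kernel_tensor:
  fixes a b :: "nat \<Rightarrow> 'g \<Rightarrow> 'g \<times> 'g \<Rightarrow> real" and \<tau> :: "'g \<Rightarrow> 'g \<times> 'g"
  assumes K: "rad_const K" and \<tau>: "finite (range \<tau>)" "\<And>p. {w. \<tau> w = p} \<in> sets borel"
    and W: "compact W" and Z: "compact Z"
    and m: "\<And>j p. (\<lambda>y. a j y p) \<in> borel_measurable \<mu>" "\<And>j p. (\<lambda>y. b j y p) \<in> borel_measurable \<mu>"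
    and f: "f \<in> L\<Phi>" "\<And>y. y \<notin> Z \<Longrightarrow> f y = 0" and g: "g \<in> L\<Psi>" "\<And>y. y \<notin> Z \<Longrightarrow> g y = 0"
    and \<alpha>: "\<alpha> > 0" "\<And>y. y \<in> Z \<Longrightarrow> (\<integral>w. indicator W w * (\<Sum>j<n. (a j y (\<tau> w))\<^sup>2) \<partial>\<mu>) \<le> \<alpha>\<^sup>2"
    and \<beta>: "\<beta> > 0" "\<And>y. y \<in> Z \<Longrightarrow> (\<integral>w. indicator W w * (\<Sum>j<n. (b j y (\<tau> w))\<^sup>2) \<partial>\<mu>) \<le> \<beta>\<^sup>2"
  defines "\<kappa> \<equiv> \<lambda>y y'. \<integral>w. indicator W w * (\<Sum>j<n. a j y (\<tau> w) * b j y' (\<tau> w)) \<partial>\<mu>"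
  shows "vten f g \<kappa> \<in> A \<and> nA (vten f g \<kappa>) \<le> K * \<alpha> * \<beta> * N\<Phi> f * N\<Psi> g"
    "\<And>x. integrable \<mu> (\<lambda>y. f y * g (- x + y) * complex_of_real (\<kappa> y (- x + y)))"
proof -
  define c :: "'g \<times> 'g \<Rightarrow> real" where "c = (\<lambda>p. \<integral>w. indicator W w * indicator {w. \<tau> w = p} w \<partial>\<mu>)"
  have c0: "c p \<ge> 0" for p unfolding c_def by simp
  have Wi: "integrable \<mu> (\<lambda>w. indicator W w :: real)" by (rule integrable_indicator_compact[OF W])
  have rnd: "(\<integral>w. indicator W w * G (\<tau> w) \<partial>\<mu>) = (\<Sum>p\<in>range \<tau>. c p * G p)" for G :: "'g \<times> 'g \<Rightarrow> real"
    unfolding c_def by (rule integral_rounded(2)[OF Wi \<tau>])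
  define I where "I = {..<n} \<times> range \<tau>"
  have I: "finite I" using \<tau> by (simp add: I_def)
  \<comment> \<open>Cutting to \<open>Z\<close> extends the bound on the sums of squares to all
    \<open>y\<close>, as the sign average requires; \<open>f\<close> and \<open>g\<close> vanish off
    \<open>Z\<close>, so the convolutions do not change.\<close>
  define a' where "a' = (\<lambda>i y. indicator Z y * (sqrt (c (snd i)) * a (fst i) y (snd i)))"
  define b' where "b' = (\<lambda>i y. indicator Z y * (sqrt (c (snd i)) * b (fst i) y (snd i)))"
  have Zm: "(\<lambda>y. indicator Z y :: real) \<in> borel_measurable \<mu>" by (rule borel_measurable_indicator) (simp add: Z)
  have am: "a' i \<in> borel_measurable \<mu>" "b' i \<in> borel_measurable \<mu>" for i
    unfolding a'_def b'_def using m Zm by measurable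
  have sw: "(\<Sum>i\<in>I. G (fst i) (snd i)) = (\<Sum>p\<in>range \<tau>. \<Sum>j<n. G j p)" for G :: "nat \<Rightarrow> 'g \<times> 'g \<Rightarrow> real"
    unfolding I_def by (subst sum.swap) (simp add: sum.cartesian_product case_prod_beta)
  have sa: "(\<Sum>i\<in>I. (a' i y)\<^sup>2) \<le> \<alpha>\<^sup>2" for y
  proof (cases "y \<in> Z")
    case True
    have "(\<Sum>i\<in>I. (a' i y)\<^sup>2) = (\<Sum>p\<in>range \<tau>. c p * (\<Sum>j<n. (a j y p)\<^sup>2))"
      using sw[of "\<lambda>j p. c p * (a j y p)\<^sup>2"] True c0 by (simp add: a'_def power_mult_distrib sum_distrib_left)
    then show ?thesis using \<alpha>(2)[OF True] rnd[of "\<lambda>p. \<Sum>j<n. (a j y p)\<^sup>2"] by simp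
  qed (simp add: a'_def)
  have sb: "(\<Sum>i\<in>I. (b' i y)\<^sup>2) \<le> \<beta>\<^sup>2" for y
  proof (cases "y \<in> Z")
    case True
    have "(\<Sum>i\<in>I. (b' i y)\<^sup>2) = (\<Sum>p\<in>range \<tau>. c p * (\<Sum>j<n. (b j y p)\<^sup>2))"
      using sw[of "\<lambda>j p. c p * (b j y p)\<^sup>2"] True c0 by (simp add: b'_def power_mult_distrib sum_distrib_left)
    then show ?thesis using \<beta>(2)[OF True] rnd[of "\<lambda>p. \<Sum>j<n. (b j y p)\<^sup>2"] by simp
  qed (simp add: b'_def)
  have bd: "\<bar>t i\<bar> \<le> s" if "(\<Sum>i\<in>I. (t i)\<^sup>2) \<le> s\<^sup>2" "s > 0" "i \<in> I" for t :: "nat \<times> 'g \<times> 'g \<Rightarrow> real" and s i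
  proof -
    have "(t i)\<^sup>2 \<le> (\<Sum>i\<in>I. (t i)\<^sup>2)" by (rule member_le_sum[OF that(3)]) (use I in auto)
    then have "(t i)\<^sup>2 \<le> s\<^sup>2" using that(1) by linarith
    then show ?thesis using that(2) abs_le_square_iff[of "t i" s] by simp
  qed
  have fa: "(\<lambda>y. f y * complex_of_real (a' i y)) \<in> L\<Phi>" if "i \<in> I" for i
    by (rule orlicz_space_mult_bounded[OF young\<Phi> d2\<Phi> f(1) am(1), of _ \<alpha>]) (rule bd[OF sa \<alpha>(1) that])
  have gb: "(\<lambda>y. g y * complex_of_real (b' i y)) \<in> L\<Psi>" if "i \<in> I" for i
    by (rule orlicz_space_mult_bounded[OF young\<Psi> d2\<Psi> g(1) am(2), of _ \<beta>]) (rule bd[OF sb \<beta>(1) that])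
  have pw: "f y * g y' * complex_of_real (\<kappa> y y') = (\<Sum>i\<in>I. f y * complex_of_real (a' i y) * (g y' * complex_of_real (b' i y')))" for y y'
  proof (cases "y \<in> Z \<and> y' \<in> Z")
    case True
    have "\<kappa> y y' = (\<Sum>p\<in>range \<tau>. c p * (\<Sum>j<n. a j y p * b j y' p))" unfolding \<kappa>_def by (rule rnd)
    also have "\<dots> = (\<Sum>i\<in>I. a' i y * b' i y')"
    proof -
      have "a' i y * b' i y' = c (snd i) * (a (fst i) y (snd i) * b (fst i) y' (snd i))" for i
      proof -
        have "a' i y * b' i y' = (sqrt (c (snd i)) * sqrt (c (snd i))) * (a (fst i) y (snd i) * b (fst i) y' (snd i))"
          using True by (simp add: a'_def b'_def mult_ac)
        then show ?thesis using c0[of "snd i"] by simp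
      qed
      then show ?thesis using sw[of "\<lambda>j p. c p * (a j y p * b j y' p)"] by (simp add: sum_distrib_left)
    qed
    finally show ?thesis by (simp add: sum_distrib_left mult_ac)
  next
    case False
    then have "f y = 0 \<or> g y' = 0" using f(2) g(2) by blast
    then show ?thesis by auto
  qed
  have "vten f g \<kappa> = (\<lambda>x. \<Sum>i\<in>I. conv_check \<mu> (\<lambda>y. f y * complex_of_real (a' i y)) (\<lambda>y. g y * complex_of_real (b' i y)) x)"
    unfolding vten_def pw conv_check_def
    by (rule ext, rule Bochner_Integration.integral_sum) (rule conv_check_integrable[OF fa gb])
  then show "vten f g \<kappa> \<in> A \<and> nA (vten f g \<kappa>) \<le> K * \<alpha> * \<beta> * N\<Phi> f * N\<Psi> g"
    using rademacher_tensor[OF K I am \<alpha>(1) sa \<beta>(1) sb f(1) g(1)] by simp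
  show "integrable \<mu> (\<lambda>y. f y * g (- x + y) * complex_of_real (\<kappa> y (- x + y)))" for x
    unfolding pw by (rule Bochner_Integration.integrable_sum) (rule conv_check_integrable[OF fa gb])
qed

end

context haar_group
begin

lemma rounding_for_family:
  fixes F :: "'i \<Rightarrow> 'g \<times> 'g \<Rightarrow> real"
  assumes J: "finite J" and F: "\<And>j. j \<in> J \<Longrightarrow> continuous_on UNIV (F j)" and K: "compact K" and L: "compact L" and e: "e > 0"
  obtains \<tau> where "finite (range \<tau>)" "\<And>p. {w. \<tau> w = p} \<in> sets borel"
    "\<And>j y w. j \<in> J \<Longrightarrow> y \<in> L \<Longrightarrow> w \<in> K \<Longrightarrow> \<bar>F j (y, w) - F j (y, \<tau> w)\<bar> \<le> e"
proof -
  have "\<exists>V. open V \<and> w0 \<in> V \<and> (\<forall>w y. w \<in> V \<longrightarrow> y \<in> L \<longrightarrow> \<bar>F j (y, w) - F j (y, w0)\<bar> \<le> e)" if "j \<in> J" for j w0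
  proof -
    have c: "continuous_on UNIV (\<lambda>p. F j (snd p, fst p))" by (rule continuous_on_compose2[OF F[OF that]]) (auto intro!: continuous_intros)
    obtain V where "open V" "w0 \<in> V" "\<And>w y. w \<in> V \<Longrightarrow> y \<in> L \<Longrightarrow> \<bar>(\<lambda>p. F j (snd p, fst p)) (w, y) - (\<lambda>p. F j (snd p, fst p)) (w0, y)\<bar> \<le> e"
      using tube[OF c L e] by metis
    then show ?thesis by auto
  qed
  then obtain V where V: "\<And>j w0. j \<in> J \<Longrightarrow> open (V j w0)" "\<And>j w0. j \<in> J \<Longrightarrow> w0 \<in> V j w0"
    "\<And>j w0 w y. j \<in> J \<Longrightarrow> w \<in> V j w0 \<Longrightarrow> y \<in> L \<Longrightarrow> \<bar>F j (y, w) - F j (y, w0)\<bar> \<le> e" by metis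
  have "open (\<Inter>j\<in>J. V j w0) \<and> w0 \<in> (\<Inter>j\<in>J. V j w0)" for w0 using J V by (auto intro: open_INT)
  then obtain \<tau> where "finite (range \<tau>)" "\<And>p. {w. \<tau> w = p} \<in> sets borel" "\<And>w. w \<in> K \<Longrightarrow> \<tau> w \<in> K \<and> w \<in> (\<Inter>j\<in>J. V j (\<tau> w))"
    using rounding_map[OF K, of "\<lambda>w0. \<Inter>j\<in>J. V j w0"] by blast
  then show ?thesis using that[of \<tau>] V(3) by blast
qed

end

context orlicz_setup
begin

text \<open>Rounding \<open>w\<close> to finitely many values makes the kernel finite dimensional; the error of the
  \<open>m\<close>-th rounding decays like \<open>2^-m\<close>, so the kernel is an absolutely convergent series of
  finite-dimensional ones.\<close>

lemma kernel_tensor: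
  fixes al be :: "nat \<Rightarrow> 'g \<times> 'g \<Rightarrow> real"
  assumes K: "rad_const K" and W: "compact W" and Z: "compact Z"
    and cont: "\<And>j. continuous_on UNIV (al j)" "\<And>j. continuous_on UNIV (be j)"
    and f: "f \<in> L\<Phi>" "\<And>y. y \<notin> Z \<Longrightarrow> f y = 0" and g: "g \<in> L\<Psi>" "\<And>y. y \<notin> Z \<Longrightarrow> g y = 0"
    and \<alpha>: "\<alpha> > 0" "\<And>y. y \<in> Z \<Longrightarrow> (\<integral>w. indicator W w * (\<Sum>j<n. (al j (y, w))\<^sup>2) \<partial>\<mu>) \<le> \<alpha>\<^sup>2"
    and \<beta>: "\<beta> > 0" "\<And>y. y \<in> Z \<Longrightarrow> (\<integral>w. indicator W w * (\<Sum>j<n. (be j (y, w))\<^sup>2) \<partial>\<mu>) \<le> \<beta>\<^sup>2"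
  defines "\<kappa> \<equiv> \<lambda>y y'. \<integral>w. indicator W w * (\<Sum>j<n. al j (y, w) * be j (y', w)) \<partial>\<mu>"
  shows "vten f g \<kappa> \<in> A \<and> nA (vten f g \<kappa>) \<le> 20 * K * \<alpha> * \<beta> * N\<Phi> f * N\<Psi> g"
    "\<And>x. integrable \<mu> (\<lambda>y. f y * g (- x + y) * complex_of_real (\<kappa> y (- x + y)))"
proof -
  let ?I = "\<lambda>h :: 'g \<Rightarrow> real. \<integral>w. indicator W w * h w \<partial>\<mu>"
  define V where "V = measure \<mu> W"
  define q where "q = real n * V"
  have V0: "V \<ge> 0" by (simp add: V_def)
  have q0: "q \<ge> 0" using V0 by (simp add: q_def)
  \<comment> \<open>The minimum makes the rounding errors small relative to both
    \<open>\<alpha>\<close> and \<open>\<beta>\<close>.\<close>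
  define c where "c = min \<alpha> \<beta>"
  have c: "c > 0" "c \<le> \<alpha>" "c \<le> \<beta>" using \<alpha>(1) \<beta>(1) by (auto simp: c_def)
  \<comment> \<open>An error of size \<open>t m\<close> in each of the \<open>n\<close> coordinates
    over \<open>W\<close> has squared Hilbert norm \<open>q * (t m)\<^sup>2\<close>, which is at
    most the square of \<open>c * (1/2)^m\<close>. The denominator \<open>q + 1\<close> covers the
    case \<open>q = 0\<close>.\<close>
  define t where "t = (\<lambda>m. c * (1/2)^m / (q + 1))"
  have t0: "t m > 0" for m using c q0 by (simp add: t_def)
  have tS: "t (Suc m) \<le> t m" for m
  proof -
    have "t (Suc m) = t m / 2" by (simp add: t_def)
    then show ?thesis using t0[of m] by simp
  qed
  have qt: "q * (t m)\<^sup>2 \<le> (c * (1/2)^m)\<^sup>2" for m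
  proof -
    have "q \<le> (q + 1)\<^sup>2" using q0 by (simp add: power2_eq_square algebra_simps)
    then have "(c * (1/2)^m)\<^sup>2 * (q / (q + 1)\<^sup>2) \<le> (c * (1/2)^m)\<^sup>2 * 1"
      by (intro mult_left_mono) (use q0 in auto)
    moreover have "q * (z / (q + 1))\<^sup>2 = z\<^sup>2 * (q / (q + 1)\<^sup>2)" for z by (simp add: power_divide)
    ultimately show ?thesis unfolding t_def by simp
  qed
  have c1: "c * (1/2)^m \<le> c" for m using c power_le_one[of "1/2::real" m] by simp
  have tc: "q * (t m)\<^sup>2 \<le> c\<^sup>2" for m by (rule order.trans[OF qt power_mono[OF c1]]) (use c in simp)
  \<comment> \<open>Both families are put into one, indexed additionally by a boolean, so that a
    single \<open>\<tau>\<close> rounds \<open>al\<close> and \<open>be\<close> together.\<close>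
  define F where "F = (\<lambda>(j, s). if s then al j else be j)"
  have "\<exists>\<tau>. finite (range \<tau>) \<and> (\<forall>p. {w. \<tau> w = p} \<in> sets borel) \<and>
    (\<forall>j<n. \<forall>y\<in>Z. \<forall>w\<in>W. \<bar>al j (y, w) - al j (y, \<tau> w)\<bar> \<le> t m \<and> \<bar>be j (y, w) - be j (y, \<tau> w)\<bar> \<le> t m)" for m
  proof -
    have fin: "finite ({..<n} \<times> (UNIV :: bool set))" by simp
    have Fc: "\<And>i. i \<in> {..<n} \<times> (UNIV :: bool set) \<Longrightarrow> continuous_on UNIV (F i)" using cont by (auto simp: F_def)
    obtain \<tau> where \<tau>: "finite (range \<tau>)" "\<And>p. {w. \<tau> w = p} \<in> sets borel"
      "\<And>i y w. i \<in> {..<n} \<times> (UNIV :: bool set) \<Longrightarrow> y \<in> Z \<Longrightarrow> w \<in> W \<Longrightarrow> \<bar>F i (y, w) - F i (y, \<tau> w)\<bar> \<le> t m"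
      by (rule rounding_for_family[where F = F and J = "{..<n} \<times> (UNIV :: bool set)", OF fin Fc W Z t0[of m]])
         (assumption, rule that)
    show ?thesis
      by (rule exI[of _ \<tau>]) (use \<tau>(1,2) \<tau>(3)[of "(_, True)"] \<tau>(3)[of "(_, False)"] in \<open>auto simp: F_def\<close>)
  qed
  then obtain \<tau> where \<tau>: "\<And>m. finite (range (\<tau> m))" "\<And>m p. {w. \<tau> m w = p} \<in> sets borel"
    "\<And>m j y w. j < n \<Longrightarrow> y \<in> Z \<Longrightarrow> w \<in> W \<Longrightarrow> \<bar>al j (y, w) - al j (y, \<tau> m w)\<bar> \<le> t m"
    "\<And>m j y w. j < n \<Longrightarrow> y \<in> Z \<Longrightarrow> w \<in> W \<Longrightarrow> \<bar>be j (y, w) - be j (y, \<tau> m w)\<bar> \<le> t m" by metis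
  \<comment> \<open>Two consecutive roundings as one finite-valued map; the differences between them
    are then step kernels too.\<close>
  define \<sigma> where "\<sigma> = (\<lambda>m w. (\<tau> m w, \<tau> (Suc m) w))"
  have \<sigma>: "finite (range (\<sigma> m))" "{w. \<sigma> m w = p} \<in> sets borel" for m p
  proof -
    show "finite (range (\<sigma> m))" by (rule finite_subset[of _ "range (\<tau> m) \<times> range (\<tau> (Suc m))"]) (use \<tau>(1) in \<open>auto simp: \<sigma>_def\<close>)
    have "{w. \<sigma> m w = p} = {w. \<tau> m w = fst p} \<inter> {w. \<tau> (Suc m) w = snd p}" by (auto simp: \<sigma>_def)
    then show "{w. \<sigma> m w = p} \<in> sets borel" using \<tau>(2) by auto
  qed
  have Wi: "integrable \<mu> (\<lambda>w. indicator W w :: real)" by (rule integrable_indicator_compact[OF W])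
  have isig: "integrable \<mu> (\<lambda>w. indicator W w * G (\<sigma> m w))" for m and G :: "'g \<times> 'g \<Rightarrow> real"
    by (rule integral_rounded(1)[OF Wi \<sigma>])
  have icont: "integrable \<mu> (\<lambda>w. indicator W w * G w)" if Gc: "continuous_on UNIV G" for G :: "'g \<Rightarrow> real"
  proof -
    obtain C where C: "\<And>x. x \<in> W \<Longrightarrow> \<bar>G x\<bar> \<le> C" using continuous_bounded_on_compact[OF Gc W] by blast
    have m: "(\<lambda>w. indicator W w * G w) \<in> borel_measurable \<mu>"
      using borel_measurable_times[OF borel_measurable_indicator borel_measurable_continuous_haar[OF Gc], of W] W by simp
    show ?thesis
      by (rule integrable_compact_support(1)[OF m W, of C]) (use C in \<open>auto simp: indicator_def\<close>)
  qed
  have sec: "continuous_on UNIV (\<lambda>w. al j (y, w))" "continuous_on UNIV (\<lambda>w. be j (y, w))"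
    "continuous_on UNIV (\<lambda>y. al j (y, w))" "continuous_on UNIV (\<lambda>y. be j (y, w))" for j y w
    using continuous_section cont by blast+
  have iW: "?I (\<lambda>w. r) = V * r" for r :: real using W by (simp add: V_def)
  have sq: "?I (\<lambda>w. \<Sum>j<n. (h j (y, \<tau> m w))\<^sup>2) \<le> (2 * \<gamma>)\<^sup>2"
    if h: "\<And>j. continuous_on UNIV (\<lambda>w. h j (y, w))" and \<gamma>: "c \<le> \<gamma>" "?I (\<lambda>w. \<Sum>j<n. (h j (y, w))\<^sup>2) \<le> \<gamma>\<^sup>2"
      and er: "\<And>j w. j < n \<Longrightarrow> w \<in> W \<Longrightarrow> \<bar>h j (y, w) - h j (y, \<tau> m w)\<bar> \<le> t m"
    for h :: "nat \<Rightarrow> 'g \<times> 'g \<Rightarrow> real" and y m \<gamma>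
  proof -
    have i1: "integrable \<mu> (\<lambda>w. indicator W w * (\<Sum>j<n. (h j (y, \<tau> m w))\<^sup>2))"
      using isig[of "\<lambda>p. \<Sum>j<n. (h j (y, fst p))\<^sup>2" m] by (simp add: \<sigma>_def)
    have i2: "integrable \<mu> (\<lambda>w. indicator W w * (\<Sum>j<n. (h j (y, w))\<^sup>2))" by (rule icont) (intro continuous_intros h)
    have i3: "integrable \<mu> (\<lambda>w. indicator W w * (2 * real n * (t m)\<^sup>2))" using Wi by simp
    have "?I (\<lambda>w. \<Sum>j<n. (h j (y, \<tau> m w))\<^sup>2) \<le>
        (\<integral>w. 2 * (indicator W w * (\<Sum>j<n. (h j (y, w))\<^sup>2)) + indicator W w * (2 * real n * (t m)\<^sup>2) \<partial>\<mu>)"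
    proof (rule integral_mono)
      fix w
      show "indicator W w * (\<Sum>j<n. (h j (y, \<tau> m w))\<^sup>2) \<le> 2 * (indicator W w * (\<Sum>j<n. (h j (y, w))\<^sup>2)) + indicator W w * (2 * real n * (t m)\<^sup>2)"
      proof (cases "w \<in> W")
        case True
        have "(\<Sum>j<n. (h j (y, \<tau> m w))\<^sup>2) \<le> (\<Sum>j<n. 2 * (h j (y, w))\<^sup>2 + 2 * (t m)\<^sup>2)"
        proof (rule sum_mono)
          fix j assume "j \<in> {..<n}"
          then have e: "\<bar>h j (y, w) - h j (y, \<tau> m w)\<bar> \<le> t m" using er True by simp
          define d where "d = h j (y, w) - h j (y, \<tau> m w)"
          have d2: "d\<^sup>2 \<le> (t m)\<^sup>2" using e t0[of m] by (simp add: d_def abs_le_square_iff[symmetric])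
          have "(h j (y, \<tau> m w))\<^sup>2 = (h j (y, w) - d)\<^sup>2" by (simp add: d_def)
          also have "\<dots> \<le> 2 * (h j (y, w))\<^sup>2 + 2 * d\<^sup>2"
            using zero_le_power2[of "h j (y, w) + d"] by (simp add: power2_eq_square algebra_simps)
          finally show "(h j (y, \<tau> m w))\<^sup>2 \<le> 2 * (h j (y, w))\<^sup>2 + 2 * (t m)\<^sup>2" using d2 by simp
        qed
        also have "\<dots> = 2 * (\<Sum>j<n. (h j (y, w))\<^sup>2) + 2 * real n * (t m)\<^sup>2" by (simp add: sum.distrib sum_distrib_left)
        finally show ?thesis using True by simp
      qed simp
    qed (use i1 i2 i3 in auto)
    also have "\<dots> = 2 * ?I (\<lambda>w. \<Sum>j<n. (h j (y, w))\<^sup>2) + V * (2 * real n * (t m)\<^sup>2)"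
      using i2 i3 iW[of "2 * real n * (t m)\<^sup>2"] by simp
    also have "V * (2 * real n * (t m)\<^sup>2) = 2 * (q * (t m)\<^sup>2)" by (simp add: q_def)
    also have "\<dots> \<le> 2 * c\<^sup>2" using tc by simp
    also have "c\<^sup>2 \<le> \<gamma>\<^sup>2" using \<gamma>(1) c(1) by (simp add: power_mono)
    finally show ?thesis using \<gamma>(2) by (simp add: power_mult_distrib)
  qed
  have dsq: "?I (\<lambda>w. \<Sum>j<n. (h j (y, \<tau> (Suc m) w) - h j (y, \<tau> m w))\<^sup>2) \<le> (2 * (1/2)^m * \<gamma>)\<^sup>2"
    if \<gamma>: "c \<le> \<gamma>" and er: "\<And>m j w. j < n \<Longrightarrow> w \<in> W \<Longrightarrow> \<bar>h j (y, w) - h j (y, \<tau> m w)\<bar> \<le> t m"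
    for h :: "nat \<Rightarrow> 'g \<times> 'g \<Rightarrow> real" and y m \<gamma>
  proof -
    have i1: "integrable \<mu> (\<lambda>w. indicator W w * (\<Sum>j<n. (h j (y, \<tau> (Suc m) w) - h j (y, \<tau> m w))\<^sup>2))"
      using isig[of "\<lambda>p. \<Sum>j<n. (h j (y, snd p) - h j (y, fst p))\<^sup>2" m] by (simp add: \<sigma>_def)
    have i3: "integrable \<mu> (\<lambda>w. indicator W w * (real n * (2 * t m)\<^sup>2))" using Wi by simp
    have "?I (\<lambda>w. \<Sum>j<n. (h j (y, \<tau> (Suc m) w) - h j (y, \<tau> m w))\<^sup>2) \<le> ?I (\<lambda>w. real n * (2 * t m)\<^sup>2)"
    proof (rule integral_mono[OF i1 i3])
      fix w
      show "indicator W w * (\<Sum>j<n. (h j (y, \<tau> (Suc m) w) - h j (y, \<tau> m w))\<^sup>2) \<le> indicator W w * (real n * (2 * t m)\<^sup>2)"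
      proof (cases "w \<in> W")
        case True
        have "(\<Sum>j<n. (h j (y, \<tau> (Suc m) w) - h j (y, \<tau> m w))\<^sup>2) \<le> (\<Sum>j<n. (2 * t m)\<^sup>2)"
        proof (rule sum_mono)
          fix j assume "j \<in> {..<n}"
          then have "\<bar>h j (y, \<tau> (Suc m) w) - h j (y, \<tau> m w)\<bar> \<le> 2 * t m"
            using er[of j w m] er[of j w "Suc m"] True tS[of m] by auto
          then show "(h j (y, \<tau> (Suc m) w) - h j (y, \<tau> m w))\<^sup>2 \<le> (2 * t m)\<^sup>2"
            using t0[of m] by (subst abs_le_square_iff[symmetric]) simp
        qed
        then show ?thesis using True by simp
      qed simp
    qed
    also have "\<dots> = 4 * (q * (t m)\<^sup>2)" unfolding iW by (simp add: q_def power_mult_distrib)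
    also have "\<dots> \<le> 4 * (c * (1/2)^m)\<^sup>2" using qt[of m] by simp
    also have "\<dots> = (2 * (1/2)^m * c)\<^sup>2" by (simp add: power_mult_distrib)
    also have "\<dots> \<le> (2 * (1/2)^m * \<gamma>)\<^sup>2" by (rule power_mono[OF mult_left_mono[OF \<gamma>]]) (use c in auto)
    finally show ?thesis .
  qed
  define kern where "kern = (\<lambda>m y y'. \<integral>w. indicator W w * (\<Sum>j<n. al j (y, \<tau> m w) * be j (y', \<tau> m w)) \<partial>\<mu>)"
  \<comment> \<open>The step from \<open>kern m\<close> to \<open>kern (Suc m)\<close> is split so
    that each part has a difference in one factor only; that factor has a Hilbert norm of order
    \<open>(1/2)^m\<close>, the other stays bounded.\<close>
  define k1 where "k1 = (\<lambda>m y y'. \<integral>w. indicator W w * (\<Sum>j<n. (al j (y, \<tau> (Suc m) w) - al j (y, \<tau> m w)) * be j (y', \<tau> (Suc m) w)) \<partial>\<mu>)"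
  define k2 where "k2 = (\<lambda>m y y'. \<integral>w. indicator W w * (\<Sum>j<n. al j (y, \<tau> m w) * (be j (y', \<tau> (Suc m) w) - be j (y', \<tau> m w))) \<partial>\<mu>)"
  have bm: "(\<lambda>y. al j (y, w)) \<in> borel_measurable \<mu>" "(\<lambda>y. be j (y, w)) \<in> borel_measurable \<mu>" for j w
    using borel_measurable_continuous_haar sec by blast+
  have two: "2 * \<alpha> > 0" "2 * \<beta> > 0" "2 * (1/2)^m * \<alpha> > 0" "2 * (1/2)^m * \<beta> > 0" for m using \<alpha>(1) \<beta>(1) by auto
  have sqa: "?I (\<lambda>w. \<Sum>j<n. (al j (y, \<tau> m w))\<^sup>2) \<le> (2 * \<alpha>)\<^sup>2" if "y \<in> Z" for y m
    by (rule sq[OF sec(1) c(2) \<alpha>(2)[OF that] \<tau>(3)]) (use that in auto)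
  have sqb: "?I (\<lambda>w. \<Sum>j<n. (be j (y, \<tau> m w))\<^sup>2) \<le> (2 * \<beta>)\<^sup>2" if "y \<in> Z" for y m
    by (rule sq[OF sec(2) c(3) \<beta>(2)[OF that] \<tau>(4)]) (use that in auto)
  have dsa: "?I (\<lambda>w. \<Sum>j<n. (al j (y, \<tau> (Suc m) w) - al j (y, \<tau> m w))\<^sup>2) \<le> (2 * (1/2)^m * \<alpha>)\<^sup>2" if "y \<in> Z" for y m
    by (rule dsq[OF c(2) \<tau>(3)]) (use that in auto)
  have dsb: "?I (\<lambda>w. \<Sum>j<n. (be j (y, \<tau> (Suc m) w) - be j (y, \<tau> m w))\<^sup>2) \<le> (2 * (1/2)^m * \<beta>)\<^sup>2" if "y \<in> Z" for y m
    by (rule dsq[OF c(3) \<tau>(4)]) (use that in auto)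
  have fs: "fst (\<sigma> m w) = \<tau> m w" "snd (\<sigma> m w) = \<tau> (Suc m) w" for m w by (simp_all add: \<sigma>_def)
  have e0: "kern m = (\<lambda>y y'. \<integral>w. indicator W w * (\<Sum>j<n. al j (y, fst (\<sigma> m w)) * be j (y', fst (\<sigma> m w))) \<partial>\<mu>)" for m
    by (simp add: kern_def fs)
  have e1: "k1 m = (\<lambda>y y'. \<integral>w. indicator W w * (\<Sum>j<n. (al j (y, snd (\<sigma> m w)) - al j (y, fst (\<sigma> m w))) * be j (y', snd (\<sigma> m w))) \<partial>\<mu>)" for m
    by (simp add: k1_def fs)
  have e2: "k2 m = (\<lambda>y y'. \<integral>w. indicator W w * (\<Sum>j<n. al j (y, fst (\<sigma> m w)) * (be j (y', snd (\<sigma> m w)) - be j (y', fst (\<sigma> m w)))) \<partial>\<mu>)" for m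
    by (simp add: k2_def fs)
  have bms: "(\<lambda>y. al j (y, w) - al j (y, w')) \<in> borel_measurable \<mu>" "(\<lambda>y. be j (y, w) - be j (y, w')) \<in> borel_measurable \<mu>" for j w w'
    using bm by (auto intro!: borel_measurable_diff)
  have sqa': "\<And>y. y \<in> Z \<Longrightarrow> ?I (\<lambda>w. \<Sum>j<n. (al j (y, fst (\<sigma> m w)))\<^sup>2) \<le> (2 * \<alpha>)\<^sup>2" for m
    unfolding fs by (rule sqa)
  have sqb0: "\<And>y. y \<in> Z \<Longrightarrow> ?I (\<lambda>w. \<Sum>j<n. (be j (y, fst (\<sigma> m w)))\<^sup>2) \<le> (2 * \<beta>)\<^sup>2" for m
    unfolding fs by (rule sqb)
  have sqb1: "\<And>y. y \<in> Z \<Longrightarrow> ?I (\<lambda>w. \<Sum>j<n. (be j (y, snd (\<sigma> m w)))\<^sup>2) \<le> (2 * \<beta>)\<^sup>2" for m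
    unfolding fs by (rule sqb)
  have dsa': "\<And>y. y \<in> Z \<Longrightarrow> ?I (\<lambda>w. \<Sum>j<n. (al j (y, snd (\<sigma> m w)) - al j (y, fst (\<sigma> m w)))\<^sup>2) \<le> (2 * (1/2)^m * \<alpha>)\<^sup>2" for m
    unfolding fs by (rule dsa)
  have dsb': "\<And>y. y \<in> Z \<Longrightarrow> ?I (\<lambda>w. \<Sum>j<n. (be j (y, snd (\<sigma> m w)) - be j (y, fst (\<sigma> m w)))\<^sup>2) \<le> (2 * (1/2)^m * \<beta>)\<^sup>2" for m
    unfolding fs by (rule dsb)
  have s0: "vten f g (kern m) \<in> A \<and> nA (vten f g (kern m)) \<le> K * (2 * \<alpha>) * (2 * \<beta>) * N\<Phi> f * N\<Psi> g"
    "integrable \<mu> (\<lambda>y. f y * g (- x + y) * complex_of_real (kern m y (- x + y)))" for m x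
    unfolding e0 by ((rule step_kernel_tensor(1)[where \<tau> = "\<sigma> m" and a = "\<lambda>j y p. al j (y, fst p)" and b = "\<lambda>j y p. be j (y, fst p)" and n = n,
          OF K \<sigma> W Z bm f g two(1) sqa' two(2) sqb0]; assumption),
      (rule step_kernel_tensor(2)[where \<tau> = "\<sigma> m" and a = "\<lambda>j y p. al j (y, fst p)" and b = "\<lambda>j y p. be j (y, fst p)" and n = n,
          OF K \<sigma> W Z bm f g two(1) sqa' two(2) sqb0]; assumption))
  have s1: "vten f g (k1 m) \<in> A \<and> nA (vten f g (k1 m)) \<le> K * (2 * (1/2)^m * \<alpha>) * (2 * \<beta>) * N\<Phi> f * N\<Psi> g"
    "integrable \<mu> (\<lambda>y. f y * g (- x + y) * complex_of_real (k1 m y (- x + y)))" for m x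
    unfolding e1 by ((rule step_kernel_tensor(1)[where \<tau> = "\<sigma> m" and a = "\<lambda>j y p. al j (y, snd p) - al j (y, fst p)" and b = "\<lambda>j y p. be j (y, snd p)" and n = n,
          OF K \<sigma> W Z bms(1) bm(2) f g two(3) dsa' two(2) sqb1]; assumption),
      (rule step_kernel_tensor(2)[where \<tau> = "\<sigma> m" and a = "\<lambda>j y p. al j (y, snd p) - al j (y, fst p)" and b = "\<lambda>j y p. be j (y, snd p)" and n = n,
          OF K \<sigma> W Z bms(1) bm(2) f g two(3) dsa' two(2) sqb1]; assumption))
  have s2: "vten f g (k2 m) \<in> A \<and> nA (vten f g (k2 m)) \<le> K * (2 * \<alpha>) * (2 * (1/2)^m * \<beta>) * N\<Phi> f * N\<Psi> g"
    "integrable \<mu> (\<lambda>y. f y * g (- x + y) * complex_of_real (k2 m y (- x + y)))" for m x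
    unfolding e2 by ((rule step_kernel_tensor(1)[where \<tau> = "\<sigma> m" and a = "\<lambda>j y p. al j (y, fst p)" and b = "\<lambda>j y p. be j (y, snd p) - be j (y, fst p)" and n = n,
          OF K \<sigma> W Z bm(1) bms(2) f g two(1) sqa' two(4) dsb']; assumption),
      (rule step_kernel_tensor(2)[where \<tau> = "\<sigma> m" and a = "\<lambda>j y p. al j (y, fst p)" and b = "\<lambda>j y p. be j (y, snd p) - be j (y, fst p)" and n = n,
          OF K \<sigma> W Z bm(1) bms(2) f g two(1) sqa' two(4) dsb']; assumption))
  have kadd: "kern (Suc m) y y' = kern m y y' + k1 m y y' + k2 m y y'" for m y y'
  proof -
    have i0: "integrable \<mu> (\<lambda>w. indicator W w * (\<Sum>j<n. al j (y, \<tau> m w) * be j (y', \<tau> m w)))"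
      using isig[of "\<lambda>p. \<Sum>j<n. al j (y, fst p) * be j (y', fst p)" m] by (simp add: fs)
    have i1: "integrable \<mu> (\<lambda>w. indicator W w * (\<Sum>j<n. (al j (y, \<tau> (Suc m) w) - al j (y, \<tau> m w)) * be j (y', \<tau> (Suc m) w)))"
      using isig[of "\<lambda>p. \<Sum>j<n. (al j (y, snd p) - al j (y, fst p)) * be j (y', snd p)" m] by (simp add: fs)
    have i2: "integrable \<mu> (\<lambda>w. indicator W w * (\<Sum>j<n. al j (y, \<tau> m w) * (be j (y', \<tau> (Suc m) w) - be j (y', \<tau> m w))))"
      using isig[of "\<lambda>p. \<Sum>j<n. al j (y, fst p) * (be j (y', snd p) - be j (y', fst p))" m] by (simp add: fs)
    have p: "(\<Sum>j<n. al j (y, \<tau> (Suc m) w) * be j (y', \<tau> (Suc m) w)) =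
        (\<Sum>j<n. al j (y, \<tau> m w) * be j (y', \<tau> m w)) +
        (\<Sum>j<n. (al j (y, \<tau> (Suc m) w) - al j (y, \<tau> m w)) * be j (y', \<tau> (Suc m) w)) +
        (\<Sum>j<n. al j (y, \<tau> m w) * (be j (y', \<tau> (Suc m) w) - be j (y', \<tau> m w)))" for w
      unfolding sum.distrib[symmetric] by (intro sum.cong refl) (simp add: algebra_simps)
    show ?thesis
      unfolding kern_def k1_def k2_def p distrib_left using i0 i1 i2 by simp
  qed
  have vadd: "vten f g (kern (Suc m)) x = vten f g (kern m) x + (vten f g (k1 m) x + vten f g (k2 m) x)" for m x
    unfolding vten_def kadd of_real_add distrib_left using s0(2)[of x m] s1(2)[of x m] s2(2)[of x m] by simp
  have t_le: "t m \<le> c" for m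
  proof -
    have "c * (1/2)^m / (q + 1) \<le> c * (1/2)^m / 1" by (rule divide_left_mono) (use c q0 in auto)
    then have "t m \<le> c * (1/2)^m" by (simp add: t_def)
    then show ?thesis using c1[of m] by simp
  qed
  have t_lim: "t \<longlonglongrightarrow> 0"
  proof -
    have "(\<lambda>m. c / (q + 1) * (1/2)^m) \<longlonglongrightarrow> c / (q + 1) * 0" by (intro tendsto_intros LIMSEQ_realpow_zero) auto
    then show ?thesis by (simp add: t_def[abs_def])
  qed
  have lim_er: "(\<lambda>m. h m) \<longlonglongrightarrow> r" if "\<And>m. \<bar>r - h m\<bar> \<le> t m" for h :: "nat \<Rightarrow> real" and r
  proof -
    have "(\<lambda>m. h m - r) \<longlonglongrightarrow> 0"
      by (rule Lim_null_comparison[OF always_eventually t_lim]) (use that in \<open>simp add: abs_minus_commute\<close>)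
    then show ?thesis by (rule LIM_zero_cancel)
  qed
  have sqle: "r\<^sup>2 \<le> 2 * s\<^sup>2 + 2 * c\<^sup>2" if "\<bar>s - r\<bar> \<le> t m" for r s :: real and m
  proof -
    define d where "d = s - r"
    have "d\<^sup>2 \<le> c\<^sup>2" using that t_le[of m] c(1) by (simp add: d_def abs_le_square_iff[symmetric])
    moreover have "r\<^sup>2 = (s - d)\<^sup>2" by (simp add: d_def)
    moreover have "(s - d)\<^sup>2 \<le> 2 * s\<^sup>2 + 2 * d\<^sup>2" using zero_le_power2[of "s + d"] by (simp add: power2_eq_square algebra_simps)
    ultimately show ?thesis by linarith
  qed
  have amgm: "\<bar>r * s\<bar> \<le> (r\<^sup>2 + s\<^sup>2) / 2" for r s :: real
    using zero_le_power2[of "\<bar>r\<bar> - \<bar>s\<bar>"] by (simp add: power2_eq_square algebra_simps abs_mult)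
  \<comment> \<open>Convergence is claimed on \<open>Z\<close> only, where the roundings are
    accurate; elsewhere one of the factors \<open>f\<close> and \<open>g\<close> vanishes.\<close>
  have klim: "(\<lambda>m. kern m y y') \<longlonglongrightarrow> \<kappa> y y'" if y: "y \<in> Z" "y' \<in> Z" for y y'
    unfolding kern_def \<kappa>_def
  proof (rule integral_dominated_convergence[where w = "\<lambda>w. indicator W w * (\<Sum>j<n. (al j (y, w))\<^sup>2 + (be j (y', w))\<^sup>2 + 2 * c\<^sup>2)"])
    show "(\<lambda>w. indicator W w * (\<Sum>j<n. al j (y, w) * be j (y', w))) \<in> borel_measurable \<mu>"
      by (rule borel_measurable_integrable, rule icont) (intro continuous_intros sec)
    show "(\<lambda>w. indicator W w * (\<Sum>j<n. al j (y, \<tau> m w) * be j (y', \<tau> m w))) \<in> borel_measurable \<mu>" for m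
      using borel_measurable_integrable[OF isig[of "\<lambda>p. \<Sum>j<n. al j (y, fst p) * be j (y', fst p)" m]] by (simp add: fs)
    show "integrable \<mu> (\<lambda>w. indicator W w * (\<Sum>j<n. (al j (y, w))\<^sup>2 + (be j (y', w))\<^sup>2 + 2 * c\<^sup>2))"
      by (rule icont) (intro continuous_intros sec)
    show "AE w in \<mu>. (\<lambda>m. indicator W w * (\<Sum>j<n. al j (y, \<tau> m w) * be j (y', \<tau> m w))) \<longlonglongrightarrow> indicator W w * (\<Sum>j<n. al j (y, w) * be j (y', w))"
    proof (rule AE_I2)
      fix w
      show "(\<lambda>m. indicator W w * (\<Sum>j<n. al j (y, \<tau> m w) * be j (y', \<tau> m w))) \<longlonglongrightarrow> indicator W w * (\<Sum>j<n. al j (y, w) * be j (y', w))"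
      proof (cases "w \<in> W")
        case True
        show ?thesis by (intro tendsto_intros lim_er \<tau>(3,4)) (use True y in auto)
      qed simp
    qed
    show "AE w in \<mu>. norm (indicator W w * (\<Sum>j<n. al j (y, \<tau> m w) * be j (y', \<tau> m w))) \<le> indicator W w * (\<Sum>j<n. (al j (y, w))\<^sup>2 + (be j (y', w))\<^sup>2 + 2 * c\<^sup>2)" for m
    proof (rule AE_I2)
      fix w
      show "norm (indicator W w * (\<Sum>j<n. al j (y, \<tau> m w) * be j (y', \<tau> m w))) \<le> indicator W w * (\<Sum>j<n. (al j (y, w))\<^sup>2 + (be j (y', w))\<^sup>2 + 2 * c\<^sup>2)"
      proof (cases "w \<in> W")
        case True
        have "\<bar>\<Sum>j<n. al j (y, \<tau> m w) * be j (y', \<tau> m w)\<bar> \<le> (\<Sum>j<n. \<bar>al j (y, \<tau> m w) * be j (y', \<tau> m w)\<bar>)" by (rule sum_abs)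
        also have "\<dots> \<le> (\<Sum>j<n. (al j (y, w))\<^sup>2 + (be j (y', w))\<^sup>2 + 2 * c\<^sup>2)"
        proof (rule sum_mono)
          fix j assume "j \<in> {..<n}"
          then have jn: "j < n" by simp
          have ar: "p \<le> r1 + r2 + 2 * d" if "p \<le> (s1 + s2) / 2" "s1 \<le> 2 * r1 + 2 * d" "s2 \<le> 2 * r2 + 2 * d" for p r1 r2 s1 s2 d :: real
            using that by (simp add: field_simps)
          from ar[OF amgm[of "al j (y, \<tau> m w)" "be j (y', \<tau> m w)"] sqle[OF \<tau>(3)[OF jn y(1) True, of m]] sqle[OF \<tau>(4)[OF jn y(2) True, of m]]]
          show "\<bar>al j (y, \<tau> m w) * be j (y', \<tau> m w)\<bar> \<le> (al j (y, w))\<^sup>2 + (be j (y', w))\<^sup>2 + 2 * c\<^sup>2" .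
        qed
        finally show ?thesis using True by simp
      qed simp
    qed
  qed
  define M where "M = 2 * \<alpha>\<^sup>2 + 2 * \<beta>\<^sup>2"
  have kb: "\<bar>kern m y y'\<bar> \<le> M" if y: "y \<in> Z" "y' \<in> Z" for m y y'
  proof -
    have i1: "integrable \<mu> (\<lambda>w. indicator W w * (\<Sum>j<n. (al j (y, \<tau> m w))\<^sup>2))" and i2: "integrable \<mu> (\<lambda>w. indicator W w * (\<Sum>j<n. (be j (y', \<tau> m w))\<^sup>2))"
      and i3: "integrable \<mu> (\<lambda>w. indicator W w * (\<Sum>j<n. al j (y, \<tau> m w) * be j (y', \<tau> m w)))"
      using isig[of "\<lambda>p. \<Sum>j<n. (al j (y, fst p))\<^sup>2" m] isig[of "\<lambda>p. \<Sum>j<n. (be j (y', fst p))\<^sup>2" m]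
        isig[of "\<lambda>p. \<Sum>j<n. al j (y, fst p) * be j (y', fst p)" m] by (simp_all add: fs)
    have "\<bar>kern m y y'\<bar> \<le> (\<integral>w. \<bar>indicator W w * (\<Sum>j<n. al j (y, \<tau> m w) * be j (y', \<tau> m w))\<bar> \<partial>\<mu>)"
      unfolding kern_def by (rule integral_abs_bound)
    also have "\<dots> \<le> (\<integral>w. (indicator W w * (\<Sum>j<n. (al j (y, \<tau> m w))\<^sup>2) + indicator W w * (\<Sum>j<n. (be j (y', \<tau> m w))\<^sup>2)) / 2 \<partial>\<mu>)"
    proof (rule integral_mono)
      fix w
      have "\<bar>\<Sum>j<n. al j (y, \<tau> m w) * be j (y', \<tau> m w)\<bar> \<le> (\<Sum>j<n. \<bar>al j (y, \<tau> m w) * be j (y', \<tau> m w)\<bar>)" by (rule sum_abs)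
      also have "\<dots> \<le> (\<Sum>j<n. ((al j (y, \<tau> m w))\<^sup>2 + (be j (y', \<tau> m w))\<^sup>2) / 2)" by (rule sum_mono) (rule amgm)
      also have "\<dots> = ((\<Sum>j<n. (al j (y, \<tau> m w))\<^sup>2) + (\<Sum>j<n. (be j (y', \<tau> m w))\<^sup>2)) / 2" by (simp add: sum.distrib sum_divide_distrib[symmetric])
      finally show "\<bar>indicator W w * (\<Sum>j<n. al j (y, \<tau> m w) * be j (y', \<tau> m w))\<bar> \<le>
          (indicator W w * (\<Sum>j<n. (al j (y, \<tau> m w))\<^sup>2) + indicator W w * (\<Sum>j<n. (be j (y', \<tau> m w))\<^sup>2)) / 2"
        by (cases "w \<in> W") auto
    qed (use i1 i2 i3 in auto)
    also have "\<dots> = (?I (\<lambda>w. \<Sum>j<n. (al j (y, \<tau> m w))\<^sup>2) + ?I (\<lambda>w. \<Sum>j<n. (be j (y', \<tau> m w))\<^sup>2)) / 2"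
      using i1 i2 by simp
    also have "\<dots> \<le> ((2 * \<alpha>)\<^sup>2 + (2 * \<beta>)\<^sup>2) / 2" using sqa[OF y(1), of m] sqb[OF y(2), of m] by simp
    also have "\<dots> = M" by (simp add: M_def power_mult_distrib)
    finally show ?thesis .
  qed
  have pl: "(\<lambda>m. f y * g (- x + y) * complex_of_real (kern m y (- x + y))) \<longlonglongrightarrow> f y * g (- x + y) * complex_of_real (\<kappa> y (- x + y))" for x y
  proof (cases "y \<in> Z \<and> - x + y \<in> Z")
    case True
    show ?thesis by (intro tendsto_intros klim) (use True in auto)
  next
    case False
    then have "f y * g (- x + y) = 0" using f(2) g(2) by auto
    then show ?thesis by (simp only: mult_zero_left tendsto_const)
  qed
  have lm: "(\<lambda>y. f y * g (- x + y) * complex_of_real (\<kappa> y (- x + y))) \<in> borel_measurable \<mu>" for x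
    by (rule borel_measurable_LIMSEQ_metric[OF _ pl]) (rule borel_measurable_integrable[OF s0(2)])
  have dom: "norm (f y * g (- x + y) * complex_of_real (kern m y (- x + y))) \<le> M * norm (f y * g (- x + y))" for m x y
  proof (cases "y \<in> Z \<and> - x + y \<in> Z")
    case True
    then have "\<bar>kern m y (- x + y)\<bar> \<le> M" using kb by blast
    then show ?thesis using mult_right_mono[of "\<bar>kern m y (- x + y)\<bar>" M "norm (f y * g (- x + y))"] by (simp add: norm_mult mult.commute)
  next
    case False
    then have "f y * g (- x + y) = 0" using f(2) g(2) by auto
    then show ?thesis by (simp only: mult_zero_left norm_zero mult_zero_right order_refl)
  qed
  have wi: "integrable \<mu> (\<lambda>y. M * norm (f y * g (- x + y)))" for x using conv_check_integrable[OF f(1) g(1), of x] by (intro integrable_mult_right integrable_norm)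
  note dc = integral_dominated_convergence[OF lm borel_measurable_integrable[OF s0(2)] wi AE_I2[OF pl] AE_I2[OF dom]]
    integrable_dominated_convergence[OF lm borel_measurable_integrable[OF s0(2)] wi AE_I2[OF pl] AE_I2[OF dom]]
  show "integrable \<mu> (\<lambda>y. f y * g (- x + y) * complex_of_real (\<kappa> y (- x + y)))" for x by (rule dc(2))
  have vlim: "(\<lambda>m. vten f g (kern m) x) \<longlonglongrightarrow> vten f g \<kappa> x" for x unfolding vten_def by (rule dc(1))
  define u where "u = (\<lambda>m. case m of 0 \<Rightarrow> vten f g (kern 0) | Suc m \<Rightarrow> (\<lambda>x. vten f g (k1 m) x + vten f g (k2 m) x))"
  have ps: "(\<Sum>i<Suc m. u i x) = vten f g (kern m) x" for m x
    by (induction m) (auto simp: u_def vadd)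
  define R where "R = K * \<alpha> * \<beta> * N\<Phi> f * N\<Psi> g"
  \<comment> \<open>The first rounded kernel costs \<open>2 * 2 = 4\<close>, since rounding may
    double each Hilbert norm. Each correction consists of two parts with constant
    \<open>4 * (1/2)^m\<close>. The total is \<open>4 + 16 = 20\<close>, the constant of the
    statement.\<close>
  define b where "b = (\<lambda>m. case m of 0 \<Rightarrow> 4 * R | Suc m \<Rightarrow> 8 * R * (1/2)^m)"
  have us: "(\<lambda>m. u m x) sums vten f g \<kappa> x" for x
    unfolding sums_def by (subst filterlim_sequentially_Suc[symmetric]) (simp only: ps vlim)
  have uA: "u m \<in> A" for m using s0(1) AP_add(1)[OF conjunct1[OF s1(1)] conjunct1[OF s2(1)]] by (cases m) (auto simp: u_def)
  have ub: "nA (u m) \<le> b m" for m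
  proof (cases m)
    case 0
    then show ?thesis using s0(1)[of 0] by (simp add: u_def b_def R_def mult_ac)
  next
    case (Suc i)
    have "nA (u m) \<le> nA (vten f g (k1 i)) + nA (vten f g (k2 i))"
      unfolding u_def Suc using AP_add(2)[OF conjunct1[OF s1(1)] conjunct1[OF s2(1)], of i i] by simp
    also have "\<dots> \<le> K * (2 * (1/2)^i * \<alpha>) * (2 * \<beta>) * N\<Phi> f * N\<Psi> g + K * (2 * \<alpha>) * (2 * (1/2)^i * \<beta>) * N\<Phi> f * N\<Psi> g"
      using s1(1)[of i] s2(1)[of i] by (intro add_mono) auto
    also have "\<dots> = b m" by (simp add: b_def R_def Suc)
    finally show ?thesis .
  qed
  have "(\<lambda>m. 8 * R * (1/2)^m) sums (8 * R * 2)" by (intro sums_mult) (use geometric_sums[of "1/2::real"] in simp)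
  then have "(\<lambda>m. b (Suc m)) sums (20 * R - b 0)" by (simp add: b_def)
  then have bs: "b sums (20 * R)" by (simp add: sums_Suc_iff)
  from AP_series[OF uA ub sums_summable[OF bs] us] sums_unique[OF bs]
  show "vten f g \<kappa> \<in> A \<and> nA (vten f g \<kappa>) \<le> 20 * K * \<alpha> * \<beta> * N\<Phi> f * N\<Psi> g" by (simp add: R_def mult_ac)
qed

end

section \<open>Slices of a density\<close>

text \<open>For \<open>r \<ge> 0\<close> this is the length of [0,r] inside [j,j+1]: a discrete
  layer cake decomposition that is continuous in \<open>r\<close>.\<close>

definition slice :: "real \<Rightarrow> nat \<Rightarrow> real" where
  "slice r j = max 0 (min 1 (r - real j))"

lemma slice_bounds: "0 \<le> slice r j" "slice r j \<le> 1" by (auto simp: slice_def)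

lemma slice_zero: "slice r j \<noteq> 0 \<Longrightarrow> real j < r" by (auto simp: slice_def split: if_splits)

lemma slice_mono: "s \<le> r \<Longrightarrow> slice s j \<le> slice r j" by (auto simp: slice_def)

lemma sum_slice: "0 \<le> r \<Longrightarrow> (\<Sum>j<J. slice r j) = min r (real J)"
  by (induction J) (auto simp: slice_def min_def max_def)

lemma sum_slice_diff:
  assumes "0 \<le> r" "0 \<le> s"
  shows "(\<Sum>j<J. \<bar>slice r j - slice s j\<bar>) \<le> \<bar>r - s\<bar>"
proof -
  have "(\<Sum>j<J. \<bar>slice r j - slice s j\<bar>) \<le> r - s" if "0 \<le> s" "s \<le> r" for r s
  proof -
    have "(\<Sum>j<J. \<bar>slice r j - slice s j\<bar>) = (\<Sum>j<J. slice r j - slice s j)"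
      by (intro sum.cong refl) (use slice_mono[OF that(2)] in \<open>simp add: abs_of_nonneg\<close>)
    also have "\<dots> = min r (real J) - min s (real J)" using that by (simp add: sum_subtractf sum_slice)
    also have "\<dots> \<le> r - s" using that by (simp add: min_def)
    finally show ?thesis .
  qed
  from this[of s r] this[of r s] show ?thesis using assms
    by (cases "s \<le> r") (auto simp: abs_minus_commute)
qed

text \<open>At most one slice lies strictly between 0 and 1, so squaring loses at most 1 in total.
  Formally the loss in slice \<open>j\<close> is at most the drop from slice \<open>j\<close> to the
  next, and the drops telescope.\<close>

lemma sum_slice_square_ge: "0 \<le> r \<Longrightarrow> (\<Sum>j<J. (slice r j)\<^sup>2) \<ge> min r (real J) - (if r = 0 then 0 else 1)"
proof -
  assume r: "0 \<le> r"
  have tel: "(\<Sum>j<J. slice r j - slice r (Suc j)) = slice r 0 - slice r J" by (induction J) auto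
  have "slice r j - (slice r j)\<^sup>2 \<le> slice r j - slice r (Suc j)" for j
  proof (cases "slice r j = 1")
    case True
    then show ?thesis using slice_bounds(2)[of r "Suc j"] by simp
  next
    case False
    then have "slice r (Suc j) = 0" by (auto simp: slice_def)
    then show ?thesis by simp
  qed
  then have "(\<Sum>j<J. slice r j - (slice r j)\<^sup>2) \<le> slice r 0 - slice r J" unfolding tel[symmetric] by (rule sum_mono)
  also have "\<dots> \<le> (if r = 0 then 0 else 1)" using r by (auto simp: slice_def)
  finally show ?thesis using sum_slice[OF r, of J] by (simp add: sum_subtractf)
qed

lemma sum_slice_support: "0 \<le> r \<Longrightarrow> (\<Sum>j<J. if slice r j = 0 then 0 else 1 :: real) \<le> r + 1"
proof -
  assume r: "0 \<le> r"
  have "(\<Sum>j<J. if slice r j = 0 then 0 else 1 :: real) \<le> min (r + 1) (real J)"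
    by (induction J) (use r in \<open>auto simp: slice_def min_def max_def split: if_splits\<close>)
  then show ?thesis by simp
qed

context orlicz_setup
begin

text \<open>With \<open>m\<close> the measure and \<open>\<Phi> s = 1 / m\<close>, the Luxemburg
  norm is at most \<open>1 / s\<close>. For the Orlicz norm, the bound
  \<open>cmod (h x) \<le> s + s * m * \<Phi> (cmod (h x))\<close> holds on \<open>F\<close>: a value
  above \<open>s\<close> is controlled by the increasing slope of \<open>\<Phi>\<close>. Each term
  integrates to at most \<open>s * m\<close>, whence the factor 2.\<close>

lemma indicator_norm_product:
  assumes F: "F \<in> sets borel" "emeasure \<mu> F < \<infinity>"
  shows "N\<Phi> (\<lambda>x. complex_of_real (indicator F x)) * N\<Psi> (\<lambda>x. complex_of_real (indicator F x)) \<le> 2 * measure \<mu> F"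
proof -
  let ?f = "\<lambda>x. complex_of_real (indicator F x)"
  have i: "?f \<in> L\<Phi>" "?f \<in> L\<Psi>"
    using indicator_in_orlicz_space[OF young\<Phi> F, of 1] indicator_in_orlicz_space[OF young\<Psi> F, of 1] by simp_all
  have em: "emeasure \<mu> F = ennreal (measure \<mu> F)" using F by (simp add: emeasure_eq_ennreal_measure less_top)
  have Fs[measurable]: "F \<in> sets \<mu>" using F by simp
  show ?thesis
  proof (cases "measure \<mu> F = 0")
    case True
    have "N\<Psi> ?f \<le> 0"
    proof (rule orlicz_norm_least[OF i(2) order_refl])
      fix h :: "'g \<Rightarrow> complex" assume h[measurable]: "h \<in> borel_measurable \<mu>"
      have "F \<in> null_sets \<mu>" using em True F by (auto simp: null_sets_def)
      then have "AE x in \<mu>. x \<notin> F" by (rule AE_not_in)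
      then have "AE x in \<mu>. ennreal (cmod (h x) * cmod (?f x)) = 0" by (rule AE_mp) (auto intro!: AE_I2)
      then show "(\<integral>\<^sup>+ x. ennreal (cmod (h x) * cmod (?f x)) \<partial>\<mu>) \<le> ennreal 0"
        by (subst nn_integral_cong_AE) auto
    qed
    then have "N\<Phi> ?f * N\<Psi> ?f \<le> N\<Phi> ?f * 0" by (intro mult_left_mono luxemburg_nonneg[OF young\<Phi> d2\<Phi> i(1)])
    then show ?thesis using True by simp
  next
    case False
    define m where "m = measure \<mu> F"
    have m: "m > 0" using False by (simp add: m_def zero_less_measure_iff)
    obtain s where s: "s > 0" "\<Phi> s = 1 / m" using young_value_attained[OF young\<Phi>, of "1 / m"] m by auto
    have 1: "N\<Phi> ?f \<le> 1 / s"
    proof (rule luxemburg_le)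
      have "(\<integral>\<^sup>+ x. ennreal (\<Phi> (cmod (?f x) / (1 / s))) \<partial>\<mu>) = (\<integral>\<^sup>+ x. ennreal (1 / m) * indicator F x \<partial>\<mu>)"
        by (intro nn_integral_cong) (use s young_functionD(5)[OF young\<Phi>] in \<open>auto split: split_indicator\<close>)
      also have "\<dots> = ennreal (1 / m) * emeasure \<mu> F" by (rule nn_integral_cmult_indicator[OF Fs])
      also have "\<dots> = 1" using m by (simp add: em m_def[symmetric] ennreal_mult[symmetric])
      finally show "(\<integral>\<^sup>+ x. ennreal (\<Phi> (cmod (?f x) / (1 / s))) \<partial>\<mu>) \<le> 1" by simp
    qed (use s in simp)
    have 2: "N\<Psi> ?f \<le> 2 * s * m"
    proof (rule orlicz_norm_least[OF i(2)])
      fix h :: "'g \<Rightarrow> complex" assume h[measurable]: "h \<in> borel_measurable \<mu>" and hm: "modular \<Phi> h \<le> 1"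
      have pw: "ennreal (cmod (h x) * cmod (?f x)) \<le> ennreal s * indicator F x + ennreal (s * m) * ennreal (\<Phi> (cmod (h x)))" for x
      proof (cases "x \<in> F")
        case True
        have "cmod (h x) \<le> s + s * m * \<Phi> (cmod (h x))"
        proof (cases "cmod (h x) \<le> s")
          case le: True
          have "0 \<le> s * m * \<Phi> (cmod (h x))" using s m \<Phi>_nonneg[of "cmod (h x)"] by simp
          then show ?thesis using le by linarith
        next
          case False
          then have "cmod (h x) * (1 / m) \<le> s * \<Phi> (cmod (h x))" using young_ratio_mono[OF young\<Phi> s(1), of "cmod (h x)"] s by simp
          then have "cmod (h x) \<le> s * m * \<Phi> (cmod (h x))" using m by (simp add: field_simps)
          then show ?thesis using s by simp
        qed
        then show ?thesis using True s m \<Phi>_nonneg[of "cmod (h x)"]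
          by (simp add: ennreal_mult[symmetric] ennreal_plus[symmetric] del: ennreal_plus)
      qed simp
      have "(\<integral>\<^sup>+ x. ennreal (cmod (h x) * cmod (?f x)) \<partial>\<mu>) \<le> (\<integral>\<^sup>+ x. ennreal s * indicator F x + ennreal (s * m) * ennreal (\<Phi> (cmod (h x))) \<partial>\<mu>)"
        by (rule nn_integral_mono) (rule pw)
      also have "\<dots> = ennreal s * ennreal m + ennreal (s * m) * modular \<Phi> h"
        by (subst nn_integral_add) (auto simp: nn_integral_cmult_indicator[OF Fs] nn_integral_cmult em m_def[symmetric])
      also have "\<dots> \<le> ennreal s * ennreal m + ennreal (s * m) * 1" by (intro add_mono mult_left_mono hm) auto
      also have "\<dots> = ennreal (2 * s * m)" using s m by (simp add: ennreal_mult[symmetric] ennreal_plus[symmetric] del: ennreal_plus)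
      finally show "(\<integral>\<^sup>+ x. ennreal (cmod (h x) * cmod (?f x)) \<partial>\<mu>) \<le> ennreal (2 * s * m)" .
    qed (use s m in simp)
    have "N\<Phi> ?f * N\<Psi> ?f \<le> (1 / s) * (2 * s * m)"
      by (rule mult_mono[OF 1 2]) (use s orlicz_norm_nonneg[OF i(2)] in auto)
    then show ?thesis using s by (simp add: m_def)
  qed
qed

text \<open>Its value at the identity of the group is the integral of the sum of the squared slices,
  divided by \<open>n\<close>; it is close to 1 when \<open>n\<close> is large and the
  \<open>J\<close> slices exhaust \<open>n * k\<close>.\<close>

definition slice_unit :: "nat \<Rightarrow> nat \<Rightarrow> ('g \<Rightarrow> real) \<Rightarrow> 'g \<Rightarrow> complex" where
  "slice_unit n J k x = (\<Sum>j<J. conv_check \<mu> (\<lambda>w. complex_of_real (slice (real n * k w) j))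
     (\<lambda>w. complex_of_real (slice (real n * k w) j)) x) / of_nat n"

lemma slice_continuous[continuous_intros]:
  fixes f :: "'b::topological_space \<Rightarrow> real"
  shows "continuous_on S f \<Longrightarrow> continuous_on S (\<lambda>x. slice (f x) j)"
  unfolding slice_def by (intro continuous_intros)

lemma slice_Cc:
  assumes k: "k \<in> Cc" "\<And>x. k x \<ge> 0" shows "(\<lambda>w. slice (real n * k w) j) \<in> Cc"
proof -
  obtain P where P: "compact P" "\<And>x. x \<notin> P \<Longrightarrow> k x = 0" using CcE[OF k(1)] by blast
  show ?thesis by (rule CcI[OF _ P(1)]) (use P(2) in \<open>auto intro!: continuous_intros Cc_continuous[OF k(1)] simp: slice_def\<close>)
qed

lemma Cc_in_orlicz_space:
  assumes y: "young_function \<Theta>" and k: "k \<in> Cc"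
  shows "(\<lambda>x. complex_of_real (k x)) \<in> orlicz_space \<mu> \<Theta>"
proof -
  obtain P where P: "compact P" "\<And>x. x \<notin> P \<Longrightarrow> k x = 0" using CcE[OF k] by blast
  obtain C where C: "C \<ge> 0" "\<And>x. \<bar>k x\<bar> \<le> C" using Cc_bounded[OF k] by blast
  show ?thesis
  proof (rule orlicz_space_mono[OF y indicator_in_orlicz_space[OF y, of P C]])
    show "P \<in> sets borel" "emeasure \<mu> P < \<infinity>" using P measure_compact_finite by auto
    show "(\<lambda>x. complex_of_real (k x)) \<in> borel_measurable \<mu>" using Cc_measurable[OF k] by simp
    show "cmod (complex_of_real (k x)) \<le> cmod (complex_of_real (C * indicator P x))" for x
      using C P(2)[of x] by (cases "x \<in> P") auto
  qed
qed

text \<open>The tensor of one slice costs at most twice the measure of the set where the slice is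
  nonzero. At a point of \<open>P\<close> at most \<open>n * k + 1\<close> slices are nonzero, so
  these measures add up to at most \<open>n + measure \<mu> P\<close>, and this is at most
  \<open>2 * n\<close>. Division by \<open>n\<close> leaves 4.\<close>

lemma slice_unit_norm:
  assumes k: "k \<in> Cc" "\<And>x. k x \<ge> 0" "(\<integral>x. k x \<partial>\<mu>) = 1" and P: "compact P" "\<And>x. x \<notin> P \<Longrightarrow> k x = 0"
    and n: "n > 0" "measure \<mu> P \<le> real n"
  shows "slice_unit n J k \<in> A" "nA (slice_unit n J k) \<le> 4"
proof -
  let ?s = "\<lambda>j w. complex_of_real (slice (real n * k w) j)"
  have sC: "(\<lambda>w. slice (real n * k w) j) \<in> Cc" for j by (rule slice_Cc[OF k(1,2)])
  have sL: "?s j \<in> L\<Phi>" "?s j \<in> L\<Psi>" for j using Cc_in_orlicz_space[OF _ sC] young\<Phi> young\<Psi> by blast+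
  define F where "F = (\<lambda>j. {w. slice (real n * k w) j \<noteq> 0})"
  have Fb: "F j \<in> sets borel" for j
  proof -
    have "open (F j)" unfolding F_def by (intro open_Collect_neq Cc_continuous[OF sC] continuous_intros)
    then show ?thesis by simp
  qed
  have FP: "F j \<subseteq> P" for j
  proof
    fix w assume "w \<in> F j"
    then have "real j < real n * k w" using slice_zero by (simp add: F_def)
    then have "k w \<noteq> 0" by (intro notI) simp
    then show "w \<in> P" using P(2) by blast
  qed
  have Ff: "emeasure \<mu> (F j) < \<infinity>" for j
    using emeasure_mono[OF FP, of \<mu> j] P(1) measure_compact_finite[OF P(1)] by (auto intro: le_less_trans)
  have "nA (conv_check \<mu> (?s j) (?s j)) \<le> 2 * measure \<mu> (F j)" for j
  proof -
    let ?i = "\<lambda>x. complex_of_real (indicator (F j) x)"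
    have iL: "?i \<in> L\<Phi>" "?i \<in> L\<Psi>"
      using indicator_in_orlicz_space[OF young\<Phi> Fb Ff, of 1 j] indicator_in_orlicz_space[OF young\<Psi> Fb Ff, of 1 j] by simp_all
    have le: "cmod (?s j x) \<le> cmod (?i x)" for x using slice_bounds[of "real n * k x" j] by (auto simp: F_def indicator_def)
    have "nA (conv_check \<mu> (?s j) (?s j)) \<le> N\<Phi> (?s j) * N\<Psi> (?s j)" by (rule AP_tensor(2)[OF sL])
    also have "\<dots> \<le> N\<Phi> ?i * N\<Psi> ?i"
      by (rule mult_mono[OF luxemburg_mono[OF young\<Phi> d2\<Phi> iL(1) le] orlicz_norm_mono[OF iL(2) sL(2) le]])
         (use luxemburg_nonneg[OF young\<Phi> d2\<Phi> iL(1)] orlicz_norm_nonneg[OF sL(2)] in auto)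
    also have "\<dots> \<le> 2 * measure \<mu> (F j)" by (rule indicator_norm_product[OF Fb Ff])
    finally show ?thesis .
  qed
  then have b: "(\<Sum>j<J. nA (conv_check \<mu> (?s j) (?s j))) \<le> 2 * (\<Sum>j<J. measure \<mu> (F j))"
    unfolding sum_distrib_left by (rule sum_mono)
  have iF: "integrable \<mu> (\<lambda>w. indicator (F j) w :: real)" for j using Fb Ff by (simp add: less_top)
  have iP: "integrable \<mu> (\<lambda>w. indicator P w :: real)" by (rule integrable_indicator_compact[OF P(1)])
  have "(\<Sum>j<J. measure \<mu> (F j)) = (\<integral>w. (\<Sum>j<J. indicator (F j) w) \<partial>\<mu>)"
    using iF Fb by (simp add: Bochner_Integration.integral_sum)
  also have "\<dots> \<le> (\<integral>w. real n * k w + indicator P w \<partial>\<mu>)"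
  proof (rule integral_mono)
    show "(\<Sum>j<J. indicator (F j) w) \<le> real n * k w + indicator P w" for w
    proof (cases "w \<in> P")
      case True
      have "(\<Sum>j<J. indicator (F j) w :: real) = (\<Sum>j<J. if slice (real n * k w) j = 0 then 0 else 1)"
        by (intro sum.cong refl) (auto simp: F_def indicator_def)
      then show ?thesis using sum_slice_support[of "real n * k w" J] k(2)[of w] True by simp
    next
      case False
      then have "w \<notin> F j" for j using FP by auto
      then show ?thesis using False k(2)[of w] by simp
    qed
  qed (use iF iP Cc_integrable[OF k(1)] in auto)
  also have "\<dots> = real n + measure \<mu> P" using Cc_integrable[OF k(1)] iP k(3) P(1) by simp
  also have "\<dots> \<le> 2 * real n" using n by simp
  finally have c: "(\<Sum>j<J. measure \<mu> (F j)) \<le> 2 * real n" .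
  have e: "slice_unit n J k = (\<lambda>x. (1 / of_nat n) * (\<Sum>j<J. conv_check \<mu> (?s j) (?s j) x))"
    by (auto simp: slice_unit_def)
  have S: "(\<lambda>x. \<Sum>j<J. conv_check \<mu> (?s j) (?s j) x) \<in> A"
    "nA (\<lambda>x. \<Sum>j<J. conv_check \<mu> (?s j) (?s j) x) \<le> (\<Sum>j<J. nA (conv_check \<mu> (?s j) (?s j)))"
    by (rule AP_sum, simp, rule AP_tensor(1)[OF sL])+
  show "slice_unit n J k \<in> A" unfolding e by (rule AP_cmult(1)[OF S(1)])
  have "nA (slice_unit n J k) \<le> cmod (1 / of_nat n) * nA (\<lambda>x. \<Sum>j<J. conv_check \<mu> (?s j) (?s j) x)" unfolding e by (rule AP_cmult(2)[OF S(1)])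
  also have "\<dots> \<le> cmod (1 / of_nat n) * (4 * real n)" by (rule mult_left_mono) (use S(2) b c in auto)
  also have "\<dots> = 4" using n by (simp add: norm_divide)
  finally show "nA (slice_unit n J k) \<le> 4" .
qed

text \<open>For fixed \<open>y\<close> these are the coordinates, indexed by \<open>j\<close> and
  \<open>w\<close>, of the vector \<open>a y\<close> of the overview. The square root distributes
  the factor \<open>1 / n\<close> evenly over the two vectors of an inner product.\<close>

definition slice_kernel :: "nat \<Rightarrow> ('g \<Rightarrow> real) \<Rightarrow> nat \<Rightarrow> 'g \<times> 'g \<Rightarrow> real" where
  "slice_kernel n k j p = slice (real n * k (fst p + snd p)) j / sqrt (real n)"

lemma slice_kernel_continuous:
  assumes "k \<in> Cc" shows "continuous_on UNIV (slice_kernel n k j)"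
  unfolding slice_kernel_def[abs_def] divide_inverse
  by (intro continuous_intros continuous_on_compose2[OF Cc_continuous[OF assms]]) auto

lemma slice_kernel_section_Cc:
  assumes k: "k \<in> Cc" "\<And>x. k x \<ge> 0" shows "(\<lambda>w. slice_kernel n k j (y, w)) \<in> Cc"
  using Cc_cmult[OF Cc_translate[OF slice_Cc[OF k, of n j], of y], of "1 / sqrt (real n)"] by (simp add: slice_kernel_def)

lemma slice_kernel_product_integrable:
  assumes k: "k \<in> Cc" "\<And>x. k x \<ge> 0"
  shows "integrable \<mu> (\<lambda>w. slice_kernel n k j (y, w) * slice_kernel n k j (y', w))"
  by (rule Cc_integrable, rule Cc_mult)
     (rule slice_kernel_section_Cc[OF k] Cc_continuous[OF slice_kernel_section_Cc[OF k]])+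

text \<open>Left invariance allows the integration variable to be shifted by an arbitrary
  \<open>y\<close>, which turns the value at \<open>x\<close> into an inner product of the vectors
  for \<open>y\<close> and \<open>- x + y\<close>. Being valid for every \<open>y\<close>, it can be
  placed under the integral that defines the convolution of \<open>f\<close> and
  \<open>g\<close>.\<close>

lemma slice_unit_eq_kernel:
  assumes k: "k \<in> Cc" "\<And>x. k x \<ge> 0" and n: "n > 0"
  shows "slice_unit n J k x = complex_of_real (\<integral>w. (\<Sum>j<J. slice_kernel n k j (y, w) * slice_kernel n k j (- x + y, w)) \<partial>\<mu>)"
proof -
  let ?s = "\<lambda>j w. slice (real n * k w) j"
  have m: "(\<lambda>w. ?s j w * ?s j (- x + w)) \<in> borel_measurable \<mu>" for j
    using Cc_measurable[OF slice_Cc[OF k]] measurable_translate_comp by (intro borel_measurable_times) blast+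
  have "conv_check \<mu> (\<lambda>w. complex_of_real (?s j w)) (\<lambda>w. complex_of_real (?s j w)) x =
      of_nat n * complex_of_real (\<integral>w. slice_kernel n k j (y, w) * slice_kernel n k j (- x + y, w) \<partial>\<mu>)" for j
  proof -
    have "conv_check \<mu> (\<lambda>w. complex_of_real (?s j w)) (\<lambda>w. complex_of_real (?s j w)) x = complex_of_real (\<integral>w. ?s j w * ?s j (- x + w) \<partial>\<mu>)"
      unfolding conv_check_def of_real_mult[symmetric] by (rule integral_complex_of_real)
    also have "(\<integral>w. ?s j w * ?s j (- x + w) \<partial>\<mu>) = (\<integral>w. ?s j (y + w) * ?s j (- x + (y + w)) \<partial>\<mu>)"
      using integral_translate[OF m, of y j] by simp
    also have "\<dots> = (\<integral>w. real n * (slice_kernel n k j (y, w) * slice_kernel n k j (- x + y, w)) \<partial>\<mu>)"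
      using n by (intro Bochner_Integration.integral_cong refl) (simp add: slice_kernel_def add.assoc real_sqrt_mult_self)
    also have "\<dots> = real n * (\<integral>w. slice_kernel n k j (y, w) * slice_kernel n k j (- x + y, w) \<partial>\<mu>)" by simp
    finally show ?thesis by simp
  qed
  then show ?thesis
    unfolding slice_unit_def using n slice_kernel_product_integrable[OF k]
    by (simp add: Bochner_Integration.integral_sum sum_distrib_left[symmetric])
qed

text \<open>Slices and their differences have absolute value at most 1, so squares may be replaced
  by absolute values, and these sum to at most \<open>n * k\<close> and \<open>n\<close> times the
  difference of the two values of \<open>k\<close>. In this way Reiter's \<open>L^1\<close>
  condition becomes almost constancy of the vectors in Hilbert space norm.\<close>

lemma slice_kernel_square_sum:
  assumes k: "\<And>x. k x \<ge> 0" and n: "n > 0"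
  shows "(\<Sum>j<J. (slice_kernel n k j (y, w))\<^sup>2) \<le> k (y + w)"
    "(\<Sum>j<J. (slice_kernel n k j (y, w) - slice_kernel n k j (y', w))\<^sup>2) \<le> \<bar>k (y + w) - k (y' + w)\<bar>"
proof -
  define r where "r = (\<lambda>z. real n * k z)"
  have r0: "r z \<ge> 0" for z using k by (simp add: r_def)
  have sk: "slice_kernel n k j (z, w) = slice (r (z + w)) j / sqrt (real n)" for j z by (simp add: slice_kernel_def r_def)
  have sq: "(a / sqrt (real n) - b / sqrt (real n))\<^sup>2 = (a - b)\<^sup>2 / real n" for a b
    using n by (simp add: diff_divide_distrib[symmetric] power_divide)
  have "(slice (r (y + w)) j)\<^sup>2 \<le> slice (r (y + w)) j" for j
    using slice_bounds[of "r (y + w)" j] by (simp add: power2_eq_square mult_left_le)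
  then have "(\<Sum>j<J. (slice (r (y + w)) j)\<^sup>2) \<le> (\<Sum>j<J. slice (r (y + w)) j)" by (rule sum_mono)
  also have "\<dots> \<le> r (y + w)" using sum_slice[OF r0, of "y + w" J] by simp
  finally show "(\<Sum>j<J. (slice_kernel n k j (y, w))\<^sup>2) \<le> k (y + w)"
    using n unfolding sk by (simp add: power_divide sum_divide_distrib[symmetric] r_def field_simps)
  have "(slice (r (y + w)) j - slice (r (y' + w)) j)\<^sup>2 \<le> \<bar>slice (r (y + w)) j - slice (r (y' + w)) j\<bar>" for j
  proof -
    have "\<bar>slice (r (y + w)) j - slice (r (y' + w)) j\<bar> \<le> 1"
      using slice_bounds[of "r (y + w)" j] slice_bounds[of "r (y' + w)" j] by linarith
    then show ?thesis using mult_left_le[of "\<bar>slice (r (y + w)) j - slice (r (y' + w)) j\<bar>" "\<bar>slice (r (y + w)) j - slice (r (y' + w)) j\<bar>"]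
      by (simp add: power2_eq_square)
  qed
  then have "(\<Sum>j<J. (slice (r (y + w)) j - slice (r (y' + w)) j)\<^sup>2) \<le> (\<Sum>j<J. \<bar>slice (r (y + w)) j - slice (r (y' + w)) j\<bar>)" by (rule sum_mono)
  also have "\<dots> \<le> \<bar>r (y + w) - r (y' + w)\<bar>" by (rule sum_slice_diff[OF r0 r0])
  also have "\<dots> = real n * \<bar>k (y + w) - k (y' + w)\<bar>" unfolding r_def by (simp add: abs_mult right_diff_distrib[symmetric])
  finally show "(\<Sum>j<J. (slice_kernel n k j (y, w) - slice_kernel n k j (y', w))\<^sup>2) \<le> \<bar>k (y + w) - k (y' + w)\<bar>"
    using n unfolding sk sq by (simp add: sum_divide_distrib[symmetric] field_simps)
qed

text \<open>Each vector \<open>a y\<close> is compared with \<open>a 0\<close>. The inner product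
  splits into two parts, each containing one difference of norm at most
  \<open>sqrt \<delta>\<close>, and the constant \<open>c0\<close>, the squared norm of
  \<open>a 0\<close>. Each part contributes \<open>20 * K * sqrt \<delta>\<close>, and
  \<open>c0\<close> differs from 1 by at most \<open>measure \<mu> P / real n\<close>. The constant
  20 is that of \<open>kernel_tensor\<close>.\<close>

lemma slice_unit_multiplier:
  fixes J :: nat and P :: "'g set" and \<delta> :: real
  assumes K: "rad_const K" and k: "k \<in> Cc" "\<And>x. k x \<ge> 0" "(\<integral>x. k x \<partial>\<mu>) = 1" and n: "n > 0"
    and Z: "compact Z" and f: "f \<in> L\<Phi>" "\<And>y. y \<notin> Z \<Longrightarrow> f y = 0" and g: "g \<in> L\<Psi>" "\<And>y. y \<notin> Z \<Longrightarrow> g y = 0"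
  defines "ue \<equiv> \<lambda>x. conv_check \<mu> f g x * slice_unit n J k x"
  shows "ue \<in> A" "nA ue \<le> 20 * K * (N\<Phi> f * N\<Psi> g)"
    and "compact P \<Longrightarrow> (\<And>x. x \<notin> P \<Longrightarrow> k x = 0) \<Longrightarrow> \<delta> > 0 \<Longrightarrow> (\<And>y. y \<in> Z \<Longrightarrow> (\<integral>w. \<bar>k (y + w) - k w\<bar> \<partial>\<mu>) \<le> \<delta>) \<Longrightarrow>
      (\<And>x. real n * k x \<le> real J) \<Longrightarrow>
      nA (\<lambda>x. ue x - conv_check \<mu> f g x) \<le> (40 * K * sqrt \<delta> + measure \<mu> P / real n) * (N\<Phi> f * N\<Psi> g)"
proof -
  obtain P0 where P0: "compact P0" "\<And>x. x \<notin> P0 \<Longrightarrow> k x = 0" using CcE[OF k(1)] by blast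
  \<comment> \<open>A compact set outside which the vectors for \<open>y\<close> in \<open>Z\<close>
    and for \<open>y = 0\<close> vanish; integrals over the group may be restricted to it.\<close>
  define W where "W = {- y + p | y p. y \<in> Z \<and> p \<in> P0} \<union> P0"
  have W: "compact W" unfolding W_def using compact_neg_sum_set[OF Z P0(1)] P0(1) by (rule compact_Un)
  let ?a = "slice_kernel n k"
  have off: "?a j (y, w) = 0" if "y \<in> Z \<or> y = 0" "w \<notin> W" for j y w
  proof -
    have "y + w \<notin> P0"
    proof
      assume yw: "y + w \<in> P0"
      have "w = - y + (y + w)" by (simp add: add.assoc[symmetric])
      then show False using that yw unfolding W_def by auto
    qed
    then have "k (y + w) = 0" by (rule P0(2))
    then show ?thesis by (simp add: slice_kernel_def slice_def)
  qed
  have ac: "continuous_on UNIV (?a j)" for j by (rule slice_kernel_continuous[OF k(1)])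
  have sC: "(\<lambda>w. ?a j (y, w)) \<in> Cc" for j y by (rule slice_kernel_section_Cc[OF k(1,2)])
  have pC: "(\<lambda>w. (?a j (y, w))\<^sup>2) \<in> Cc" for j y
    unfolding power2_eq_square by (rule Cc_mult[OF sC Cc_continuous[OF sC]])
  have dC: "(\<lambda>w. (?a j (y, w) - ?a j (y', w))\<^sup>2) \<in> Cc" for j y y'
    unfolding power2_eq_square by (rule Cc_mult[OF Cc_diff[OF sC sC] Cc_continuous[OF Cc_diff[OF sC sC]]])
  have kC: "(\<lambda>w. k (y + w)) \<in> Cc" for y by (rule Cc_translate[OF k(1)])
  have k1: "(\<integral>w. k (y + w) \<partial>\<mu>) = 1" for y using integral_translate[OF Cc_measurable[OF k(1)], of y] k(3) by simp
  have iW: "integrable \<mu> (\<lambda>w. indicator W w * h w)" if "h \<in> Cc" for h :: "'g \<Rightarrow> real"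
    using integrable_real_mult_indicator[OF _ Cc_integrable[OF that], of W] W by (simp add: mult.commute)
  have sqb: "(\<integral>w. indicator W w * (\<Sum>j<J. (?a j (y, w))\<^sup>2) \<partial>\<mu>) \<le> 1\<^sup>2" for y
  proof -
    have "(\<integral>w. indicator W w * (\<Sum>j<J. (?a j (y, w))\<^sup>2) \<partial>\<mu>) \<le> (\<integral>w. k (y + w) \<partial>\<mu>)"
    proof (rule integral_mono)
      show "indicator W w * (\<Sum>j<J. (?a j (y, w))\<^sup>2) \<le> k (y + w)" for w
        using slice_kernel_square_sum(1)[OF k(2) n, where y = y and w = w and J = J] k(2)[of "y + w"] by (auto simp: indicator_def)
    qed (use iW[OF Cc_sum[OF _ pC, of "{..<J}" "\<lambda>j. j" "\<lambda>_. y"]] Cc_integrable[OF kC] in auto)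
    then show ?thesis using k1 by simp
  qed
  define \<kappa> where "\<kappa> = (\<lambda>y y'. \<integral>w. indicator W w * (\<Sum>j<J. ?a j (y, w) * ?a j (y', w)) \<partial>\<mu>)"
  have ker: "slice_unit n J k x = complex_of_real (\<kappa> y (- x + y))" if "y \<in> Z" for x y
    unfolding \<kappa>_def slice_unit_eq_kernel[OF k(1,2) n, of J x y]
    by (intro arg_cong[where f = complex_of_real] Bochner_Integration.integral_cong refl)
       (use off that in \<open>auto simp: indicator_def\<close>)
  have ue: "ue = vten f g \<kappa>"
  proof
    fix x
    have "ue x = (\<integral>y. f y * g (- x + y) * slice_unit n J k x \<partial>\<mu>)" by (simp add: ue_def conv_check_def)
    also have "\<dots> = vten f g \<kappa> x"
      unfolding vten_def by (intro Bochner_Integration.integral_cong refl) (use f(2) ker in \<open>metis mult_zero_left\<close>)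
    finally show "ue x = vten f g \<kappa> x" .
  qed
  have kt: "vten f g \<kappa> \<in> A \<and> nA (vten f g \<kappa>) \<le> 20 * K * 1 * 1 * N\<Phi> f * N\<Psi> g"
    unfolding \<kappa>_def by (rule kernel_tensor(1)[OF K W Z ac ac f g zero_less_one sqb zero_less_one sqb])
  then show "ue \<in> A" "nA ue \<le> 20 * K * (N\<Phi> f * N\<Psi> g)" by (simp_all add: ue mult.assoc)
  assume P: "compact P" "\<And>x. x \<notin> P \<Longrightarrow> k x = 0" and \<delta>: "\<delta> > 0" "\<And>y. y \<in> Z \<Longrightarrow> (\<integral>w. \<bar>k (y + w) - k w\<bar> \<partial>\<mu>) \<le> \<delta>"
    and J: "\<And>x. real n * k x \<le> real J"
  let ?d = "\<lambda>j p. ?a j p - ?a j (0, snd p)"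
  have zc: "continuous_on UNIV (\<lambda>p. ?a j (0, snd p))" for j
    by (rule continuous_on_compose2[OF Cc_continuous[OF sC]]) (auto intro: continuous_intros)
  have dc: "continuous_on UNIV (?d j)" for j by (intro continuous_on_diff ac zc)
  have sd: "0 < sqrt \<delta>" using \<delta>(1) by simp
  have sqz: "(\<integral>w. indicator W w * (\<Sum>j<J. (?a j (0, snd (y, w)))\<^sup>2) \<partial>\<mu>) \<le> 1\<^sup>2" for y using sqb[of 0] by simp
  have sqd: "(\<integral>w. indicator W w * (\<Sum>j<J. (?d j (y, w))\<^sup>2) \<partial>\<mu>) \<le> (sqrt \<delta>)\<^sup>2" if y: "y \<in> Z" for y
  proof -
    have "(\<integral>w. indicator W w * (\<Sum>j<J. (?d j (y, w))\<^sup>2) \<partial>\<mu>) \<le> (\<integral>w. \<bar>k (y + w) - k w\<bar> \<partial>\<mu>)"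
    proof (rule integral_mono)
      show "indicator W w * (\<Sum>j<J. (?d j (y, w))\<^sup>2) \<le> \<bar>k (y + w) - k w\<bar>" for w
        using slice_kernel_square_sum(2)[OF k(2) n, where y = y and y' = 0 and w = w and J = J] by (auto simp: indicator_def)
    qed (use iW[OF Cc_sum[OF _ dC, of "{..<J}" "\<lambda>j. j" "\<lambda>_. y" "\<lambda>_. 0"]] Cc_integrable[OF Cc_abs[OF Cc_diff[OF kC[of y] k(1)]]] in auto)
    then show ?thesis using \<delta>(2)[OF y] \<delta>(1) by simp
  qed
  define \<kappa>1 where "\<kappa>1 = (\<lambda>y y'. \<integral>w. indicator W w * (\<Sum>j<J. ?d j (y, w) * ?a j (y', w)) \<partial>\<mu>)"
  define \<kappa>2 where "\<kappa>2 = (\<lambda>(y::'g) y'. \<integral>w. indicator W w * (\<Sum>j<J. ?a j (0, snd (y, w)) * ?d j (y', w)) \<partial>\<mu>)"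
  have k1t: "vten f g \<kappa>1 \<in> A \<and> nA (vten f g \<kappa>1) \<le> 20 * K * sqrt \<delta> * 1 * N\<Phi> f * N\<Psi> g"
    "integrable \<mu> (\<lambda>y. f y * g (- x + y) * complex_of_real (\<kappa>1 y (- x + y)))" for x
    unfolding \<kappa>1_def by ((rule kernel_tensor(1)[OF K W Z dc ac f g sd sqd zero_less_one sqb]; assumption),
      (rule kernel_tensor(2)[OF K W Z dc ac f g sd sqd zero_less_one sqb]; assumption))
  have k2t: "vten f g \<kappa>2 \<in> A \<and> nA (vten f g \<kappa>2) \<le> 20 * K * 1 * sqrt \<delta> * N\<Phi> f * N\<Psi> g"
    "integrable \<mu> (\<lambda>y. f y * g (- x + y) * complex_of_real (\<kappa>2 y (- x + y)))" for x
    unfolding \<kappa>2_def by ((rule kernel_tensor(1)[OF K W Z zc dc f g zero_less_one sqz sd sqd]; assumption),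
      (rule kernel_tensor(2)[OF K W Z zc dc f g zero_less_one sqz sd sqd]; assumption))
  define c0 where "c0 = (\<integral>w. indicator W w * (\<Sum>j<J. (?a j (0, w))\<^sup>2) \<partial>\<mu>)"
  have prC: "(\<lambda>w. \<Sum>j<J. ?d j (y, w) * ?a j (y', w)) \<in> Cc" "(\<lambda>w. \<Sum>j<J. ?a j (0, w) * ?d j (y', w)) \<in> Cc" for y y'
  proof -
    have q: "(\<lambda>w. ?d j (y, w)) \<in> Cc" for j y using Cc_diff[OF sC sC, of j y j 0] by simp
    show "(\<lambda>w. \<Sum>j<J. ?d j (y, w) * ?a j (y', w)) \<in> Cc" by (intro Cc_sum Cc_mult sC Cc_continuous[OF q]) simp
    show "(\<lambda>w. \<Sum>j<J. ?a j (0, w) * ?d j (y', w)) \<in> Cc" by (intro Cc_sum Cc_mult q Cc_continuous[OF sC]) simp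
  qed
  have split: "\<kappa> y y' = \<kappa>1 y y' + \<kappa>2 y y' + c0" for y y'
  proof -
    have "(\<Sum>j<J. ?a j (y, w) * ?a j (y', w)) =
        (\<Sum>j<J. ?d j (y, w) * ?a j (y', w)) + (\<Sum>j<J. ?a j (0, w) * ?d j (y', w)) + (\<Sum>j<J. (?a j (0, w))\<^sup>2)" for w
      unfolding sum.distrib[symmetric] by (intro sum.cong refl) (simp add: algebra_simps power2_eq_square)
    then show ?thesis unfolding \<kappa>_def \<kappa>1_def \<kappa>2_def c0_def
      using iW[OF prC(1)[of y y']] iW[OF prC(2)[of y']] iW[OF Cc_sum[OF _ pC, of "{..<J}" "\<lambda>j. j" "\<lambda>_. 0"]] by (simp add: distrib_left)
  qed
  have ue2: "ue x = vten f g \<kappa>1 x + vten f g \<kappa>2 x + complex_of_real c0 * conv_check \<mu> f g x" for x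
  proof -
    have "vten f g \<kappa> x = (\<integral>y. f y * g (- x + y) * complex_of_real (\<kappa>1 y (- x + y)) + f y * g (- x + y) * complex_of_real (\<kappa>2 y (- x + y)) + f y * g (- x + y) * complex_of_real c0 \<partial>\<mu>)"
      unfolding vten_def split by (simp add: algebra_simps)
    then show ?thesis unfolding ue using k1t(2)[of x] k2t(2)[of x] conv_check_integrable[OF f(1) g(1), of x]
      by (simp add: vten_def conv_check_def)
  qed
  have c1: "c0 \<le> 1" using sqb[of 0] by (simp add: c0_def)
  \<comment> \<open>Where \<open>k\<close> is nonzero the squared slices add up to at least
    \<open>n * k - 1\<close>; the loss of \<open>1 / n\<close> after normalization is integrated
    over \<open>P\<close>.\<close>
  have c2: "1 - measure \<mu> P / real n \<le> c0"
  proof -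
    have "1 - measure \<mu> P / real n = (\<integral>w. k w - indicator P w / real n \<partial>\<mu>)"
      using Cc_integrable[OF k(1)] integrable_indicator_compact[OF P(1)] k(3) P(1) by simp
    also have "\<dots> \<le> c0" unfolding c0_def
    proof (rule integral_mono)
      show "k w - indicator P w / real n \<le> indicator W w * (\<Sum>j<J. (?a j (0, w))\<^sup>2)" for w
      proof (cases "k w = 0")
        case True
        have "0 \<le> indicator W w * (\<Sum>j<J. (?a j (0, w))\<^sup>2)" by (intro mult_nonneg_nonneg sum_nonneg) auto
        moreover have "0 \<le> indicator P w / real n" by simp
        ultimately show ?thesis unfolding True by linarith
      next
        case False
        then have w: "w \<in> P" "w \<in> W" using P(2) P0(2) by (auto simp: W_def)
        have "real n * k w - 1 \<le> (\<Sum>j<J. (slice (real n * k w) j)\<^sup>2)"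
          using sum_slice_square_ge[of "real n * k w" J] k(2)[of w] J[of w] n False by (simp add: min_def)
        also have "\<dots> = real n * (\<Sum>j<J. (?a j (0, w))\<^sup>2)"
          using n by (simp add: slice_kernel_def power_divide sum_divide_distrib[symmetric])
        finally have "(real n * k w - 1) / real n \<le> (\<Sum>j<J. (?a j (0, w))\<^sup>2)" using n by (simp add: field_simps)
        then show ?thesis using w n by (simp add: diff_divide_distrib)
      qed
      show "integrable \<mu> (\<lambda>w. indicator W w * (\<Sum>j<J. (?a j (0, w))\<^sup>2))" by (rule iW[OF Cc_sum[OF _ pC]]) simp
    qed (use Cc_integrable[OF k(1)] integrable_indicator_compact[OF P(1)] in auto)
    finally show ?thesis .
  qed
  have uA: "conv_check \<mu> f g \<in> A" "nA (conv_check \<mu> f g) \<le> N\<Phi> f * N\<Psi> g" using AP_tensor[OF f(1) g(1)] by auto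
  let ?v = "\<lambda>x. vten f g \<kappa>1 x + vten f g \<kappa>2 x" and ?c = "\<lambda>x. (complex_of_real c0 - 1) * conv_check \<mu> f g x"
  have v: "?v \<in> A" "nA ?v \<le> nA (vten f g \<kappa>1) + nA (vten f g \<kappa>2)" using AP_add[OF conjunct1[OF k1t(1)] conjunct1[OF k2t(1)]] by auto
  have c: "?c \<in> A" "nA ?c \<le> cmod (complex_of_real c0 - 1) * nA (conv_check \<mu> f g)" using AP_cmult[OF uA(1)] by auto
  have "(\<lambda>x. ue x - conv_check \<mu> f g x) = (\<lambda>x. ?v x + ?c x)" by (auto simp: ue2 algebra_simps)
  then have "nA (\<lambda>x. ue x - conv_check \<mu> f g x) \<le> nA ?v + nA ?c" using AP_add(2)[OF v(1) c(1)] by simp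
  also have "nA ?c \<le> measure \<mu> P / real n * (N\<Phi> f * N\<Psi> g)"
  proof (rule order.trans[OF c(2)])
    have "cmod (complex_of_real c0 - 1) = \<bar>c0 - 1\<bar>" by (metis norm_of_real of_real_1 of_real_diff)
    then show "cmod (complex_of_real c0 - 1) * nA (conv_check \<mu> f g) \<le> measure \<mu> P / real n * (N\<Phi> f * N\<Psi> g)"
      using c1 c2 uA(2) AP_norm_nonneg[OF uA(1)] by (intro mult_mono) auto
  qed
  also have "nA ?v \<le> 40 * K * sqrt \<delta> * (N\<Phi> f * N\<Psi> g)" using v(2) k1t(1) k2t(1) by (simp add: mult_ac)
  finally show "nA (\<lambda>x. ue x - conv_check \<mu> f g x) \<le> (40 * K * sqrt \<delta> + measure \<mu> P / real n) * (N\<Phi> f * N\<Psi> g)"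
    by (simp add: distrib_right)
qed

end

section \<open>Compactly supported representations\<close>

context haar_group
begin

text \<open>Inner regularity is given for open sets only. A level set \<open>E\<close> of finite
  measure is therefore first enclosed in an open \<open>U\<close> of finite measure, and a compact
  \<open>C\<close> is then chosen inside \<open>U\<close>; it need not lie in
  \<open>E\<close>.\<close>

lemma integrable_compact_tail:
  fixes H :: "'g \<Rightarrow> real"
  assumes H: "integrable \<mu> H" "\<And>x. H x \<ge> 0" and c: "c > 0"
  obtains C where "compact C" "(\<integral>x. indicator (- C) x * H x \<partial>\<mu>) \<le> c"
proof -
  \<comment> \<open>Truncated from both sides: the lower cut gives a carrier of finite measure, the
    upper cut bounds the contribution of \<open>U - C\<close> by a multiple of its measure.\<close>
  define Hn where "Hn = (\<lambda>n x. if H x > 1 / real (Suc n) then min (H x) (real (Suc n)) else 0)"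
  have Hm[measurable]: "H \<in> borel_measurable \<mu>" using H(1) by simp
  have Hn0: "0 \<le> Hn n x" "Hn n x \<le> H x" "Hn n x \<le> real (Suc n)" for n x using H(2)[of x] by (auto simp: Hn_def)
  have Hnm[measurable]: "Hn n \<in> borel_measurable \<mu>" for n unfolding Hn_def by measurable
  have Hni: "integrable \<mu> (Hn n)" for n
  proof (rule Bochner_Integration.integrable_bound[OF H(1) Hnm])
    show "AE x in \<mu>. norm (Hn n x) \<le> norm (H x)" by (rule AE_I2) (use Hn0(1,2) H(2) in simp)
  qed
  have pw: "(\<lambda>n. Hn n x) \<longlonglongrightarrow> H x" for x
  proof (cases "H x = 0")
    case True
    then have "Hn n x = 0" for n by (simp add: Hn_def)
    then show ?thesis using True by simp
  next
    case False
    then have hx: "H x > 0" using H(2)[of x] by simp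
    obtain N where N: "H x < real N" "1 / H x < real N" by (meson reals_Archimedean2 less_trans linorder_less_linear order_less_le_trans max.strict_boundedE)
    have "Hn n x = H x" if "n \<ge> N" for n
    proof -
      have "1 / H x < real (Suc n)" "H x < real (Suc n)" using N that by auto
      then have "1 / real (Suc n) < H x" using hx by (simp add: field_simps)
      then show ?thesis using \<open>H x < real (Suc n)\<close> by (simp add: Hn_def)
    qed
    then have "\<forall>\<^sub>F n in sequentially. Hn n x = H x" by (auto simp: eventually_sequentially)
    then show ?thesis by (rule tendsto_eventually)
  qed
  have "(\<lambda>n. \<integral>x. Hn n x \<partial>\<mu>) \<longlonglongrightarrow> (\<integral>x. H x \<partial>\<mu>)"
    by (rule integral_dominated_convergence[OF Hm Hnm H(1)]) (use pw Hn0 in auto)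
  then have "\<forall>\<^sub>F n in sequentially. dist (\<integral>x. Hn n x \<partial>\<mu>) (\<integral>x. H x \<partial>\<mu>) < c / 2" by (rule tendstoD) (use c in simp)
  then obtain n where n: "\<bar>(\<integral>x. Hn n x \<partial>\<mu>) - (\<integral>x. H x \<partial>\<mu>)\<bar> < c / 2" by (auto simp: eventually_sequentially dist_real_def)
  define E where "E = {x. H x > 1 / real (Suc n)}"
  have Em[measurable]: "E \<in> sets borel"
  proof -
    have "{x \<in> space \<mu>. H x > 1 / real (Suc n)} \<in> sets \<mu>" by measurable
    then show ?thesis by (simp add: E_def)
  qed
  have iE: "integrable \<mu> (\<lambda>x. indicator E x :: real)"
  proof (rule Bochner_Integration.integrable_bound[OF integrable_mult_right[OF H(1), of "real (Suc n)"]])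
    show "AE x in \<mu>. norm (indicator E x :: real) \<le> norm (real (Suc n) * H x)"
    proof (rule AE_I2)
      fix x
      have "1 \<le> real (Suc n) * H x" if "x \<in> E" using that by (simp add: E_def field_simps)
      then show "norm (indicator E x :: real) \<le> norm (real (Suc n) * H x)" by (auto simp: indicator_def)
    qed
  qed (use Em in simp)
  then have Ef: "emeasure \<mu> E < \<infinity>" using Em by (simp add: integrable_indicator_iff)
  define d where "d = c / (2 * real (Suc n))"
  have d: "d > 0" using c by (simp add: d_def)
  have "emeasure \<mu> E < ennreal (measure \<mu> E + 1)"
    using Ef by (simp add: emeasure_eq_ennreal_measure less_top ennreal_less_iff)
  then obtain U where U: "open U" "E \<subseteq> U" "emeasure \<mu> U < ennreal (measure \<mu> E + 1)"
    using haarD(4)[rule_format, OF Em] by (auto simp: INF_less_iff)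
  have Uf: "emeasure \<mu> U < \<infinity>" using U(3) by (rule less_trans) simp
  obtain C where C: "compact C" "C \<subseteq> U" "measure \<mu> (U - C) \<le> d"
  proof (cases "emeasure \<mu> U = 0")
    case True
    have "measure \<mu> U = 0" using True by (simp add: measure_def)
    then show ?thesis using d that[of "{}"] by simp
  next
    case False
    have eU: "emeasure \<mu> U = ennreal (measure \<mu> U)" using Uf by (simp add: emeasure_eq_ennreal_measure less_top)
    then have "0 < measure \<mu> U" using False by (auto simp: zero_less_measure_iff)
    then have "ennreal (measure \<mu> U - d) < emeasure \<mu> U" unfolding eU by (rule ennreal_lessI) (use d in simp)
    then have "ennreal (measure \<mu> U - d) < (SUP K \<in> {K. compact K \<and> K \<subseteq> U}. emeasure \<mu> K)" using haarD(5) U(1) by simp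
    then obtain C where C: "compact C" "C \<subseteq> U" "ennreal (measure \<mu> U - d) < emeasure \<mu> C" by (auto simp: less_SUP_iff)
    have eC: "emeasure \<mu> C = ennreal (measure \<mu> C)" using measure_compact_finite[OF C(1)] by (simp add: emeasure_eq_ennreal_measure less_top)
    have "measure \<mu> U \<le> d + measure \<mu> C"
    proof (rule ccontr)
      assume "\<not> measure \<mu> U \<le> d + measure \<mu> C"
      then have "ennreal (measure \<mu> C) \<le> ennreal (measure \<mu> U - d)" by (intro ennreal_leI) simp
      then show False using C(3) unfolding eC by simp
    qed
    moreover have "measure \<mu> (U - C) = measure \<mu> U - measure \<mu> C"
      by (rule measure_Diff) (use C U Uf in \<open>auto simp: less_top\<close>)
    ultimately show ?thesis using C that by simp
  qed
  have UC: "U - C \<in> sets \<mu>" using U C by auto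
  have UCf: "emeasure \<mu> (U - C) < \<infinity>" using emeasure_mono[of "U - C" U \<mu>] Uf U by (auto intro: le_less_trans)
  have iUC: "integrable \<mu> (\<lambda>x. indicator (U - C) x :: real)" using UC UCf by (simp add: integrable_indicator_iff)
  have iCH: "integrable \<mu> (\<lambda>x. indicator (- C) x * H x)"
    using integrable_real_mult_indicator[OF _ H(1), of "- C"] C(1) by (simp add: mult.commute borel_comp)
  have "(\<integral>x. indicator (- C) x * H x \<partial>\<mu>) \<le> (\<integral>x. (H x - Hn n x) + real (Suc n) * indicator (U - C) x \<partial>\<mu>)"
  proof (rule integral_mono[OF iCH])
    show "integrable \<mu> (\<lambda>x. (H x - Hn n x) + real (Suc n) * indicator (U - C) x)" using H(1) Hni iUC by simp
    show "indicator (- C) x * H x \<le> (H x - Hn n x) + real (Suc n) * indicator (U - C) x" for x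
    proof (cases "x \<in> C \<or> x \<in> U")
      case True
      then show ?thesis using Hn0[of n x] C(2) by (auto simp: indicator_def)
    next
      case False
      then have "Hn n x = 0" using U(2) by (auto simp: E_def Hn_def)
      then show ?thesis using False by simp
    qed
  qed
  also have "\<dots> = (\<integral>x. H x \<partial>\<mu>) - (\<integral>x. Hn n x \<partial>\<mu>) + real (Suc n) * measure \<mu> (U - C)"
    using H(1) Hni iUC UC by simp
  also have "real (Suc n) * measure \<mu> (U - C) \<le> real (Suc n) * d" by (rule mult_left_mono[OF C(3)]) simp
  also have "real (Suc n) * d = c / 2" by (simp add: d_def del: of_nat_Suc)
  also have "(\<integral>x. H x \<partial>\<mu>) - (\<integral>x. Hn n x \<partial>\<mu>) + c / 2 \<le> c" using n by linarith
  finally show ?thesis using that C(1) by simp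
qed

end

definition restr :: "'a set \<Rightarrow> ('a \<Rightarrow> complex) \<Rightarrow> 'a \<Rightarrow> complex" where
  "restr B f x = (if x \<in> B then f x else 0)"

definition compactly_supported :: "('a::topological_space \<Rightarrow> complex) \<Rightarrow> bool" where
  "compactly_supported f \<longleftrightarrow> (\<exists>C. compact C \<and> (\<forall>x. x \<notin> C \<longrightarrow> f x = 0))"

context orlicz_setup
begin

lemma restr_in_orlicz_space:
  assumes y: "young_function \<Theta>" and f: "f \<in> orlicz_space \<mu> \<Theta>" and B: "B \<in> sets borel"
  shows "restr B f \<in> orlicz_space \<mu> \<Theta>"
proof (rule orlicz_space_mono[OF y f])
  have "(\<lambda>x. if x \<in> B then f x else 0) \<in> borel_measurable \<mu>"
    using B orlicz_space_measurable[OF f] by (intro measurable_If) auto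
  then show "restr B f \<in> borel_measurable \<mu>" by (simp add: restr_def[abs_def])
qed (simp add: restr_def)

lemma modular_compact_tail:
  assumes y: "young_function \<Theta>" and d: "delta2 \<Theta>" and f: "f \<in> orlicz_space \<mu> \<Theta>" and c: "c \<ge> 0"
  obtains C where "compact C" "(\<integral>\<^sup>+ x. ennreal (\<Theta> (c * cmod (restr (- C) f x))) \<partial>\<mu>) \<le> 1"
proof -
  define H where "H = (\<lambda>x. \<Theta> (c * cmod (f x)))"
  have H0: "H x \<ge> 0" for x using young_functionD(4)[OF y] by (simp add: H_def)
  have [measurable]: "f \<in> borel_measurable \<mu>" "\<Theta> \<in> borel_measurable borel"
    using orlicz_space_measurable[OF f] young_measurable[OF y] by auto
  have Hm: "H \<in> borel_measurable \<mu>" unfolding H_def by measurable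
  have Hi: "integrable \<mu> H"
    by (rule integrableI_bounded[OF Hm]) (use orlicz_modular_finite[OF y d f c] H0 in \<open>simp add: H_def\<close>)
  obtain C where C: "compact C" "(\<integral>x. indicator (- C) x * H x \<partial>\<mu>) \<le> 1"
    by (rule integrable_compact_tail[OF Hi H0 zero_less_one]) (rule that)
  have iCH: "integrable \<mu> (\<lambda>x. indicator (- C) x * H x)"
    using integrable_real_mult_indicator[OF _ Hi, of "- C"] C(1) by (simp add: mult.commute borel_comp)
  have "(\<integral>\<^sup>+ x. ennreal (\<Theta> (c * cmod (restr (- C) f x))) \<partial>\<mu>) = (\<integral>\<^sup>+ x. ennreal (indicator (- C) x * H x) \<partial>\<mu>)"
    by (intro nn_integral_cong) (simp add: restr_def H_def young_functionD(5)[OF y])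
  also have "\<dots> = ennreal (\<integral>x. indicator (- C) x * H x \<partial>\<mu>)"
    by (rule nn_integral_eq_integral[OF iCH]) (use H0 in auto)
  also have "\<dots> \<le> 1" using C(2) by simp
  finally show ?thesis using that C(1) by blast
qed

text \<open>Stated for an abstract monotone \<open>N\<close>, to serve the Luxemburg and the Orlicz
  norm alike. The function is cut along an increasing sequence of compact sets whose complements
  carry tails of geometrically small norm: the first piece costs at most \<open>N f\<close>, all
  later ones together at most \<open>\<eta>\<close>.\<close>

lemma compact_pieces:
  fixes N :: "('g \<Rightarrow> complex) \<Rightarrow> real"
  assumes N0: "\<And>h. h \<in> S \<Longrightarrow> N h \<ge> 0" and mono: "\<And>h h'. h \<in> S \<Longrightarrow> h' \<in> S \<Longrightarrow> (\<And>x. cmod (h x) \<le> cmod (h' x)) \<Longrightarrow> N h \<le> N h'"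
    and r: "\<And>B. B \<in> sets borel \<Longrightarrow> restr B f \<in> S"
    and tail: "\<And>c. c > 0 \<Longrightarrow> \<exists>C. compact C \<and> N (restr (- C) f) \<le> c" and \<eta>: "\<eta> > 0"
  obtains F where "\<And>m. F m \<in> S" "\<And>m. compactly_supported (F m)" "summable (\<lambda>m. N (F m))" "(\<Sum>m. N (F m)) \<le> N f + \<eta>"
    "\<And>m. (\<lambda>x. f x - (\<Sum>i<m. F i x)) \<in> S" "(\<lambda>m. N (\<lambda>x. f x - (\<Sum>i<m. F i x))) \<longlonglongrightarrow> 0"
proof -
  have "\<forall>m. \<exists>C. compact C \<and> N (restr (- C) f) \<le> \<eta> * (1/2)^Suc m" by (intro allI tail) (use \<eta> in simp)
  then obtain C0 where C0: "\<And>m. compact (C0 m)" "\<And>m. N (restr (- C0 m) f) \<le> \<eta> * (1/2)^Suc m" by metis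
  define C where "C = (\<lambda>m. \<Union>i\<le>m. C0 i)"
  have C: "compact (C m)" for m unfolding C_def by (intro compact_UN) (use C0 in auto)
  have Cb: "C m \<in> sets borel" for m using C by simp
  have Cm: "C m \<subseteq> C (Suc m)" for m unfolding C_def by (intro UN_mono) auto
  have CN: "N (restr (- C m) f) \<le> \<eta> * (1/2)^Suc m" for m
  proof (rule order.trans[OF mono C0(2)])
    show "restr (- C m) f \<in> S" "restr (- C0 m) f \<in> S" by (rule r, simp add: borel_comp C C0(1))+
    show "cmod (restr (- C m) f x) \<le> cmod (restr (- C0 m) f x)" for x by (auto simp: restr_def C_def)
  qed
  define B where "B = (\<lambda>m. case m of 0 \<Rightarrow> C 0 | Suc i \<Rightarrow> C (Suc i) - C i)"
  have Bb: "B m \<in> sets borel" for m using Cb by (cases m) (auto simp: B_def)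
  define F where "F = (\<lambda>m. restr (B m) f)"
  have FS: "F m \<in> S" for m unfolding F_def by (rule r[OF Bb])
  have fS: "f \<in> S" using r[of UNIV] by (simp add: restr_def[abs_def])
  have Fc: "compactly_supported (F m)" for m
  proof -
    have "B m \<subseteq> C m" by (cases m) (auto simp: B_def)
    then show ?thesis unfolding compactly_supported_def using C[of m] by (intro exI[of _ "C m"]) (auto simp: F_def restr_def)
  qed
  have part: "(\<Sum>i<Suc m. F i x) = restr (C m) f x" for m x
  proof (induction m)
    case (Suc m)
    then show ?case using Cm[of m] by (auto simp: F_def B_def restr_def)
  qed (simp add: F_def B_def)
  have rem: "(\<lambda>x. f x - (\<Sum>i<Suc m. F i x)) = restr (- C m) f" for m unfolding part by (auto simp: restr_def)
  define b where "b = (\<lambda>m. case m of 0 \<Rightarrow> N f | Suc i \<Rightarrow> \<eta> * (1/2)^Suc i)"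
  have Fb: "N (F m) \<le> b m" for m
  proof (cases m)
    case 0
    then show ?thesis using mono[OF FS fS, of 0] by (simp add: b_def F_def restr_def)
  next
    case (Suc i)
    have "N (F (Suc i)) \<le> N (restr (- C i) f)"
      by (rule mono[OF FS r]) (use Cb in \<open>auto simp: F_def B_def restr_def\<close>)
    then show ?thesis using CN[of i] Suc by (simp add: b_def)
  qed
  have "(\<lambda>i. (\<eta> / 2) * (1/2)^i) sums ((\<eta> / 2) * 2)" by (intro sums_mult) (use geometric_sums[of "1/2::real"] in simp)
  then have "(\<lambda>i. b (Suc i)) sums (N f + \<eta> - b 0)" by (simp add: b_def)
  then have bs: "b sums (N f + \<eta>)" by (simp add: sums_Suc_iff)
  have su: "summable (\<lambda>m. N (F m))"
    by (rule summable_comparison_test'[OF sums_summable[OF bs], of 0]) (use Fb N0[OF FS] in simp)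
  have le: "(\<Sum>m. N (F m)) \<le> N f + \<eta>" using suminf_le[OF Fb su sums_summable[OF bs]] sums_unique[OF bs] by simp
  have remS: "(\<lambda>x. f x - (\<Sum>i<m. F i x)) \<in> S" for m using fS rem r Cb by (cases m) (auto simp: borel_comp simp del: sum.lessThan_Suc)
  have lim: "(\<lambda>m. N (\<lambda>x. f x - (\<Sum>i<m. F i x))) \<longlonglongrightarrow> 0"
  proof (subst filterlim_sequentially_Suc[symmetric], rule Lim_null_comparison)
    show "\<forall>\<^sub>F m in sequentially. norm (N (\<lambda>x. f x - (\<Sum>i<Suc m. F i x))) \<le> (\<eta> / 2) * (1/2)^m"
      using CN N0[OF r] Cb unfolding rem by (intro always_eventually) simp
    show "(\<lambda>m. (\<eta> / 2) * (1/2)^m) \<longlonglongrightarrow> 0" by (rule tendsto_mult_right_zero, rule LIMSEQ_realpow_zero) auto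
  qed
  show ?thesis by (rule that[OF FS Fc su le remS lim])
qed

lemma luxemburg_pieces:
  assumes f: "f \<in> L\<Phi>" and \<eta>: "\<eta> > 0"
  obtains F where "\<And>m. F m \<in> L\<Phi>" "\<And>m. compactly_supported (F m)" "summable (\<lambda>m. N\<Phi> (F m))" "(\<Sum>m. N\<Phi> (F m)) \<le> N\<Phi> f + \<eta>"
    "\<And>m. (\<lambda>x. f x - (\<Sum>i<m. F i x)) \<in> L\<Phi>" "(\<lambda>m. N\<Phi> (\<lambda>x. f x - (\<Sum>i<m. F i x))) \<longlonglongrightarrow> 0"
proof -
  have tail: "\<exists>C. compact C \<and> N\<Phi> (restr (- C) f) \<le> c" if c: "c > 0" for c
  proof -
  obtain C where C: "compact C" "(\<integral>\<^sup>+ x. ennreal (\<Phi> ((1 / c) * cmod (restr (- C) f x))) \<partial>\<mu>) \<le> 1"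
    by (rule modular_compact_tail[OF young\<Phi> d2\<Phi> f, of "1 / c"]) (use c in simp, rule that)
  then have "N\<Phi> (restr (- C) f) \<le> c" using c by (intro luxemburg_le) simp_all
  then show ?thesis using C(1) by blast
  qed
  show ?thesis
    by (rule compact_pieces[where N = N\<Phi> and S = L\<Phi> and f = f and \<eta> = \<eta>], (rule luxemburg_nonneg[OF young\<Phi> d2\<Phi>]; assumption),
       (rule luxemburg_mono[OF young\<Phi> d2\<Phi>]; simp), (rule restr_in_orlicz_space[OF young\<Phi> f]; assumption), (rule tail; assumption), rule \<eta>)
       (rule that)
qed

lemma orlicz_pieces:
  assumes g: "g \<in> L\<Psi>" and \<eta>: "\<eta> > 0"
  obtains G where "\<And>m. G m \<in> L\<Psi>" "\<And>m. compactly_supported (G m)" "summable (\<lambda>m. N\<Psi> (G m))" "(\<Sum>m. N\<Psi> (G m)) \<le> N\<Psi> g + \<eta>"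
    "\<And>m. (\<lambda>x. g x - (\<Sum>i<m. G i x)) \<in> L\<Psi>" "(\<lambda>m. N\<Psi> (\<lambda>x. g x - (\<Sum>i<m. G i x))) \<longlonglongrightarrow> 0"
proof -
  have tail: "\<exists>C. compact C \<and> N\<Psi> (restr (- C) g) \<le> c" if c: "c > 0" for c
  proof -
  \<comment> \<open>The factor 2 in \<open>2 / c\<close> compensates that a modular of at most 1
    gives only an Orlicz norm of at most 2.\<close>
  obtain C where C: "compact C" "(\<integral>\<^sup>+ x. ennreal (\<Psi> ((2 / c) * cmod (restr (- C) g x))) \<partial>\<mu>) \<le> 1"
    by (rule modular_compact_tail[OF young\<Psi> d2\<Psi> g, of "2 / c"]) (use c in simp, rule that)
  define h where "h = (\<lambda>x. complex_of_real (2 / c) * restr (- C) g x)"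
  have h: "h \<in> L\<Psi>" unfolding h_def
    by (rule orlicz_space_cmult[OF young\<Psi> d2\<Psi> restr_in_orlicz_space[OF young\<Psi> g]]) (use C in \<open>simp add: borel_comp\<close>)
  have Nh: "N\<Psi> h \<le> 1 + 1"
    by (rule orlicz_norm_le_modular[OF orlicz_space_measurable[OF h]]) (use C(2) c in \<open>simp_all add: h_def norm_mult norm_divide\<close>)
  have re: "restr (- C) g = (\<lambda>x. complex_of_real (c / 2) * h x)" using c by (auto simp: h_def)
  have "N\<Psi> (restr (- C) g) \<le> cmod (complex_of_real (c / 2)) * N\<Psi> h" unfolding re by (rule orlicz_norm_cmult_le[OF h])
  also have "\<dots> \<le> cmod (complex_of_real (c / 2)) * 2" by (rule mult_left_mono) (use Nh in auto)
  also have "\<dots> = c" using c by (simp add: norm_divide)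
  finally have "N\<Psi> (restr (- C) g) \<le> c" .
  then show ?thesis using C(1) by blast
  qed
  show ?thesis
    by (rule compact_pieces[where N = N\<Psi> and S = L\<Psi> and f = g and \<eta> = \<eta>], (rule orlicz_norm_nonneg; assumption),
       (rule orlicz_norm_mono; simp), (rule restr_in_orlicz_space[OF young\<Psi> g]; assumption), (rule tail; assumption), rule \<eta>)
       (rule that)
qed

lemma conv_check_sums_left:
  assumes f: "f \<in> L\<Phi>" and g: "g \<in> L\<Psi>" and F: "\<And>m. F m \<in> L\<Phi>" "\<And>m. (\<lambda>x. f x - (\<Sum>i<m. F i x)) \<in> L\<Phi>"
    and lim: "(\<lambda>m. N\<Phi> (\<lambda>x. f x - (\<Sum>i<m. F i x))) \<longlonglongrightarrow> 0"
  shows "(\<lambda>m. conv_check \<mu> (F m) g x) sums conv_check \<mu> f g x"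
  unfolding sums_def
proof (rule LIM_zero_cancel, rule Lim_null_comparison)
  show "(\<lambda>m. N\<Phi> (\<lambda>x. f x - (\<Sum>i<m. F i x)) * N\<Psi> g) \<longlonglongrightarrow> 0" by (rule tendsto_mult_left_zero[OF lim])
  have "conv_check \<mu> (\<lambda>x. f x - (\<Sum>i<m. F i x)) g x = conv_check \<mu> f g x - (\<Sum>i<m. conv_check \<mu> (F i) g x)" for m
    unfolding conv_check_def left_diff_distrib sum_distrib_right
    using conv_check_integrable[OF f g, of x] conv_check_integrable[OF F(1) g, of _ x] by (simp add: Bochner_Integration.integral_sum)
  then have "norm ((\<Sum>i<m. conv_check \<mu> (F i) g x) - conv_check \<mu> f g x) \<le> N\<Phi> (\<lambda>x. f x - (\<Sum>i<m. F i x)) * N\<Psi> g" for m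
    using conv_check_bound[OF F(2) g, of m x] by (simp add: norm_minus_commute)
  then show "\<forall>\<^sub>F m in sequentially. norm ((\<Sum>i<m. conv_check \<mu> (F i) g x) - conv_check \<mu> f g x) \<le> N\<Phi> (\<lambda>x. f x - (\<Sum>i<m. F i x)) * N\<Psi> g"
    by (intro always_eventually) simp
qed

lemma conv_check_sums_right:
  assumes f: "f \<in> L\<Phi>" and g: "g \<in> L\<Psi>" and G: "\<And>m. G m \<in> L\<Psi>" "\<And>m. (\<lambda>x. g x - (\<Sum>i<m. G i x)) \<in> L\<Psi>"
    and lim: "(\<lambda>m. N\<Psi> (\<lambda>x. g x - (\<Sum>i<m. G i x))) \<longlonglongrightarrow> 0"
  shows "(\<lambda>m. conv_check \<mu> f (G m) x) sums conv_check \<mu> f g x"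
  unfolding sums_def
proof (rule LIM_zero_cancel, rule Lim_null_comparison)
  show "(\<lambda>m. N\<Phi> f * N\<Psi> (\<lambda>x. g x - (\<Sum>i<m. G i x))) \<longlonglongrightarrow> 0" by (rule tendsto_mult_right_zero[OF lim])
  have "conv_check \<mu> f (\<lambda>x. g x - (\<Sum>i<m. G i x)) x = conv_check \<mu> f g x - (\<Sum>i<m. conv_check \<mu> f (G i) x)" for m
    unfolding conv_check_def right_diff_distrib sum_distrib_left
    using conv_check_integrable[OF f g, of x] conv_check_integrable[OF f G(1), of _ x] by (simp add: Bochner_Integration.integral_sum)
  then have "norm ((\<Sum>i<m. conv_check \<mu> f (G i) x) - conv_check \<mu> f g x) \<le> N\<Phi> f * N\<Psi> (\<lambda>x. g x - (\<Sum>i<m. G i x))" for m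
    using conv_check_bound[OF f G(2), of m x] by (simp add: norm_minus_commute)
  then show "\<forall>\<^sub>F m in sequentially. norm ((\<Sum>i<m. conv_check \<mu> f (G i) x) - conv_check \<mu> f g x) \<le> N\<Phi> f * N\<Psi> (\<lambda>x. g x - (\<Sum>i<m. G i x))"
    by (intro always_eventually) simp
qed

lemma tensor_compact_rep:
  assumes f: "f \<in> L\<Phi>" and g: "g \<in> L\<Psi>" and \<epsilon>: "\<epsilon> > 0"
  obtains F G where "rep (conv_check \<mu> f g) F G" "\<And>m. compactly_supported (F m) \<and> compactly_supported (G m)"
    "(\<Sum>m. N\<Phi> (F m) * N\<Psi> (G m)) \<le> N\<Phi> f * N\<Psi> g + \<epsilon>"
proof -
  define s where "s = N\<Phi> f + N\<Psi> g + 1"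
  have n0: "N\<Phi> f \<ge> 0" "N\<Psi> g \<ge> 0" using luxemburg_nonneg[OF young\<Phi> d2\<Phi> f] orlicz_norm_nonneg[OF g] by auto
  then have s: "s \<ge> 1" by (simp add: s_def)
  \<comment> \<open>The excess in the product of the two norms is
    \<open>\<eta> * (N\<Phi> f + N\<Psi> g + \<eta>)\<close>; because of
    \<open>\<eta> \<le> 1\<close> it is at most \<open>\<eta> * s\<close>, hence at most
    \<open>\<epsilon>\<close>.\<close>
  define \<eta> where "\<eta> = min 1 (\<epsilon> / s)"
  have \<eta>: "\<eta> > 0" "\<eta> \<le> 1" "\<eta> * s \<le> \<epsilon>"
  proof -
    show "\<eta> > 0" "\<eta> \<le> 1" using \<epsilon> s by (auto simp: \<eta>_def)
    have "\<eta> * s \<le> (\<epsilon> / s) * s" by (rule mult_right_mono) (use s in \<open>auto simp: \<eta>_def\<close>)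
    then show "\<eta> * s \<le> \<epsilon>" using s by simp
  qed
  obtain F where F: "\<And>m. F m \<in> L\<Phi>" "\<And>m. compactly_supported (F m)" "summable (\<lambda>m. N\<Phi> (F m))" "(\<Sum>m. N\<Phi> (F m)) \<le> N\<Phi> f + \<eta>"
    "\<And>m. (\<lambda>x. f x - (\<Sum>i<m. F i x)) \<in> L\<Phi>" "(\<lambda>m. N\<Phi> (\<lambda>x. f x - (\<Sum>i<m. F i x))) \<longlonglongrightarrow> 0"
    by (rule luxemburg_pieces[OF f \<eta>(1)]) (rule that)
  obtain G where G: "\<And>m. G m \<in> L\<Psi>" "\<And>m. compactly_supported (G m)" "summable (\<lambda>m. N\<Psi> (G m))" "(\<Sum>m. N\<Psi> (G m)) \<le> N\<Psi> g + \<eta>"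
    "\<And>m. (\<lambda>x. g x - (\<Sum>i<m. G i x)) \<in> L\<Psi>" "(\<lambda>m. N\<Psi> (\<lambda>x. g x - (\<Sum>i<m. G i x))) \<longlonglongrightarrow> 0"
    by (rule orlicz_pieces[OF g \<eta>(1)]) (rule that)
  have r: "rep (conv_check \<mu> (F m) g) (\<lambda>_. F m) G" for m
    unfolding AP_rep_def using F(1) G(1,3) conv_check_sums_right[OF F(1) g G(1,5,6)] by (auto intro: summable_mult)
  have Sm: "(\<Sum>l. N\<Phi> (F m) * N\<Psi> (G l)) = (\<Sum>l. N\<Psi> (G l)) * N\<Phi> (F m)" for m
    using suminf_mult[OF G(3), of "N\<Phi> (F m)"] by (simp add: mult.commute)
  have "summable (\<lambda>m. \<Sum>l. N\<Phi> (F m) * N\<Psi> (G l))" unfolding Sm by (rule summable_mult[OF F(3)])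
  note d = AP_rep_double[OF r this conv_check_sums_left[OF f g F(1,5,6)]]
  show ?thesis
  proof (rule that[OF d(1)])
    have "(\<Sum>m. \<Sum>l. N\<Phi> (F m) * N\<Psi> (G l)) = (\<Sum>l. N\<Psi> (G l)) * (\<Sum>m. N\<Phi> (F m))" unfolding Sm by (rule suminf_mult[OF F(3)])
    also have "\<dots> \<le> (N\<Psi> g + \<eta>) * (N\<Phi> f + \<eta>)"
      by (rule mult_mono[OF G(4) F(4)]) (use n0 \<eta> suminf_nonneg[OF F(3)] luxemburg_nonneg[OF young\<Phi> d2\<Phi> F(1)] in auto)
    also have "\<dots> = N\<Phi> f * N\<Psi> g + \<eta> * (N\<Phi> f + N\<Psi> g + \<eta>)" by (simp add: algebra_simps)
    also have "\<eta> * (N\<Phi> f + N\<Psi> g + \<eta>) \<le> \<eta> * s" by (rule mult_left_mono) (use \<eta> in \<open>auto simp: s_def\<close>)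
    finally show "(\<Sum>k. N\<Phi> (F (fst (prod_decode k))) * N\<Psi> (G (snd (prod_decode k)))) \<le> N\<Phi> f * N\<Psi> g + \<epsilon>"
      unfolding d(2) using \<eta>(3) by linarith
  qed (use F(2) G(2) in simp)
qed

text \<open>Products with the approximate units are estimated for compactly supported tensors, so
  every element needs such a representation. Each tensor of a given representation is decomposed
  separately, with an excess \<open>(1/2)^n\<close> that keeps the total summable.\<close>

lemma AP_compact_rep:
  assumes u: "u \<in> A"
  obtains F G where "rep u F G" "\<And>m. compactly_supported (F m) \<and> compactly_supported (G m)"
proof -
  obtain f g where r: "rep u f g" using u by (auto simp: AP_def)
  note rD = repD[OF r]
  have "\<forall>n. \<exists>F G. rep (conv_check \<mu> (f n) (g n)) F G \<and> (\<forall>m. compactly_supported (F m) \<and> compactly_supported (G m)) \<and>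
      (\<Sum>m. N\<Phi> (F m) * N\<Psi> (G m)) \<le> N\<Phi> (f n) * N\<Psi> (g n) + (1/2)^n"
  proof
    fix n
    have p: "(1/2::real)^n > 0" by simp
    show "\<exists>F G. rep (conv_check \<mu> (f n) (g n)) F G \<and> (\<forall>m. compactly_supported (F m) \<and> compactly_supported (G m)) \<and>
      (\<Sum>m. N\<Phi> (F m) * N\<Psi> (G m)) \<le> N\<Phi> (f n) * N\<Psi> (g n) + (1/2)^n"
      by (rule tensor_compact_rep[OF rD(1,2) p, of n n]) blast
  qed
  from choice[OF this] obtain F where "\<forall>n. \<exists>G. rep (conv_check \<mu> (f n) (g n)) (F n) G \<and>
      (\<forall>m. compactly_supported (F n m) \<and> compactly_supported (G m)) \<and>
      (\<Sum>m. N\<Phi> (F n m) * N\<Psi> (G m)) \<le> N\<Phi> (f n) * N\<Psi> (g n) + (1/2)^n" by (rule exE) (rule that)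
  from choice[OF this] obtain G where G: "\<forall>n. rep (conv_check \<mu> (f n) (g n)) (F n) (G n) \<and>
      (\<forall>m. compactly_supported (F n m) \<and> compactly_supported (G n m)) \<and>
      (\<Sum>m. N\<Phi> (F n m) * N\<Psi> (G n m)) \<le> N\<Phi> (f n) * N\<Psi> (g n) + (1/2)^n" by (rule exE) (rule that)
  then have FG: "rep (conv_check \<mu> (f n) (g n)) (F n) (G n)" "compactly_supported (F n m) \<and> compactly_supported (G n m)"
    "(\<Sum>m. N\<Phi> (F n m) * N\<Psi> (G n m)) \<le> N\<Phi> (f n) * N\<Psi> (g n) + (1/2)^n" for n m by simp_all
  have "summable (\<lambda>n. \<Sum>m. N\<Phi> (F n m) * N\<Psi> (G n m))"
  proof (rule summable_comparison_test'[of "\<lambda>n. N\<Phi> (f n) * N\<Psi> (g n) + (1/2)^n" 0])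
    show "summable (\<lambda>n. N\<Phi> (f n) * N\<Psi> (g n) + (1/2)^n)" by (intro summable_add rD(3) summable_geometric) simp
    show "norm (\<Sum>m. N\<Phi> (F n m) * N\<Psi> (G n m)) \<le> N\<Phi> (f n) * N\<Psi> (g n) + (1/2)^n" for n
      using FG(3)[of n] suminf_nonneg[OF repD(3)[OF FG(1)[of n]]] norm_product_nonneg[OF repD(1,2)[OF FG(1)[of n]]] by simp
  qed
  from AP_rep_double(1)[OF FG(1) this rD(4)] show ?thesis by (rule that) (use FG(2) in simp)
qed

section \<open>From an invariant mean to a right identity\<close>

text \<open>The multiplier bound is demanded for compactly supported tensors;
  \<open>AP_compact_rep\<close> carries it to products with every element of \<open>A\<close>. It is
  kept apart from the approximation property in \<open>units_on\<close>, because it must hold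
  uniformly for the limits along the filter to be limits of bounded functions.\<close>

definition multiplier_units :: "real \<Rightarrow> ('g \<Rightarrow> complex) set" where
  "multiplier_units K = {e \<in> A. nA e \<le> 4 \<and> (\<forall>f\<in>L\<Phi>. \<forall>g\<in>L\<Psi>. compactly_supported f \<longrightarrow> compactly_supported g \<longrightarrow>
     (\<lambda>x. conv_check \<mu> f g x * e x) \<in> A \<and> nA (\<lambda>x. conv_check \<mu> f g x * e x) \<le> 20 * K * (N\<Phi> f * N\<Psi> g))}"

definition units_on :: "real \<Rightarrow> 'g set \<Rightarrow> real \<Rightarrow> ('g \<Rightarrow> complex) set" where
  "units_on K Z \<epsilon> = {e \<in> multiplier_units K. \<forall>f\<in>L\<Phi>. \<forall>g\<in>L\<Psi>. (\<forall>y. y \<notin> Z \<longrightarrow> f y = 0 \<and> g y = 0) \<longrightarrow>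
     nA (\<lambda>x. conv_check \<mu> f g x * e x - conv_check \<mu> f g x) \<le> \<epsilon> * (N\<Phi> f * N\<Psi> g)}"

lemma units_on_antimono:
  assumes "Z \<subseteq> Z'" "\<epsilon>' \<le> \<epsilon>" shows "units_on K Z' \<epsilon>' \<subseteq> units_on K Z \<epsilon>"
proof
  fix e assume e: "e \<in> units_on K Z' \<epsilon>'"
  show "e \<in> units_on K Z \<epsilon>"
    unfolding units_on_def
  proof (intro CollectI conjI ballI impI)
    show "e \<in> multiplier_units K" using e by (simp add: units_on_def)
    fix f g assume fg: "f \<in> L\<Phi>" "g \<in> L\<Psi>" "\<forall>y. y \<notin> Z \<longrightarrow> f y = 0 \<and> g y = 0"
    then have "nA (\<lambda>x. conv_check \<mu> f g x * e x - conv_check \<mu> f g x) \<le> \<epsilon>' * (N\<Phi> f * N\<Psi> g)"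
      using e assms(1) unfolding units_on_def by blast
    also have "\<dots> \<le> \<epsilon> * (N\<Phi> f * N\<Psi> g)" by (rule mult_right_mono[OF assms(2) norm_product_nonneg[OF fg(1,2)]])
    finally show "nA (\<lambda>x. conv_check \<mu> f g x * e x - conv_check \<mu> f g x) \<le> \<epsilon> * (N\<Phi> f * N\<Psi> g)" .
  qed
qed

lemma units_on_nonempty:
  assumes am: "amenable \<mu>" and K: "rad_const K" and Z: "compact Z" and \<epsilon>: "\<epsilon> > 0"
  shows "units_on K Z \<epsilon> \<noteq> {}"
proof -
  have K0: "K > 0" using K by (simp add: rad_const_def)
  \<comment> \<open>The Reiter tolerance for which the part \<open>40 * K * sqrt d\<close> of the
    error is \<open>\<epsilon> / 2\<close>. The other half is left to
    \<open>measure \<mu> P / real n\<close>, where \<open>n\<close> is chosen after \<open>k\<close>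
    and its support \<open>P\<close>.\<close>
  define d where "d = (\<epsilon> / (80 * K))\<^sup>2"
  have d: "d > 0" "40 * K * sqrt d = \<epsilon> / 2" using \<epsilon> K0 by (auto simp: d_def)
  obtain k where k: "k \<in> Cc" "\<And>x. k x \<ge> 0" "(\<integral>x. k x \<partial>\<mu>) = 1" "\<And>y. y \<in> Z \<Longrightarrow> (\<integral>w. \<bar>k (y + w) - k w\<bar> \<partial>\<mu>) \<le> d"
    by (rule reiter_compact[OF am Z d(1)]) (rule that)
  obtain P where P: "compact P" "\<And>x. x \<notin> P \<Longrightarrow> k x = 0" using CcE[OF k(1)] by blast
  obtain C where C: "C \<ge> 0" "\<And>x. \<bar>k x\<bar> \<le> C" using Cc_bounded[OF k(1)] by blast
  obtain n :: nat where n0: "max 1 (max (measure \<mu> P) (2 * measure \<mu> P / \<epsilon>)) \<le> real n" using real_arch_simple by blast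
  then have n: "n > 0" "measure \<mu> P \<le> real n" "2 * measure \<mu> P / \<epsilon> \<le> real n" by auto
  obtain J :: nat where J0: "real n * C \<le> real J" using real_arch_simple by blast
  have J: "real n * k x \<le> real J" for x
    by (rule order.trans[OF mult_left_mono[OF abs_le_D1[OF C(2)]] J0]) simp
  let ?e = "slice_unit n J k"
  have m: "?e \<in> multiplier_units K"
    unfolding multiplier_units_def
  proof (intro CollectI conjI ballI impI)
    show "?e \<in> A" "nA ?e \<le> 4" by (rule slice_unit_norm[OF k(1-3) P n(1,2)]; assumption)+
    fix f g assume fg: "f \<in> L\<Phi>" "g \<in> L\<Psi>" "compactly_supported f" "compactly_supported g"
    from fg(3,4) obtain C1 C2 where C12: "compact C1" "\<forall>x. x \<notin> C1 \<longrightarrow> f x = 0" "compact C2" "\<forall>x. x \<notin> C2 \<longrightarrow> g x = 0"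
      unfolding compactly_supported_def by blast
    have c: "compact (C1 \<union> C2)" using C12 by (simp add: compact_Un)
    have z: "f y = 0" "g y = 0" if "y \<notin> C1 \<union> C2" for y using that C12 by auto
    show "(\<lambda>x. conv_check \<mu> f g x * ?e x) \<in> A" "nA (\<lambda>x. conv_check \<mu> f g x * ?e x) \<le> 20 * K * (N\<Phi> f * N\<Psi> g)"
      using slice_unit_multiplier(1,2)[OF K k(1-3) n(1) c fg(1) z(1) fg(2) z(2)] by blast+
  qed
  have "?e \<in> units_on K Z \<epsilon>"
    unfolding units_on_def
  proof (intro CollectI conjI ballI impI m)
    fix f g assume fg: "f \<in> L\<Phi>" "g \<in> L\<Psi>" and z: "\<forall>y. y \<notin> Z \<longrightarrow> f y = 0 \<and> g y = 0"
    have z': "f y = 0" "g y = 0" if "y \<notin> Z" for y using z that by auto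
    have "nA (\<lambda>x. conv_check \<mu> f g x * ?e x - conv_check \<mu> f g x) \<le> (40 * K * sqrt d + measure \<mu> P / real n) * (N\<Phi> f * N\<Psi> g)"
      by (rule slice_unit_multiplier(3)[OF K k(1-3) n(1) Z fg(1) z'(1) fg(2) z'(2) P d(1) k(4) J]; assumption)
    also have "\<dots> \<le> \<epsilon> * (N\<Phi> f * N\<Psi> g)"
    proof (rule mult_right_mono[OF _ norm_product_nonneg[OF fg]])
      have "measure \<mu> P / real n \<le> \<epsilon> / 2" using n \<epsilon> by (simp add: field_simps)
      then show "40 * K * sqrt d + measure \<mu> P / real n \<le> \<epsilon>" using d(2) by linarith
    qed
    finally show "nA (\<lambda>x. conv_check \<mu> f g x * ?e x - conv_check \<mu> f g x) \<le> \<epsilon> * (N\<Phi> f * N\<Psi> g)" .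
  qed
  then show ?thesis by blast
qed

lemma multiplier_unit_product:
  assumes K: "rad_const K" and e: "e \<in> multiplier_units K" and r: "rep u F G" and c: "\<And>m. compactly_supported (F m) \<and> compactly_supported (G m)"
  shows "(\<lambda>x. u x * e x) \<in> A" "nA (\<lambda>x. u x * e x) \<le> 20 * K * (\<Sum>m. N\<Phi> (F m) * N\<Psi> (G m))"
proof -
  note rD = repD[OF r]
  have t: "(\<lambda>x. conv_check \<mu> (F m) (G m) x * e x) \<in> A" "nA (\<lambda>x. conv_check \<mu> (F m) (G m) x * e x) \<le> 20 * K * (N\<Phi> (F m) * N\<Psi> (G m))" for m
    using e rD(1,2)[of m] c[of m] unfolding multiplier_units_def by blast+
  have s: "(\<lambda>m. conv_check \<mu> (F m) (G m) x * e x) sums (u x * e x)" for x by (rule sums_mult2[OF rD(4)])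
  from AP_series[OF t summable_mult[OF rD(3)] s] show "(\<lambda>x. u x * e x) \<in> A" "nA (\<lambda>x. u x * e x) \<le> 20 * K * (\<Sum>m. N\<Phi> (F m) * N\<Psi> (G m))"
    by (simp_all add: suminf_mult[OF rD(3)])
qed

text \<open>A head and tail argument: the first \<open>N\<close> tensors of a compactly supported
  representation live on one compact \<open>Z\<close>, where \<open>e\<close> is nearly an identity.
  On the tail there is only the uniform bound \<open>20 * K + 1\<close>, one part for the product
  with \<open>e\<close> and one for the tensor itself.\<close>

lemma approximate_unit_limit:
  assumes K: "rad_const K" and u: "u \<in> A" and T: "T \<in> D" and r: "r > 0"
  obtains Z \<epsilon> where "compact Z" "\<epsilon> > 0" "\<And>e. e \<in> units_on K Z \<epsilon> \<Longrightarrow> cmod (T (\<lambda>x. u x * e x) - T u) \<le> r"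
proof -
  have K0: "K > 0" using K by (simp add: rad_const_def)
  obtain F G where R: "rep u F G" "\<And>m. compactly_supported (F m) \<and> compactly_supported (G m)"
    by (rule AP_compact_rep[OF u]) (rule that)
  note rD = repD[OF R(1)]
  define a where "a = (\<lambda>m. N\<Phi> (F m) * N\<Psi> (G m))"
  have a0: "a m \<ge> 0" for m unfolding a_def by (rule norm_product_nonneg[OF rD(1,2)])
  have as: "summable a" using rD(3) by (simp add: a_def)
  define s where "s = suminf a"
  have s0: "s \<ge> 0" unfolding s_def by (rule suminf_nonneg[OF as a0])
  define M where "M = 20 * K + 1"
  have M0: "M > 0" using K0 by (simp add: M_def)
  have nT: "nD T \<ge> 0" by (rule dual_norm_nonneg[OF T])
  define q where "q = r / (nD T + 1)"
  have q: "q > 0" using r nT by (simp add: q_def)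
  have "q / (2 * M) > 0" using q M0 by simp
  then obtain N where "\<forall>n\<ge>N. norm (\<Sum>i. a (i + n)) < q / (2 * M)" using suminf_exist_split[OF _ as] by blast
  then have N: "(\<Sum>i. a (i + N)) < q / (2 * M)" by (auto dest!: spec[of _ N] simp: abs_less_iff)
  define \<epsilon> where "\<epsilon> = q / (2 * (s + 1))"
  have \<epsilon>: "\<epsilon> > 0" using q s0 by (simp add: \<epsilon>_def)
  have "\<forall>m. \<exists>C. compact C \<and> (\<forall>y. y \<notin> C \<longrightarrow> F m y = 0 \<and> G m y = 0)"
  proof
    fix m
    obtain C1 C2 where "compact C1" "\<forall>x. x \<notin> C1 \<longrightarrow> F m x = 0" "compact C2" "\<forall>x. x \<notin> C2 \<longrightarrow> G m x = 0"
      using R(2)[of m] unfolding compactly_supported_def by blast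
    then show "\<exists>C. compact C \<and> (\<forall>y. y \<notin> C \<longrightarrow> F m y = 0 \<and> G m y = 0)" by (intro exI[of _ "C1 \<union> C2"]) (auto simp: compact_Un)
  qed
  from choice[OF this] obtain C where C': "\<forall>m. compact (C m) \<and> (\<forall>y. y \<notin> C m \<longrightarrow> F m y = 0 \<and> G m y = 0)"
    by (rule exE) (rule that)
  then have C: "compact (C m)" "y \<notin> C m \<Longrightarrow> F m y = 0 \<and> G m y = 0" for m y by auto
  define Z where "Z = (\<Union>m<N. C m)"
  have Z: "compact Z" unfolding Z_def by (intro compact_UN) (use C(1) in auto)
  have "cmod (T (\<lambda>x. u x * e x) - T u) \<le> r" if e: "e \<in> units_on K Z \<epsilon>" for e
  proof -
    have em: "e \<in> multiplier_units K" using e by (simp add: units_on_def)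
    let ?t = "\<lambda>m. conv_check \<mu> (F m) (G m)"
    have tA: "?t m \<in> A" "nA (?t m) \<le> a m" for m using AP_tensor[OF rD(1,2)] by (simp_all add: a_def)
    have te: "(\<lambda>x. ?t m x * e x) \<in> A" "nA (\<lambda>x. ?t m x * e x) \<le> 20 * K * a m" for m
      using em rD(1,2)[of m] R(2)[of m] unfolding multiplier_units_def a_def by blast+
    define b where "b = (\<lambda>m. if m < N then \<epsilon> * a m else M * a m)"
    have dA: "(\<lambda>x. ?t m x * e x - ?t m x) \<in> A" for m by (rule AP_diff(1)[OF te(1) tA(1)])
    have db: "nA (\<lambda>x. ?t m x * e x - ?t m x) \<le> b m" for m
    proof (cases "m < N")
      case True
      then have "\<forall>y. y \<notin> Z \<longrightarrow> F m y = 0 \<and> G m y = 0" using C(2) by (auto simp: Z_def)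
      then show ?thesis using e rD(1,2)[of m] True unfolding units_on_def b_def a_def by auto
    next
      case False
      have "nA (\<lambda>x. ?t m x * e x - ?t m x) \<le> 20 * K * a m + a m"
        using AP_diff(2)[OF te(1) tA(1), of m m] te(2)[of m] tA(2)[of m] by linarith
      then show ?thesis using False by (simp add: b_def M_def algebra_simps)
    qed
    have bs: "summable b"
    proof (rule summable_comparison_test'[OF summable_mult[OF as, of "\<epsilon> + M"], of 0])
      show "norm (b m) \<le> (\<epsilon> + M) * a m" for m using a0[of m] \<epsilon> M0 by (simp add: b_def distrib_right)
    qed
    have us: "(\<lambda>m. ?t m x * e x - ?t m x) sums (u x * e x - u x)" for x
      by (intro sums_diff sums_mult2 rD(4))
    note U = AP_series[OF dA db bs us]
    have "suminf b = (\<Sum>i. b (i + N)) + (\<Sum>i<N. b i)" by (rule suminf_split_initial_segment[OF bs])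
    also have "(\<Sum>i. b (i + N)) = M * (\<Sum>i. a (i + N))"
      using suminf_mult[OF summable_ignore_initial_segment[OF as, of N], of M] by (simp add: b_def)
    also have "\<dots> \<le> M * (q / (2 * M))" by (rule mult_left_mono) (use N M0 in auto)
    also have "\<dots> = q / 2" using M0 by simp
    also have "(\<Sum>i<N. b i) = \<epsilon> * (\<Sum>i<N. a i)" by (simp add: b_def sum_distrib_left)
    also have "\<dots> \<le> \<epsilon> * (s + 1)"
      using sum_le_suminf[OF as, of "{..<N}"] a0 \<epsilon> by (intro mult_left_mono) (auto simp: s_def)
    also have "\<dots> = q / 2"
    proof -
      have "q / (2 * t) * t = q / 2" if "t > 0" for t using that by simp
      from this[of "s + 1"] show ?thesis unfolding \<epsilon>_def using s0 by linarith
    qed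
    finally have "nA (\<lambda>x. u x * e x - u x) \<le> q" using U(2) by simp
    then have "cmod (T (\<lambda>x. u x * e x - u x)) \<le> q * nD T" by (rule dual_norm_bound[OF T U(1) _ q])
    also have "\<dots> \<le> q * (nD T + 1)" using q by simp
    also have "\<dots> = r" using nT by (simp add: q_def)
    finally show ?thesis using AP_dual_diff[OF T multiplier_unit_product(1)[OF K em R] u] by simp
  qed
  with Z \<epsilon> show ?thesis by (rule that)
qed

theorem right_identity_of_amenable:
  assumes am: "amenable \<mu>"
  shows "AP_bidual_has_right_identity \<mu> \<Phi> \<Psi>"
proof -
  obtain K where K: "rad_const K" using rad_const_exists by blast
  have K0: "K > 0" using K by (simp add: rad_const_def)
  define B where "B = {p :: 'g set \<times> real. compact (fst p) \<and> snd p > 0}"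
  define F where "F = (INF p\<in>B. principal (units_on K (fst p) (snd p)))"
  have ev: "eventually P F \<longleftrightarrow> (\<exists>p\<in>B. \<forall>e\<in>units_on K (fst p) (snd p). P e)" for P
    unfolding F_def eventually_principal[symmetric]
  proof (rule eventually_INF_base)
    show "B \<noteq> {}" by (auto simp: B_def intro!: exI[of _ "{}"] exI[of _ 1])
    fix p p' assume p: "p \<in> B" "p' \<in> B"
    define p'' where "p'' = (fst p \<union> fst p', min (snd p) (snd p'))"
    have "p'' \<in> B" using p by (auto simp: B_def p''_def compact_Un)
    moreover have "units_on K (fst p'') (snd p'') \<subseteq> units_on K (fst p) (snd p) \<inter> units_on K (fst p') (snd p')"
      unfolding p''_def by (intro Int_greatest units_on_antimono) auto
    ultimately show "\<exists>x\<in>B. principal (units_on K (fst x) (snd x)) \<le> inf (principal (units_on K (fst p) (snd p))) (principal (units_on K (fst p') (snd p')))"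
      by (intro bexI[of _ p'']) auto
  qed
  have Fb: "F \<noteq> bot"
  proof
    assume "F = bot"
    then have "eventually (\<lambda>_. False) F" by simp
    then obtain p where "p \<in> B" "units_on K (fst p) (snd p) = {}" unfolding ev by auto
    then show False using units_on_nonempty[OF am K] by (auto simp: B_def)
  qed
  obtain L where L: "linear_on_space bounded_functions L"
    "\<And>a c. a \<in> bounded_functions \<Longrightarrow> (\<forall>\<^sub>F i in F. a i \<le> c) \<Longrightarrow> L a \<le> c"
    "\<And>a c. a \<in> bounded_functions \<Longrightarrow> (\<forall>\<^sub>F i in F. c \<le> a i) \<Longrightarrow> c \<le> L a"
    "\<And>a c. a \<in> bounded_functions \<Longrightarrow> (a \<longlongrightarrow> c) F \<Longrightarrow> L a = c"
    by (rule generalized_limit_exists[OF Fb]) (rule that)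
  \<comment> \<open>Restricting to multiplier units makes the arguments of \<open>L\<close> bounded
    everywhere, not merely eventually along \<open>F\<close>.\<close>
  define cut where "cut = (\<lambda>S e. if e \<in> multiplier_units K then S e else 0 :: complex)"
  \<comment> \<open>The functional \<open>L\<close> is real, so real and imaginary parts are treated
    apart; this turns the bound 4 for the units into the bound 8 for \<open>E\<close>.\<close>
  define E where "E = (\<lambda>S. Complex (L (\<lambda>e. Re (cut S e))) (L (\<lambda>e. Im (cut S e))))"
  have bnd: "(\<lambda>e. Re (h e)) \<in> bounded_functions" "(\<lambda>e. Im (h e)) \<in> bounded_functions" if "\<And>e. cmod (h e) \<le> C" for h :: "('g \<Rightarrow> complex) \<Rightarrow> complex" and C
    unfolding bounded_functions_def using abs_Re_le_cmod abs_Im_le_cmod that order.trans by blast+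
  have cutb: "cmod (cut S e) \<le> 4 * nD S" if S: "S \<in> D" for S e
  proof (cases "e \<in> multiplier_units K")
    case True
    then have "e \<in> A" "nA e \<le> 4" by (auto simp: multiplier_units_def)
    then show ?thesis using dual_norm_bound[OF S, of e 4] True by (simp add: cut_def)
  qed (use dual_norm_nonneg[OF S] in \<open>simp add: cut_def\<close>)
  note cb = bnd[OF cutb]
  have Ladd: "L (\<lambda>e. a e + b e) = L a + L b" "L (\<lambda>e. c * a e) = c * L a" if "a \<in> bounded_functions" "b \<in> bounded_functions" for a b c
    using linear_on_spaceD[OF L(1)] that by blast+
  have bcm: "(\<lambda>e. c * a e) \<in> bounded_functions" if "a \<in> bounded_functions" for a :: "('g \<Rightarrow> complex) \<Rightarrow> real" and c
    using function_spaceD[OF function_space_bounded_functions] that by blast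
  have E: "E \<in> DD"
    unfolding AP_bidual_def bidual_space_def
  proof (intro CollectI conjI ballI allI)
    fix S T assume S: "S \<in> D" and T: "T \<in> D"
    have "cut (\<lambda>u. S u + T u) = (\<lambda>e. cut S e + cut T e)" by (auto simp: cut_def)
    then show "E (\<lambda>u. S u + T u) = E S + E T"
      using Ladd(1)[OF cb(1)[OF S] cb(1)[OF T]] Ladd(1)[OF cb(2)[OF S] cb(2)[OF T]] by (simp add: E_def complex_eq_iff)
  next
    fix S c assume S: "S \<in> D"
    have "cut (\<lambda>u. c * S u) = (\<lambda>e. c * cut S e)" by (auto simp: cut_def)
    moreover have "L (\<lambda>e. Re c * Re (cut S e) + - Im c * Im (cut S e)) = Re c * L (\<lambda>e. Re (cut S e)) + - Im c * L (\<lambda>e. Im (cut S e))"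
      "L (\<lambda>e. Re c * Im (cut S e) + Im c * Re (cut S e)) = Re c * L (\<lambda>e. Im (cut S e)) + Im c * L (\<lambda>e. Re (cut S e))"
      by (simp_all only: Ladd(1)[OF bcm[OF cb(1)[OF S]] bcm[OF cb(2)[OF S]]] Ladd(1)[OF bcm[OF cb(2)[OF S]] bcm[OF cb(1)[OF S]]]
          Ladd(2)[OF cb(1)[OF S] cb(1)[OF S]] Ladd(2)[OF cb(2)[OF S] cb(1)[OF S]])
    ultimately show "E (\<lambda>u. c * S u) = c * E S" by (simp add: E_def complex_eq_iff)
  next
    have "cmod (E S) \<le> 8 * nD S" if S: "S \<in> D" for S
    proof -
      have "\<bar>Re (cut S e)\<bar> \<le> 4 * nD S" "\<bar>Im (cut S e)\<bar> \<le> 4 * nD S" for e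
        using cutb[OF S, of e] abs_Re_le_cmod[of "cut S e"] abs_Im_le_cmod[of "cut S e"] by linarith+
      then have i: "Re (cut S e) \<le> 4 * nD S" "- (4 * nD S) \<le> Re (cut S e)" "Im (cut S e) \<le> 4 * nD S" "- (4 * nD S) \<le> Im (cut S e)" for e
        by (simp_all add: abs_le_iff minus_le_iff)
      have "\<bar>L (\<lambda>e. Re (cut S e))\<bar> \<le> 4 * nD S" "\<bar>L (\<lambda>e. Im (cut S e))\<bar> \<le> 4 * nD S"
        using L(2)[OF cb(1)[OF S] always_eventually, where c = "4 * nD S"] L(3)[OF cb(1)[OF S] always_eventually, where c = "- (4 * nD S)"]
          L(2)[OF cb(2)[OF S] always_eventually, where c = "4 * nD S"] L(3)[OF cb(2)[OF S] always_eventually, where c = "- (4 * nD S)"] i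
        by (simp_all add: abs_le_iff minus_le_iff)
      then show ?thesis using cmod_le[of "E S"] by (simp add: E_def)
    qed
    then show "\<exists>C. \<forall>T\<in>D. cmod (E T) \<le> C * nD T" by blast
  qed
  \<comment> \<open>Only the values of the module product on the units enter: the multiplier bound
    makes them bounded, and by \<open>approximate_unit_limit\<close> they converge to
    \<open>T u\<close>.\<close>
  have act: "E (dual_act pointwise_mult u T) = T u" if u: "u \<in> A" and T: "T \<in> D" for u T
  proof -
    let ?h = "cut (dual_act pointwise_mult u T)"
    have h: "?h e = (if e \<in> multiplier_units K then T (\<lambda>x. u x * e x) else 0)" for e
      by (simp add: cut_def dual_act_def pointwise_mult_def)
    obtain f g where R: "rep u f g" "\<And>m. compactly_supported (f m) \<and> compactly_supported (g m)"
      by (rule AP_compact_rep[OF u]) (rule that)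
    define C where "C = 20 * K * (\<Sum>m. N\<Phi> (f m) * N\<Psi> (g m)) + 1"
    have C0: "C > 0" unfolding C_def
      using suminf_nonneg[OF repD(3)[OF R(1)] norm_product_nonneg[OF repD(1,2)[OF R(1)]]] K0 by (simp add: add_nonneg_pos)
    have hb: "cmod (?h e) \<le> C * nD T" for e
    proof (cases "e \<in> multiplier_units K")
      case True
      note p = multiplier_unit_product[OF K True R]
      have "nA (\<lambda>x. u x * e x) \<le> C" using p(2) by (simp add: C_def)
      then show ?thesis using dual_norm_bound[OF T p(1) _ C0] True by (simp add: h)
    qed (use C0 dual_norm_nonneg[OF T] h in simp)
    have lim: "(?h \<longlongrightarrow> T u) F"
    proof (rule tendstoI)
      fix r :: real assume r: "r > 0"
      have r2: "r / 2 > 0" using r by simp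
      obtain Z \<epsilon> where Z: "compact Z" "\<epsilon> > 0" "\<And>e. e \<in> units_on K Z \<epsilon> \<Longrightarrow> cmod (T (\<lambda>x. u x * e x) - T u) \<le> r / 2"
        by (rule approximate_unit_limit[OF K u T r2]) (rule that)
      have "dist (?h e) (T u) < r" if e: "e \<in> units_on K Z \<epsilon>" for e
      proof -
        have "e \<in> multiplier_units K" using e by (simp add: units_on_def)
        then show ?thesis using Z(3)[OF e] r by (simp add: h dist_norm)
      qed
      then show "\<forall>\<^sub>F e in F. dist (?h e) (T u) < r" unfolding ev using Z(1,2) by (intro bexI[of _ "(Z, \<epsilon>)"]) (auto simp: B_def)
    qed
    have "L (\<lambda>e. Re (?h e)) = Re (T u)" by (rule L(4)[OF bnd(1)[OF hb] tendsto_Re[OF lim]])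
    moreover have "L (\<lambda>e. Im (?h e)) = Im (T u)" by (rule L(4)[OF bnd(2)[OF hb] tendsto_Im[OF lim]])
    ultimately show ?thesis by (simp add: E_def)
  qed
  have "arens1 pointwise_mult \<Gamma> E T = \<Gamma> T" if \<Gamma>: "\<Gamma> \<in> DD" and T: "T \<in> D" for \<Gamma> T
  proof -
    define R where "R = bidual_act pointwise_mult E T"
    have RT: "R u = T u" if "u \<in> A" for u using act[OF that T] by (simp add: R_def bidual_act_def)
    \<comment> \<open>Functionals are total functions, and \<open>R\<close> is known to agree with
      \<open>T\<close> on \<open>A\<close> only. The difference \<open>Q\<close> has dual norm 0,
      and boundedness of \<open>\<Gamma>\<close> is what makes \<open>\<Gamma>\<close> vanish on
      it.\<close>
    define Q where "Q = (\<lambda>u. R u - T u)"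
    have Q0: "Q u = 0" if "u \<in> A" for u using RT[OF that] by (simp add: Q_def)
    have QD: "Q \<in> D" by (rule AP_dualI[where C = 0]) (use Q0 AP_add(1) AP_cmult(1) in auto)
    have "nD Q \<le> 0" by (rule dual_norm_least) (simp add: Q0)
    then have nQ: "nD Q = 0" using dual_norm_nonneg[OF QD] by simp
    obtain C where "\<forall>S\<in>D. cmod (\<Gamma> S) \<le> C * nD S" using \<Gamma> unfolding AP_bidual_def bidual_space_def by blast
    then have "cmod (\<Gamma> Q) \<le> C * nD Q" using QD by blast
    then have GQ: "\<Gamma> Q = 0" by (simp add: nQ)
    have "\<Gamma> (\<lambda>u. T u + Q u) = \<Gamma> T + \<Gamma> Q" using \<Gamma> T QD unfolding AP_bidual_def bidual_space_def by blast
    then show ?thesis using GQ by (simp add: arens1_def R_def[symmetric] Q_def)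
  qed
  then show ?thesis unfolding AP_bidual_has_right_identity_def using E by blast
qed

end

theorem theorem3p4:
  fixes \<mu> :: "('g::{group_add,t2_space}) measure"
    and \<Phi> \<Psi> :: "real \<Rightarrow> real"
  assumes "locally_compact_group TYPE('g)"
    and "left_haar_measure \<mu>"
    and "complementary_pair \<Phi> \<Psi>"
    and "delta2 \<Phi>" and "delta2 \<Psi>"
    and "MA_condition \<Phi>"
  shows "AP_bidual_has_right_identity \<mu> \<Phi> \<Psi> \<longleftrightarrow> amenable \<mu>"
proof -
  interpret orlicz_setup \<mu> \<Phi> \<Psi>
    using assms by unfold_locales
  show ?thesis
    using amenable_of_right_identity right_identity_of_amenable by blast
qed

end
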